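(* Assume condition (A): there exist $C_A,\gamma_A>0$ and, for all $x,y\in E$, a Markovian coupling $\mathbb{P}_{(x,y)}$ between $\mathbb{P}_x$ and $\mathbb{P}_y$ such that for all $t\in I$, $\mathbb{E}_{(x,y)}[G^X_t\, d(X_t,Y_t)]\le C_A e^{-\gamma_A t}d(x,y)$. For $x\in E$ and $t\in I\setminus\{0\}$ define the probability measure $$\mu^x_t=\frac{\mathbb{E}_x\left[Z_t\left(\frac1t\int_0^t\delta_{X_s}ds\right)\right]}{\mathbb{E}_xZ_t}\ \text{ if } I=[0,+\infty),\qquad \mu^x_t=\frac{\mathbb{E}_x\left[Z_t\left(\frac1t\sum_{s\in\mathbb{Z}_+,\,s<t}\delta_{X_s}\right)\right]}{\mathbb{E}_xZ_t}\ \text{ if } I=\mathbb{Z}_+.$$ Then there exists a constant $C>0$ such that, for all $x\in E$ and $t\in I\setminus\{0\}$, $$\mathcal{W}_d(\mu^x_t,\nu_Q)\le\frac Ct,$$ where $\nu_Q(dx)=\eta(x)\,\nu_{QS}(dx)$.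
   Context: Setting. $(E,d)$ is a Polish space whose distance satisfies $d\le\bar d$ on $E\times E$ for a finite constant $\bar d$. $\mathcal{W}_d(\mu,\nu)=\inf_{\pi}\iint d(x,y)\,\pi(dx,dy)$ (infimum over couplings $\pi$ of $\mu,\nu$). The time set $I$ is either $[0,+\infty)$ or $\mathbb{Z}_+$. $(\Omega,(\mathcal F_t)_{t\in I},(\mathbb{P}_x)_{x\in E},(X_t)_{t\in I})$ is a time-homogeneous Markov process in $E$ with $\mathbb{P}_x(X_0=x)=1$; $\mathbb{E}_x$ is the expectation under $\mathbb{P}_x$. The function $\rho:E\to\mathbb{R}_+$ is $d$-Lipschitz. The penalization is $Z_t=Z_t(X)=e^{-\int_0^t\rho(X_s)ds}$ if $I=[0,+\infty)$ (the integral being assumed well defined), and $Z_t=Z_t(X)=p(X_0)p(X_1)\cdots p(X_{t-1})$ with $p=e^{-\rho}$ (and $Z_0=1$) if $I=\mathbb{Z}_+$. The penalized semigroup is $P_tf(x)=\mathbb{E}_x[Z_tf(X_t)]$ for bounded measurable $f$, and $\mu P_tf=\int_E P_tf(x)\,\mu(dx)$. Couplings. A coupling measure between $\mathbb{P}_x$ and $\mathbb{P}_y$ is a probability measure $\mathbb{P}_{(x,y)}$ on a space carrying $(X_t,Y_t)_{t\in I}$ such that $(X_t)$ has the law of $X$ under $\mathbb{P}_x$ and $(Y_t)$ the law of $X$ under $\mathbb{P}_y$. It is Markovian if $(X_t,Y_t)_{t\in I}$ is Markov with respect to its natural filtration; the couplings are understood as a family $(\mathbb{P}_{(x,y)})_{x,y\in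 E}$ of laws of a time-homogeneous Markov process on $E\times E$ started from $(x,y)$ (conditionally on the past up to time $t$, the process shifted by $t$ has law $\mathbb{P}_{(X_t,Y_t)}$). Write $Z^X_t=Z_t(X)$ and $G^X_t=Z^X_t/\mathbb{E}_xZ_t$. Quasi-stationary objects. A quasi-stationary distribution is a probability measure $\nu$ with $\frac{\nu P_t}{\nu P_t\mathbf 1}=\nu$ for all $t\in I$; its absorption rate is the number $\lambda_0\ge0$ with $\nu P_t=e^{-\lambda_0t}\nu$ for all $t\in I$. Under (A) there is a unique quasi-stationary distribution $\nu_{QS}$; $\lambda_0$ denotes its absorption rate, and $\eta(x)=\lim_{t\to\infty}e^{\lambda_0t}\mathbb{E}_xZ_t$ (the limit exists, uniformly in $x$, and $\eta$ is $d$-Lipschitz, bounded away from $0$, with $\nu_{QS}(\eta)=1$, so that $\nu_Q$ is a probability measure). *)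

theory Defs
  imports "HOL-Probability.Probability"
begin

text \<open>
  The time set \<^term>\<open>I\<close> is a set of reals, either \<^term>\<open>{0..} :: real set\<close> or
  \<^term>\<open>\<nat> :: real set\<close>; processes are indexed by reals and only their values at times
  in \<^term>\<open>I\<close> matter. The law of a process is its law on \<open>E\<^sup>I\<close> with the product sigma-algebra.
\<close>

definition path_law ::
    "real set \<Rightarrow> (real \<Rightarrow> 'w \<Rightarrow> 's::topological_space) \<Rightarrow> 'w measure \<Rightarrow> (real \<Rightarrow> 's) measure" where
  "path_law I X N = distr N (\<Pi>\<^sub>M s\<in>I. borel) (\<lambda>\<omega>. \<lambda>s\<in>I. X s \<omega>)"

text \<open>
  A family \<open>(P x)\<^sub>x\<close> of laws under which \<open>X\<close> is Markov with respect to \<open>(F t)\<^sub>t\<close>, time-homogeneous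
  and started from \<open>x\<close>. The last clause is the Markov property: conditionally on \<open>F t\<close>, the process
  shifted by \<open>t\<close> has the law of \<open>X\<close> under \<open>P (X t)\<close>.
\<close>

definition markov_process ::
    "real set \<Rightarrow> 'w measure \<Rightarrow> (real \<Rightarrow> 'w measure) \<Rightarrow> ('s::topological_space \<Rightarrow> 'w measure)
      \<Rightarrow> (real \<Rightarrow> 'w \<Rightarrow> 's) \<Rightarrow> bool" where
  "markov_process I M F P X \<longleftrightarrow>
     (\<forall>t\<in>I. subalgebra M (F t)) \<and>
     (\<forall>s\<in>I. \<forall>t\<in>I. s \<le> t \<longrightarrow> sets (F s) \<subseteq> sets (F t)) \<and>
     (\<forall>t\<in>I. X t \<in> F t \<rightarrow>\<^sub>M borel) \<and>
     (\<forall>x. prob_space (P x) \<and> sets (P x) = sets M) \<and>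
     (\<lambda>x. path_law I X (P x)) \<in> borel \<rightarrow>\<^sub>M prob_algebra (\<Pi>\<^sub>M s\<in>I. borel) \<and>
     (\<forall>x. AE \<omega> in P x. X 0 \<omega> = x) \<and>
     (\<forall>x. \<forall>t\<in>I. \<forall>A\<in>sets (\<Pi>\<^sub>M s\<in>I. borel). AE \<omega> in P x.
        real_cond_exp (P x) (F t) (indicator {\<omega>'\<in>space M. (\<lambda>s\<in>I. X (t + s) \<omega>') \<in> A}) \<omega>
          = measure (path_law I X (P (X t \<omega>))) A)"

text \<open>
  Joint measurability in time and \<open>\<omega>\<close>, which makes the time integrals along trajectories
  well-defined random variables. For \<^term>\<open>I = \<nat>\<close> it just says that every \<open>X t\<close> is measurable.
\<close>

definition measurable_process ::
    "real set \<Rightarrow> 'w measure \<Rightarrow> (real \<Rightarrow> 'w \<Rightarrow> 's::topological_space) \<Rightarrow> bool" where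
  "measurable_process I M X \<longleftrightarrow>
     (\<lambda>(s, \<omega>). X s \<omega>) \<in> restrict_space borel I \<Otimes>\<^sub>M M \<rightarrow>\<^sub>M borel"

definition penalization ::
    "real set \<Rightarrow> ('e \<Rightarrow> real) \<Rightarrow> (real \<Rightarrow> 'w \<Rightarrow> 'e) \<Rightarrow> real \<Rightarrow> 'w \<Rightarrow> real" where
  "penalization I \<rho> X t \<omega> =
     (if I = \<nat> then \<Prod>s\<in>{s\<in>\<nat>. s < t}. exp (- \<rho> (X s \<omega>))
      else exp (- (LINT s:{0..t}|lborel. \<rho> (X s \<omega>))))"

definition penalized_semigroup ::
    "real set \<Rightarrow> ('e \<Rightarrow> real) \<Rightarrow> ('e \<Rightarrow> 'w measure) \<Rightarrow> (real \<Rightarrow> 'w \<Rightarrow> 'e) \<Rightarrow> real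
      \<Rightarrow> ('e \<Rightarrow> real) \<Rightarrow> 'e \<Rightarrow> real" where
  "penalized_semigroup I \<rho> P X t f x = (LINT \<omega>|P x. penalization I \<rho> X t \<omega> * f (X t \<omega>))"

definition expected_penalization ::
    "real set \<Rightarrow> ('e \<Rightarrow> real) \<Rightarrow> ('e \<Rightarrow> 'w measure) \<Rightarrow> (real \<Rightarrow> 'w \<Rightarrow> 'e) \<Rightarrow> real \<Rightarrow> 'e \<Rightarrow> real" where
  "expected_penalization I \<rho> P X t x = (LINT \<omega>|P x. penalization I \<rho> X t \<omega>)"

definition quasi_stationary ::
    "real set \<Rightarrow> ('e::topological_space \<Rightarrow> real) \<Rightarrow> ('e \<Rightarrow> 'w measure) \<Rightarrow> (real \<Rightarrow> 'w \<Rightarrow> 'e)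
      \<Rightarrow> 'e measure \<Rightarrow> bool" where
  "quasi_stationary I \<rho> P X \<nu> \<longleftrightarrow>
     prob_space \<nu> \<and> sets \<nu> = sets borel \<and>
     (\<forall>t\<in>I. \<forall>f\<in>borel_measurable borel. bounded (range f) \<longrightarrow>
        (LINT x|\<nu>. penalized_semigroup I \<rho> P X t f x)
          / (LINT x|\<nu>. penalized_semigroup I \<rho> P X t (\<lambda>_. 1) x) = (LINT x|\<nu>. f x))"

definition absorption_rate ::
    "real set \<Rightarrow> ('e::topological_space \<Rightarrow> real) \<Rightarrow> ('e \<Rightarrow> 'w measure) \<Rightarrow> (real \<Rightarrow> 'w \<Rightarrow> 'e)
      \<Rightarrow> 'e measure \<Rightarrow> real \<Rightarrow> bool" where
  "absorption_rate I \<rho> P X \<nu> l \<longleftrightarrow>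
     0 \<le> l \<and>
     (\<forall>t\<in>I. \<forall>f\<in>borel_measurable borel. bounded (range f) \<longrightarrow>
        (LINT x|\<nu>. penalized_semigroup I \<rho> P X t f x) = exp (- l * t) * (LINT x|\<nu>. f x))"

definition eta ::
    "real set \<Rightarrow> ('e \<Rightarrow> real) \<Rightarrow> ('e \<Rightarrow> 'w measure) \<Rightarrow> (real \<Rightarrow> 'w \<Rightarrow> 'e) \<Rightarrow> real \<Rightarrow> 'e \<Rightarrow> real" where
  "eta I \<rho> P X l x =
     Lim (inf at_top (principal I)) (\<lambda>t. exp (l * t) * expected_penalization I \<rho> P X t x)"

definition couplings :: "'e::topological_space measure \<Rightarrow> 'e measure \<Rightarrow> ('e \<times> 'e) measure set" where
  "couplings \<mu> \<nu> =
     {\<pi>. sets \<pi> = sets (borel \<Otimes>\<^sub>M borel) \<and> distr \<pi> borel fst = \<mu> \<and> distr \<pi> borel snd = \<nu>}"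

definition wasserstein :: "'e::metric_space measure \<Rightarrow> 'e measure \<Rightarrow> ennreal" where
  "wasserstein \<mu> \<nu> = (INF \<pi>\<in>couplings \<mu> \<nu>. \<integral>\<^sup>+ z. ennreal (dist (fst z) (snd z)) \<partial>\<pi>)"

text \<open>The value on \<open>B\<close> of the empirical measure of the trajectory up to time \<open>t\<close>.\<close>

definition empirical ::
    "real set \<Rightarrow> (real \<Rightarrow> 'w \<Rightarrow> 'e) \<Rightarrow> real \<Rightarrow> 'w \<Rightarrow> 'e set \<Rightarrow> real" where
  "empirical I X t \<omega> B =
     (if I = \<nat> then 1 / t * (\<Sum>s\<in>{s\<in>\<nat>. s < t}. indicator B (X s \<omega>))
      else 1 / t * (LINT s:{0..t}|lborel. indicator B (X s \<omega>)))"

definition penalized_occupation ::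
    "real set \<Rightarrow> ('e::topological_space \<Rightarrow> real) \<Rightarrow> ('e \<Rightarrow> 'w measure) \<Rightarrow> (real \<Rightarrow> 'w \<Rightarrow> 'e)
      \<Rightarrow> 'e \<Rightarrow> real \<Rightarrow> 'e measure" where
  "penalized_occupation I \<rho> P X x t =
     measure_of UNIV (sets borel)
       (\<lambda>B. ennreal ((LINT \<omega>|P x. penalization I \<rho> X t \<omega> * empirical I X t \<omega> B)
                      / expected_penalization I \<rho> P X t x))"

definition natural_filtration ::
    "real set \<Rightarrow> 'w measure \<Rightarrow> (real \<Rightarrow> 'w \<Rightarrow> 's::topological_space) \<Rightarrow> real \<Rightarrow> 'w measure" where
  "natural_filtration I M X t =
     sigma (space M) {X s -` B \<inter> space M | s B. s \<in> I \<and> s \<le> t \<and> B \<in> sets borel}"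

text \<open>
  A family \<open>(Q (x, y))\<close> of Markovian couplings between \<open>P x\<close> and \<open>P y\<close>: laws, on a measurable space
  \<open>N\<close> carrying \<open>(Y1, Y2)\<close>, of a time-homogeneous Markov process on the product space.
\<close>

definition markovian_coupling ::
    "real set \<Rightarrow> ('e::topological_space \<Rightarrow> 'w measure) \<Rightarrow> (real \<Rightarrow> 'w \<Rightarrow> 'e) \<Rightarrow> 'v measure
      \<Rightarrow> ('e \<times> 'e \<Rightarrow> 'v measure) \<Rightarrow> (real \<Rightarrow> 'v \<Rightarrow> 'e) \<Rightarrow> (real \<Rightarrow> 'v \<Rightarrow> 'e) \<Rightarrow> bool" where
  "markovian_coupling I P X N Q Y1 Y2 \<longleftrightarrow>
     (\<forall>x y. path_law I Y1 (Q (x, y)) = path_law I X (P x) \<and>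
            path_law I Y2 (Q (x, y)) = path_law I X (P y)) \<and>
     markov_process I N (natural_filtration I N (\<lambda>t \<omega>. (Y1 t \<omega>, Y2 t \<omega>))) Q
       (\<lambda>t \<omega>. (Y1 t \<omega>, Y2 t \<omega>)) \<and>
     measurable_process I N (\<lambda>t \<omega>. (Y1 t \<omega>, Y2 t \<omega>))"

definition condition_A ::
    "real set \<Rightarrow> ('e::metric_space \<Rightarrow> real) \<Rightarrow> ('e \<Rightarrow> 'w measure) \<Rightarrow> (real \<Rightarrow> 'w \<Rightarrow> 'e) \<Rightarrow> 'v measure
      \<Rightarrow> ('e \<times> 'e \<Rightarrow> 'v measure) \<Rightarrow> (real \<Rightarrow> 'v \<Rightarrow> 'e) \<Rightarrow> (real \<Rightarrow> 'v \<Rightarrow> 'e) \<Rightarrow> bool" where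
  "condition_A I \<rho> P X N Q Y1 Y2 \<longleftrightarrow>
     markovian_coupling I P X N Q Y1 Y2 \<and>
     (\<exists>C>0. \<exists>\<gamma>>0. \<forall>x y. \<forall>t\<in>I.
        (LINT \<omega>|Q (x, y). penalization I \<rho> Y1 t \<omega> / expected_penalization I \<rho> P X t x
                            * dist (Y1 t \<omega>) (Y2 t \<omega>))
          \<le> C * exp (- \<gamma> * t) * dist x y)"

end

theory Submission
  imports Defs
begin

text \<open>
  Switching the weight from the first to the second coordinate of the coupling one unit of time after
  the other, and using the Markov property at each switch, turns (A) into a Doeblin--Fortet estimate:
  the Lipschitz constant of \<open>P\<^sub>n f\<close> is bounded by \<open>C e\<^sup>-\<^sup>\<gamma>\<^sup>n E\<^sub>x Z\<^sub>n\<close> times that of \<open>f\<close>, plus a sum of products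
  \<open>e\<^sup>-\<^sup>\<gamma>\<^sup>k E\<^sub>x Z\<^sub>k sup P\<^sub>n\<^sub>-\<^sub>k\<^sub>-\<^sub>1 f\<close>. The same telescoping, started late, compares \<open>E\<^sub>x Z\<^sub>n\<close> with \<open>E\<^sub>y Z\<^sub>n\<close>; at times when
  the suitably normalised supremum of \<open>E\<^sub>x Z\<^sub>n\<close> is close to a record it gives a Harnack inequality, and
  then every time is such a time, so that \<open>e\<^sup>\<lambda>\<^sup>t E\<^sub>x Z\<^sub>t\<close> stays between two positive constants. Hence the kernels
  \<open>f \<mapsto> P\<^sub>n (h\<^sub>u f) / h\<^sub>n\<^sub>+\<^sub>u\<close> with \<open>h\<^sub>t = E Z\<^sub>t\<close> contract, uniformly in \<open>u\<close>, the cone norm that combines oscillation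
  and Lipschitz constant: the oscillation by the coupling, the Lipschitz constant by Doeblin--Fortet.
  The penalized law of \<open>X\<^sub>s\<close> is therefore within \<open>K (e\<^sup>-\<^sup>\<delta>\<^sup>s + e\<^sup>-\<^sup>\<delta>\<^sup>(\<^sup>t\<^sup>-\<^sup>s\<^sup>))\<close> of its limit when tested on
  \<open>1\<close>-Lipschitz functions; average over \<open>s\<close> and use Kantorovich--Rubinstein duality.
\<close>

section \<open>Finite optimal transport\<close>

text \<open>Two obstacles shape the proof. In continuous time the weight \<open>pen\<close> is not a
  function of the path that the product sigma-algebra sees, while coupling and Markov property are
  given only through laws on that sigma-algebra. The way round is to write the weight as a constant
  times the exponential of \<open>R * u - rate_integral I \<rho> X 0 u \<omega>\<close>: the
  exponent is nonnegative, its powers are iterated time integrals of cylinder functions, and the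
  series can be summed in \<open>ennreal\<close> without integrability questions. The second
  obstacle is that (A) is normalised by E_x Z_t at the start x of the first coordinate, whereas the
  error terms contain suprema over E. A Harnack inequality makes them comparable, but proving it by
  telescoping requires that earlier normalised suprema do not dwarf the one at time n. At a record
  time this is automatic; and since the quasi-stationary measure averages E_y Z_t to e^(-lambda t),
  Harnack at records bounds the normalised suprema, after which every time qualifies. The decay rate
  of the suprema enters as \<open>lexp\<close>, of which only \<open>lexp \<le> lam\<close> is
  used.\<close>

lemma farkas:
  fixes A :: "'i \<Rightarrow> 'k \<Rightarrow> real" and B :: "'k \<Rightarrow> real"
  assumes "finite J" and K: "finite K"
    and "\<And>x. (\<And>i. i \<in> J \<Longrightarrow> (\<Sum>k\<in>K. A i k * x k) \<le> 0) \<Longrightarrow> (\<Sum>k\<in>K. B k * x k) \<le> 0"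
  shows "\<exists>l. (\<forall>i\<in>J. 0 \<le> l i) \<and> (\<forall>k\<in>K. B k = (\<Sum>i\<in>J. l i * A i k))"
  using assms(1,3)
proof (induction J arbitrary: A B rule: finite_induct)
  case empty
  \<comment> \<open>Without inequalities every x is admissible; the choice x = B forces B to vanish
    on K.\<close>
  have "(\<Sum>k\<in>K. B k * B k) \<le> 0" by (rule empty) simp
  moreover have "(\<Sum>k\<in>K. B k * B k) \<ge> 0" by (intro sum_nonneg) simp
  ultimately have "(\<Sum>k\<in>K. B k * B k) = 0" by simp
  hence "\<forall>k\<in>K. B k = 0" using K by (subst (asm) sum_nonneg_eq_0_iff) auto
  thus ?case by simp
next
  case (insert m J)
  define dot :: "('k \<Rightarrow> real) \<Rightarrow> ('k \<Rightarrow> real) \<Rightarrow> real" where "dot = (\<lambda>f x. \<Sum>k\<in>K. f k * x k)"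
  have dot_l: "dot (\<lambda>k. f k - c * g k) x = dot f x - c * dot g x" for f g x c
    by (simp add: dot_def left_diff_distrib sum_subtractf sum_distrib_left mult.assoc)
  have dot_r: "dot f (\<lambda>k. x k - c * y k) = dot f x - c * dot f y" for f x y c
    by (simp add: dot_def right_diff_distrib sum_subtractf sum_distrib_left mult.left_commute)
  have dot_s: "dot f (\<lambda>k. c * y k) = c * dot f y" for f y c
    by (simp add: dot_def sum_distrib_left mult.left_commute)
  show ?case
  proof (cases "\<forall>x. (\<forall>i\<in>J. dot (A i) x \<le> 0) \<longrightarrow> dot B x \<le> 0")
    \<comment> \<open>The rows of \<open>J\<close> alone already imply the conclusion, so row
      \<open>m\<close> receives the multiplier zero.\<close>
    case True
    then obtain l where l: "\<forall>i\<in>J. 0 \<le> l i" "\<forall>k\<in>K. B k = (\<Sum>i\<in>J. l i * A i k)"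
      using insert.IH[of A B] unfolding dot_def by blast
    have "(\<Sum>i\<in>J. (l(m := 0)) i * A i k) = (\<Sum>i\<in>J. l i * A i k)" for k
      using insert.hyps by (intro sum.cong) auto
    then show ?thesis using l insert.hyps
      by (intro exI[of _ "l(m := 0)"]) (auto simp: fun_upd_def)
  next
    case False
    then obtain x1 where x1: "\<And>i. i \<in> J \<Longrightarrow> dot (A i) x1 \<le> 0" "dot B x1 > 0"
      by (auto simp: not_le)
    have pos: "dot (A m) x1 > 0"
    proof (rule ccontr)
      assume "\<not> dot (A m) x1 > 0"
      hence "dot B x1 \<le> 0" using insert.prems[of x1] x1(1) unfolding dot_def by force
      thus False using x1(2) by simp
    qed
    \<comment> \<open>Subtracting multiples of \<open>A m\<close> kills the component along \<open>x0\<close> and removes the inequality \<open>m\<close>.\<close>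
    define x0 where "x0 = (\<lambda>k. (1 / dot (A m) x1) * x1 k)"
    have x0: "\<And>i. i \<in> J \<Longrightarrow> dot (A i) x0 \<le> 0" "dot B x0 > 0" "dot (A m) x0 = 1"
      using x1 pos unfolding x0_def dot_s by (auto simp: divide_le_0_iff)
    define A' where "A' = (\<lambda>i k. A i k - dot (A i) x0 * A m k)"
    define B' where "B' = (\<lambda>k. B k - dot B x0 * A m k)"
    have "dot B' x \<le> 0" if "\<And>i. i \<in> J \<Longrightarrow> dot (A' i) x \<le> 0" for x
    proof -
      let ?x = "\<lambda>k. x k - dot (A m) x * x0 k"
      have "dot (A i) ?x = dot (A' i) x" for i
        unfolding A'_def dot_l dot_r by simp
      moreover have "dot (A m) ?x = 0" unfolding dot_r using x0(3) by simp
      ultimately have "dot (A i) ?x \<le> 0" if "i \<in> insert m J" for i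
        using that \<open>\<And>i. i \<in> J \<Longrightarrow> dot (A' i) x \<le> 0\<close>[of i] by auto
      hence "dot B ?x \<le> 0" using insert.prems[of ?x] unfolding dot_def by blast
      thus ?thesis unfolding B'_def dot_l dot_r by (simp add: mult.commute)
    qed
    then obtain l where l: "\<forall>i\<in>J. 0 \<le> l i" "\<forall>k\<in>K. B' k = (\<Sum>i\<in>J. l i * A' i k)"
      using insert.IH[of A' B'] unfolding dot_def by blast
    \<comment> \<open>Undoing the substitutions that define \<open>A'\<close> and \<open>B'\<close>
      dictates this multiplier for row \<open>m\<close>. It is nonnegative because \<open>x0\<close>
      violates the conclusion but satisfies the rows of \<open>J\<close>.\<close>
    define lm where "lm = dot B x0 - (\<Sum>i\<in>J. l i * dot (A i) x0)"
    have "(\<Sum>i\<in>J. l i * dot (A i) x0) \<le> 0"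
      using l(1) x0(1) by (intro sum_nonpos) (simp add: mult_nonneg_nonpos)
    hence lm: "lm \<ge> 0" using x0(2) by (simp add: lm_def)
    have "(\<Sum>i\<in>J. (l(m := lm)) i * A i k) = (\<Sum>i\<in>J. l i * A i k)" for k
      using insert.hyps by (intro sum.cong) auto
    moreover have "B k = lm * A m k + (\<Sum>i\<in>J. l i * A i k)" if "k \<in> K" for k
    proof -
      have "B k - dot B x0 * A m k = (\<Sum>i\<in>J. l i * A i k) - (\<Sum>i\<in>J. l i * dot (A i) x0) * A m k"
        using l(2) that unfolding B'_def A'_def
        by (simp add: right_diff_distrib sum_subtractf sum_distrib_right mult.assoc)
      thus ?thesis by (simp add: lm_def algebra_simps)
    qed
    ultimately show ?thesis using l(1) lm insert.hyps
      by (intro exI[of _ "l(m := lm)"]) (auto simp: fun_upd_def)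
  qed
qed

text \<open>Linear programming duality by Farkas. The unknown of the linear system is a pair of
  potentials u, v and a scale s, subject to u i + v j \<le> s * d i j and s \<ge> 0. The multipliers
  of the first family form the transport plan; the multiplier of the last inequality is the slack in
  the cost bound.\<close>

lemma finite_kantorovich:
  fixes d :: "nat \<Rightarrow> nat \<Rightarrow> real" and a b :: "nat \<Rightarrow> real"
  assumes "0 < n"
    and d_refl: "\<And>i. d i i = 0" and d_nonneg: "\<And>i j. 0 \<le> d i j" and d_tri: "\<And>i j k. d i k \<le> d i j + d j k"
    and a: "\<And>i. 0 \<le> a i" and b: "\<And>i. 0 \<le> b i"
    and dual: "\<And>f. (\<And>i j. i < n \<Longrightarrow> j < n \<Longrightarrow> f i - f j \<le> d i j)
                  \<Longrightarrow> (\<Sum>i<n. a i * f i) - (\<Sum>i<n. b i * f i) \<le> \<delta>"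
  shows "\<exists>w. (\<forall>i<n. \<forall>j<n. 0 \<le> w i j) \<and> (\<forall>i<n. (\<Sum>j<n. w i j) = a i) \<and>
             (\<forall>j<n. (\<Sum>i<n. w i j) = b j) \<and> (\<Sum>i<n. \<Sum>j<n. w i j * d i j) \<le> \<delta>"
proof -
  define K :: "(nat + nat + unit) set" where "K = {..<n} <+> ({..<n} <+> {()})"
  define J :: "((nat \<times> nat) + unit) set" where "J = ({..<n} \<times> {..<n}) <+> {()}"
  define A :: "(nat \<times> nat) + unit \<Rightarrow> nat + nat + unit \<Rightarrow> real" where
    "A = (\<lambda>c k. case c of Inl (i, j) \<Rightarrow>
              (case k of Inl i' \<Rightarrow> of_bool (i' = i) | Inr (Inl j') \<Rightarrow> of_bool (j' = j) | Inr (Inr _) \<Rightarrow> - d i j)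
          | Inr _ \<Rightarrow> (case k of Inr (Inr _) \<Rightarrow> - 1 | _ \<Rightarrow> 0))"
  define B :: "nat + nat + unit \<Rightarrow> real" where
    "B = (\<lambda>k. case k of Inl i \<Rightarrow> a i | Inr (Inl j) \<Rightarrow> b j | Inr (Inr _) \<Rightarrow> - \<delta>)"
  have sumK: "sum F K = (\<Sum>i<n. F (Inl i)) + ((\<Sum>j<n. F (Inr (Inl j))) + F (Inr (Inr ())))"
    for F :: "nat + nat + unit \<Rightarrow> real"
    by (simp add: K_def sum.Plus)
  have sumJ: "sum F J = (\<Sum>i<n. \<Sum>j<n. F (Inl (i, j))) + F (Inr ())"
    for F :: "(nat \<times> nat) + unit \<Rightarrow> real"
    by (simp add: J_def sum.Plus sum.cartesian_product)
  \<comment> \<open>Homogeneous form of \<open>dual\<close>. For s > 0 it is a rescaling. For s = 0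
    the function is constant on the points, all its multiples are admissible in \<open>dual\<close>,
    and a linear functional bounded on a whole line of multiples cannot be positive.\<close>
  have delta: "(\<Sum>i<n. a i * f i) - (\<Sum>i<n. b i * f i) \<le> \<delta> * s"
    if s: "0 \<le> s" and f: "\<And>i j. i < n \<Longrightarrow> j < n \<Longrightarrow> f i - f j \<le> s * d i j" for f s
  proof (cases "s = 0")
    case False
    have "(\<Sum>i<n. a i * (f i / s)) - (\<Sum>i<n. b i * (f i / s)) \<le> \<delta>"
    proof (rule dual)
      fix i j assume "i < n" "j < n"
      thus "f i / s - f j / s \<le> d i j" using f[of i j] s False
        by (simp add: diff_divide_distrib[symmetric] divide_le_eq mult.commute)
    qed
    moreover have "(\<Sum>i<n. c i * (f i / s)) = (\<Sum>i<n. c i * f i) / s" for c :: "nat \<Rightarrow> real"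
      by (simp add: sum_divide_distrib)
    ultimately show ?thesis using s False
      by (simp add: diff_divide_distrib[symmetric] divide_le_eq)
  next
    case True
    let ?D = "(\<Sum>i<n. a i * f i) - (\<Sum>i<n. b i * f i)"
    have cD: "c * ?D \<le> \<delta>" for c
    proof -
      have eq: "f i = f j" if "i < n" "j < n" for i j
        using f[of i j] f[of j i] that True by simp
      have "(\<Sum>i<n. a i * f i) = (\<Sum>i<n. a i * f 0)" "(\<Sum>i<n. b i * f i) = (\<Sum>i<n. b i * f 0)"
        using \<open>0 < n\<close> by (intro sum.cong arg_cong2[where f = "(*)"] eq refl; simp)+
      moreover have "(\<Sum>i<n. a i * (c * f 0)) - (\<Sum>i<n. b i * (c * f 0)) \<le> \<delta>"
        using d_nonneg by (intro dual) simp
      moreover have "(\<Sum>i<n. e i * (c * f 0)) = c * (\<Sum>i<n. e i * f 0)" for e :: "nat \<Rightarrow> real"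
        by (simp add: sum_distrib_left mult.left_commute)
      ultimately show ?thesis by (simp add: right_diff_distrib)
    qed
    have "?D \<le> 0"
    proof (rule ccontr)
      assume "\<not> ?D \<le> 0"
      thus False using cD[of "(\<delta> + 1) / ?D"] by simp
    qed
    thus ?thesis using True by simp
  qed
  have fK: "finite K" and fJ: "finite J" by (auto simp: K_def J_def)
  have "\<exists>l. (\<forall>i\<in>J. 0 \<le> l i) \<and> (\<forall>k\<in>K. B k = (\<Sum>i\<in>J. l i * A i k))"
  proof (rule farkas[OF fJ fK])
    fix x assume x: "\<And>i. i \<in> J \<Longrightarrow> (\<Sum>k\<in>K. A i k * x k) \<le> 0"
    define u where "u = (\<lambda>i. x (Inl i))"
    define v where "v = (\<lambda>i. x (Inr (Inl i)))"
    define s where "s = x (Inr (Inr ()))"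
    have Inr_J: "Inr () \<in> J" by (auto simp: J_def)
    have s: "0 \<le> s" using x[OF Inr_J] by (simp add: sumK A_def s_def)
    have uv: "u i + v j \<le> s * d i j" if "i < n" "j < n" for i j
    proof -
      have "Inl (i, j) \<in> J" using that by (auto simp: J_def)
      from x[OF this] show ?thesis using that
        by (simp add: sumK A_def s_def u_def v_def mult.commute)
    qed
    \<comment> \<open>The c-transform of v: a single function with u \<le> f \<le> - v that is
      s-Lipschitz by the triangle inequality, so that the pair of potentials may be replaced by
      it.\<close>
    define f where "f = (\<lambda>i. Min ((\<lambda>j. s * d i j - v j) ` {..<n}))"
    have ne: "{..<n} \<noteq> {}" using \<open>0 < n\<close> by auto
    have f_le: "f i \<le> s * d i j - v j" if "j < n" for i j
      unfolding f_def using that by (intro Min_le) auto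
    have f_ge: "c \<le> f i" if "\<And>j. j < n \<Longrightarrow> c \<le> s * d i j - v j" for c i
      unfolding f_def using that ne by (subst Min_ge_iff) auto
    have "(\<Sum>i<n. a i * f i) - (\<Sum>i<n. b i * f i) \<le> \<delta> * s"
    proof (rule delta[OF s])
      fix i j
      have "f i - s * d i j \<le> f j"
      proof (rule f_ge)
        fix k assume "k < n"
        have "s * d i k \<le> s * d i j + s * d j k"
          using mult_left_mono[OF d_tri[of i k j] s] by (simp add: distrib_left)
        thus "f i - s * d i j \<le> s * d j k - v k" using f_le[OF \<open>k < n\<close>, of i] by simp
      qed
      thus "f i - f j \<le> s * d i j" by simp
    qed
    moreover have "(\<Sum>i<n. a i * u i) \<le> (\<Sum>i<n. a i * f i)"
      using uv a by (intro sum_mono mult_left_mono f_ge) (auto simp: le_diff_eq)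
    moreover have "(\<Sum>i<n. b i * v i) \<le> (\<Sum>i<n. b i * (- f i))"
    proof (intro sum_mono mult_left_mono b)
      fix i assume "i \<in> {..<n}"
      thus "v i \<le> - f i" using f_le[of i i] d_refl by simp
    qed
    ultimately show "(\<Sum>k\<in>K. B k * x k) \<le> 0"
      by (simp add: sumK B_def u_def v_def s_def sum_negf)
  qed
  then obtain l where l: "\<And>i. i \<in> J \<Longrightarrow> 0 \<le> l i" "\<And>k. k \<in> K \<Longrightarrow> B k = (\<Sum>i\<in>J. l i * A i k)"
    by blast
  have mem: "Inl i \<in> K" "Inr (Inl i) \<in> K" "Inr (Inr ()) \<in> K" if "i < n" for i
    using that by (auto simp: K_def)
  define w where "w = (\<lambda>i j. l (Inl (i, j)))"
  have row: "a i = (\<Sum>j<n. w i j)" if "i < n" for i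
  proof -
    have "a i = (\<Sum>i'<n. \<Sum>j<n. w i' j * of_bool (i = i'))"
      using l(2)[OF mem(1)[OF that]] by (simp add: sumJ A_def B_def w_def)
    also have "\<dots> = (\<Sum>i'<n. if i = i' then (\<Sum>j<n. w i' j) else 0)" by (intro sum.cong) auto
    finally show ?thesis using that by simp
  qed
  have col: "b j = (\<Sum>i<n. w i j)" if "j < n" for j
  proof -
    have "b j = (\<Sum>i<n. \<Sum>j'<n. w i j' * of_bool (j = j'))"
      using l(2)[OF mem(2)[OF that]] by (simp add: sumJ A_def B_def w_def)
    also have "\<dots> = (\<Sum>i<n. \<Sum>j'<n. if j = j' then w i j' else 0)" by (intro sum.cong) auto
    finally show ?thesis using that by simp
  qed
  have "- \<delta> = (\<Sum>i<n. \<Sum>j<n. w i j * - d i j) - l (Inr ())"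
    using l(2)[OF mem(3)[OF \<open>0 < n\<close>]] by (simp add: sumJ A_def B_def w_def)
  moreover have "0 \<le> l (Inr ())" by (rule l) (auto simp: J_def)
  ultimately have "(\<Sum>i<n. \<Sum>j<n. w i j * d i j) \<le> \<delta>" by (simp add: sum_negf)
  moreover have "0 \<le> w i j" if "i < n" "j < n" for i j
    unfolding w_def using that by (intro l) (auto simp: J_def)
  ultimately show ?thesis using row col by (intro exI[of _ w]) simp
qed

section \<open>Kantorovich--Rubinstein bound\<close>

lemma nn_integral_finite_range:
  fixes c :: "'a \<Rightarrow> nat" and g :: "nat \<Rightarrow> ennreal"
  assumes c: "c \<in> M \<rightarrow>\<^sub>M count_space UNIV" and bd: "\<And>x. c x < n"
  shows "(\<integral>\<^sup>+x. g (c x) \<partial>M) = (\<Sum>i<n. g i * emeasure M {x\<in>space M. c x = i})"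
proof -
  have "(\<integral>\<^sup>+x. g (c x) \<partial>M) = (\<integral>\<^sup>+x. (\<Sum>i<n. g i * indicator {x\<in>space M. c x = i} x) \<partial>M)"
  proof (rule nn_integral_cong)
    fix x assume "x \<in> space M"
    hence "(\<Sum>i<n. g i * indicator {x\<in>space M. c x = i} x) = (\<Sum>i<n. if i = c x then g i else 0)"
      by (intro sum.cong) (auto simp: indicator_def)
    thus "g (c x) = (\<Sum>i<n. g i * indicator {x\<in>space M. c x = i} x)" using bd[of x] by simp
  qed
  also have "\<dots> = (\<Sum>i<n. g i * emeasure M {x\<in>space M. c x = i})"
    using c by (subst nn_integral_sum) (auto simp: nn_integral_cmult_indicator)
  finally show ?thesis .
qed

lemma integral_finite_range:
  fixes c :: "'a \<Rightarrow> nat" and g :: "nat \<Rightarrow> real"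
  assumes "finite_measure M" and c: "c \<in> M \<rightarrow>\<^sub>M count_space UNIV" and bd: "\<And>x. c x < n"
  shows "(\<integral>x. g (c x) \<partial>M) = (\<Sum>i<n. measure M {x\<in>space M. c x = i} * g i)"
proof -
  interpret finite_measure M by fact
  have "(\<integral>x. g (c x) \<partial>M) = (\<integral>x. (\<Sum>i<n. g i * indicator {x\<in>space M. c x = i} x) \<partial>M)"
  proof (rule Bochner_Integration.integral_cong[OF refl])
    fix x assume "x \<in> space M"
    hence "(\<Sum>i<n. g i * indicator {x\<in>space M. c x = i} x) = (\<Sum>i<n. if i = c x then g i else 0)"
      by (intro sum.cong) (auto simp: indicator_def)
    thus "g (c x) = (\<Sum>i<n. g i * indicator {x\<in>space M. c x = i} x)" using bd[of x] by simp
  qed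
  also have "\<dots> = (\<Sum>i<n. measure M {x\<in>space M. c x = i} * g i)"
    using c by (subst Bochner_Integration.integral_sum)
      (auto simp: less_top[symmetric] integral_mult_right_zero mult.commute intro!: sum.cong integrable_mult_right
        integrable_real_indicator)
  finally show ?thesis .
qed

lemma mcshane_extension:
  fixes p :: "nat \<Rightarrow> 'e::metric_space"
  assumes "0 < n" and f: "\<And>i j. i < n \<Longrightarrow> j < n \<Longrightarrow> f i - f j \<le> dist (p i) (p j)"
  shows "\<exists>F. 1-lipschitz_on UNIV F \<and> (\<forall>i<n. F (p i) = (f i :: real))"
proof -
  define F where "F = (\<lambda>x. Min ((\<lambda>j. f j + dist x (p j)) ` {..<n}))"
  have F_le: "F x \<le> f j + dist x (p j)" if "j < n" for x j
    unfolding F_def using that by (intro Min_le) auto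
  have F_ge: "c \<le> F x" if "\<And>j. j < n \<Longrightarrow> c \<le> f j + dist x (p j)" for c x
    unfolding F_def using that \<open>0 < n\<close> by (subst Min_ge_iff) auto
  have le: "F x \<le> F y + dist x y" for x y
  proof -
    have "F x - dist x y \<le> F y"
    proof (rule F_ge)
      fix j assume "j < n"
      thus "F x - dist x y \<le> f j + dist y (p j)"
        using F_le[of j x] dist_triangle[of x "p j" y] by simp
    qed
    thus ?thesis by simp
  qed
  have "1-lipschitz_on UNIV F"
  proof (rule lipschitz_onI)
    show "dist (F x) (F y) \<le> 1 * dist x y" for x y
      using le[of x y] le[of y x] by (simp add: dist_real_def abs_le_iff dist_commute)
  qed simp
  moreover have "F (p i) = f i" if "i < n" for i
  proof (rule antisym)
    show "F (p i) \<le> f i" using F_le[OF that, of "p i"] by simp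
    show "f i \<le> F (p i)" using f[OF that] by (intro F_ge) (simp add: algebra_simps)
  qed
  ultimately show ?thesis by blast
qed

lemma dense_sequence:
  obtains p :: "nat \<Rightarrow> 'e::{metric_space, second_countable_topology}"
  where "\<And>x r. 0 < r \<Longrightarrow> \<exists>i. dist x (p i) < r"
proof -
  obtain S :: "'e set" where S: "countable S" "\<And>X. open X \<Longrightarrow> X \<noteq> {} \<Longrightarrow> \<exists>d\<in>S. d \<in> X"
    by (rule countable_dense_setE) blast
  define p where "p = from_nat_into S"
  have "\<exists>i. dist x (p i) < r" if "0 < r" for x r
  proof -
    have "ball x r \<noteq> {}" using that by simp
    then obtain d where "d \<in> S" "d \<in> ball x r" using S(2)[of "ball x r"] by blast
    moreover obtain i where "d = p i"
      using \<open>d \<in> S\<close> S(1) from_nat_into_surj unfolding p_def by metis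
    ultimately show ?thesis by (auto simp: dist_commute)
  qed
  thus ?thesis by (rule that)
qed

text \<open>Reduces both measures at once to the same finite set of points with small transport
  error: tightness is only needed along the cells of a dense sequence, and outside finitely many
  cells the distance is bounded by \<open>D\<close> on a set of small mass.\<close>

lemma quantization:
  fixes \<mu> \<nu> :: "'e::{metric_space, second_countable_topology} measure"
  assumes "prob_space \<mu>" "prob_space \<nu>" and sets: "sets \<mu> = sets borel" "sets \<nu> = sets borel"
    and D: "\<And>x y :: 'e. dist x y \<le> D" and "0 < e"
  obtains p :: "nat \<Rightarrow> 'e" and c :: "'e \<Rightarrow> nat" and n where "0 < n"
    "c \<in> borel \<rightarrow>\<^sub>M count_space UNIV" "\<And>x. c x < n"
    "(\<integral>x. dist x (p (c x)) \<partial>\<mu>) \<le> e" "(\<integral>x. dist x (p (c x)) \<partial>\<nu>) \<le> e"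
proof -
  interpret \<mu>: prob_space \<mu> by fact
  interpret \<nu>: prob_space \<nu> by fact
  have D0: "0 \<le> D" using D[of undefined undefined] by simp
  obtain p :: "nat \<Rightarrow> 'e" where dense: "\<And>x r. 0 < r \<Longrightarrow> \<exists>i. dist x (p i) < r"
    by (rule dense_sequence, rule that)
  \<comment> \<open>Chosen such that r + D * r = e / 2: radius of the cells plus \<open>D\<close>
    times the mass of the remainder.\<close>
  define r where "r = e / (2 + 2 * D)"
  have r: "0 < r" using \<open>0 < e\<close> D0 by (simp add: r_def)
  have rD: "r + D * r \<le> e"
  proof -
    have "r * (2 + 2 * D) = e" using D0 by (simp add: r_def)
    hence "2 * (r + D * r) = e" by (simp add: algebra_simps)
    thus ?thesis using \<open>0 < e\<close> by simp
  qed
  define k where "k = (\<lambda>x. LEAST i. dist x (p i) < r)"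
  have k: "dist x (p (k x)) < r" for x
    unfolding k_def using dense[OF r] by (rule LeastI_ex)
  have k_meas[measurable]: "k \<in> borel \<rightarrow>\<^sub>M count_space UNIV"
    unfolding k_def by measurable
  have small: "\<exists>n. measure \<kappa> {x. n \<le> k x} \<le> r" if "prob_space \<kappa>" "sets \<kappa> = sets borel" for \<kappa>
  proof -
    interpret prob_space \<kappa> by fact
    have [measurable_cong]: "sets \<kappa> = sets borel" by fact
    have sp: "space \<kappa> = UNIV" using sets_eq_imp_space_eq[OF that(2)] by simp
    have "(\<lambda>n. measure \<kappa> {x\<in>space \<kappa>. n \<le> k x}) \<longlonglongrightarrow> measure \<kappa> (\<Inter>n. {x\<in>space \<kappa>. n \<le> k x})"
      by (intro finite_Lim_measure_decseq) (auto simp: decseq_def)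
    moreover have "(\<Inter>n. {x\<in>space \<kappa>. n \<le> k x}) = {}"
      by (auto intro: exI[of _ "Suc _"]) (metis not_less_eq_eq order_refl)
    ultimately have "(\<lambda>n. measure \<kappa> {x. n \<le> k x}) \<longlonglongrightarrow> 0" by (simp add: sp)
    hence "eventually (\<lambda>n. measure \<kappa> {x. n \<le> k x} < r) sequentially"
      using r by (rule order_tendstoD)
    thus ?thesis by (metis (no_types, lifting) eventually_sequentially less_imp_le order_refl)
  qed
  obtain n1 n2 where n12: "measure \<mu> {x. n1 \<le> k x} \<le> r" "measure \<nu> {x. n2 \<le> k x} \<le> r"
    using small assms by metis
  define n where "n = max n1 n2"
  \<comment> \<open>All points outside the first \<open>n\<close> cells are sent to the point with
    index \<open>n\<close>, at a cost of at most \<open>D\<close> each.\<close>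
  define c where "c = (\<lambda>x. min (k x) n)"
  have [measurable]: "c \<in> borel \<rightarrow>\<^sub>M count_space UNIV" unfolding c_def by measurable
  have est: "(\<integral>x. dist x (p (c x)) \<partial>\<kappa>) \<le> e"
    if "prob_space \<kappa>" "sets \<kappa> = sets borel" "measure \<kappa> {x. n' \<le> k x} \<le> r" "n' \<le> n" for \<kappa> n'
  proof -
    interpret prob_space \<kappa> by fact
    have [measurable_cong]: "sets \<kappa> = sets borel" by fact
    have sp: "space \<kappa> = UNIV" using sets_eq_imp_space_eq[OF that(2)] by simp
    have [measurable]: "{x. n \<le> k x} \<in> sets borel" by measurable
    have "measure \<kappa> {x. n \<le> k x} \<le> measure \<kappa> {x. n' \<le> k x}"
      using \<open>n' \<le> n\<close> by (intro finite_measure_mono) auto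
    hence le: "measure \<kappa> {x. n \<le> k x} \<le> r" using that(3) by simp
    have "(\<integral>x. dist x (p (c x)) \<partial>\<kappa>) \<le> (\<integral>x. r + D * indicator {x. n \<le> k x} x \<partial>\<kappa>)"
    proof (rule integral_mono)
      show "integrable \<kappa> (\<lambda>x. dist x (p (c x)))"
        by (rule integrable_const_bound[of _ D]) (auto simp: D)
      show "integrable \<kappa> (\<lambda>x. r + D * indicator {x. n \<le> k x} x)"
        by (intro Bochner_Integration.integrable_add integrable_mult_right integrable_real_indicator)
           (auto simp: less_top[symmetric])
      show "dist x (p (c x)) \<le> r + D * indicator {x. n \<le> k x} x" for x
        using k[of x] D[of x "p (c x)"] r D0 by (auto simp: c_def indicator_def min_def not_le)
    qed
    also have "\<dots> = r + D * measure \<kappa> {x. n \<le> k x}"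
      by (subst Bochner_Integration.integral_add) (auto simp: prob_space[unfolded sp] sp less_top[symmetric])
    also have "\<dots> \<le> r + D * r" using le D0 by (intro add_left_mono mult_left_mono)
    finally show ?thesis using rD by simp
  qed
  show ?thesis
  proof (rule that)
    show "0 < Suc n" "c \<in> borel \<rightarrow>\<^sub>M count_space UNIV" "c x < Suc n" for x
      by (auto simp: c_def)
    show "(\<integral>x. dist x (p (c x)) \<partial>\<mu>) \<le> e" "(\<integral>x. dist x (p (c x)) \<partial>\<nu>) \<le> e"
      using est[of \<mu> n1] est[of \<nu> n2] n12 assms by (auto simp: n_def)
  qed
qed

text \<open>An optimal plan between the quantized measures is lifted to a genuine coupling of the
  original ones by taking, inside each product of cells, the product measure rescaled to the planned
  mass. The marginals are then exact and only distances are approximated: \<open>2 * e\<close> is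
  lost when \<open>dual\<close> is passed to the finite problem and \<open>2 * e\<close> when its
  cost is lifted.\<close>

theorem kantorovich_rubinstein_le:
  fixes \<mu> \<nu> :: "'e::{metric_space, second_countable_topology} measure"
  assumes prob: "prob_space \<mu>" "prob_space \<nu>" and sets: "sets \<mu> = sets borel" "sets \<nu> = sets borel"
    and D: "\<And>x y :: 'e. dist x y \<le> D"
    and dual: "\<And>f. 1-lipschitz_on UNIV f \<Longrightarrow> (\<integral>x. f x \<partial>\<mu>) - (\<integral>x. f x \<partial>\<nu>) \<le> \<delta>"
  shows "wasserstein \<mu> \<nu> \<le> ennreal \<delta>"
proof -
  interpret \<mu>: prob_space \<mu> by fact
  interpret \<nu>: prob_space \<nu> by fact
  interpret pair_sigma_finite \<mu> \<nu> ..
  note [measurable_cong] = sets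
  have sp: "space \<mu> = UNIV" "space \<nu> = UNIV"
    using sets_eq_imp_space_eq[OF sets(1)] sets_eq_imp_space_eq[OF sets(2)] by simp_all
  have \<delta>: "0 \<le> \<delta>" using dual[of "\<lambda>_. 0"] by (simp add: lipschitz_on_def)
  have "wasserstein \<mu> \<nu> \<le> ennreal \<delta> + ennreal (4 * e)" if "0 < e" for e
  proof -
    obtain p and c :: "'e \<Rightarrow> nat" and n where n: "0 < n"
      and c[measurable]: "c \<in> borel \<rightarrow>\<^sub>M count_space UNIV" and cn: "\<And>x. c x < n"
      and err: "(\<integral>x. dist x (p (c x)) \<partial>\<mu>) \<le> e" "(\<integral>x. dist x (p (c x)) \<partial>\<nu>) \<le> e"
      by (rule quantization[OF prob sets D \<open>0 < e\<close>], rule that)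
    define a where "a = (\<lambda>i. measure \<mu> {x\<in>space \<mu>. c x = i})"
    define b where "b = (\<lambda>i. measure \<nu> {x\<in>space \<nu>. c x = i})"
    \<comment> \<open>A function on the finite point set extends to a 1-Lipschitz function on E, to
      which \<open>dual\<close> applies; each of the two integrals moves by at most
      \<open>e\<close>.\<close>
    have dual': "(\<Sum>i<n. a i * f i) - (\<Sum>i<n. b i * f i) \<le> \<delta> + 2 * e"
      if f: "\<And>i j. i < n \<Longrightarrow> j < n \<Longrightarrow> f i - f j \<le> dist (p i) (p j)" for f
    proof -
      obtain F where F: "1-lipschitz_on UNIV F" "\<And>i. i < n \<Longrightarrow> F (p i) = f i"
        using mcshane_extension[of n f p, OF n f] by blast
      have [measurable]: "F \<in> borel_measurable borel"
        using F(1) by (intro borel_measurable_continuous_onI lipschitz_on_continuous_on)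
      have Fd: "\<bar>F x - F y\<bar> \<le> dist x y" for x y
        using lipschitz_onD[OF F(1), of x y] by (simp add: dist_real_def)
      have Fb: "\<bar>F x\<bar> \<le> \<bar>F (p 0)\<bar> + D" for x
        using Fd[of x "p 0"] D[of x "p 0"] by linarith
      have close: "\<bar>(\<Sum>i<n. measure \<kappa> {x\<in>space \<kappa>. c x = i} * f i) - (\<integral>x. F x \<partial>\<kappa>)\<bar> \<le> e"
        if "prob_space \<kappa>" "sets \<kappa> = sets borel" "(\<integral>x. dist x (p (c x)) \<partial>\<kappa>) \<le> e" for \<kappa>
      proof -
        interpret \<kappa>: prob_space \<kappa> by fact
        have [measurable_cong]: "sets \<kappa> = sets borel" by fact
        have int: "integrable \<kappa> (\<lambda>x. F x)" "integrable \<kappa> (\<lambda>x. F (p (c x)))"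
          "integrable \<kappa> (\<lambda>x. dist x (p (c x)))"
          by (rule \<kappa>.integrable_const_bound[of _ "\<bar>F (p 0)\<bar> + D"] \<kappa>.integrable_const_bound[of _ D];
              use D Fb in \<open>auto\<close>)+
        have "(\<Sum>i<n. measure \<kappa> {x\<in>space \<kappa>. c x = i} * f i) = (\<integral>x. f (c x) \<partial>\<kappa>)"
          using that(2) by (subst integral_finite_range[where n = n]) (auto simp: cn \<kappa>.finite_measure_axioms)
        also have "\<dots> = (\<integral>x. F (p (c x)) \<partial>\<kappa>)" using F(2) cn by simp
        finally have "\<bar>(\<Sum>i<n. measure \<kappa> {x\<in>space \<kappa>. c x = i} * f i) - (\<integral>x. F x \<partial>\<kappa>)\<bar>
            = \<bar>\<integral>x. F (p (c x)) - F x \<partial>\<kappa>\<bar>"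
          using int by simp
        also have "\<dots> \<le> (\<integral>x. dist x (p (c x)) \<partial>\<kappa>)"
        proof -
          have "\<bar>\<integral>x. F (p (c x)) - F x \<partial>\<kappa>\<bar> \<le> (\<integral>x. \<bar>F (p (c x)) - F x\<bar> \<partial>\<kappa>)"
            by (rule integral_abs_bound)
          also have "\<dots> \<le> (\<integral>x. dist x (p (c x)) \<partial>\<kappa>)"
            using int Fd[of "p (c _)"]
            by (intro integral_mono integrable_abs) (auto simp: dist_commute[of _ "p (c _)"])
          finally show ?thesis .
        qed
        finally show ?thesis using that(3) by simp
      qed
      show ?thesis
        using close[OF prob(1) sets(1) err(1)] close[OF prob(2) sets(2) err(2)] dual[OF F(1)]
        unfolding a_def b_def by linarith
    qed
    have ab: "0 \<le> a i" "0 \<le> b i" for i by (auto simp: a_def b_def)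
    obtain w where w: "\<And>i j. i < n \<Longrightarrow> j < n \<Longrightarrow> 0 \<le> w i j" "\<And>i. i < n \<Longrightarrow> (\<Sum>j<n. w i j) = a i"
      "\<And>j. j < n \<Longrightarrow> (\<Sum>i<n. w i j) = b j" "(\<Sum>i<n. \<Sum>j<n. w i j * dist (p i) (p j)) \<le> \<delta> + 2 * e"
      using finite_kantorovich[of n "\<lambda>i j. dist (p i) (p j)" a b, OF n _ _ _ ab dual']
      by (auto simp: dist_triangle)
    \<comment> \<open>The density below divides by \<open>a i * b j\<close>; division by zero yields
      0, and this is harmless because a cell without mass carries no part of the plan.\<close>
    have w0: "w i j = 0" if "i < n" "j < n" "a i = 0 \<or> b j = 0" for i j
    proof -
      have "w i j \<le> a i" using w(1) that by (subst w(2)[symmetric]) (auto intro!: member_le_sum)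
      moreover have "w i j \<le> b j"
        using w(1) that by (subst w(3)[symmetric]) (auto intro!: member_le_sum[of i "{..<n}" "\<lambda>i. w i j"])
      ultimately show ?thesis using that w(1)[of i j] by auto
    qed
    define h where "h = (\<lambda>i j. w i j / (a i * b j))"
    have h: "0 \<le> h i j" if "i < n" "j < n" for i j using that w(1) ab by (simp add: h_def)
    define W where "W = density (\<mu> \<Otimes>\<^sub>M \<nu>) (\<lambda>(x, y). ennreal (h (c x) (c y)))"
    have ema: "emeasure \<mu> {x\<in>space \<mu>. c x = i} = ennreal (a i)"
      and emb: "emeasure \<nu> {x\<in>space \<nu>. c x = i} = ennreal (b i)" for i
      by (simp_all add: a_def b_def \<mu>.emeasure_eq_measure \<nu>.emeasure_eq_measure)
    have nnb: "(\<integral>\<^sup>+y. ennreal (g (c y)) \<partial>\<nu>) = ennreal (\<Sum>j<n. g j * b j)"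
      if "\<And>j. j < n \<Longrightarrow> 0 \<le> g j" for g
      using that ab(2) by (subst nn_integral_finite_range[where n = n and g = "\<lambda>i. ennreal (g i)"])
        (auto simp: cn emb ennreal_mult[symmetric] intro!: sum_ennreal)
    have nna: "(\<integral>\<^sup>+y. ennreal (g (c y)) \<partial>\<mu>) = ennreal (\<Sum>j<n. g j * a j)"
      if "\<And>j. j < n \<Longrightarrow> 0 \<le> g j" for g
      using that ab(1) by (subst nn_integral_finite_range[where n = n and g = "\<lambda>i. ennreal (g i)"])
        (auto simp: cn ema ennreal_mult[symmetric] intro!: sum_ennreal)
    have pos_a: "AE x in \<mu>. a (c x) \<noteq> 0"
    proof -
      have "(\<integral>\<^sup>+x. ennreal (of_bool (a (c x) = 0)) \<partial>\<mu>) = 0"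
        by (subst nna[of "\<lambda>i. of_bool (a i = 0)"]) (auto intro!: sum.neutral)
      hence "AE x in \<mu>. ennreal (of_bool (a (c x) = 0)) = 0"
        by (subst (asm) nn_integral_0_iff_AE) auto
      thus ?thesis by eventually_elim (auto split: if_splits)
    qed
    have pos_b: "AE x in \<nu>. b (c x) \<noteq> 0"
    proof -
      have "(\<integral>\<^sup>+x. ennreal (of_bool (b (c x) = 0)) \<partial>\<nu>) = 0"
        by (subst nnb[of "\<lambda>i. of_bool (b i = 0)"]) (auto intro!: sum.neutral)
      hence "AE x in \<nu>. ennreal (of_bool (b (c x) = 0)) = 0"
        by (subst (asm) nn_integral_0_iff_AE) auto
      thus ?thesis by eventually_elim (auto split: if_splits)
    qed
    have row: "(\<Sum>j<n. h i j * b j) = 1" if "i < n" "a i \<noteq> 0" for i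
    proof -
      have "(\<Sum>j<n. h i j * b j) = (\<Sum>j<n. w i j / a i)"
        using that w0 by (intro sum.cong) (auto simp: h_def)
      thus ?thesis using that w(2) by (simp add: sum_divide_distrib[symmetric])
    qed
    have col: "(\<Sum>i<n. h i j * a i) = 1" if "j < n" "b j \<noteq> 0" for j
    proof -
      have "(\<Sum>i<n. h i j * a i) = (\<Sum>i<n. w i j / b j)"
        using that w0 by (intro sum.cong) (auto simp: h_def)
      thus ?thesis using that w(3) by (simp add: sum_divide_distrib[symmetric])
    qed
    have marg1: "distr W borel fst = \<mu>"
    proof (rule measure_eqI)
      fix B assume "B \<in> sets (distr W borel fst)"
      hence [measurable]: "B \<in> sets borel" by simp
      have "emeasure (distr W borel fst) B = emeasure W (fst -` B \<inter> space (\<mu> \<Otimes>\<^sub>M \<nu>))"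
        unfolding W_def by (subst emeasure_distr) auto
      also have "\<dots> = (\<integral>\<^sup>+z. ennreal (h (c (fst z)) (c (snd z))) * indicator B (fst z) \<partial>(\<mu> \<Otimes>\<^sub>M \<nu>))"
        unfolding W_def by (subst emeasure_density) (auto simp: split_beta indicator_def intro!: nn_integral_cong)
      also have "\<dots> = (\<integral>\<^sup>+x. \<integral>\<^sup>+y. ennreal (h (c x) (c y)) * indicator B x \<partial>\<nu> \<partial>\<mu>)"
        by (subst \<nu>.nn_integral_fst[symmetric]) auto
      also have "\<dots> = (\<integral>\<^sup>+x. indicator B x \<partial>\<mu>)"
        using pos_a
      proof (intro nn_integral_cong_AE, eventually_elim)
        fix x assume "a (c x) \<noteq> 0"
        thus "(\<integral>\<^sup>+y. ennreal (h (c x) (c y)) * indicator B x \<partial>\<nu>) = indicator B x"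
          by (subst nn_integral_multc) (auto simp: nnb[of "h (c x)"] h cn row)
      qed
      finally show "emeasure (distr W borel fst) B = emeasure \<mu> B" by simp
    qed (simp add: sets)
    have marg2: "distr W borel snd = \<nu>"
    proof (rule measure_eqI)
      fix B assume "B \<in> sets (distr W borel snd)"
      hence [measurable]: "B \<in> sets borel" by simp
      have "emeasure (distr W borel snd) B = emeasure W (snd -` B \<inter> space (\<mu> \<Otimes>\<^sub>M \<nu>))"
        unfolding W_def by (subst emeasure_distr) auto
      also have "\<dots> = (\<integral>\<^sup>+z. ennreal (h (c (fst z)) (c (snd z))) * indicator B (snd z) \<partial>(\<mu> \<Otimes>\<^sub>M \<nu>))"
        unfolding W_def by (subst emeasure_density) (auto simp: split_beta indicator_def intro!: nn_integral_cong)
      also have "\<dots> = (\<integral>\<^sup>+y. \<integral>\<^sup>+x. ennreal (h (c x) (c y)) * indicator B y \<partial>\<mu> \<partial>\<nu>)"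
        by (subst nn_integral_snd[symmetric]) auto
      also have "\<dots> = (\<integral>\<^sup>+y. indicator B y \<partial>\<nu>)"
        using pos_b
      proof (intro nn_integral_cong_AE, eventually_elim)
        fix y assume "b (c y) \<noteq> 0"
        thus "(\<integral>\<^sup>+x. ennreal (h (c x) (c y)) * indicator B y \<partial>\<mu>) = indicator B y"
          by (subst nn_integral_multc) (auto simp: nna[of "\<lambda>i. h i (c y)"] h cn col)
      qed
      finally show "emeasure (distr W borel snd) B = emeasure \<nu> B" by simp
    qed (simp add: sets)
    have sets_W: "sets W = sets (borel \<Otimes>\<^sub>M borel)"
      unfolding W_def by (simp add: sets cong: sets_pair_measure_cong)
    note [measurable_cong] = sets_W
    have "W \<in> couplings \<mu> \<nu>" using marg1 marg2 sets_W by (simp add: couplings_def)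
    hence "wasserstein \<mu> \<nu> \<le> (\<integral>\<^sup>+z. ennreal (dist (fst z) (snd z)) \<partial>W)"
      unfolding wasserstein_def by (rule INF_lower)
    also have "\<dots> \<le> (\<integral>\<^sup>+z. ennreal (dist (p (c (fst z))) (p (c (snd z))))
        + ennreal (dist (fst z) (p (c (fst z)))) + ennreal (dist (snd z) (p (c (snd z)))) \<partial>W)"
    proof (rule nn_integral_mono)
      fix z :: "'e \<times> 'e"
      have "dist (fst z) (snd z) \<le> dist (p (c (fst z))) (p (c (snd z)))
        + dist (fst z) (p (c (fst z))) + dist (snd z) (p (c (snd z)))"
        by metric
      thus "ennreal (dist (fst z) (snd z)) \<le> ennreal (dist (p (c (fst z))) (p (c (snd z))))
        + ennreal (dist (fst z) (p (c (fst z)))) + ennreal (dist (snd z) (p (c (snd z))))"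
        by (simp add: ennreal_plus[symmetric] del: ennreal_plus)
    qed
    also have "\<dots> = (\<integral>\<^sup>+z. ennreal (dist (p (c (fst z))) (p (c (snd z)))) \<partial>W)
        + (\<integral>\<^sup>+z. ennreal (dist (fst z) (p (c (fst z)))) \<partial>W)
        + (\<integral>\<^sup>+z. ennreal (dist (snd z) (p (c (snd z)))) \<partial>W)"
      by (simp add: nn_integral_add)
    also have "(\<integral>\<^sup>+z. ennreal (dist (fst z) (p (c (fst z)))) \<partial>W) = (\<integral>\<^sup>+x. ennreal (dist x (p (c x))) \<partial>\<mu>)"
      by (subst marg1[symmetric], subst nn_integral_distr) auto
    also have "\<dots> = ennreal (\<integral>x. dist x (p (c x)) \<partial>\<mu>)"
      by (intro nn_integral_eq_integral \<mu>.integrable_const_bound[of _ D]) (auto simp: D)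
    also have "(\<integral>\<^sup>+z. ennreal (dist (snd z) (p (c (snd z)))) \<partial>W) = (\<integral>\<^sup>+x. ennreal (dist x (p (c x))) \<partial>\<nu>)"
      by (subst marg2[symmetric], subst nn_integral_distr) auto
    also have "\<dots> = ennreal (\<integral>x. dist x (p (c x)) \<partial>\<nu>)"
      by (intro nn_integral_eq_integral \<nu>.integrable_const_bound[of _ D]) (auto simp: D)
    also have "(\<integral>\<^sup>+z. ennreal (dist (p (c (fst z))) (p (c (snd z)))) \<partial>W) \<le> ennreal (\<delta> + 2 * e)"
    proof -
      have "(\<integral>\<^sup>+z. ennreal (dist (p (c (fst z))) (p (c (snd z)))) \<partial>W)
        = (\<integral>\<^sup>+x. \<integral>\<^sup>+y. ennreal (h (c x) (c y) * dist (p (c x)) (p (c y))) \<partial>\<nu> \<partial>\<mu>)"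
        unfolding W_def
        by (subst nn_integral_density)
           (auto simp: \<nu>.nn_integral_fst[symmetric] split_beta ennreal_mult' h cn)
      also have "\<dots> = (\<integral>\<^sup>+x. ennreal (\<Sum>j<n. h (c x) j * dist (p (c x)) (p j) * b j) \<partial>\<mu>)"
        by (subst nnb) (auto simp: h cn)
      also have "\<dots> = ennreal (\<Sum>i<n. (\<Sum>j<n. h i j * dist (p i) (p j) * b j) * a i)"
        by (subst nna[of "\<lambda>i. \<Sum>j<n. h i j * dist (p i) (p j) * b j"]) (auto simp: h ab intro!: sum_nonneg)
      also have "(\<Sum>i<n. (\<Sum>j<n. h i j * dist (p i) (p j) * b j) * a i)
        = (\<Sum>i<n. \<Sum>j<n. w i j * dist (p i) (p j))"
        unfolding sum_distrib_right using w0 by (intro sum.cong refl) (auto simp: h_def)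
      finally show ?thesis using w(4) by (simp add: ennreal_leI)
    qed
    also have "ennreal (\<delta> + 2 * e) + ennreal (\<integral>x. dist x (p (c x)) \<partial>\<mu>) + ennreal (\<integral>x. dist x (p (c x)) \<partial>\<nu>)
        \<le> ennreal (\<delta> + 2 * e) + ennreal e + ennreal e"
      using err by (intro add_mono ennreal_leI order_refl)
    also have "\<dots> = ennreal \<delta> + ennreal (4 * e)"
      using \<open>0 < e\<close> \<delta> by (simp add: ennreal_plus[symmetric] del: ennreal_plus)
    finally show ?thesis by (simp add: add_mono)
  qed
  from this[of "e / 4" for e] have "wasserstein \<mu> \<nu> \<le> ennreal \<delta> + ennreal e" if "0 < e" for e
    using that by simp
  thus ?thesis by (rule ennreal_le_epsilon)
qed

section \<open>Exponential weights\<close>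

lemma ennreal_exp_series:
  assumes "0 \<le> x"
  shows "ennreal (exp x) = (\<Sum>k. ennreal x ^ k * ennreal (1 / fact k))"
proof -
  have "(\<lambda>k. x ^ k * (1 / fact k)) sums exp x"
    using exp_converges[of x] by (simp add: divide_inverse mult.commute)
  hence "(\<Sum>k. ennreal (x ^ k * (1 / fact k))) = ennreal (exp x)"
    using assms by (intro suminf_ennreal_eq) auto
  thus ?thesis using assms by (simp add: ennreal_mult[symmetric] ennreal_power)
qed

text \<open>\<open>K\<close> relates weights on two spaces that give \<open>G1\<close> and \<open>G2\<close> the same integral. Expanding the power as an
  iterated integral over time only uses instances of this relation at finitely many times.\<close>

lemma power_weight:
  fixes G1 :: "'a \<Rightarrow> ennreal" and G2 :: "'b \<Rightarrow> ennreal"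
  assumes "sigma_finite_measure T" "sigma_finite_measure N1" "sigma_finite_measure N2"
    and U1: "(\<lambda>(s, \<omega>). U1 s \<omega>) \<in> borel_measurable (T \<Otimes>\<^sub>M N1)"
    and U2: "(\<lambda>(s, \<omega>). U2 s \<omega>) \<in> borel_measurable (T \<Otimes>\<^sub>M N2)"
    and G1: "G1 \<in> borel_measurable N1" and G2: "G2 \<in> borel_measurable N2"
    and meas: "\<And>H1 H2. K H1 H2 \<Longrightarrow> H1 \<in> borel_measurable N1 \<and> H2 \<in> borel_measurable N2"
    and mult: "\<And>H1 H2 s. K H1 H2 \<Longrightarrow> s \<in> space T \<Longrightarrow> K (\<lambda>\<omega>. H1 \<omega> * U1 s \<omega>) (\<lambda>\<omega>. H2 \<omega> * U2 s \<omega>)"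
    and eq: "\<And>H1 H2. K H1 H2 \<Longrightarrow> (\<integral>\<^sup>+\<omega>. H1 \<omega> * G1 \<omega> \<partial>N1) = (\<integral>\<^sup>+\<omega>. H2 \<omega> * G2 \<omega> \<partial>N2)"
    and "K H1 H2"
  shows "(\<integral>\<^sup>+\<omega>. H1 \<omega> * (\<integral>\<^sup>+s. U1 s \<omega> \<partial>T) ^ k * G1 \<omega> \<partial>N1)
       = (\<integral>\<^sup>+\<omega>. H2 \<omega> * (\<integral>\<^sup>+s. U2 s \<omega> \<partial>T) ^ k * G2 \<omega> \<partial>N2)"
  using \<open>K H1 H2\<close>
proof (induction k arbitrary: H1 H2)
  case 0
  thus ?case using eq by simp
next
  case (Suc k)
  interpret T: sigma_finite_measure T by fact
  interpret N1: sigma_finite_measure N1 by fact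
  interpret N2: sigma_finite_measure N2 by fact
  have [measurable]: "H1 \<in> borel_measurable N1" "H2 \<in> borel_measurable N2"
    using meas[OF Suc.prems] by auto
  note [measurable] = U1 U2 G1 G2
  have "(\<integral>\<^sup>+\<omega>. H1 \<omega> * (\<integral>\<^sup>+s. U1 s \<omega> \<partial>T) ^ Suc k * G1 \<omega> \<partial>N1)
      = (\<integral>\<^sup>+\<omega>. \<integral>\<^sup>+s. (H1 \<omega> * U1 s \<omega>) * (\<integral>\<^sup>+s. U1 s \<omega> \<partial>T) ^ k * G1 \<omega> \<partial>T \<partial>N1)"
  proof (rule nn_integral_cong)
    fix \<omega> assume [measurable]: "\<omega> \<in> space N1"
    have [measurable]: "(\<lambda>s. U1 s \<omega>) \<in> borel_measurable T" by measurable
    have "(\<integral>\<^sup>+s. (H1 \<omega> * U1 s \<omega>) * (\<integral>\<^sup>+s. U1 s \<omega> \<partial>T) ^ k * G1 \<omega> \<partial>T)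
      = (\<integral>\<^sup>+s. U1 s \<omega> * (H1 \<omega> * (\<integral>\<^sup>+s. U1 s \<omega> \<partial>T) ^ k * G1 \<omega>) \<partial>T)"
      by (simp add: mult_ac)
    also have "\<dots> = (\<integral>\<^sup>+s. U1 s \<omega> \<partial>T) * (H1 \<omega> * (\<integral>\<^sup>+s. U1 s \<omega> \<partial>T) ^ k * G1 \<omega>)"
      by (rule nn_integral_multc) measurable
    finally show "H1 \<omega> * (\<integral>\<^sup>+s. U1 s \<omega> \<partial>T) ^ Suc k * G1 \<omega>
      = (\<integral>\<^sup>+s. (H1 \<omega> * U1 s \<omega>) * (\<integral>\<^sup>+s. U1 s \<omega> \<partial>T) ^ k * G1 \<omega> \<partial>T)"
      by (simp add: mult_ac)
  qed
  also have "\<dots> = (\<integral>\<^sup>+s. \<integral>\<^sup>+\<omega>. (H1 \<omega> * U1 s \<omega>) * (\<integral>\<^sup>+s. U1 s \<omega> \<partial>T) ^ k * G1 \<omega> \<partial>N1 \<partial>T)"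
  proof -
    interpret pair_sigma_finite T N1 ..
    show ?thesis by (rule Fubini') measurable
  qed
  also have "\<dots> = (\<integral>\<^sup>+s. \<integral>\<^sup>+\<omega>. (H2 \<omega> * U2 s \<omega>) * (\<integral>\<^sup>+s. U2 s \<omega> \<partial>T) ^ k * G2 \<omega> \<partial>N2 \<partial>T)"
    by (intro nn_integral_cong Suc.IH mult Suc.prems)
  also have "\<dots> = (\<integral>\<^sup>+\<omega>. \<integral>\<^sup>+s. (H2 \<omega> * U2 s \<omega>) * (\<integral>\<^sup>+s. U2 s \<omega> \<partial>T) ^ k * G2 \<omega> \<partial>T \<partial>N2)"
  proof -
    interpret pair_sigma_finite T N2 ..
    show ?thesis by (rule Fubini'[symmetric]) measurable
  qed
  also have "\<dots> = (\<integral>\<^sup>+\<omega>. H2 \<omega> * (\<integral>\<^sup>+s. U2 s \<omega> \<partial>T) ^ Suc k * G2 \<omega> \<partial>N2)"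
  proof (rule nn_integral_cong)
    fix \<omega> assume [measurable]: "\<omega> \<in> space N2"
    have [measurable]: "(\<lambda>s. U2 s \<omega>) \<in> borel_measurable T" by measurable
    have "(\<integral>\<^sup>+s. (H2 \<omega> * U2 s \<omega>) * (\<integral>\<^sup>+s. U2 s \<omega> \<partial>T) ^ k * G2 \<omega> \<partial>T)
      = (\<integral>\<^sup>+s. U2 s \<omega> * (H2 \<omega> * (\<integral>\<^sup>+s. U2 s \<omega> \<partial>T) ^ k * G2 \<omega>) \<partial>T)"
      by (simp add: mult_ac)
    also have "\<dots> = (\<integral>\<^sup>+s. U2 s \<omega> \<partial>T) * (H2 \<omega> * (\<integral>\<^sup>+s. U2 s \<omega> \<partial>T) ^ k * G2 \<omega>)"
      by (rule nn_integral_multc) measurable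
    finally show "(\<integral>\<^sup>+s. (H2 \<omega> * U2 s \<omega>) * (\<integral>\<^sup>+s. U2 s \<omega> \<partial>T) ^ k * G2 \<omega> \<partial>T)
       = H2 \<omega> * (\<integral>\<^sup>+s. U2 s \<omega> \<partial>T) ^ Suc k * G2 \<omega>"
      by (simp add: mult_ac)
  qed
  finally show ?case .
qed

lemma nn_integral_exp_series:
  assumes [measurable]: "A \<in> borel_measurable N" "a \<in> borel_measurable N"
    and a: "\<And>\<omega>. \<omega> \<in> space N \<Longrightarrow> 0 \<le> a \<omega>"
  shows "(\<integral>\<^sup>+\<omega>. A \<omega> * ennreal (exp (a \<omega>)) \<partial>N)
       = (\<Sum>k. ennreal (1 / fact k) * (\<integral>\<^sup>+\<omega>. A \<omega> * ennreal (a \<omega>) ^ k \<partial>N))"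
proof -
  have "(\<integral>\<^sup>+\<omega>. A \<omega> * ennreal (exp (a \<omega>)) \<partial>N)
      = (\<integral>\<^sup>+\<omega>. (\<Sum>k. A \<omega> * ennreal (a \<omega>) ^ k * ennreal (1 / fact k)) \<partial>N)"
    by (intro nn_integral_cong) (simp only: ennreal_exp_series a ennreal_suminf_cmult mult.assoc)
  also have "\<dots> = (\<Sum>k. \<integral>\<^sup>+\<omega>. A \<omega> * ennreal (a \<omega>) ^ k * ennreal (1 / fact k) \<partial>N)"
    by (rule nn_integral_suminf) measurable
  also have "\<dots> = (\<Sum>k. ennreal (1 / fact k) * (\<integral>\<^sup>+\<omega>. A \<omega> * ennreal (a \<omega>) ^ k \<partial>N))"
    by (intro suminf_cong, subst nn_integral_multc) (auto simp: mult.commute)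
  finally show ?thesis .
qed

text \<open>The same transfer for the exponential: every power transfers by
  \<open>power_weight\<close>, and in \<open>ennreal\<close> the series may be exchanged with the
  integral. This is why the exponents have to be nonnegative.\<close>

lemma exp_weight:
  fixes G1 :: "'a \<Rightarrow> ennreal" and G2 :: "'b \<Rightarrow> ennreal"
  assumes "sigma_finite_measure T" "sigma_finite_measure N1" "sigma_finite_measure N2"
    and U1: "(\<lambda>(s, \<omega>). U1 s \<omega>) \<in> borel_measurable (T \<Otimes>\<^sub>M N1)"
    and U2: "(\<lambda>(s, \<omega>). U2 s \<omega>) \<in> borel_measurable (T \<Otimes>\<^sub>M N2)"
    and G1: "G1 \<in> borel_measurable N1" and G2: "G2 \<in> borel_measurable N2"
    and meas: "\<And>H1 H2. K H1 H2 \<Longrightarrow> H1 \<in> borel_measurable N1 \<and> H2 \<in> borel_measurable N2"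
    and mult: "\<And>H1 H2 s. K H1 H2 \<Longrightarrow> s \<in> space T \<Longrightarrow> K (\<lambda>\<omega>. H1 \<omega> * U1 s \<omega>) (\<lambda>\<omega>. H2 \<omega> * U2 s \<omega>)"
    and eq: "\<And>H1 H2. K H1 H2 \<Longrightarrow> (\<integral>\<^sup>+\<omega>. H1 \<omega> * G1 \<omega> \<partial>N1) = (\<integral>\<^sup>+\<omega>. H2 \<omega> * G2 \<omega> \<partial>N2)"
    and u1: "u1 \<in> borel_measurable N1" "\<And>\<omega>. \<omega> \<in> space N1 \<Longrightarrow> 0 \<le> u1 \<omega>"
      "\<And>\<omega>. \<omega> \<in> space N1 \<Longrightarrow> (\<integral>\<^sup>+s. U1 s \<omega> \<partial>T) = ennreal (u1 \<omega>)"
    and u2: "u2 \<in> borel_measurable N2" "\<And>\<omega>. \<omega> \<in> space N2 \<Longrightarrow> 0 \<le> u2 \<omega>"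
      "\<And>\<omega>. \<omega> \<in> space N2 \<Longrightarrow> (\<integral>\<^sup>+s. U2 s \<omega> \<partial>T) = ennreal (u2 \<omega>)"
    and KH: "K H1 H2"
  shows "(\<integral>\<^sup>+\<omega>. H1 \<omega> * ennreal (exp (u1 \<omega>)) * G1 \<omega> \<partial>N1)
       = (\<integral>\<^sup>+\<omega>. H2 \<omega> * ennreal (exp (u2 \<omega>)) * G2 \<omega> \<partial>N2)"
proof -
  note [measurable] = G1 G2 u1(1) u2(1)
  have [measurable]: "H1 \<in> borel_measurable N1" "H2 \<in> borel_measurable N2" using meas[OF KH] by auto
  have pw: "(\<integral>\<^sup>+\<omega>. (H1 \<omega> * G1 \<omega>) * ennreal (u1 \<omega>) ^ k \<partial>N1)
      = (\<integral>\<^sup>+\<omega>. (H2 \<omega> * G2 \<omega>) * ennreal (u2 \<omega>) ^ k \<partial>N2)" for k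
  proof -
    have "(\<integral>\<^sup>+\<omega>. (H1 \<omega> * G1 \<omega>) * ennreal (u1 \<omega>) ^ k \<partial>N1)
      = (\<integral>\<^sup>+\<omega>. H1 \<omega> * (\<integral>\<^sup>+s. U1 s \<omega> \<partial>T) ^ k * G1 \<omega> \<partial>N1)"
      by (intro nn_integral_cong) (simp add: u1(3) mult_ac)
    also have "\<dots> = (\<integral>\<^sup>+\<omega>. H2 \<omega> * (\<integral>\<^sup>+s. U2 s \<omega> \<partial>T) ^ k * G2 \<omega> \<partial>N2)"
      by (rule power_weight[where K = K]) fact+
    also have "\<dots> = (\<integral>\<^sup>+\<omega>. (H2 \<omega> * G2 \<omega>) * ennreal (u2 \<omega>) ^ k \<partial>N2)"
      by (intro nn_integral_cong) (simp add: u2(3) mult_ac)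
    finally show ?thesis .
  qed
  have "(\<integral>\<^sup>+\<omega>. (H1 \<omega> * G1 \<omega>) * ennreal (exp (u1 \<omega>)) \<partial>N1)
      = (\<integral>\<^sup>+\<omega>. (H2 \<omega> * G2 \<omega>) * ennreal (exp (u2 \<omega>)) \<partial>N2)"
    using u1(2) u2(2) by (simp add: nn_integral_exp_series pw)
  thus ?thesis by (simp add: mult_ac)
qed

text \<open>Replace x by the first point of a dense sequence within distance 1 / (n + 1). The
  approximating function depends on x through a countable index, hence is jointly measurable, and
  continuity in x gives pointwise convergence.\<close>

lemma borel_measurable_Caratheodory:
  fixes f :: "'a \<Rightarrow> 'e::{metric_space, second_countable_topology} \<Rightarrow> real"
  assumes f_meas: "\<And>x. (\<lambda>s. f s x) \<in> borel_measurable T"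
    and f_cont: "\<And>s. s \<in> space T \<Longrightarrow> continuous_on UNIV (f s)"
  shows "(\<lambda>(s, x). f s x) \<in> borel_measurable (T \<Otimes>\<^sub>M borel)"
proof -
  obtain p :: "nat \<Rightarrow> 'e" where dense: "\<And>x r. 0 < r \<Longrightarrow> \<exists>i. dist x (p i) < r"
    by (rule dense_sequence, rule that)
  define k where "k = (\<lambda>(n::nat) x. LEAST i. dist x (p i) < inverse (real (Suc n)))"
  have k: "dist x (p (k n x)) < inverse (real (Suc n))" for n x
    unfolding k_def by (rule LeastI_ex, rule dense) simp
  have [measurable]: "k n \<in> borel \<rightarrow>\<^sub>M count_space UNIV" for n
    unfolding k_def by measurable
  show ?thesis
  proof (rule borel_measurable_LIMSEQ_metric)
    fix n
    show "(\<lambda>z. f (fst z) (p (k n (snd z)))) \<in> borel_measurable (T \<Otimes>\<^sub>M borel)"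
    proof (rule measurable_compose_countable[where f = "\<lambda>i z. f (fst z) (p i)" and g = "\<lambda>z. k n (snd z)"])
      show "(\<lambda>z. f (fst z) (p i)) \<in> borel_measurable (T \<Otimes>\<^sub>M borel)" for i
        using f_meas by (rule measurable_compose[OF measurable_fst])
    qed measurable
  next
    fix z assume "z \<in> space (T \<Otimes>\<^sub>M (borel :: 'e measure))"
    hence z: "fst z \<in> space T" by (auto simp: space_pair_measure)
    have "(\<lambda>n. p (k n (snd z))) \<longlonglongrightarrow> snd z"
    proof (rule metric_LIMSEQ_I)
      fix e :: real assume "0 < e"
      then obtain n0 where n0: "inverse (real (Suc n0)) < e" using reals_Archimedean by blast
      show "\<exists>n0. \<forall>n\<ge>n0. dist (p (k n (snd z))) (snd z) < e"
      proof (intro exI allI impI)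
        fix n assume "n0 \<le> n"
        hence "inverse (real (Suc n)) \<le> inverse (real (Suc n0))" by (intro le_imp_inverse_le) auto
        thus "dist (p (k n (snd z))) (snd z) < e"
          using k[of "snd z" n] n0 by (simp only: dist_commute[of "snd z"])
      qed
    qed
    hence "(\<lambda>n. f (fst z) (p (k n (snd z)))) \<longlonglongrightarrow> f (fst z) (snd z)"
      using f_cont[OF z] by (intro isCont_tendsto_compose[of _ "f (fst z)"])
        (auto simp: continuous_on_eq_continuous_at)
    thus "(\<lambda>n. f (fst z) (p (k n (snd z)))) \<longlonglongrightarrow> (case z of (s, x) \<Rightarrow> f s x)"
      by (simp add: split_beta)
  qed
qed

section \<open>Discrete and continuous time\<close>

definition time_base :: "real set \<Rightarrow> real measure" where
  "time_base I = (if I = \<nat> then count_space \<nat> else restrict_space lborel {0..})"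

text \<open>Counting or Lebesgue measure, so that sums and time integrals are treated together. The
  intervals are half-open because the discrete penalization runs over s < t, and because adjacent
  intervals then concatenate without a double point.\<close>

definition time_measure :: "real set \<Rightarrow> real \<Rightarrow> real \<Rightarrow> real measure" where
  "time_measure I a b = restrict_space (time_base I) {a..<b}"

lemma Nats_interval: "\<nat> \<inter> {real m..<real n} = real ` {m..<n}"
proof (intro equalityI subsetI)
  fix x :: real assume "x \<in> \<nat> \<inter> {real m..<real n}"
  then obtain k where "x = real k" by (auto elim: Nats_cases)
  thus "x \<in> real ` {m..<n}" using \<open>x \<in> \<nat> \<inter> {real m..<real n}\<close> by auto
qed auto

lemma finite_Nats_interval: "finite (\<nat> \<inter> {a..<b::real})"
proof (rule finite_subset)
  show "\<nat> \<inter> {a..<b} \<subseteq> real ` {..<nat \<lceil>b\<rceil>}"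
  proof
    fix x assume x: "x \<in> \<nat> \<inter> {a..<b}"
    then obtain k where k: "x = real k" by (auto elim: Nats_cases)
    hence "k < nat \<lceil>b\<rceil>" using x by (auto simp: less_ceiling_iff) linarith
    thus "x \<in> real ` {..<nat \<lceil>b\<rceil>}" using k by auto
  qed
qed simp

locale time_index =
  fixes I :: "real set"
  assumes time_set: "I = {0..} \<or> I = \<nat>"
begin

lemma I_nonneg: "t \<in> I \<Longrightarrow> 0 \<le> t"
  using time_set by (auto elim: Nats_cases)

lemma I_of_nat [simp]: "real n \<in> I"
  using time_set by auto

lemma I_0 [simp]: "0 \<in> I" and I_1 [simp]: "1 \<in> I"
  using I_of_nat[of 0] I_of_nat[of 1] by simp_all

lemma I_add [intro]: "s \<in> I \<Longrightarrow> t \<in> I \<Longrightarrow> s + t \<in> I"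
  using time_set by auto

lemma I_diff [intro]: "s \<in> I \<Longrightarrow> t \<in> I \<Longrightarrow> s \<le> t \<Longrightarrow> t - s \<in> I"
  using time_set
proof
  assume "I = \<nat>" "s \<in> I" "t \<in> I" "s \<le> t"
  then obtain m n where "s = real m" "t = real n" by (auto elim!: Nats_cases)
  thus ?thesis using \<open>s \<le> t\<close> \<open>I = \<nat>\<close> by (metis of_nat_diff of_nat_in_Nats of_nat_le_iff)
qed auto

text \<open>The iterations run over whole units of time; the remainder \<open>r\<close>, which is 0
  in discrete time, is dealt with separately.\<close>

lemma I_decompose:
  assumes "t \<in> I"
  obtains n r where "t = real n + r" "r \<in> I" "0 \<le> r" "r < 1"
proof
  have "0 \<le> t" using assms by (rule I_nonneg)
  hence le: "real (nat \<lfloor>t\<rfloor>) \<le> t" by linarith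
  show "t = real (nat \<lfloor>t\<rfloor>) + (t - real (nat \<lfloor>t\<rfloor>))" by simp
  show "t - real (nat \<lfloor>t\<rfloor>) \<in> I" by (rule I_diff[OF I_of_nat assms le])
  show "0 \<le> t - real (nat \<lfloor>t\<rfloor>)" using le by simp
  show "t - real (nat \<lfloor>t\<rfloor>) < 1" using \<open>0 \<le> t\<close> by linarith
qed

lemma base_continuous: "I \<noteq> \<nat> \<Longrightarrow> I = {0..}"
  using time_set by auto

lemma space_base: "space (time_base I) = I"
  using time_set by (auto simp: time_base_def space_restrict_space)

lemma interval_sets [measurable]: "{a..<b} \<inter> space (time_base I) \<in> sets (time_base I)"
proof (cases "I = \<nat>")
  case True
  thus ?thesis by (simp add: time_base_def)
next
  case False
  have "{a..<b} \<inter> {0..} \<in> sets (restrict_space lborel {0..})"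
    unfolding sets_restrict_space by (rule image_eqI[of _ _ "{a..<b}"]) auto
  thus ?thesis using False by (simp add: time_base_def space_restrict_space)
qed

lemma T_Nats: "time_measure \<nat> a b = count_space (\<nat> \<inter> {a..<b})"
  by (simp add: time_measure_def time_base_def restrict_count_space Int_commute)

lemma T_continuous:
  assumes "I \<noteq> \<nat>" "0 \<le> a"
  shows "time_measure I a b = restrict_space lborel {a..<b}"
proof -
  have "{0..} \<inter> {a..<b} = {a..<b}" using assms(2) by auto
  thus ?thesis using assms(1) by (simp add: time_measure_def time_base_def restrict_restrict_space)
qed

lemma space_T: "space (time_measure I a b) = I \<inter> {a..<b}"
  by (auto simp: time_measure_def space_restrict_space space_base)

lemma finite_T: "finite_measure (time_measure I a b)"
proof (cases "I = \<nat>")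
  case True
  thus ?thesis
    using finite_Nats_interval by (auto simp: T_Nats intro!: finite_measure_count_space)
next
  case False
  have "emeasure lborel ({0..} \<inter> {a..<b}) \<le> emeasure lborel {a..b}" by (intro emeasure_mono) auto
  also have "\<dots> < \<infinity>" by (simp add: emeasure_lborel_Icc_eq)
  finally show ?thesis using False
    by (intro finite_measureI)
       (auto simp: time_measure_def time_base_def emeasure_restrict_space space_restrict_space
           restrict_restrict_space Int_commute)
qed

lemma emeasure_T:
  assumes "a \<in> I" "b \<in> I" "a \<le> b"
  shows "emeasure (time_measure I a b) (space (time_measure I a b)) = ennreal (b - a)"
proof (cases "I = \<nat>")
  case True
  then obtain m n where mn: "a = real m" "b = real n" using assms by (auto elim!: Nats_cases)
  hence "m \<le> n" using assms by simp
  have "card (\<nat> \<inter> {a..<b}) = n - m"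
    unfolding mn Nats_interval by (subst card_image) auto
  thus ?thesis using True mn \<open>m \<le> n\<close> finite_Nats_interval[of a b]
    by (simp add: T_Nats emeasure_count_space_finite of_nat_diff ennreal_of_nat_eq_real_of_nat)
next
  case False
  thus ?thesis using assms I_nonneg[OF assms(1)]
    by (simp add: T_continuous emeasure_restrict_space space_restrict_space)
qed

lemma measure_T:
  assumes "a \<in> I" "b \<in> I" "a \<le> b"
  shows "measure (time_measure I a b) (space (time_measure I a b)) = b - a"
  using emeasure_T[OF assms] assms(3) by (simp add: measure_def)

lemma T_measurable_id: "(\<lambda>s. s) \<in> time_measure I a b \<rightarrow>\<^sub>M restrict_space borel I"
proof (cases "I = \<nat>")
  case True
  thus ?thesis
    by (auto simp: time_measure_def time_base_def restrict_count_space space_restrict_space)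
next
  case False
  have "(\<lambda>s. s) \<in> restrict_space lborel {0..} \<rightarrow>\<^sub>M restrict_space borel {0..}"
    by (intro measurable_restrict_space2 measurable_restrict_space1) (auto simp: space_restrict_space)
  thus ?thesis using False base_continuous
    by (auto simp: time_measure_def time_base_def intro: measurable_restrict_space1)
qed

lemma process_T_measurable:
  assumes "measurable_process I K V"
  shows "(\<lambda>(s, \<omega>). V s \<omega>) \<in> time_measure I a b \<Otimes>\<^sub>M K \<rightarrow>\<^sub>M borel"
proof -
  have "(\<lambda>z. (fst z, snd z)) \<in> time_measure I a b \<Otimes>\<^sub>M K \<rightarrow>\<^sub>M restrict_space borel I \<Otimes>\<^sub>M K"
    by (intro measurable_Pair measurable_snd measurable_compose[OF measurable_fst T_measurable_id])
  from measurable_compose[OF this assms[unfolded measurable_process_def]] show ?thesis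
    by (simp add: split_beta)
qed

text \<open>Translation invariance of both time measures. It identifies the additive functional
  after time \<open>c\<close> with that of the shifted process.\<close>

lemma T_shift:
  assumes c: "c \<in> I" and "0 \<le> a"
  shows "time_measure I (c + a) (c + b) = distr (time_measure I a b) (time_measure I (c + a) (c + b)) (\<lambda>s. c + s)"
proof (cases "I = \<nat>")
  case True
  have "(\<lambda>s. c + s) ` (\<nat> \<inter> {a..<b}) = \<nat> \<inter> {c + a..<c + b}"
  proof (intro equalityI subsetI)
    fix x assume x: "x \<in> \<nat> \<inter> {c + a..<c + b}"
    hence "x - c \<in> I" using c \<open>0 \<le> a\<close> True by (intro I_diff) auto
    thus "x \<in> (\<lambda>s. c + s) ` (\<nat> \<inter> {a..<b})" using x True by (intro image_eqI[of _ _ "x - c"]) auto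
  qed (use c True in auto)
  hence "bij_betw (\<lambda>s. c + s) (\<nat> \<inter> {a..<b}) (\<nat> \<inter> {c + a..<c + b})"
    by (auto simp: bij_betw_def)
  from distr_bij_count_space[OF this] show ?thesis using True by (simp add: T_Nats)
next
  case False
  have c0: "0 \<le> c" using c by (rule I_nonneg)
  note T = T_continuous[OF False]
  let ?f = "\<lambda>s. c + s"
  have [measurable]: "?f \<in> restrict_space lborel {a..<b} \<rightarrow>\<^sub>M restrict_space lborel {c + a..<c + b}"
    by (intro measurable_restrict_space2 measurable_restrict_space1) (auto simp: space_restrict_space)
  have "restrict_space lborel {c + a..<c + b}
      = distr (restrict_space lborel {a..<b}) (restrict_space lborel {c + a..<c + b}) ?f"
  proof (rule measure_eqI)
    fix A assume A: "A \<in> sets (restrict_space lborel {c + a..<c + b})"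
    hence A': "A \<in> sets borel" "A \<subseteq> {c + a..<c + b}" by (auto simp: sets_restrict_space)
    note [measurable] = A'(1)
    have "emeasure (restrict_space lborel {c + a..<c + b}) A = emeasure lborel A"
      using A' by (simp add: emeasure_restrict_space)
    also have "\<dots> = emeasure (distr lborel borel ?f) A" by (simp add: lborel_distr_plus)
    also have "\<dots> = emeasure lborel (?f -` A)" by (subst emeasure_distr) auto
    also have "?f -` A = ?f -` A \<inter> space (restrict_space lborel {a..<b})"
      using A'(2) by (auto simp: space_restrict_space subset_iff)
    also have "emeasure lborel \<dots> = emeasure (restrict_space lborel {a..<b}) \<dots>"
      by (subst emeasure_restrict_space) (auto simp: space_restrict_space)
    also have "\<dots> = emeasure (distr (restrict_space lborel {a..<b}) (restrict_space lborel {c + a..<c + b}) ?f) A"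
      using A by (subst emeasure_distr) auto
    finally show "emeasure (restrict_space lborel {c + a..<c + b}) A = \<dots>" .
  qed simp
  thus ?thesis using T[of a b] T[of "c + a" "c + b"] \<open>0 \<le> a\<close> c0 by simp
qed

lemma integral_T_add:
  fixes g :: "real \<Rightarrow> real"
  assumes "a \<le> b" "b \<le> c" and g: "integrable (time_measure I a c) g"
  shows "(\<integral>s. g s \<partial>time_measure I a c) = (\<integral>s. g s \<partial>time_measure I a b) + (\<integral>s. g s \<partial>time_measure I b c)"
proof -
  let ?B = "time_base I"
  have U: "{a..<c} = {a..<b} \<union> {b..<c}" "{a..<b} \<inter> {b..<c} = {}" using assms by auto
  have int: "set_integrable ?B {a..<c} g"
    using g unfolding time_measure_def set_integrable_def
    by (subst (asm) integrable_restrict_space[OF interval_sets])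
  have m: "{a'..<b'} \<inter> space ?B \<in> sets ?B" for a' b' by measurable
  have "integrable ?B (\<lambda>x. indicator {a'..<b'} x *\<^sub>R g x)" if "{a'..<b'} \<subseteq> {a..<c}" for a' b'
  proof -
    have "integrable ?B (\<lambda>x. indicator ({a'..<b'} \<inter> space ?B) x *\<^sub>R (indicator {a..<c} x *\<^sub>R g x))"
      by (rule integrable_mult_indicator[OF m int[unfolded set_integrable_def]])
    moreover have "indicator ({a'..<b'} \<inter> space ?B) x *\<^sub>R (indicator {a..<c} x *\<^sub>R g x) = indicator {a'..<b'} x *\<^sub>R g x"
      if "x \<in> space ?B" for x
      using that \<open>{a'..<b'} \<subseteq> {a..<c}\<close> by (auto simp: indicator_def)
    ultimately show ?thesis
      using Bochner_Integration.integrable_cong[OF refl, of ?B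
          "\<lambda>x. indicator ({a'..<b'} \<inter> space ?B) x *\<^sub>R (indicator {a..<c} x *\<^sub>R g x)"
          "\<lambda>x. indicator {a'..<b'} x *\<^sub>R g x"] by blast
  qed
  hence "integrable ?B (\<lambda>x. indicator {a..<b} x *\<^sub>R g x)" "integrable ?B (\<lambda>x. indicator {b..<c} x *\<^sub>R g x)"
    using assms by auto
  hence "(\<integral>x. indicator {a..<b} x *\<^sub>R g x + indicator {b..<c} x *\<^sub>R g x \<partial>?B)
     = (\<integral>x. indicator {a..<b} x *\<^sub>R g x \<partial>?B) + (\<integral>x. indicator {b..<c} x *\<^sub>R g x \<partial>?B)"
    by (rule Bochner_Integration.integral_add)
  moreover have "indicator {a..<b} x *\<^sub>R g x + indicator {b..<c} x *\<^sub>R g x = indicator {a..<c} x *\<^sub>R g x" for x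
    using assms by (auto simp: indicator_def)
  ultimately show ?thesis using m by (simp add: time_measure_def integral_restrict_space)
qed

lemma integral_T:
  fixes g :: "real \<Rightarrow> real"
  assumes "0 \<le> t"
  shows "(\<integral>s. g s \<partial>time_measure I 0 t)
     = (if I = \<nat> then \<Sum>s\<in>{s\<in>\<nat>. s < t}. g s else LINT s:{0..t}|lborel. g s)"
proof (cases "I = \<nat>")
  case True
  have "\<nat> \<inter> {0..<t} = {s\<in>\<nat>. s < t}" by (auto elim: Nats_cases)
  thus ?thesis using True finite_Nats_interval[of 0 t]
    by (simp add: T_Nats lebesgue_integral_count_space_finite)
next
  case False
  have "(\<integral>s. g s \<partial>time_measure I 0 t) = (\<integral>s. indicator {0..<t} s *\<^sub>R g s \<partial>lborel)"
    using False by (simp add: T_continuous integral_restrict_space)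
  \<comment> \<open>The end point, which the continuous-time penalization includes, is a null
    set.\<close>
  also have "\<dots> = (\<integral>s. indicator {0..t} s *\<^sub>R g s \<partial>lborel)"
    by (rule integral_discrete_difference[of "{t}"]) (auto simp: indicator_def)
  finally show ?thesis using False by (simp add: set_lebesgue_integral_def)
qed

lemma T_borel_measurable: "g \<in> borel_measurable borel \<Longrightarrow> g \<in> borel_measurable (time_measure I a b)"
  by (rule measurable_compose[OF T_measurable_id measurable_restrict_space1])

lemma T_integrable:
  fixes g :: "real \<Rightarrow> real"
  assumes "g \<in> borel_measurable borel" "\<And>s. s \<in> I \<Longrightarrow> a \<le> s \<Longrightarrow> s < b \<Longrightarrow> \<bar>g s\<bar> \<le> c"
  shows "integrable (time_measure I a b) g"
proof -
  interpret finite_measure "time_measure I a b" by (rule finite_T)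
  show ?thesis using assms T_borel_measurable[OF assms(1)]
    by (intro integrable_const_bound[of _ c] AE_I2) (auto simp: space_T)
qed

lemma T_integral_le:
  fixes g :: "real \<Rightarrow> real"
  assumes "a \<in> I" "b \<in> I" "a \<le> b" "g \<in> borel_measurable borel"
    "\<And>s. s \<in> I \<Longrightarrow> a \<le> s \<Longrightarrow> s < b \<Longrightarrow> 0 \<le> g s \<and> g s \<le> c"
  shows "(\<integral>s. g s \<partial>time_measure I a b) \<le> c * (b - a)"
proof -
  interpret finite_measure "time_measure I a b" by (rule finite_T)
  have "(\<integral>s. g s \<partial>time_measure I a b) \<le> (\<integral>s. c \<partial>time_measure I a b)"
    using assms(5) by (intro integral_mono T_integrable[OF assms(4), of _ _ c]) (auto simp: space_T)
  thus ?thesis by (simp add: measure_T[OF assms(1-3)] mult.commute)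
qed

text \<open>Adding one unit of time at a time covers discrete and continuous time alike: the first
  integral is dominated by a geometric series, while the second obeys the recursion c \<mapsto> 1 +
  q * c. These integrals produce the rate 1 / t after averaging.\<close>

lemma T_exp_bounded:
  assumes "0 < \<delta>"
  shows "\<exists>C. \<forall>t\<in>I. (\<integral>s. exp (- \<delta> * s) \<partial>time_measure I 0 t) \<le> C \<and> (\<integral>s. exp (- \<delta> * (t - s)) \<partial>time_measure I 0 t) \<le> C"
proof -
  define q where "q = exp (- \<delta>)"
  have q: "0 < q" "q < 1" using assms by (auto simp: q_def)
  \<comment> \<open>A supersolution of the recursion, 1 + q * C \<le> C, that also exceeds one plus
    the full geometric series.\<close>
  define C where "C = 1 + 1 / (1 - q)"
  have "(1 - q) * C = 2 - q" using q by (simp add: C_def distrib_left)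
  hence C: "1 \<le> C" "1 + q * C \<le> C" using q by (auto simp: C_def left_diff_distrib)
  have m: "(\<lambda>s. exp (- \<delta> * s)) \<in> borel_measurable borel" "(\<lambda>s. exp (- \<delta> * (t - s))) \<in> borel_measurable borel" for t
    by measurable
  have *: "(\<integral>s. exp (- \<delta> * s) \<partial>time_measure I 0 (r + real n)) \<le> 1 + (\<Sum>k=0..<n. q ^ k) \<and>
           (\<integral>s. exp (- \<delta> * (r + real n - s)) \<partial>time_measure I 0 (r + real n)) \<le> C"
    if r: "r \<in> I" "0 \<le> r" "r < 1" for r n
  proof (induction n)
    case 0
    have "(\<integral>s. exp (- \<delta> * s) \<partial>time_measure I 0 r) \<le> 1 * (r - 0)"
      using r assms by (intro T_integral_le m) auto
    moreover have "(\<integral>s. exp (- \<delta> * (r - s)) \<partial>time_measure I 0 r) \<le> 1 * (r - 0)"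
      using r assms by (intro T_integral_le m) auto
    ultimately show ?case using r C by simp
  next
    case (Suc n)
    let ?t = "r + real n"
    have t: "?t \<in> I" by (rule I_add[OF r(1) I_of_nat])
    have t': "?t + 1 \<in> I" by (rule I_add[OF t I_1])
    have t0: "0 \<le> ?t" using r by simp
    have i1: "integrable (time_measure I 0 (?t + 1)) (\<lambda>s. exp (- \<delta> * s))"
      using assms by (intro T_integrable[OF m(1), where c = 1]) auto
    have i2: "integrable (time_measure I 0 (?t + 1)) (\<lambda>s. exp (- \<delta> * (?t + 1 - s)))"
      using assms by (intro T_integrable[OF m(2), where c = 1]) auto
    have "(\<integral>s. exp (- \<delta> * s) \<partial>time_measure I ?t (?t + 1)) \<le> exp (- \<delta> * real n) * (?t + 1 - ?t)"
      using assms r by (intro T_integral_le t t' m) auto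
    moreover have "exp (- \<delta> * real n) = q ^ n" by (simp add: q_def mult.commute flip: exp_of_nat_mult)
    ultimately have 1: "(\<integral>s. exp (- \<delta> * s) \<partial>time_measure I 0 (?t + 1)) \<le> 1 + (\<Sum>k=0..<Suc n. q ^ k)"
      using Suc.IH integral_T_add[OF t0 _ i1] by simp
    have "(\<integral>s. exp (- \<delta> * (?t + 1 - s)) \<partial>time_measure I ?t (?t + 1)) \<le> 1 * (?t + 1 - ?t)"
      using assms by (intro T_integral_le t t' m) auto
    moreover have "(\<integral>s. exp (- \<delta> * (?t + 1 - s)) \<partial>time_measure I 0 ?t) \<le> q * C"
    proof -
      have "(\<integral>s. exp (- \<delta> * (?t + 1 - s)) \<partial>time_measure I 0 ?t) = (\<integral>s. q * exp (- \<delta> * (?t - s)) \<partial>time_measure I 0 ?t)"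
        by (simp add: q_def algebra_simps flip: exp_add)
      also have "\<dots> = q * (\<integral>s. exp (- \<delta> * (?t - s)) \<partial>time_measure I 0 ?t)" by simp
      finally show ?thesis using Suc.IH q by (simp add: mult_left_mono)
    qed
    ultimately have 2: "(\<integral>s. exp (- \<delta> * (?t + 1 - s)) \<partial>time_measure I 0 (?t + 1)) \<le> C"
      using integral_T_add[OF t0 _ i2] C(2) by simp
    have "?t + 1 = r + real (Suc n)" by simp
    with 1 2 show ?case by (simp only: conj_commute)
  qed
  have "(\<integral>s. exp (- \<delta> * s) \<partial>time_measure I 0 t) \<le> C \<and> (\<integral>s. exp (- \<delta> * (t - s)) \<partial>time_measure I 0 t) \<le> C"
    if tI: "t \<in> I" for t
  proof -
    obtain n r where nr: "t = real n + r" "r \<in> I" "0 \<le> r" "r < 1" using I_decompose[OF tI] by blast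
    have "(\<Sum>k=0..<n. q ^ k) \<le> (\<Sum>k. q ^ k)"
      using q by (intro sum_le_suminf summable_geometric) auto
    also have "\<dots> = 1 / (1 - q)" using q by (intro suminf_geometric) auto
    finally have "(\<Sum>k=0..<n. q ^ k) \<le> 1 / (1 - q)" .
    thus ?thesis using *[OF nr(2-4), of n] by (simp add: nr(1) C_def add.commute)
  qed
  thus ?thesis by blast
qed

end

section \<open>Penalization\<close>

definition rate_integral :: "real set \<Rightarrow> ('e \<Rightarrow> real) \<Rightarrow> (real \<Rightarrow> 'w \<Rightarrow> 'e) \<Rightarrow> real \<Rightarrow> real \<Rightarrow> 'w \<Rightarrow> real" where
  "rate_integral I \<rho> V a b \<omega> = (\<integral>s. \<rho> (V s \<omega>) \<partial>time_measure I a b)"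

text \<open>Two time arguments make the weight multiplicative over adjacent intervals, so that
  different stretches of time can carry the weights of different coordinates of the
  coupling.\<close>

definition pen :: "real set \<Rightarrow> ('e \<Rightarrow> real) \<Rightarrow> (real \<Rightarrow> 'w \<Rightarrow> 'e) \<Rightarrow> real \<Rightarrow> real \<Rightarrow> 'w \<Rightarrow> real" where
  "pen I \<rho> V a b \<omega> = exp (- rate_integral I \<rho> V a b \<omega>)"

abbreviation path_space :: "real set \<Rightarrow> (real \<Rightarrow> 's::topological_space) measure" where
  "path_space I \<equiv> (\<Pi>\<^sub>M s\<in>I. borel)"

lemma measurable_processD:
  assumes "measurable_process I K V" "s \<in> I"
  shows "V s \<in> K \<rightarrow>\<^sub>M borel"
proof -
  have "(\<lambda>\<omega>. (s, \<omega>)) \<in> K \<rightarrow>\<^sub>M restrict_space borel I \<Otimes>\<^sub>M K"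
    using assms(2) by (intro measurable_Pair1') (simp add: space_restrict_space)
  from measurable_compose[OF this assms(1)[unfolded measurable_process_def]] show ?thesis by simp
qed

locale bounded_rate = time_index I
  for I :: "real set" +
  fixes \<rho> :: "'e::topological_space \<Rightarrow> real" and R :: real
  assumes rate_nonneg: "0 \<le> \<rho> x" and rate_le: "\<rho> x \<le> R"
    and rate_measurable[measurable]: "\<rho> \<in> borel_measurable borel"
begin

lemma R_nonneg: "0 \<le> R"
  using rate_nonneg rate_le order_trans by blast

context
  fixes K :: "'w measure" and V :: "real \<Rightarrow> 'w \<Rightarrow> 'e"
  assumes V: "measurable_process I K V"
begin

lemma V_measurable: "s \<in> I \<Longrightarrow> V s \<in> K \<rightarrow>\<^sub>M borel"
  using V by (rule measurable_processD)

lemma V_joint[measurable]: "(\<lambda>z. V (fst z) (snd z)) \<in> time_measure I a b \<Otimes>\<^sub>M K \<rightarrow>\<^sub>M borel"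
  using process_T_measurable[OF V] by (simp add: split_beta)

lemma V_section: "\<omega> \<in> space K \<Longrightarrow> (\<lambda>s. V s \<omega>) \<in> time_measure I a b \<rightarrow>\<^sub>M borel"
  using measurable_compose[OF measurable_Pair2' V_joint[of a b]] by simp

lemma rate_section: "\<omega> \<in> space K \<Longrightarrow> (\<lambda>s. \<rho> (V s \<omega>)) \<in> borel_measurable (time_measure I a b)"
  by (rule measurable_compose[OF V_section rate_measurable])

lemma rate_integrable: "\<omega> \<in> space K \<Longrightarrow> integrable (time_measure I a b) (\<lambda>s. \<rho> (V s \<omega>))"
proof -
  assume \<omega>: "\<omega> \<in> space K"
  interpret finite_measure "time_measure I a b" by (rule finite_T)
  show ?thesis
    using rate_section[OF \<omega>] rate_nonneg rate_le by (intro integrable_const_bound[of _ R]) auto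
qed

lemma rate_integral_measurable[measurable]: "rate_integral I \<rho> V a b \<in> borel_measurable K"
proof -
  interpret finite_measure "time_measure I a b" by (rule finite_T)
  have "(\<lambda>z. \<rho> (V (snd z) (fst z))) \<in> borel_measurable (K \<Otimes>\<^sub>M time_measure I a b)"
    using measurable_compose[OF measurable_pair_swap' V_joint[of a b]] by (simp add: split_beta)
  hence "(\<lambda>\<omega>. \<integral>s. \<rho> (V s \<omega>) \<partial>time_measure I a b) \<in> borel_measurable K"
    by (intro borel_measurable_lebesgue_integral) (simp add: split_beta)
  thus ?thesis by (simp add: rate_integral_def[abs_def])
qed

lemma pen_measurable[measurable]: "pen I \<rho> V a b \<in> borel_measurable K"
  unfolding pen_def[abs_def] by measurable

lemma rate_integral_nonneg: "0 \<le> rate_integral I \<rho> V a b \<omega>"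
  unfolding rate_integral_def using rate_nonneg by (intro integral_nonneg_AE) auto

lemma rate_integral_le:
  assumes "a \<in> I" "b \<in> I" "a \<le> b" "\<omega> \<in> space K"
  shows "rate_integral I \<rho> V a b \<omega> \<le> R * (b - a)"
proof -
  interpret finite_measure "time_measure I a b" by (rule finite_T)
  have "rate_integral I \<rho> V a b \<omega> \<le> (\<integral>s. R \<partial>time_measure I a b)"
    unfolding rate_integral_def using rate_le by (intro integral_mono rate_integrable assms) auto
  thus ?thesis by (simp add: measure_T[OF assms(1-3)] mult.commute)
qed

lemma pen_pos: "0 < pen I \<rho> V a b \<omega>" and pen_nonneg: "0 \<le> pen I \<rho> V a b \<omega>"
  and pen_le_1: "pen I \<rho> V a b \<omega> \<le> 1"
  using rate_integral_nonneg[of a b \<omega>] by (auto simp: pen_def)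

lemma pen_ge:
  assumes "a \<in> I" "b \<in> I" "a \<le> b" "\<omega> \<in> space K"
  shows "exp (- R * (b - a)) \<le> pen I \<rho> V a b \<omega>"
  using rate_integral_le[OF assms] by (simp add: pen_def)

lemma pen_mult:
  assumes "a \<le> b" "b \<le> c" "\<omega> \<in> space K"
  shows "pen I \<rho> V a c \<omega> = pen I \<rho> V a b \<omega> * pen I \<rho> V b c \<omega>"
  unfolding pen_def rate_integral_def
  using integral_T_add[OF assms(1,2) rate_integrable[OF assms(3)]] by (simp add: exp_add[symmetric])

lemma pen_same [simp]: "pen I \<rho> V a a \<omega> = 1"
proof -
  have "rate_integral I \<rho> V a a \<omega> = (\<integral>s. 0 \<partial>time_measure I a a)"
    unfolding rate_integral_def by (rule Bochner_Integration.integral_cong) (auto simp: space_T)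
  thus ?thesis by (simp add: pen_def)
qed

text \<open>The complementary rate \<open>R - \<rho>\<close> is nonnegative, unlike
  \<open>- \<rho>\<close>. Its integral is the exponent that is expanded into powers; the price is
  the deterministic factor e^(-R (b - a)).\<close>

lemma nn_integral_complement:
  assumes "a \<in> I" "b \<in> I" "a \<le> b" "\<omega> \<in> space K"
  shows "(\<integral>\<^sup>+s. ennreal (R - \<rho> (V s \<omega>)) \<partial>time_measure I a b) = ennreal (R * (b - a) - rate_integral I \<rho> V a b \<omega>)"
proof -
  interpret finite_measure "time_measure I a b" by (rule finite_T)
  have "(\<integral>\<^sup>+s. ennreal (R - \<rho> (V s \<omega>)) \<partial>time_measure I a b) = ennreal (\<integral>s. R - \<rho> (V s \<omega>) \<partial>time_measure I a b)"
    using rate_le by (intro nn_integral_eq_integral Bochner_Integration.integrable_diff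
        rate_integrable assms) auto
  also have "(\<integral>s. R - \<rho> (V s \<omega>) \<partial>time_measure I a b) = R * (b - a) - rate_integral I \<rho> V a b \<omega>"
    unfolding rate_integral_def using rate_integrable[OF assms(4)]
    by (subst Bochner_Integration.integral_diff) (auto simp: measure_T[OF assms(1-3)] mult.commute)
  finally show ?thesis .
qed

lemma pen_eq_exp_complement:
  "pen I \<rho> V a b \<omega> = exp (- R * (b - a)) * exp (R * (b - a) - rate_integral I \<rho> V a b \<omega>)"
  by (simp add: pen_def exp_add[symmetric])

lemma complement_joint[measurable]:
  "(\<lambda>(s, \<omega>). ennreal (R - \<rho> (V s \<omega>))) \<in> borel_measurable (time_measure I a b \<Otimes>\<^sub>M K)"
  unfolding split_beta by measurable

lemma path_measurable: "(\<lambda>\<omega>. \<lambda>s\<in>I. V s \<omega>) \<in> K \<rightarrow>\<^sub>M path_space I"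
  by (intro measurable_restrict V_measurable)

lemma path_shift_measurable: "t \<in> I \<Longrightarrow> (\<lambda>\<omega>. \<lambda>s\<in>I. V (t + s) \<omega>) \<in> K \<rightarrow>\<^sub>M path_space I"
  by (intro measurable_restrict V_measurable I_add)

lemma nn_integral_path_law:
  "\<Phi> \<in> borel_measurable (path_space I) \<Longrightarrow>
    (\<integral>\<^sup>+w. \<Phi> w \<partial>path_law I V K) = (\<integral>\<^sup>+\<omega>. \<Phi> (\<lambda>s\<in>I. V s \<omega>) \<partial>K)"
  unfolding path_law_def by (rule nn_integral_distr[OF path_measurable]) simp

lemma penalization_eq:
  assumes "t \<in> I"
  shows "penalization I \<rho> V t \<omega> = pen I \<rho> V 0 t \<omega>"
proof -
  have "finite {s \<in> \<nat>. s < t}"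
    by (rule finite_subset[OF _ finite_Nats_interval[of 0 t]]) (auto elim: Nats_cases)
  thus ?thesis using integral_T[of t "\<lambda>s. \<rho> (V s \<omega>)"] I_nonneg[OF assms]
    by (simp add: penalization_def pen_def rate_integral_def exp_sum sum_negf[symmetric])
qed

end

text \<open>In continuous time the penalization is not a measurable function of the path for the product
  sigma-algebra, but the moments of the additive functional are determined by the path law.\<close>

lemma
  fixes K1 :: "'w measure" and K2 :: "'v measure"
  assumes V1: "measurable_process I K1 V1" and V2: "measurable_process I K2 V2"
    and K: "finite_measure K1" "finite_measure K2"
    and law: "path_law I V1 K1 = path_law I V2 K2"
    and \<Phi>: "\<Phi> \<in> borel_measurable (path_space I)"
    and ab: "a \<in> I" "b \<in> I" "a \<le> b"
  shows power_law_transfer: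
    "(\<integral>\<^sup>+\<omega>. \<Phi> (\<lambda>s\<in>I. V1 s \<omega>) * ennreal (R * (b - a) - rate_integral I \<rho> V1 a b \<omega>) ^ k \<partial>K1)
      = (\<integral>\<^sup>+\<omega>. \<Phi> (\<lambda>s\<in>I. V2 s \<omega>) * ennreal (R * (b - a) - rate_integral I \<rho> V2 a b \<omega>) ^ k \<partial>K2)" (is ?pw)
    and pen_law_transfer:
    "(\<integral>\<^sup>+\<omega>. \<Phi> (\<lambda>s\<in>I. V1 s \<omega>) * ennreal (pen I \<rho> V1 a b \<omega>) \<partial>K1)
      = (\<integral>\<^sup>+\<omega>. \<Phi> (\<lambda>s\<in>I. V2 s \<omega>) * ennreal (pen I \<rho> V2 a b \<omega>) \<partial>K2)" (is ?pen)
proof -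
  interpret K1: finite_measure K1 by fact
  interpret K2: finite_measure K2 by fact
  interpret T: finite_measure "time_measure I a b" by (rule finite_T)
  \<comment> \<open>Pairs obtained by evaluating one and the same path functional along both
    processes. The class is stable under multiplication by \<open>R - \<rho>\<close> at a fixed
    time, since this only involves one more coordinate of the path.\<close>
  define C where "C = (\<lambda>H1 H2. \<exists>\<Psi>\<in>borel_measurable (path_space I).
     H1 = (\<lambda>\<omega>. \<Psi> (\<lambda>s\<in>I. V1 s \<omega>) :: ennreal) \<and> H2 = (\<lambda>\<omega>. \<Psi> (\<lambda>s\<in>I. V2 s \<omega>) :: ennreal))"
  have meas: "H1 \<in> borel_measurable K1 \<and> H2 \<in> borel_measurable K2" if "C H1 H2" for H1 H2
    using that measurable_compose[OF path_measurable[OF V1]] measurable_compose[OF path_measurable[OF V2]]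
    by (auto simp: C_def)
  have mult: "C (\<lambda>\<omega>. H1 \<omega> * ennreal (R - \<rho> (V1 s \<omega>))) (\<lambda>\<omega>. H2 \<omega> * ennreal (R - \<rho> (V2 s \<omega>)))"
    if "C H1 H2" "s \<in> space (time_measure I a b)" for H1 H2 s
  proof -
    have s: "s \<in> I" using that(2) by (simp add: space_T)
    from that(1) obtain \<Psi> where \<Psi>[measurable]: "\<Psi> \<in> borel_measurable (path_space I)"
      "H1 = (\<lambda>\<omega>. \<Psi> (\<lambda>s\<in>I. V1 s \<omega>))" "H2 = (\<lambda>\<omega>. \<Psi> (\<lambda>s\<in>I. V2 s \<omega>))"
      by (auto simp: C_def)
    have [measurable]: "(\<lambda>w. w s) \<in> path_space I \<rightarrow>\<^sub>M borel" using s by (rule measurable_component_singleton)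
    have "(\<lambda>w. \<Psi> w * ennreal (R - \<rho> (w s))) \<in> borel_measurable (path_space I)" by measurable
    thus ?thesis unfolding C_def using s \<Psi>(2,3)
      by (intro bexI[of _ "\<lambda>w. \<Psi> w * ennreal (R - \<rho> (w s))"]) auto
  qed
  have eq: "(\<integral>\<^sup>+\<omega>. H1 \<omega> * 1 \<partial>K1) = (\<integral>\<^sup>+\<omega>. H2 \<omega> * 1 \<partial>K2)" if "C H1 H2" for H1 H2
    using that nn_integral_path_law[OF V1, symmetric] nn_integral_path_law[OF V2, symmetric] law
    by (auto simp: C_def)
  have C\<Phi>: "C (\<lambda>\<omega>. \<Phi> (\<lambda>s\<in>I. V1 s \<omega>)) (\<lambda>\<omega>. \<Phi> (\<lambda>s\<in>I. V2 s \<omega>))"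
    using \<Phi> by (auto simp: C_def)
  have "(\<integral>\<^sup>+\<omega>. \<Phi> (\<lambda>s\<in>I. V1 s \<omega>) * (\<integral>\<^sup>+s. ennreal (R - \<rho> (V1 s \<omega>)) \<partial>time_measure I a b) ^ k * 1 \<partial>K1)
      = (\<integral>\<^sup>+\<omega>. \<Phi> (\<lambda>s\<in>I. V2 s \<omega>) * (\<integral>\<^sup>+s. ennreal (R - \<rho> (V2 s \<omega>)) \<partial>time_measure I a b) ^ k * 1 \<partial>K2)"
    by (rule power_weight[where K = C, OF T.sigma_finite_measure_axioms K1.sigma_finite_measure_axioms
        K2.sigma_finite_measure_axioms complement_joint[OF V1] complement_joint[OF V2] _ _ meas mult eq C\<Phi>]) auto
  thus ?pw
    by (simp add: nn_integral_complement[OF V1 ab] nn_integral_complement[OF V2 ab] cong: nn_integral_cong)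
  have "(\<integral>\<^sup>+\<omega>. \<Phi> (\<lambda>s\<in>I. V1 s \<omega>) * ennreal (exp (R * (b - a) - rate_integral I \<rho> V1 a b \<omega>)) * 1 \<partial>K1)
      = (\<integral>\<^sup>+\<omega>. \<Phi> (\<lambda>s\<in>I. V2 s \<omega>) * ennreal (exp (R * (b - a) - rate_integral I \<rho> V2 a b \<omega>)) * 1 \<partial>K2)"
    using V1 V2 rate_integral_le[OF V1 ab] rate_integral_le[OF V2 ab]
      nn_integral_complement[OF V1 ab] nn_integral_complement[OF V2 ab]
    by (intro exp_weight[where K = C, OF T.sigma_finite_measure_axioms K1.sigma_finite_measure_axioms
        K2.sigma_finite_measure_axioms complement_joint[OF V1] complement_joint[OF V2] _ _ meas mult eq _ _ _ _ _ _ C\<Phi>])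
      (auto intro!: borel_measurable_diff rate_integral_measurable)
  hence eq': "(\<integral>\<^sup>+\<omega>. \<Phi> (\<lambda>s\<in>I. V1 s \<omega>) * ennreal (exp (R * (b - a) - rate_integral I \<rho> V1 a b \<omega>)) \<partial>K1)
      = (\<integral>\<^sup>+\<omega>. \<Phi> (\<lambda>s\<in>I. V2 s \<omega>) * ennreal (exp (R * (b - a) - rate_integral I \<rho> V2 a b \<omega>)) \<partial>K2)"
    by simp
  have pull: "(\<integral>\<^sup>+\<omega>. \<Phi> (\<lambda>s\<in>I. V s \<omega>) * ennreal (pen I \<rho> V a b \<omega>) \<partial>K)
      = ennreal (exp (- R * (b - a)))
         * (\<integral>\<^sup>+\<omega>. \<Phi> (\<lambda>s\<in>I. V s \<omega>) * ennreal (exp (R * (b - a) - rate_integral I \<rho> V a b \<omega>)) \<partial>K)"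
    if V: "measurable_process I K V" for V :: "real \<Rightarrow> 'x \<Rightarrow> 'e" and K
  proof -
    have [measurable]: "rate_integral I \<rho> V a b \<in> borel_measurable K"
      "(\<lambda>\<omega>. \<Phi> (\<lambda>s\<in>I. V s \<omega>)) \<in> borel_measurable K"
      using rate_integral_measurable[OF V] measurable_compose[OF path_measurable[OF V] \<Phi>] by auto
    show ?thesis
      by (subst nn_integral_cmult[symmetric], measurable)
         (simp add: pen_eq_exp_complement[OF V] ennreal_mult mult_ac)
  qed
  show ?pen using eq' unfolding pull[OF V1] pull[OF V2] by simp
qed

end

section \<open>Penalized semigroup and couplings\<close>

text \<open>Lipschitz constant and upper bound are kept apart because the Doeblin--Fortet estimate
  shrinks only the former. Nonnegativity lets expectations be computed in
  \<open>ennreal\<close>.\<close>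

definition lipb :: "real \<Rightarrow> real \<Rightarrow> ('e::metric_space \<Rightarrow> real) \<Rightarrow> bool" where
  "lipb l b f \<longleftrightarrow> (\<forall>x. 0 \<le> f x \<and> f x \<le> b) \<and> (\<forall>x y. \<bar>f x - f y\<bar> \<le> l * dist x y)"

lemma lipbD:
  assumes "lipb l b f"
  shows "0 \<le> f x" "f x \<le> b" "\<bar>f x - f y\<bar> \<le> l * dist x y"
  using assms by (auto simp: lipb_def)

lemma lipschitz_imp_borel:
  fixes f :: "'e::metric_space \<Rightarrow> real"
  assumes "\<And>x y. \<bar>f x - f y\<bar> \<le> K * dist x y"
  shows "continuous_on UNIV f" "f \<in> borel_measurable borel"
proof -
  have "\<bar>K\<bar>-lipschitz_on UNIV f"
  proof (rule lipschitz_onI)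
    fix x y :: 'e
    have "K * dist x y \<le> \<bar>K\<bar> * dist x y" by (intro mult_right_mono) auto
    thus "dist (f x) (f y) \<le> \<bar>K\<bar> * dist x y" using assms[of x y] by (simp add: dist_real_def)
  qed simp
  thus "continuous_on UNIV f" by (rule lipschitz_on_continuous_on)
  thus "f \<in> borel_measurable borel" by (rule borel_measurable_continuous_onI)
qed

lemma lipb_measurable: "lipb l b f \<Longrightarrow> f \<in> borel_measurable borel"
  by (rule lipschitz_imp_borel(2)[of f l]) (auto simp: lipb_def)

lemma lipb_mult:
  assumes f: "lipb l1 b1 f" and g: "lipb l2 b2 g"
  shows "lipb (l1 * b2 + b1 * l2) (b1 * b2) (\<lambda>x. f x * g x)"
  unfolding lipb_def
proof (intro conjI allI)
  fix x y
  have b: "0 \<le> b1" "0 \<le> b2" using lipbD(1,2)[OF f, of x] lipbD(1,2)[OF g, of x] by auto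
  show "0 \<le> f x * g x" "f x * g x \<le> b1 * b2"
    using lipbD(1,2)[OF f, of x] lipbD(1,2)[OF g, of x] by (auto intro!: mult_mono)
  have "\<bar>f x * g x - f y * g y\<bar> = \<bar>(f x - f y) * g x + f y * (g x - g y)\<bar>" by (simp add: algebra_simps)
  also have "\<dots> \<le> \<bar>f x - f y\<bar> * g x + f y * \<bar>g x - g y\<bar>"
    using lipbD(1)[OF f] lipbD(1)[OF g] by (intro order_trans[OF abs_triangle_ineq]) (simp add: abs_mult)
  also have "\<dots> \<le> (l1 * dist x y) * b2 + b1 * (l2 * dist x y)"
  proof (intro add_mono mult_mono)
    show "0 \<le> l1 * dist x y" by (rule order_trans[OF abs_ge_zero lipbD(3)[OF f]])
  qed (use lipbD[OF f] lipbD[OF g] b in auto)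
  finally show "\<bar>f x * g x - f y * g y\<bar> \<le> (l1 * b2 + b1 * l2) * dist x y" by (simp add: algebra_simps)
qed

text \<open>Bounded nonnegative functionals that are Lipschitz in finitely many coordinates of the
  path; the constants may change freely, only stability under one more factor
  \<open>R - \<rho>\<close> matters.\<close>

definition lip_cyl :: "real set \<Rightarrow> ((real \<Rightarrow> 'e::metric_space) \<Rightarrow> real) \<Rightarrow> bool" where
  "lip_cyl I \<Phi> \<longleftrightarrow> \<Phi> \<in> borel_measurable (path_space I) \<and> (\<exists>c. \<forall>w. 0 \<le> \<Phi> w \<and> \<Phi> w \<le> c) \<and>
     (\<exists>K J. 0 \<le> K \<and> finite J \<and> J \<subseteq> I \<and> (\<forall>w w'. \<bar>\<Phi> w - \<Phi> w'\<bar> \<le> K * (\<Sum>s\<in>J. dist (w s) (w' s))))"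

lemma lip_cylE:
  assumes "lip_cyl I \<Phi>"
  obtains c K J where "0 \<le> c" "\<And>w. 0 \<le> \<Phi> w" "\<And>w. \<Phi> w \<le> c" "0 \<le> K" "finite J" "J \<subseteq> I"
    "\<And>w w'. \<bar>\<Phi> w - \<Phi> w'\<bar> \<le> K * (\<Sum>s\<in>J. dist (w s) (w' s))" "\<Phi> \<in> borel_measurable (path_space I)"
proof -
  from assms obtain c K J where "\<And>w. 0 \<le> \<Phi> w" "\<And>w. \<Phi> w \<le> c" "0 \<le> K" "finite J" "J \<subseteq> I"
    "\<And>w w'. \<bar>\<Phi> w - \<Phi> w'\<bar> \<le> K * (\<Sum>s\<in>J. dist (w s) (w' s))" "\<Phi> \<in> borel_measurable (path_space I)"
    unfolding lip_cyl_def by metis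
  moreover from this(1,2) have "0 \<le> c" using order_trans by blast
  ultimately show ?thesis by (intro that)
qed

lemma lip_cyl_eval:
  assumes "lipb l b g" "s \<in> I"
  shows "lip_cyl I (\<lambda>w. g (w s))"
  unfolding lip_cyl_def
proof (intro conjI)
  have "(\<lambda>w. w s) \<in> path_space I \<rightarrow>\<^sub>M borel" using assms(2) by (rule measurable_component_singleton)
  thus "(\<lambda>w. g (w s)) \<in> borel_measurable (path_space I)"
    using lipb_measurable[OF assms(1)] by (rule measurable_compose)
  show "\<exists>c. \<forall>w. 0 \<le> g (w s) \<and> g (w s) \<le> c" using lipbD[OF assms(1)] by blast
  have "\<bar>g x - g y\<bar> \<le> \<bar>l\<bar> * dist x y" for x y
  proof -
    have "l * dist x y \<le> \<bar>l\<bar> * dist x y" by (intro mult_right_mono) auto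
    thus ?thesis using lipbD(3)[OF assms(1), of x y] by simp
  qed
  thus "\<exists>K J. 0 \<le> K \<and> finite J \<and> J \<subseteq> I \<and> (\<forall>w w'. \<bar>g (w s) - g (w' s)\<bar> \<le> K * (\<Sum>s\<in>J. dist (w s) (w' s)))"
    using assms(2) by (intro exI[of _ "\<bar>l\<bar>"] exI[of _ "{s}"]) auto
qed

section \<open>Elementary inequalities for exponentials and powers\<close>

lemma exp_minus_diff:
  fixes a b :: real
  assumes "0 \<le> a" "0 \<le> b"
  shows "\<bar>exp (- a) - exp (- b)\<bar> \<le> \<bar>a - b\<bar>"
proof -
  have *: "exp (- a) - exp (- b) \<le> b - a" if "0 \<le> a" "a \<le> b" for a b :: real
  proof -
    have "1 - exp (a - b) \<le> b - a" using exp_ge_add_one_self[of "a - b"] by linarith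
    hence "exp (- a) * (1 - exp (a - b)) \<le> 1 * (b - a)"
      using that by (intro mult_mono) auto
    moreover have "exp (- a) * exp (a - b) = exp (- b)" by (simp flip: exp_add)
    ultimately show ?thesis by (simp add: right_diff_distrib)
  qed
  show ?thesis
  proof (cases "a \<le> b")
    case True
    thus ?thesis using *[of a b] assms by (simp add: abs_if)
  next
    case False
    thus ?thesis using *[of b a] assms by (simp add: abs_if)
  qed
qed

lemma geometric_tail:
  fixes q :: real
  assumes "0 \<le> q" "q < 1"
  shows "(\<Sum>k=m..<n. q ^ k) \<le> q ^ m / (1 - q)"
proof (cases "m \<le> n")
  case True
  have "(\<Sum>k=m..<n. q ^ k) * (1 - q) = q ^ m - q ^ n"
    using True
  proof (induction n rule: dec_induct)
    case (step n)
    have "(\<Sum>k=m..<Suc n. q ^ k) * (1 - q) = (\<Sum>k=m..<n. q ^ k) * (1 - q) + q ^ n * (1 - q)"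
      using step by (simp add: distrib_right)
    thus ?case unfolding step.IH by (simp add: algebra_simps)
  qed simp
  also have "\<dots> \<le> q ^ m" using assms by simp
  finally show ?thesis using assms by (simp add: le_divide_eq)
next
  case False
  thus ?thesis using assms by simp
qed

lemma power_diff_bound:
  fixes B :: real
  shows "\<exists>c\<ge>0. \<forall>a b. 0 \<le> a \<longrightarrow> a \<le> B \<longrightarrow> 0 \<le> b \<longrightarrow> b \<le> B \<longrightarrow> \<bar>a ^ k - b ^ k\<bar> \<le> c * \<bar>a - b\<bar>"
proof (cases "0 \<le> B")
  case B: True
  show ?thesis
  proof (induction k)
    case 0
    show ?case by (rule exI[of _ 0]) auto
  next
    case (Suc k)
    then obtain c where c: "0 \<le> c" "\<And>a b. 0 \<le> a \<Longrightarrow> a \<le> B \<Longrightarrow> 0 \<le> b \<Longrightarrow> b \<le> B \<Longrightarrow> \<bar>a ^ k - b ^ k\<bar> \<le> c * \<bar>a - b\<bar>"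
      by blast
    show ?case
    proof (intro exI[of _ "B * c + B ^ k"] conjI allI impI)
      show "0 \<le> B * c + B ^ k" using B c(1) by simp
      fix a b assume ab: "0 \<le> a" "a \<le> B" "0 \<le> b" "b \<le> B"
      have "\<bar>a ^ Suc k - b ^ Suc k\<bar> = \<bar>a * (a ^ k - b ^ k) + b ^ k * (a - b)\<bar>" by (simp add: algebra_simps)
      also have "\<dots> \<le> a * \<bar>a ^ k - b ^ k\<bar> + b ^ k * \<bar>a - b\<bar>"
        using ab by (intro order_trans[OF abs_triangle_ineq]) (simp add: abs_mult)
      also have "\<dots> \<le> B * (c * \<bar>a - b\<bar>) + B ^ k * \<bar>a - b\<bar>"
        using ab c by (intro add_mono mult_mono power_mono) auto
      finally show "\<bar>a ^ Suc k - b ^ Suc k\<bar> \<le> (B * c + B ^ k) * \<bar>a - b\<bar>" by (simp add: algebra_simps)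
    qed
  qed
next
  case False
  thus ?thesis by (intro exI[of _ 0]) auto
qed

lemma measurable_process_cong:
  assumes "sets K = sets K'" "measurable_process I K V"
  shows "measurable_process I K' V"
  using assms unfolding measurable_process_def
  by (subst measurable_cong_sets[OF sets_pair_measure_cong[OF refl] refl]) auto

locale coupled = bounded_rate I \<rho> R
  for I :: "real set" and \<rho> :: "'e::polish_space \<Rightarrow> real" and R :: real +
  fixes L dbar CA \<gamma> :: real
    and M :: "'w measure" and F :: "real \<Rightarrow> 'w measure"
    and P :: "'e \<Rightarrow> 'w measure" and X :: "real \<Rightarrow> 'w \<Rightarrow> 'e"
    and N :: "'v measure" and Q :: "'e \<times> 'e \<Rightarrow> 'v measure"
    and Y1 Y2 :: "real \<Rightarrow> 'v \<Rightarrow> 'e"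
  assumes dist_le: "\<And>x y :: 'e. dist x y \<le> dbar"
    and lip: "\<And>x y. \<bar>\<rho> x - \<rho> y\<bar> \<le> L * dist x y" and L_nonneg: "0 \<le> L"
    and CA_pos: "0 < CA" and \<gamma>_pos: "0 < \<gamma>"
    and markov: "markov_process I M F P X"
    and measurable_X: "measurable_process I M X"
    and coupling: "markovian_coupling I P X N Q Y1 Y2"
    and contract: "\<And>x y t. t \<in> I \<Longrightarrow> (LINT \<omega>|Q (x, y). penalization I \<rho> Y1 t \<omega> / expected_penalization I \<rho> P X t x
                            * dist (Y1 t \<omega>) (Y2 t \<omega>)) \<le> CA * exp (- \<gamma> * t) * dist x y"
begin

lemma dbar_nonneg: "0 \<le> dbar"
  using dist_le[of undefined undefined] by simp

lemma prob_P: "prob_space (P x)" and sets_P: "sets (P x) = sets M"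
  using markov by (auto simp: markov_process_def)

lemma law_measurable: "(\<lambda>x. path_law I X (P x)) \<in> borel \<rightarrow>\<^sub>M prob_algebra (path_space I)"
  using markov by (auto simp: markov_process_def)

abbreviation "Gf t \<equiv> natural_filtration I N (\<lambda>t \<omega>. (Y1 t \<omega>, Y2 t \<omega>)) t"

lemma coupling_markov: "markov_process I N (natural_filtration I N (\<lambda>t \<omega>. (Y1 t \<omega>, Y2 t \<omega>))) Q (\<lambda>t \<omega>. (Y1 t \<omega>, Y2 t \<omega>))"
  and law1: "path_law I Y1 (Q (x, y)) = path_law I X (P x)"
  and law2: "path_law I Y2 (Q (x, y)) = path_law I X (P y)"
  and coupling_process: "measurable_process I N (\<lambda>t \<omega>. (Y1 t \<omega>, Y2 t \<omega>))"
  using coupling by (auto simp: markovian_coupling_def)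

lemma prob_Q: "prob_space (Q z)" and sets_Q: "sets (Q z) = sets N"
  using coupling_markov unfolding markov_process_def by blast+

lemma space_Q: "space (Q z) = space N" and space_P: "space (P x) = space M"
  by (rule sets_eq_imp_space_eq[OF sets_Q], rule sets_eq_imp_space_eq[OF sets_P])

lemma measurable_Y: "measurable_process I N Y1" "measurable_process I N Y2"
proof -
  have "fst \<in> borel \<rightarrow>\<^sub>M (borel :: 'e measure)" "snd \<in> borel \<rightarrow>\<^sub>M (borel :: 'e measure)"
    by (intro borel_measurable_continuous_onI continuous_intros)+
  from this[THEN measurable_compose[OF coupling_process[unfolded measurable_process_def]]]
  show "measurable_process I N Y1" "measurable_process I N Y2"
    unfolding measurable_process_def by (simp_all add: split_beta)
qed

lemma process_P: "measurable_process I (P x) X"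
  and process_Q1: "measurable_process I (Q z) Y1" and process_Q2: "measurable_process I (Q z) Y2"
  by (rule measurable_process_cong[OF sets_P[symmetric] measurable_X],
      rule measurable_process_cong[OF sets_Q[symmetric] measurable_Y(1)],
      rule measurable_process_cong[OF sets_Q[symmetric] measurable_Y(2)])

lemma X_meas: "t \<in> I \<Longrightarrow> X t \<in> P x \<rightarrow>\<^sub>M borel"
  and Y1_meas: "t \<in> I \<Longrightarrow> Y1 t \<in> Q z \<rightarrow>\<^sub>M borel" and Y2_meas: "t \<in> I \<Longrightarrow> Y2 t \<in> Q z \<rightarrow>\<^sub>M borel"
  by (rule measurable_processD[OF process_P], assumption, rule measurable_processD[OF process_Q1], assumption,
      rule measurable_processD[OF process_Q2])

definition S :: "real \<Rightarrow> ('e \<Rightarrow> real) \<Rightarrow> 'e \<Rightarrow> real" where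
  "S t f x = (\<integral>\<omega>. pen I \<rho> X 0 t \<omega> * f (X t \<omega>) \<partial>P x)"

abbreviation h :: "real \<Rightarrow> 'e \<Rightarrow> real" where
  "h t \<equiv> S t (\<lambda>_. 1)"

text \<open>Equality of path laws does not apply to the weight directly; the moment expansion behind
  \<open>pen_law_transfer\<close> bridges this. The observation time \<open>s\<close> is independent
  of the horizon \<open>t\<close>, as the occupation measure requires.\<close>

lemma occupation_transfer:
  assumes f: "f \<in> borel_measurable borel" "\<And>x. 0 \<le> f x" and "s \<in> I" "t \<in> I"
  shows "(\<integral>\<omega>. pen I \<rho> Y1 0 t \<omega> * f (Y1 s \<omega>) \<partial>Q (x, y)) = (\<integral>\<omega>. pen I \<rho> X 0 t \<omega> * f (X s \<omega>) \<partial>P x)"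
    and "(\<integral>\<omega>. pen I \<rho> Y2 0 t \<omega> * f (Y2 s \<omega>) \<partial>Q (x, y)) = (\<integral>\<omega>. pen I \<rho> X 0 t \<omega> * f (X s \<omega>) \<partial>P y)"
proof -
  have [measurable]: "(\<lambda>w. w s) \<in> path_space I \<rightarrow>\<^sub>M borel" using \<open>s \<in> I\<close> by (rule measurable_component_singleton)
  note f(1)[measurable]
  have \<Phi>: "(\<lambda>w. ennreal (f (w s))) \<in> borel_measurable (path_space I)" by measurable
  have t: "0 \<in> I" "t \<in> I" "0 \<le> t" using \<open>t \<in> I\<close> I_nonneg by auto
  have *: "(\<integral>\<omega>. pen I \<rho> V1 0 t \<omega> * f (V1 s \<omega>) \<partial>K1) = (\<integral>\<omega>. pen I \<rho> V2 0 t \<omega> * f (V2 s \<omega>) \<partial>K2)"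
    if V: "measurable_process I K1 V1" "measurable_process I K2 V2" and K: "prob_space K1" "prob_space K2"
      and law: "path_law I V1 K1 = path_law I V2 K2" for K1 :: "'v measure" and K2 :: "'w measure" and V1 V2
  proof -
    interpret K1: prob_space K1 by fact
    interpret K2: prob_space K2 by fact
    have [measurable]: "V1 s \<in> K1 \<rightarrow>\<^sub>M borel" "V2 s \<in> K2 \<rightarrow>\<^sub>M borel"
      "pen I \<rho> V1 0 t \<in> borel_measurable K1" "pen I \<rho> V2 0 t \<in> borel_measurable K2"
      using V \<open>s \<in> I\<close> by (auto intro: measurable_processD pen_measurable)
    have "(\<integral>\<^sup>+\<omega>. ennreal (f (V1 s \<omega>)) * ennreal (pen I \<rho> V1 0 t \<omega>) \<partial>K1)
        = (\<integral>\<^sup>+\<omega>. ennreal (f (V2 s \<omega>)) * ennreal (pen I \<rho> V2 0 t \<omega>) \<partial>K2)"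
      using pen_law_transfer[OF V K1.finite_measure_axioms K2.finite_measure_axioms law \<Phi> t] \<open>s \<in> I\<close> by simp
    hence "(\<integral>\<^sup>+\<omega>. ennreal (pen I \<rho> V1 0 t \<omega> * f (V1 s \<omega>)) \<partial>K1) = (\<integral>\<^sup>+\<omega>. ennreal (pen I \<rho> V2 0 t \<omega> * f (V2 s \<omega>)) \<partial>K2)"
      using f(2) by (simp add: ennreal_mult[symmetric] pen_nonneg[OF V(1)] pen_nonneg[OF V(2)] mult.commute
        flip: ennreal_mult')
    thus ?thesis
      using f(2) by (subst (1 2) integral_eq_nn_integral)
        (auto simp: pen_nonneg[OF V(1)] pen_nonneg[OF V(2)])
  qed
  show "(\<integral>\<omega>. pen I \<rho> Y1 0 t \<omega> * f (Y1 s \<omega>) \<partial>Q (x, y)) = (\<integral>\<omega>. pen I \<rho> X 0 t \<omega> * f (X s \<omega>) \<partial>P x)"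
    by (rule *[OF process_Q1 process_P prob_Q prob_P law1])
  show "(\<integral>\<omega>. pen I \<rho> Y2 0 t \<omega> * f (Y2 s \<omega>) \<partial>Q (x, y)) = (\<integral>\<omega>. pen I \<rho> X 0 t \<omega> * f (X s \<omega>) \<partial>P y)"
    by (rule *[OF process_Q2 process_P prob_Q prob_P law2])
qed

lemma S_Y:
  assumes "f \<in> borel_measurable borel" "\<And>x. 0 \<le> f x" "t \<in> I"
  shows "(\<integral>\<omega>. pen I \<rho> Y1 0 t \<omega> * f (Y1 t \<omega>) \<partial>Q (x, y)) = S t f x"
    and "(\<integral>\<omega>. pen I \<rho> Y2 0 t \<omega> * f (Y2 t \<omega>) \<partial>Q (x, y)) = S t f y"
  using occupation_transfer[OF assms(1,2,3,3)] by (simp_all add: S_def)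

lemma h_Y:
  assumes "t \<in> I"
  shows "(\<integral>\<omega>. pen I \<rho> Y1 0 t \<omega> \<partial>Q (x, y)) = h t x" "(\<integral>\<omega>. pen I \<rho> Y2 0 t \<omega> \<partial>Q (x, y)) = h t y"
  using S_Y[of "\<lambda>_. 1", OF _ _ assms] by simp_all

lemma h_bounds:
  assumes "t \<in> I"
  shows "exp (- R * t) \<le> h t x" "h t x \<le> 1"
proof -
  interpret prob_space "P x" by (rule prob_P)
  have "0 \<le> t" using assms by (rule I_nonneg)
  have int: "integrable (P x) (pen I \<rho> X 0 t)"
    using pen_measurable[OF process_P] pen_nonneg[OF process_P] pen_le_1[OF process_P]
    by (intro integrable_const_bound[of _ 1]) auto
  have "(\<integral>\<omega>. exp (- R * t) \<partial>P x) \<le> (\<integral>\<omega>. pen I \<rho> X 0 t \<omega> \<partial>P x)"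
    using int pen_ge[OF process_P I_0 assms \<open>0 \<le> t\<close>] by (intro integral_mono) auto
  thus "exp (- R * t) \<le> h t x" by (simp add: S_def prob_space)
  have "(\<integral>\<omega>. pen I \<rho> X 0 t \<omega> \<partial>P x) \<le> (\<integral>\<omega>. 1 \<partial>P x)"
    using int pen_le_1[OF process_P] by (intro integral_mono) auto
  thus "h t x \<le> 1" by (simp add: S_def prob_space)
qed

lemma h_pos: "t \<in> I \<Longrightarrow> 0 < h t x"
  using h_bounds(1)[of t x] exp_gt_zero less_le_trans by blast

lemma expected_penalization_eq: "t \<in> I \<Longrightarrow> expected_penalization I \<rho> P X t x = h t x"
  by (simp add: expected_penalization_def S_def penalization_eq[OF measurable_X])

lemma dist_Y_measurable: "s \<in> I \<Longrightarrow> (\<lambda>\<omega>. dist (Y1 s \<omega>) (Y2 s \<omega>)) \<in> borel_measurable (Q z)"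
  by (intro borel_measurable_dist Y1_meas Y2_meas)

lemma weighted_dist:
  assumes "t \<in> I"
  shows "(\<integral>\<omega>. pen I \<rho> Y1 0 t \<omega> * dist (Y1 t \<omega>) (Y2 t \<omega>) \<partial>Q (x, y)) \<le> CA * exp (- \<gamma> * t) * h t x * dist x y"
proof -
  have "(\<integral>\<omega>. pen I \<rho> Y1 0 t \<omega> / h t x * dist (Y1 t \<omega>) (Y2 t \<omega>) \<partial>Q (x, y)) \<le> CA * exp (- \<gamma> * t) * dist x y"
    using contract[OF assms, of x y] by (simp add: expected_penalization_eq penalization_eq[OF measurable_Y(1)] assms)
  hence "(\<integral>\<omega>. pen I \<rho> Y1 0 t \<omega> * dist (Y1 t \<omega>) (Y2 t \<omega>) \<partial>Q (x, y)) / h t x \<le> CA * exp (- \<gamma> * t) * dist x y"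
    by simp
  thus ?thesis using h_pos[OF assms, of x] by (simp add: divide_le_eq mult_ac)
qed

lemma integrable_Q_bounded:
  assumes "g \<in> borel_measurable (Q z)" "\<And>\<omega>. \<bar>g \<omega>\<bar> \<le> (b :: real)"
  shows "integrable (Q z) g"
proof -
  interpret prob_space "Q z" by (rule prob_Q)
  show ?thesis using assms by (intro integrable_const_bound[of _ b]) auto
qed

text \<open>Removes the weight from (A) at the price of its lower bound e^(-R t). The growth in
  \<open>t\<close> does no harm: the estimate only serves continuity in the starting point at a
  fixed time.\<close>

lemma integral_dist_Y:
  assumes "t \<in> I"
  shows "(\<integral>\<omega>. dist (Y1 t \<omega>) (Y2 t \<omega>) \<partial>Q (x, y)) \<le> CA * exp (R * t) * dist x y"
proof -
  have t: "0 \<le> t" using assms by (rule I_nonneg)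
  note [measurable] = dist_Y_measurable[OF assms] pen_measurable[OF process_Q1]
  have "exp (- R * t) * (\<integral>\<omega>. dist (Y1 t \<omega>) (Y2 t \<omega>) \<partial>Q (x, y))
    = (\<integral>\<omega>. exp (- R * t) * dist (Y1 t \<omega>) (Y2 t \<omega>) \<partial>Q (x, y))" by simp
  also have "\<dots> \<le> (\<integral>\<omega>. pen I \<rho> Y1 0 t \<omega> * dist (Y1 t \<omega>) (Y2 t \<omega>) \<partial>Q (x, y))"
  proof (rule integral_mono)
    show "integrable (Q (x, y)) (\<lambda>\<omega>. exp (- R * t) * dist (Y1 t \<omega>) (Y2 t \<omega>))"
      using dist_le by (intro integrable_Q_bounded[of _ _ "exp (- R * t) * dbar"]) (auto simp: abs_mult)
    show "integrable (Q (x, y)) (\<lambda>\<omega>. pen I \<rho> Y1 0 t \<omega> * dist (Y1 t \<omega>) (Y2 t \<omega>))"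
    proof (rule integrable_Q_bounded[of _ _ "1 * dbar"])
      show "\<bar>pen I \<rho> Y1 0 t \<omega> * dist (Y1 t \<omega>) (Y2 t \<omega>)\<bar> \<le> 1 * dbar" for \<omega>
        unfolding abs_mult using dist_le pen_le_1[OF process_Q1] pen_nonneg[OF process_Q1]
        by (intro mult_mono) auto
    qed measurable
    show "exp (- R * t) * dist (Y1 t \<omega>) (Y2 t \<omega>) \<le> pen I \<rho> Y1 0 t \<omega> * dist (Y1 t \<omega>) (Y2 t \<omega>)"
      if "\<omega> \<in> space (Q (x, y))" for \<omega>
      using pen_ge[OF process_Q1 I_0 assms t that] by (intro mult_right_mono) auto
  qed
  also have "\<dots> \<le> CA * exp (- \<gamma> * t) * h t x * dist x y" by (rule weighted_dist[OF assms])
  also have "\<dots> = CA * (exp (- \<gamma> * t) * h t x) * dist x y" by simp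
  also have "\<dots> \<le> CA * (1 * 1) * dist x y"
  proof -
    have "exp (- \<gamma> * t) * h t x \<le> 1 * 1"
      using h_bounds[OF assms, of x] h_pos[OF assms, of x] \<gamma>_pos t by (intro mult_mono) auto
    thus ?thesis using CA_pos by (intro mult_right_mono mult_left_mono) auto
  qed
  finally have "exp (R * t) * (exp (- R * t) * (\<integral>\<omega>. dist (Y1 t \<omega>) (Y2 t \<omega>) \<partial>Q (x, y))) \<le> exp (R * t) * (CA * dist x y)"
    by (intro mult_left_mono) auto
  moreover have "exp (R * t) * exp (- R * t) = 1" by (simp flip: exp_add)
  ultimately have "(\<integral>\<omega>. dist (Y1 t \<omega>) (Y2 t \<omega>) \<partial>Q (x, y)) \<le> exp (R * t) * (CA * dist x y)"
    by (simp only: mult.assoc[symmetric] mult_1_left)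
  thus ?thesis by (simp add: mult_ac)
qed

section \<open>Moments of the additive functional\<close>

text \<open>Lipschitz continuity of \<rho> under the time integral, then Fubini. The weight
  \<open>W\<close> is left open: it is 1 in the continuity of \<open>psi\<close> and the weight of
  the first coordinate in \<open>step_diff\<close>.\<close>

lemma weighted_rate_diff:
  assumes ab: "a \<in> I" "b \<in> I" "a \<le> b"
    and W: "W \<in> borel_measurable (Q z)" "\<And>\<omega>. 0 \<le> W \<omega>" "\<And>\<omega>. W \<omega> \<le> 1"
    and B: "\<And>s. s \<in> I \<Longrightarrow> a \<le> s \<Longrightarrow> s < b \<Longrightarrow> (\<integral>\<omega>. W \<omega> * dist (Y1 s \<omega>) (Y2 s \<omega>) \<partial>Q z) \<le> B"
  shows "(\<integral>\<omega>. W \<omega> * \<bar>rate_integral I \<rho> Y1 a b \<omega> - rate_integral I \<rho> Y2 a b \<omega>\<bar> \<partial>Q z) \<le> L * (b - a) * B"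
proof -
  interpret Q: prob_space "Q z" by (rule prob_Q)
  interpret T: finite_measure "time_measure I a b" by (rule finite_T)
  interpret TQ: pair_sigma_finite "time_measure I a b" "Q z" ..
  interpret TQf: finite_measure "time_measure I a b \<Otimes>\<^sub>M Q z"
    by (intro finite_measure_pair_measure T.finite_measure_axioms Q.finite_measure_axioms)
  note [measurable] = W(1) rate_integral_measurable[OF process_Q1] rate_integral_measurable[OF process_Q2]
    V_joint[OF process_Q1] V_joint[OF process_Q2]
  have Wd: "\<bar>W \<omega> * dist (Y1 s \<omega>) (Y2 s \<omega>)\<bar> \<le> 1 * dbar" for s \<omega>
    unfolding abs_mult using W dist_le by (intro mult_mono) auto
  have joint[measurable]: "(\<lambda>z. W (snd z) * dist (Y1 (fst z) (snd z)) (Y2 (fst z) (snd z)))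
      \<in> borel_measurable (time_measure I a b \<Otimes>\<^sub>M Q z)"
    by measurable
  have int: "integrable (time_measure I a b \<Otimes>\<^sub>M Q z) (\<lambda>(s, \<omega>). W \<omega> * dist (Y1 s \<omega>) (Y2 s \<omega>))"
    using Wd by (intro TQf.integrable_const_bound[of _ "1 * dbar"]) (auto simp: split_beta)
  have int_s: "integrable (time_measure I a b) (\<lambda>s. W \<omega> * dist (Y1 s \<omega>) (Y2 s \<omega>))" if "\<omega> \<in> space (Q z)" for \<omega>
    using Wd measurable_compose[OF measurable_Pair2'[OF that] joint]
    by (intro T.integrable_const_bound[of _ "1 * dbar"]) auto
  have pointwise: "W \<omega> * \<bar>rate_integral I \<rho> Y1 a b \<omega> - rate_integral I \<rho> Y2 a b \<omega>\<bar>
      \<le> L * (\<integral>s. W \<omega> * dist (Y1 s \<omega>) (Y2 s \<omega>) \<partial>time_measure I a b)" if \<omega>: "\<omega> \<in> space (Q z)" for \<omega>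
  proof -
    note i1 = rate_integrable[OF process_Q1 \<omega>] and i2 = rate_integrable[OF process_Q2 \<omega>]
    have "W \<omega> * \<bar>rate_integral I \<rho> Y1 a b \<omega> - rate_integral I \<rho> Y2 a b \<omega>\<bar>
      = \<bar>\<integral>s. W \<omega> * (\<rho> (Y1 s \<omega>) - \<rho> (Y2 s \<omega>)) \<partial>time_measure I a b\<bar>"
      using W(2)[of \<omega>] i1 i2 by (simp add: rate_integral_def abs_mult)
    also have "\<dots> \<le> (\<integral>s. \<bar>W \<omega> * (\<rho> (Y1 s \<omega>) - \<rho> (Y2 s \<omega>))\<bar> \<partial>time_measure I a b)"
      by (rule integral_abs_bound)
    also have "\<dots> \<le> (\<integral>s. L * (W \<omega> * dist (Y1 s \<omega>) (Y2 s \<omega>)) \<partial>time_measure I a b)"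
    proof (rule integral_mono)
      show "\<bar>W \<omega> * (\<rho> (Y1 s \<omega>) - \<rho> (Y2 s \<omega>))\<bar> \<le> L * (W \<omega> * dist (Y1 s \<omega>) (Y2 s \<omega>))" for s
        using mult_left_mono[OF lip[of "Y1 s \<omega>" "Y2 s \<omega>"] W(2)[of \<omega>]] W(2)[of \<omega>]
        by (simp add: abs_mult mult.left_commute)
    qed (use i1 i2 int_s[OF \<omega>] in auto)
    finally show ?thesis by simp
  qed
  have "(\<integral>\<omega>. W \<omega> * \<bar>rate_integral I \<rho> Y1 a b \<omega> - rate_integral I \<rho> Y2 a b \<omega>\<bar> \<partial>Q z)
      \<le> (\<integral>\<omega>. L * (\<integral>s. W \<omega> * dist (Y1 s \<omega>) (Y2 s \<omega>) \<partial>time_measure I a b) \<partial>Q z)"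
  proof (rule integral_mono)
    show "integrable (Q z) (\<lambda>\<omega>. L * (\<integral>s. W \<omega> * dist (Y1 s \<omega>) (Y2 s \<omega>) \<partial>time_measure I a b))"
      using TQ.integrable_snd[OF int] by (rule integrable_mult_right)
    show "integrable (Q z) (\<lambda>\<omega>. W \<omega> * \<bar>rate_integral I \<rho> Y1 a b \<omega> - rate_integral I \<rho> Y2 a b \<omega>\<bar>)"
    proof (rule Q.integrable_const_bound[of _ "1 * (R * (b - a))"], rule AE_I2)
      fix \<omega> assume \<omega>: "\<omega> \<in> space (Q z)"
      show "norm (W \<omega> * \<bar>rate_integral I \<rho> Y1 a b \<omega> - rate_integral I \<rho> Y2 a b \<omega>\<bar>) \<le> 1 * (R * (b - a))"
        using W rate_integral_le[OF process_Q1 ab \<omega>] rate_integral_le[OF process_Q2 ab \<omega>]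
          rate_integral_nonneg[OF process_Q1, of a b \<omega>] rate_integral_nonneg[OF process_Q2, of a b \<omega>]
        unfolding real_norm_def abs_mult by (intro mult_mono) auto
    qed measurable
  qed (rule pointwise)
  also have "\<dots> = L * (\<integral>s. (\<integral>\<omega>. W \<omega> * dist (Y1 s \<omega>) (Y2 s \<omega>) \<partial>Q z) \<partial>time_measure I a b)"
    using TQ.Fubini_integral[OF int] by simp
  also have "\<dots> \<le> L * (\<integral>s. B \<partial>time_measure I a b)"
  proof (intro mult_left_mono integral_mono L_nonneg)
    show "integrable (time_measure I a b) (\<lambda>s. \<integral>\<omega>. W \<omega> * dist (Y1 s \<omega>) (Y2 s \<omega>) \<partial>Q z)"
      by (rule TQ.integrable_fst[OF int])
    show "(\<integral>\<omega>. W \<omega> * dist (Y1 s \<omega>) (Y2 s \<omega>) \<partial>Q z) \<le> B" if "s \<in> space (time_measure I a b)" for s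
      using that by (intro B) (auto simp: space_T)
  qed auto
  finally show ?thesis by (simp add: measure_T[OF ab] mult_ac)
qed

text \<open>Lipschitz cylinder functions make \<open>psi\<close> continuous in the starting point, hence jointly measurable in time
  and space, which the Fubini argument in the induction for the Markov property requires.\<close>

definition psi :: "nat \<Rightarrow> ((real \<Rightarrow> 'e) \<Rightarrow> real) \<Rightarrow> real \<Rightarrow> 'e \<Rightarrow> real" where
  "psi k \<Phi> u x = (\<integral>\<omega>. \<Phi> (\<lambda>s\<in>I. X s \<omega>) * (R * u - rate_integral I \<rho> X 0 u \<omega>) ^ k \<partial>P x)"

lemma complement_bounds:
  assumes "measurable_process I K V" "u \<in> I" "\<omega> \<in> space K"
  shows "0 \<le> R * u - rate_integral I \<rho> V 0 u \<omega>" "R * u - rate_integral I \<rho> V 0 u \<omega> \<le> R * u"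
  using rate_integral_le[OF assms(1) I_0 assms(2) I_nonneg[OF assms(2)] assms(3)]
    rate_integral_nonneg[OF assms(1), of 0 u \<omega>] by auto

lemma psi_integrand:
  assumes V: "measurable_process I K V" and K: "prob_space K" and \<Phi>: "lip_cyl I \<Phi>" and u: "u \<in> I"
  shows "integrable K (\<lambda>\<omega>. \<Phi> (\<lambda>s\<in>I. V s \<omega>) * (R * u - rate_integral I \<rho> V 0 u \<omega>) ^ k)" (is ?int)
    and "ennreal (\<integral>\<omega>. \<Phi> (\<lambda>s\<in>I. V s \<omega>) * (R * u - rate_integral I \<rho> V 0 u \<omega>) ^ k \<partial>K)
      = (\<integral>\<^sup>+\<omega>. ennreal (\<Phi> (\<lambda>s\<in>I. V s \<omega>)) * ennreal (R * u - rate_integral I \<rho> V 0 u \<omega>) ^ k \<partial>K)" (is ?nn)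
    and "0 \<le> (\<integral>\<omega>. \<Phi> (\<lambda>s\<in>I. V s \<omega>) * (R * u - rate_integral I \<rho> V 0 u \<omega>) ^ k \<partial>K)" (is ?ge)
proof -
  interpret prob_space K by fact
  obtain c where c: "0 \<le> c" "\<And>w. 0 \<le> \<Phi> w" "\<And>w. \<Phi> w \<le> c" and \<Phi>m: "\<Phi> \<in> borel_measurable (path_space I)"
    by (rule lip_cylE[OF \<Phi>], rule that)
  note b = complement_bounds[OF V u]
  have [measurable]: "(\<lambda>\<omega>. \<Phi> (\<lambda>s\<in>I. V s \<omega>)) \<in> borel_measurable K" "rate_integral I \<rho> V 0 u \<in> borel_measurable K"
    using measurable_compose[OF path_measurable[OF V] \<Phi>m] rate_integral_measurable[OF V] by auto
  show int: ?int
  proof (rule integrable_const_bound[of _ "c * (R * u) ^ k"], rule AE_I2)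
    fix \<omega> assume "\<omega> \<in> space K"
    from b[OF this] show "norm (\<Phi> (\<lambda>s\<in>I. V s \<omega>) * (R * u - rate_integral I \<rho> V 0 u \<omega>) ^ k) \<le> c * (R * u) ^ k"
      using c by (auto simp: abs_mult power_abs intro!: mult_mono power_mono)
  qed measurable
  have nonneg: "AE \<omega> in K. 0 \<le> \<Phi> (\<lambda>s\<in>I. V s \<omega>) * (R * u - rate_integral I \<rho> V 0 u \<omega>) ^ k"
    using b(1) c(2) by (intro AE_I2) simp
  show ?ge using nonneg by (rule integral_nonneg_AE)
  have "ennreal (\<integral>\<omega>. \<Phi> (\<lambda>s\<in>I. V s \<omega>) * (R * u - rate_integral I \<rho> V 0 u \<omega>) ^ k \<partial>K)
      = (\<integral>\<^sup>+\<omega>. ennreal (\<Phi> (\<lambda>s\<in>I. V s \<omega>) * (R * u - rate_integral I \<rho> V 0 u \<omega>) ^ k) \<partial>K)"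
    by (rule nn_integral_eq_integral[OF int nonneg, symmetric])
  also have "\<dots> = (\<integral>\<^sup>+\<omega>. ennreal (\<Phi> (\<lambda>s\<in>I. V s \<omega>)) * ennreal (R * u - rate_integral I \<rho> V 0 u \<omega>) ^ k \<partial>K)"
    using b(1) c(2) by (intro nn_integral_cong) (simp add: ennreal_mult ennreal_power)
  finally show ?nn .
qed

lemma psi_nonneg: "lip_cyl I \<Phi> \<Longrightarrow> u \<in> I \<Longrightarrow> 0 \<le> psi k \<Phi> u x"
  unfolding psi_def by (rule psi_integrand(3)[OF process_P prob_P])

lemma ennreal_psi:
  "lip_cyl I \<Phi> \<Longrightarrow> u \<in> I \<Longrightarrow> ennreal (psi k \<Phi> u x)
    = (\<integral>\<^sup>+\<omega>. ennreal (\<Phi> (\<lambda>s\<in>I. X s \<omega>)) * ennreal (R * u - rate_integral I \<rho> X 0 u \<omega>) ^ k \<partial>P x)"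
  unfolding psi_def by (rule psi_integrand(2)[OF process_P prob_P])

lemma psi_Y:
  assumes \<Phi>: "lip_cyl I \<Phi>" and u: "u \<in> I"
  shows "psi k \<Phi> u x = (\<integral>\<omega>. \<Phi> (\<lambda>s\<in>I. Y1 s \<omega>) * (R * u - rate_integral I \<rho> Y1 0 u \<omega>) ^ k \<partial>Q (x, y))"
    and "psi k \<Phi> u y = (\<integral>\<omega>. \<Phi> (\<lambda>s\<in>I. Y2 s \<omega>) * (R * u - rate_integral I \<rho> Y2 0 u \<omega>) ^ k \<partial>Q (x, y))"
proof -
  have \<Phi>m: "(\<lambda>w. ennreal (\<Phi> w)) \<in> borel_measurable (path_space I)" using \<Phi> by (auto simp: lip_cyl_def)
  have fin: "finite_measure (P x)" "finite_measure (Q z)" for x z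
    using prob_P prob_Q by (auto simp: prob_space.finite_measure)
  note tr = power_law_transfer[OF _ _ fin(1) fin(2) _ \<Phi>m I_0 u I_nonneg[OF u], simplified]
  have "ennreal (psi k \<Phi> u x) = ennreal (\<integral>\<omega>. \<Phi> (\<lambda>s\<in>I. Y1 s \<omega>) * (R * u - rate_integral I \<rho> Y1 0 u \<omega>) ^ k \<partial>Q (x, y))"
    unfolding ennreal_psi[OF \<Phi> u] psi_integrand(2)[OF process_Q1 prob_Q \<Phi> u]
    by (rule tr[OF process_P process_Q1 law1[symmetric]])
  thus "psi k \<Phi> u x = (\<integral>\<omega>. \<Phi> (\<lambda>s\<in>I. Y1 s \<omega>) * (R * u - rate_integral I \<rho> Y1 0 u \<omega>) ^ k \<partial>Q (x, y))"
    using psi_nonneg[OF \<Phi> u] psi_integrand(3)[OF process_Q1 prob_Q \<Phi> u] by (subst (asm) ennreal_inj) auto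
  have "ennreal (psi k \<Phi> u y) = ennreal (\<integral>\<omega>. \<Phi> (\<lambda>s\<in>I. Y2 s \<omega>) * (R * u - rate_integral I \<rho> Y2 0 u \<omega>) ^ k \<partial>Q (x, y))"
    unfolding ennreal_psi[OF \<Phi> u] psi_integrand(2)[OF process_Q2 prob_Q \<Phi> u]
    by (rule tr[OF process_P process_Q2 law2[symmetric]])
  thus "psi k \<Phi> u y = (\<integral>\<omega>. \<Phi> (\<lambda>s\<in>I. Y2 s \<omega>) * (R * u - rate_integral I \<rho> Y2 0 u \<omega>) ^ k \<partial>Q (x, y))"
    using psi_nonneg[OF \<Phi> u] psi_integrand(3)[OF process_Q2 prob_Q \<Phi> u] by (subst (asm) ennreal_inj) auto
qed

text \<open>Both values are expectations under the same coupling measure, so the difference is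
  controlled by the expected distances along the two coordinates, which are of the order of the
  initial distance.\<close>

lemma psi_lipschitz:
  assumes \<Phi>: "lip_cyl I \<Phi>" and u: "u \<in> I"
  shows "\<exists>K. \<forall>x y. \<bar>psi k \<Phi> u x - psi k \<Phi> u y\<bar> \<le> K * dist x y"
proof -
  obtain c A J where c: "0 \<le> c" "\<And>w. 0 \<le> \<Phi> w" "\<And>w. \<Phi> w \<le> c" and A: "0 \<le> A" and J: "finite J" "J \<subseteq> I"
    and \<Phi>L: "\<And>w w'. \<bar>\<Phi> w - \<Phi> w'\<bar> \<le> A * (\<Sum>s\<in>J. dist (w s) (w' s))"
    by (rule lip_cylE[OF \<Phi>], rule that)
  obtain p where p: "0 \<le> p" "\<And>a b. 0 \<le> a \<Longrightarrow> a \<le> R * u \<Longrightarrow> 0 \<le> b \<Longrightarrow> b \<le> R * u \<Longrightarrow> \<bar>a ^ k - b ^ k\<bar> \<le> p * \<bar>a - b\<bar>"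
    using power_diff_bound[of "R * u" k] by blast
  have Ru: "0 \<le> R * u" using R_nonneg I_nonneg[OF u] by simp
  \<comment> \<open>The first summand comes from varying the cylinder function, with the power
    bounded by \<open>(R * u) ^ k\<close>; the second from varying the power, with the cylinder
    function bounded by \<open>c\<close>.\<close>
  define K where "K = (R * u) ^ k * A * (\<Sum>s\<in>J. CA * exp (R * s)) + c * p * (L * u * (CA * exp (R * u)))"
  have "\<bar>psi k \<Phi> u x - psi k \<Phi> u y\<bar> \<le> K * dist x y" for x y
  proof -
    let ?Q = "Q (x, y)"
    interpret prob_space ?Q by (rule prob_Q)
    let ?a = "\<lambda>V \<omega>. R * u - rate_integral I \<rho> V 0 u \<omega>"
    let ?d = "\<lambda>s \<omega>. dist (Y1 s \<omega>) (Y2 s \<omega>)"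
    let ?r = "\<lambda>\<omega>. \<bar>rate_integral I \<rho> Y1 0 u \<omega> - rate_integral I \<rho> Y2 0 u \<omega>\<bar>"
    note i1 = psi_integrand(1)[OF process_Q1 prob_Q \<Phi> u, where k = k]
      and i2 = psi_integrand(1)[OF process_Q2 prob_Q \<Phi> u, where k = k]
    have id: "integrable ?Q (?d s)" if "s \<in> J" for s
      using that J dist_le by (intro integrable_Q_bounded[of _ _ dbar] dist_Y_measurable) auto
    have ir: "integrable ?Q ?r"
    proof (rule integrable_const_bound[of _ "R * u"], rule AE_I2)
      fix \<omega> assume "\<omega> \<in> space ?Q"
      thus "norm (?r \<omega>) \<le> R * u"
        using complement_bounds[OF process_Q1 u] complement_bounds[OF process_Q2 u] by fastforce
    qed (intro borel_measurable_abs borel_measurable_diff rate_integral_measurable[OF process_Q1]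
      rate_integral_measurable[OF process_Q2])
    have ii: "integrable ?Q (\<lambda>\<omega>. (R * u) ^ k * A * (\<Sum>s\<in>J. ?d s \<omega>) + c * p * ?r \<omega>)"
      using id ir by (intro Bochner_Integration.integrable_add integrable_mult_right Bochner_Integration.integrable_sum) auto
    have "\<bar>psi k \<Phi> u x - psi k \<Phi> u y\<bar>
      = \<bar>\<integral>\<omega>. \<Phi> (\<lambda>s\<in>I. Y1 s \<omega>) * ?a Y1 \<omega> ^ k - \<Phi> (\<lambda>s\<in>I. Y2 s \<omega>) * ?a Y2 \<omega> ^ k \<partial>?Q\<bar>"
      using psi_Y(1)[OF \<Phi> u, where k = k and x = x and y = y] psi_Y(2)[OF \<Phi> u, where k = k and x = x and y = y] i1 i2 by simp
    also have "\<dots> \<le> (\<integral>\<omega>. \<bar>\<Phi> (\<lambda>s\<in>I. Y1 s \<omega>) * ?a Y1 \<omega> ^ k - \<Phi> (\<lambda>s\<in>I. Y2 s \<omega>) * ?a Y2 \<omega> ^ k\<bar> \<partial>?Q)"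
      by (rule integral_abs_bound)
    also have "\<dots> \<le> (\<integral>\<omega>. (R * u) ^ k * A * (\<Sum>s\<in>J. ?d s \<omega>) + c * p * ?r \<omega> \<partial>?Q)"
    proof (rule integral_mono)
      fix \<omega> assume \<omega>: "\<omega> \<in> space ?Q"
      note b1 = complement_bounds[OF process_Q1 u \<omega>] and b2 = complement_bounds[OF process_Q2 u \<omega>]
      let ?F1 = "\<Phi> (\<lambda>s\<in>I. Y1 s \<omega>)" and ?F2 = "\<Phi> (\<lambda>s\<in>I. Y2 s \<omega>)"
      have "\<bar>?F1 * ?a Y1 \<omega> ^ k - ?F2 * ?a Y2 \<omega> ^ k\<bar> = \<bar>(?F1 - ?F2) * ?a Y1 \<omega> ^ k + ?F2 * (?a Y1 \<omega> ^ k - ?a Y2 \<omega> ^ k)\<bar>"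
        by (simp add: algebra_simps)
      also have "\<dots> \<le> \<bar>?F1 - ?F2\<bar> * ?a Y1 \<omega> ^ k + ?F2 * \<bar>?a Y1 \<omega> ^ k - ?a Y2 \<omega> ^ k\<bar>"
        using b1 c(2) by (intro order_trans[OF abs_triangle_ineq]) (simp add: abs_mult)
      also have "\<dots> \<le> (A * (\<Sum>s\<in>J. ?d s \<omega>)) * (R * u) ^ k + c * (p * ?r \<omega>)"
      proof (intro add_mono mult_mono)
        have "(\<Sum>s\<in>J. dist ((\<lambda>s\<in>I. Y1 s \<omega>) s) ((\<lambda>s\<in>I. Y2 s \<omega>) s)) = (\<Sum>s\<in>J. ?d s \<omega>)"
          using J by (intro sum.cong) auto
        thus "\<bar>?F1 - ?F2\<bar> \<le> A * (\<Sum>s\<in>J. ?d s \<omega>)"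
          using \<Phi>L[of "\<lambda>s\<in>I. Y1 s \<omega>" "\<lambda>s\<in>I. Y2 s \<omega>"] by simp
        show "?a Y1 \<omega> ^ k \<le> (R * u) ^ k" using b1 by (intro power_mono)
        show "\<bar>?a Y1 \<omega> ^ k - ?a Y2 \<omega> ^ k\<bar> \<le> p * ?r \<omega>" using p(2)[OF b1 b2] by (simp add: abs_minus_commute)
      qed (use A c b1 in \<open>auto intro!: mult_nonneg_nonneg sum_nonneg\<close>)
      finally show "\<bar>?F1 * ?a Y1 \<omega> ^ k - ?F2 * ?a Y2 \<omega> ^ k\<bar> \<le> (R * u) ^ k * A * (\<Sum>s\<in>J. ?d s \<omega>) + c * p * ?r \<omega>"
        by (simp add: mult_ac)
    qed (use i1 i2 ii in auto)
    also have "\<dots> = (R * u) ^ k * A * (\<Sum>s\<in>J. \<integral>\<omega>. ?d s \<omega> \<partial>?Q) + c * p * (\<integral>\<omega>. ?r \<omega> \<partial>?Q)"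
      using id ir by (subst Bochner_Integration.integral_add) auto
    also have "\<dots> \<le> (R * u) ^ k * A * (\<Sum>s\<in>J. CA * exp (R * s) * dist x y) + c * p * (L * u * (CA * exp (R * u) * dist x y))"
    proof (intro add_mono mult_left_mono sum_mono)
      show "(\<integral>\<omega>. ?d s \<omega> \<partial>?Q) \<le> CA * exp (R * s) * dist x y" if "s \<in> J" for s
        using that J by (intro integral_dist_Y) auto
      have "(\<integral>\<omega>. 1 * ?r \<omega> \<partial>?Q) \<le> L * (u - 0) * (CA * exp (R * u) * dist x y)"
      proof (rule weighted_rate_diff[OF I_0 u I_nonneg[OF u]])
        fix s assume s: "s \<in> I" "s < u"
        have "exp (R * s) \<le> exp (R * u)" using s R_nonneg by (auto intro: mult_left_mono)
        hence "CA * exp (R * s) * dist x y \<le> CA * exp (R * u) * dist x y"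
          using CA_pos by (intro mult_right_mono mult_left_mono) auto
        thus "(\<integral>\<omega>. 1 * ?d s \<omega> \<partial>?Q) \<le> CA * exp (R * u) * dist x y"
          using integral_dist_Y[OF s(1), of x y] by simp
      qed auto
      thus "(\<integral>\<omega>. ?r \<omega> \<partial>?Q) \<le> L * u * (CA * exp (R * u) * dist x y)" by simp
    qed (use A Ru c p in auto)
    also have "\<dots> = K * dist x y" by (simp add: K_def algebra_simps sum_distrib_left sum_distrib_right)
    finally show ?thesis .
  qed
  thus ?thesis by blast
qed

lemma psi_continuous: "lip_cyl I \<Phi> \<Longrightarrow> u \<in> I \<Longrightarrow> continuous_on UNIV (psi k \<Phi> u)"
  and psi_measurable: "lip_cyl I \<Phi> \<Longrightarrow> u \<in> I \<Longrightarrow> psi k \<Phi> u \<in> borel_measurable borel"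
  using psi_lipschitz lipschitz_imp_borel by metis+

text \<open>This closure is what keeps the inductions on the power inside the class: each induction
  step moves one factor of the power into the cylinder function.\<close>

lemma lip_cyl_mult:
  assumes \<Phi>: "lip_cyl I \<Phi>" and s: "s \<in> I"
  shows "lip_cyl I (\<lambda>w. \<Phi> w * (R - \<rho> (w s)))"
proof -
  obtain c A J where c: "0 \<le> c" "\<And>w. 0 \<le> \<Phi> w" "\<And>w. \<Phi> w \<le> c" and A: "0 \<le> A" and J: "finite J" "J \<subseteq> I"
    and \<Phi>L: "\<And>w w'. \<bar>\<Phi> w - \<Phi> w'\<bar> \<le> A * (\<Sum>s\<in>J. dist (w s) (w' s))" and [measurable]: "\<Phi> \<in> borel_measurable (path_space I)"
    by (rule lip_cylE[OF \<Phi>], rule that)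
  have [measurable]: "(\<lambda>w. w s) \<in> path_space I \<rightarrow>\<^sub>M (borel :: 'e measure)" using s by (rule measurable_component_singleton)
  have r: "0 \<le> R - \<rho> x" "R - \<rho> x \<le> R" for x using rate_le[of x] rate_nonneg[of x] by auto
  have L: "\<bar>\<Phi> w * (R - \<rho> (w s)) - \<Phi> w' * (R - \<rho> (w' s))\<bar> \<le> (A * R + c * L) * (\<Sum>s\<in>insert s J. dist (w s) (w' s))"
    for w w' :: "real \<Rightarrow> 'e"
  proof -
    let ?D = "\<Sum>s\<in>insert s J. dist (w s) (w' s)"
    have D: "dist (w s) (w' s) \<le> ?D" "(\<Sum>s\<in>J. dist (w s) (w' s)) \<le> ?D"
      using J by (auto intro!: member_le_sum sum_mono2)
    have D0: "0 \<le> ?D" by (intro sum_nonneg) simp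
    have "\<bar>\<Phi> w * (R - \<rho> (w s)) - \<Phi> w' * (R - \<rho> (w' s))\<bar>
      = \<bar>(\<Phi> w - \<Phi> w') * (R - \<rho> (w s)) + \<Phi> w' * (\<rho> (w' s) - \<rho> (w s))\<bar>" by (simp add: algebra_simps)
    also have "\<dots> \<le> \<bar>\<Phi> w - \<Phi> w'\<bar> * (R - \<rho> (w s)) + \<Phi> w' * \<bar>\<rho> (w' s) - \<rho> (w s)\<bar>"
      using c r by (intro order_trans[OF abs_triangle_ineq]) (simp add: abs_mult)
    also have "\<dots> \<le> (A * ?D) * R + c * (L * ?D)"
    proof (intro add_mono mult_mono)
      show "\<bar>\<Phi> w - \<Phi> w'\<bar> \<le> A * ?D" by (rule order_trans[OF \<Phi>L mult_left_mono[OF D(2) A]])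
      show "\<bar>\<rho> (w' s) - \<rho> (w s)\<bar> \<le> L * ?D"
        using order_trans[OF lip mult_left_mono[OF D(1) L_nonneg]] by (simp add: abs_minus_commute)
      show "0 \<le> A * ?D" by (rule mult_nonneg_nonneg[OF A D0])
    qed (use c r in auto)
    finally show ?thesis by (simp add: algebra_simps)
  qed
  have "(\<lambda>w. \<Phi> w * (R - \<rho> (w s))) \<in> borel_measurable (path_space I)" by measurable
  moreover have "0 \<le> \<Phi> w * (R - \<rho> (w s)) \<and> \<Phi> w * (R - \<rho> (w s)) \<le> c * R" for w
    using c r by (auto intro!: mult_mono)
  moreover have "0 \<le> A * R + c * L" using A c R_nonneg L_nonneg by simp
  moreover have "finite (insert s J)" "insert s J \<subseteq> I" using J s by auto
  ultimately show ?thesis using L unfolding lip_cyl_def by blast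
qed

section \<open>Markov property of the coupling\<close>

lemma Gf_sub:
  assumes "t \<in> I"
  shows "subalgebra (Q z) (Gf t)"
proof -
  have "subalgebra N (Gf t)" by (rule coupling_markov[unfolded markov_process_def, THEN conjunct1, THEN bspec, OF assms])
  thus ?thesis using sets_Q[of z] space_Q[of z] by (simp add: subalgebra_def)
qed

lemma Gf_measurable:
  assumes "s \<in> I" "t \<in> I" "s \<le> t"
  shows "Y1 s \<in> Gf t \<rightarrow>\<^sub>M borel" "Y2 s \<in> Gf t \<rightarrow>\<^sub>M borel"
proof -
  note cm = coupling_markov[unfolded markov_process_def]
  note sub = cm[THEN conjunct1, THEN bspec]
  note mono = cm[THEN conjunct2, THEN conjunct1, THEN bspec, OF assms(1), THEN bspec, OF assms(2), THEN mp, OF assms(3)]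
  note ad = cm[THEN conjunct2, THEN conjunct2, THEN conjunct1, THEN bspec, OF assms(1)]
  have "subalgebra (Gf t) (Gf s)" using sub[OF assms(1)] sub[OF assms(2)] mono unfolding subalgebra_def by simp
  note * = measurable_from_subalg[OF this ad]
  have "fst \<in> borel \<rightarrow>\<^sub>M (borel :: 'e measure)" "snd \<in> borel \<rightarrow>\<^sub>M (borel :: 'e measure)"
    by (intro borel_measurable_continuous_onI continuous_intros)+
  from this[THEN measurable_compose[OF *]]
  show "Y1 s \<in> Gf t \<rightarrow>\<^sub>M borel" "Y2 s \<in> Gf t \<rightarrow>\<^sub>M borel" by simp_all
qed

text \<open>The weights \<open>pen\<close> up to time \<open>t\<close> need not be measurable for the natural filtration at time \<open>t\<close>; they are
  reached from \<open>past\<close> by the expansion into powers.\<close>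

definition past :: "real \<Rightarrow> ('v \<Rightarrow> real) \<Rightarrow> bool" where
  "past t H \<longleftrightarrow> H \<in> borel_measurable (Gf t) \<and> (\<exists>c. \<forall>\<omega>. 0 \<le> H \<omega> \<and> H \<omega> \<le> c)"

lemma past_measurable: "past t H \<Longrightarrow> t \<in> I \<Longrightarrow> H \<in> borel_measurable (Q z)"
  by (rule measurable_from_subalg[OF Gf_sub]) (auto simp: past_def)

lemma past_nonneg: "past t H \<Longrightarrow> 0 \<le> H \<omega>"
  by (auto simp: past_def)

lemma past_one: "past t (\<lambda>_. 1)"
  by (auto simp: past_def)

lemma past_mult:
  assumes "past t H" "past t H'"
  shows "past t (\<lambda>\<omega>. H \<omega> * H' \<omega>)"
proof -
  obtain c where c: "0 \<le> H \<omega>" "H \<omega> \<le> c" for \<omega> using assms(1) unfolding past_def by blast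
  obtain c' where c': "0 \<le> H' \<omega>" "H' \<omega> \<le> c'" for \<omega> using assms(2) unfolding past_def by blast
  have "0 \<le> c" using order_trans[OF c(1) c(2)] .
  have "0 \<le> H \<omega> * H' \<omega> \<and> H \<omega> * H' \<omega> \<le> c * c'" for \<omega>
    by (rule conjI[OF mult_nonneg_nonneg[OF c(1) c'(1)] mult_mono[OF c(2) c'(2) \<open>0 \<le> c\<close> c'(1)]])
  moreover have "(\<lambda>\<omega>. H \<omega> * H' \<omega>) \<in> borel_measurable (Gf t)"
    using assms unfolding past_def by (intro borel_measurable_times) blast+
  ultimately show ?thesis unfolding past_def by blast
qed

lemma past_Y:
  assumes "s \<in> I" "t \<in> I" "s \<le> t" "f \<in> borel_measurable borel" "\<And>x. 0 \<le> f x" "\<And>x. f x \<le> c"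
  shows "past t (\<lambda>\<omega>. f (Y1 s \<omega>))" "past t (\<lambda>\<omega>. f (Y2 s \<omega>))"
  using measurable_compose[OF Gf_measurable(1)[OF assms(1-3)] assms(4)]
    measurable_compose[OF Gf_measurable(2)[OF assms(1-3)] assms(4)] assms(5,6)
  by (auto simp: past_def)

text \<open>The Markov property of the pair restarts the coupling at \<open>(Y1 t, Y2 t)\<close>,
  but the law of the second coordinate after the restart is that of \<open>X\<close> started from
  \<open>Y2 t\<close>, whatever \<open>Y1 t\<close> is. Hence the semigroup of \<open>X\<close>
  appears after each switch of weights.\<close>

lemma markov_indicator:
  assumes t: "t \<in> I" and H: "past t H" and B: "B \<in> sets (path_space I)"
  shows "(\<integral>\<omega>. H \<omega> * indicator B (\<lambda>s\<in>I. Y2 (t + s) \<omega>) \<partial>Q z)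
       = (\<integral>\<omega>. H \<omega> * measure (path_law I X (P (Y2 t \<omega>))) B \<partial>Q z)"
proof -
  interpret prob_space "Q z" by (rule prob_Q)
  interpret finite_measure_subalgebra "Q z" "Gf t"
    by (intro finite_measure_subalgebra.intro finite_measure_axioms finite_measure_subalgebra_axioms.intro Gf_sub[OF t])
  let ?Y = "\<lambda>t \<omega>. (Y1 t \<omega>, Y2 t \<omega>)"
  have sndm: "snd \<in> (borel :: ('e \<times> 'e) measure) \<rightarrow>\<^sub>M borel"
    by (intro borel_measurable_continuous_onI continuous_intros)
  have proj: "(\<lambda>w. \<lambda>s\<in>I. snd (w s)) \<in> (path_space I :: (real \<Rightarrow> 'e \<times> 'e) measure) \<rightarrow>\<^sub>M (path_space I :: (real \<Rightarrow> 'e) measure)"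
    by (rule measurable_restrict, rule measurable_compose[OF _ sndm], rule measurable_component_singleton)
  \<comment> \<open>An event about the second coordinate, seen as an event about the path of the
    pair.\<close>
  define A where "A = (\<lambda>w. \<lambda>s\<in>I. snd (w s)) -` B \<inter> space (path_space I :: (real \<Rightarrow> 'e \<times> 'e) measure)"
  have A: "A \<in> sets (path_space I)" unfolding A_def by (rule measurable_sets[OF proj B])
  define E where "E = {\<omega>'\<in>space N. (\<lambda>s\<in>I. ?Y (t + s) \<omega>') \<in> A}"
  have E_eq: "E = {\<omega>'\<in>space N. (\<lambda>s\<in>I. Y2 (t + s) \<omega>') \<in> B}"
    by (auto simp: E_def A_def space_PiM restrict_def cong: if_cong)
  have E: "indicator E \<omega> = (indicator B (\<lambda>s\<in>I. Y2 (t + s) \<omega>) :: real)" if "\<omega> \<in> space (Q z)" for \<omega>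
    using that space_Q by (auto simp: E_eq indicator_def)
  have Em: "E \<in> sets (Q z)"
  proof -
    have "(\<lambda>\<omega>. \<lambda>s\<in>I. Y2 (t + s) \<omega>) -` B \<inter> space (Q z) \<in> sets (Q z)"
      by (rule measurable_sets[OF path_shift_measurable[OF process_Q2 t] B])
    thus ?thesis using space_Q by (simp add: E_eq vimage_def Int_def conj_commute)
  qed
  have law: "measure (path_law I ?Y (Q v)) A = measure (path_law I X (P (snd v))) B" for v
  proof -
    have "measure (path_law I X (P (snd v))) B = measure (path_law I Y2 (Q v)) B"
      using law2[of "fst v" "snd v"] by simp
    also have "\<dots> = measure (Q v) ((\<lambda>\<omega>. \<lambda>s\<in>I. Y2 s \<omega>) -` B \<inter> space (Q v))"
      unfolding path_law_def by (rule measure_distr[OF path_measurable[OF process_Q2] B])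
    also have "(\<lambda>\<omega>. \<lambda>s\<in>I. Y2 s \<omega>) -` B \<inter> space (Q v) = (\<lambda>\<omega>. \<lambda>s\<in>I. ?Y s \<omega>) -` A \<inter> space (Q v)"
      by (auto simp: A_def space_PiM restrict_def cong: if_cong)
    also have "measure (Q v) \<dots> = measure (path_law I ?Y (Q v)) A"
      unfolding path_law_def
    proof (rule measure_distr[symmetric, OF _ A])
      show "(\<lambda>\<omega>. \<lambda>s\<in>I. ?Y s \<omega>) \<in> Q v \<rightarrow>\<^sub>M path_space I"
        by (intro measurable_restrict measurable_processD[OF measurable_process_cong[OF sets_Q[symmetric] coupling_process]])
    qed
    finally show ?thesis by simp
  qed
  have ae: "AE \<omega> in Q z. real_cond_exp (Q z) (Gf t) (indicator E) \<omega> = measure (path_law I X (P (Y2 t \<omega>))) B"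
  proof -
    have "AE \<omega> in Q z. real_cond_exp (Q z) (Gf t) (indicator E) \<omega> = measure (path_law I ?Y (Q (?Y t \<omega>))) A"
      unfolding E_def
      by (rule coupling_markov[unfolded markov_process_def, THEN conjunct2, THEN conjunct2, THEN conjunct2,
            THEN conjunct2, THEN conjunct2, THEN conjunct2, THEN spec, THEN bspec, OF t, THEN bspec, OF A])
    thus ?thesis by (simp only: law snd_conv)
  qed
  obtain c where c: "\<And>\<omega>. 0 \<le> H \<omega> \<and> H \<omega> \<le> c" using H unfolding past_def by blast
  hence c0: "0 \<le> c" using order_trans by blast
  have Hm: "H \<in> borel_measurable (Gf t)" using H by (simp add: past_def)
  have [measurable]: "H \<in> borel_measurable (Q z)" by (rule past_measurable[OF H t])
  have int: "integrable (Q z) (\<lambda>\<omega>. H \<omega> * indicator E \<omega>)"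
    using c c0 Em by (intro integrable_const_bound[of _ c]) (auto simp: indicator_def)
  have "(\<integral>\<omega>. H \<omega> * indicator B (\<lambda>s\<in>I. Y2 (t + s) \<omega>) \<partial>Q z) = (\<integral>\<omega>. H \<omega> * indicator E \<omega> \<partial>Q z)"
    by (intro Bochner_Integration.integral_cong) (auto simp: E)
  also have "\<dots> = (\<integral>\<omega>. H \<omega> * real_cond_exp (Q z) (Gf t) (indicator E) \<omega> \<partial>Q z)"
    using Em by (intro real_cond_exp_intg(2)[symmetric] int Hm) auto
  also have "\<dots> = (\<integral>\<omega>. H \<omega> * measure (path_law I X (P (Y2 t \<omega>))) B \<partial>Q z)"
  proof (rule integral_cong_AE)
    have "real_cond_exp (Q z) (Gf t) (indicator E) \<in> borel_measurable (Q z)" by simp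
    thus "(\<lambda>\<omega>. H \<omega> * real_cond_exp (Q z) (Gf t) (indicator E) \<omega>) \<in> borel_measurable (Q z)" by simp
    have "(\<lambda>x. measure (path_law I X (P x)) B) \<in> borel_measurable borel"
      by (rule measurable_compose[OF measurable_prob_algebraD[OF law_measurable]
            measurable_measure_subprob_algebra[OF B]])
    from measurable_compose[OF Y2_meas[OF t] this]
    show "(\<lambda>\<omega>. H \<omega> * measure (path_law I X (P (Y2 t \<omega>))) B) \<in> borel_measurable (Q z)" by simp
  qed (use ae in auto)
  finally show ?thesis .
qed

text \<open>Two measures on path space agree on events by \<open>markov_indicator\<close>, hence
  give the same integral to every nonnegative functional.\<close>

lemma markov_path:
  assumes t: "t \<in> I" and H: "past t H" and \<Phi>: "\<Phi> \<in> borel_measurable (path_space I)"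
  shows "(\<integral>\<^sup>+\<omega>. ennreal (H \<omega>) * \<Phi> (\<lambda>s\<in>I. Y2 (t + s) \<omega>) \<partial>Q z)
       = (\<integral>\<^sup>+\<omega>. ennreal (H \<omega>) * (\<integral>\<^sup>+\<omega>'. \<Phi> (\<lambda>s\<in>I. X s \<omega>') \<partial>P (Y2 t \<omega>)) \<partial>Q z)"
proof -
  interpret prob_space "Q z" by (rule prob_Q)
  obtain c where c: "\<And>\<omega>. 0 \<le> H \<omega> \<and> H \<omega> \<le> c" using H unfolding past_def by blast
  hence c0: "0 \<le> c" using order_trans by blast
  define \<kappa> where "\<kappa> = (\<lambda>x. path_law I X (P x))"
  have \<kappa>: "\<kappa> \<in> borel \<rightarrow>\<^sub>M subprob_algebra (path_space I)"
    unfolding \<kappa>_def by (rule measurable_prob_algebraD[OF law_measurable])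
  have \<kappa>_prob: "prob_space (\<kappa> x)" for x
    unfolding \<kappa>_def path_law_def by (rule prob_space.prob_space_distr[OF prob_P path_measurable[OF process_P]])
  note sh[measurable] = path_shift_measurable[OF process_Q2 t]
  have [measurable]: "H \<in> borel_measurable (Q z)" "Y2 t \<in> Q z \<rightarrow>\<^sub>M borel"
    by (rule past_measurable[OF H t], rule Y2_meas[OF t])
  define D where "D = density (Q z) (\<lambda>\<omega>. ennreal (H \<omega>))"
  have setsD[measurable_cong]: "sets D = sets (Q z)" by (simp add: D_def)
  \<comment> \<open>The first is the law of the shifted second coordinate under the measure with
    density \<open>H\<close>; the second, below, is the mixture of the laws of \<open>X\<close> over
    the weighted distribution of \<open>Y2 t\<close>.\<close>
  define \<mu>1 where "\<mu>1 = distr D (path_space I) (\<lambda>\<omega>. \<lambda>s\<in>I. Y2 (t + s) \<omega>)"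
  define \<mu>2 where "\<mu>2 = distr D borel (Y2 t) \<bind> \<kappa>"
  have kd: "\<kappa> \<in> distr D borel (Y2 t) \<rightarrow>\<^sub>M subprob_algebra (path_space I)" using \<kappa> by simp
  have "\<mu>1 = \<mu>2"
  proof (rule measure_eqI)
    have s2: "sets \<mu>2 = sets (path_space I)" unfolding \<mu>2_def by (rule sets_bind[OF sets_kernel[OF kd]]) auto
    thus "sets \<mu>1 = sets \<mu>2" by (simp add: \<mu>1_def)
    fix B assume "B \<in> sets \<mu>1"
    hence B[measurable]: "B \<in> sets (path_space I)" by (simp add: \<mu>1_def)
    have mB: "(\<lambda>x. emeasure (\<kappa> x) B) \<in> borel_measurable borel"
      by (rule measurable_compose[OF \<kappa> measurable_emeasure_subprob_algebra[OF B]])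
    have mB': "(\<lambda>x. measure (\<kappa> x) B) \<in> borel_measurable borel"
      by (rule measurable_compose[OF \<kappa> measurable_measure_subprob_algebra[OF B]])
    note [measurable] = measurable_compose[OF \<open>Y2 t \<in> Q z \<rightarrow>\<^sub>M borel\<close> mB'] mB
    have "emeasure \<mu>1 B = emeasure D ((\<lambda>\<omega>. \<lambda>s\<in>I. Y2 (t + s) \<omega>) -` B \<inter> space D)"
      unfolding \<mu>1_def by (rule emeasure_distr) measurable
    also have "\<dots> = (\<integral>\<^sup>+\<omega>. ennreal (H \<omega>) * indicator ((\<lambda>\<omega>. \<lambda>s\<in>I. Y2 (t + s) \<omega>) -` B \<inter> space D) \<omega> \<partial>Q z)"
      unfolding D_def by (rule emeasure_density) measurable
    also have "\<dots> = (\<integral>\<^sup>+\<omega>. ennreal (H \<omega> * indicator B (\<lambda>s\<in>I. Y2 (t + s) \<omega>)) \<partial>Q z)"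
      by (intro nn_integral_cong) (auto simp: indicator_def D_def)
    also have "\<dots> = ennreal (\<integral>\<omega>. H \<omega> * indicator B (\<lambda>s\<in>I. Y2 (t + s) \<omega>) \<partial>Q z)"
      using c c0 by (intro nn_integral_eq_integral integrable_const_bound[of _ c]) (auto simp: indicator_def)
    also have "\<dots> = ennreal (\<integral>\<omega>. H \<omega> * measure (\<kappa> (Y2 t \<omega>)) B \<partial>Q z)"
      unfolding \<kappa>_def by (simp only: markov_indicator[OF t H B])
    also have "\<dots> = (\<integral>\<^sup>+\<omega>. ennreal (H \<omega> * measure (\<kappa> (Y2 t \<omega>)) B) \<partial>Q z)"
    proof (intro nn_integral_eq_integral[symmetric] integrable_const_bound[of _ "c * 1"] AE_I2)
      show "norm (H \<omega> * measure (\<kappa> (Y2 t \<omega>)) B) \<le> c * 1" for \<omega>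
        using c[of \<omega>] prob_space.prob_le_1[OF \<kappa>_prob] unfolding real_norm_def abs_mult by (intro mult_mono) auto
    qed (use c in auto)
    also have "\<dots> = (\<integral>\<^sup>+\<omega>. ennreal (H \<omega>) * emeasure (\<kappa> (Y2 t \<omega>)) B \<partial>Q z)"
      using c by (intro nn_integral_cong)
        (simp add: ennreal_mult finite_measure.emeasure_eq_measure[OF prob_space.finite_measure[OF \<kappa>_prob]])
    also have "\<dots> = (\<integral>\<^sup>+x. emeasure (\<kappa> x) B \<partial>distr D borel (Y2 t))"
      unfolding D_def by (subst nn_integral_distr, measurable, subst nn_integral_density)
        (auto simp: mB measurable_compose[OF _ mB])
    also have "\<dots> = emeasure \<mu>2 B"
      unfolding \<mu>2_def by (rule emeasure_bind[OF _ kd B, symmetric]) simp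
    finally show "emeasure \<mu>1 B = emeasure \<mu>2 B" .
  qed
  hence "(\<integral>\<^sup>+w. \<Phi> w \<partial>\<mu>1) = (\<integral>\<^sup>+w. \<Phi> w \<partial>\<mu>2)" by simp
  moreover have "(\<integral>\<^sup>+w. \<Phi> w \<partial>\<mu>1) = (\<integral>\<^sup>+\<omega>. ennreal (H \<omega>) * \<Phi> (\<lambda>s\<in>I. Y2 (t + s) \<omega>) \<partial>Q z)"
    unfolding \<mu>1_def D_def using \<Phi> measurable_compose[OF sh \<Phi>]
    by (subst nn_integral_distr, measurable, subst nn_integral_density) auto
  moreover have "(\<integral>\<^sup>+w. \<Phi> w \<partial>\<mu>2) = (\<integral>\<^sup>+\<omega>. ennreal (H \<omega>) * (\<integral>\<^sup>+\<omega>'. \<Phi> (\<lambda>s\<in>I. X s \<omega>') \<partial>P (Y2 t \<omega>)) \<partial>Q z)"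
  proof -
    have m: "(\<lambda>x. \<integral>\<^sup>+w. \<Phi> w \<partial>\<kappa> x) \<in> borel_measurable borel"
      by (rule measurable_compose[OF \<kappa> nn_integral_measurable_subprob_algebra[OF \<Phi>]])
    note m[measurable]
    have "(\<integral>\<^sup>+w. \<Phi> w \<partial>\<mu>2) = (\<integral>\<^sup>+x. (\<integral>\<^sup>+w. \<Phi> w \<partial>\<kappa> x) \<partial>distr D borel (Y2 t))"
      unfolding \<mu>2_def by (rule nn_integral_bind[OF \<Phi> kd])
    also have "\<dots> = (\<integral>\<^sup>+\<omega>. ennreal (H \<omega>) * (\<integral>\<^sup>+w. \<Phi> w \<partial>\<kappa> (Y2 t \<omega>)) \<partial>Q z)"
      unfolding D_def by (subst nn_integral_distr, measurable, subst nn_integral_density)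
        (auto simp: m measurable_compose[OF _ m])
    finally show ?thesis by (simp add: \<kappa>_def nn_integral_path_law[OF process_P \<Phi>])
  qed
  ultimately show ?thesis by simp
qed

section \<open>Moments of the additive functional after a time shift\<close>

lemma process_shift:
  assumes "measurable_process I K V" "t \<in> I"
  shows "measurable_process I K (\<lambda>s. V (t + s))"
proof -
  have "(\<lambda>s. t + s) \<in> restrict_space borel I \<rightarrow>\<^sub>M restrict_space borel I"
    using assms(2) by (intro measurable_restrict_space2 measurable_restrict_space1) (auto simp: space_restrict_space)
  hence "(\<lambda>z. (t + fst z, snd z)) \<in> restrict_space borel I \<Otimes>\<^sub>M K \<rightarrow>\<^sub>M restrict_space borel I \<Otimes>\<^sub>M K"
    by (intro measurable_Pair measurable_snd measurable_compose[OF measurable_fst])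
  from measurable_compose[OF this assms(1)[unfolded measurable_process_def]]
  show ?thesis by (simp add: measurable_process_def split_beta)
qed

lemma rate_integral_shift:
  assumes "measurable_process I K V" "t \<in> I" "\<omega> \<in> space K"
  shows "rate_integral I \<rho> V t (t + u) \<omega> = rate_integral I \<rho> (\<lambda>s. V (t + s)) 0 u \<omega>"
proof -
  have "rate_integral I \<rho> V t (t + u) \<omega>
    = (\<integral>s. \<rho> (V s \<omega>) \<partial>distr (time_measure I 0 u) (time_measure I (t + 0) (t + u)) (\<lambda>s. t + s))"
    unfolding rate_integral_def using T_shift[OF assms(2), of 0 u] by simp
  also have "\<dots> = rate_integral I \<rho> (\<lambda>s. V (t + s)) 0 u \<omega>"
    unfolding rate_integral_def
  proof (rule integral_distr)
    show "(\<lambda>s. \<rho> (V s \<omega>)) \<in> borel_measurable (time_measure I (t + 0) (t + u))"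
      by (rule rate_section[OF assms(1,3)])
    show "(\<lambda>s. t + s) \<in> time_measure I 0 u \<rightarrow>\<^sub>M time_measure I (t + 0) (t + u)"
    proof (cases "I = \<nat>")
      case True
      thus ?thesis using assms(2) by (auto simp: T_Nats)
    next
      case False
      have "(\<lambda>s. t + s) \<in> restrict_space lborel {0..<u} \<rightarrow>\<^sub>M restrict_space lborel {t..<t + u}"
        by (intro measurable_restrict_space2 measurable_restrict_space1) (auto simp: space_restrict_space)
      thus ?thesis using False I_nonneg[OF assms(2)] by (simp add: T_continuous)
    qed
  qed
  finally show ?thesis .
qed

lemma S_nonneg:
  assumes "\<And>x. 0 \<le> f x"
  shows "0 \<le> S t f x"
  unfolding S_def using assms pen_nonneg[OF process_P] by (intro integral_nonneg_AE) auto

lemma psi_section_measurable: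
  assumes \<Phi>: "lip_cyl I \<Phi>" and u: "u \<in> I"
  shows "(\<lambda>s. psi k (\<lambda>w. \<Phi> w * (R - \<rho> (w s))) u x) \<in> borel_measurable (time_measure I 0 u)"
proof -
  interpret prob_space "P x" by (rule prob_P)
  have [measurable]: "(\<lambda>\<omega>. \<Phi> (\<lambda>s\<in>I. X s \<omega>)) \<in> borel_measurable (P x)" "rate_integral I \<rho> X 0 u \<in> borel_measurable (P x)"
    using measurable_compose[OF path_measurable[OF process_P]] rate_integral_measurable[OF process_P] \<Phi>
    by (auto simp: lip_cyl_def)
  note [measurable] = V_joint[OF process_P]
  have "(\<lambda>s. \<integral>\<omega>. \<Phi> (\<lambda>s\<in>I. X s \<omega>) * (R - \<rho> (X s \<omega>)) * (R * u - rate_integral I \<rho> X 0 u \<omega>) ^ k \<partial>P x)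
     \<in> borel_measurable (time_measure I 0 u)"
    by (rule borel_measurable_lebesgue_integral) (unfold split_beta, measurable)
  thus ?thesis
    by (rule measurable_cong[THEN iffD1, rotated]) (simp add: psi_def space_T)
qed

text \<open>In \<open>s\<close> measurability follows from joint measurability of the process under
  a fixed \<open>P x\<close>; in \<open>x\<close> it comes from continuity. Neither argument alone
  is joint, so the two are combined in Caratheodory's way.\<close>

lemma psi_joint_measurable:
  assumes \<Phi>: "lip_cyl I \<Phi>" and u: "u \<in> I"
  shows "(\<lambda>(s, x). psi k (\<lambda>w. \<Phi> w * (R - \<rho> (w s))) u x) \<in> borel_measurable (time_measure I 0 u \<Otimes>\<^sub>M borel)"
proof (rule borel_measurable_Caratheodory)
  fix s assume "s \<in> space (time_measure I 0 u)"
  hence "s \<in> I" by (simp add: space_T)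
  thus "continuous_on UNIV (psi k (\<lambda>w. \<Phi> w * (R - \<rho> (w s))) u)"
    by (intro psi_continuous lip_cyl_mult \<Phi> u)
qed (rule psi_section_measurable[OF \<Phi> u])

text \<open>One factor of the power is the time integral of the complementary rate; by Fubini it
  becomes a factor of the cylinder function under an outer time integral.\<close>

lemma psi_Suc:
  assumes \<Phi>: "lip_cyl I \<Phi>" and u: "u \<in> I"
  shows "(\<integral>\<^sup>+s. ennreal (psi k (\<lambda>w. \<Phi> w * (R - \<rho> (w s))) u x) \<partial>time_measure I 0 u) = ennreal (psi (Suc k) \<Phi> u x)"
proof -
  interpret Px: prob_space "P x" by (rule prob_P)
  interpret T: finite_measure "time_measure I 0 u" by (rule finite_T)
  interpret pair_sigma_finite "time_measure I 0 u" "P x" ..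
  have [measurable]: "(\<lambda>\<omega>. \<Phi> (\<lambda>s\<in>I. X s \<omega>)) \<in> borel_measurable (P x)" "rate_integral I \<rho> X 0 u \<in> borel_measurable (P x)"
    using measurable_compose[OF path_measurable[OF process_P]] rate_integral_measurable[OF process_P] \<Phi>
    by (auto simp: lip_cyl_def)
  note [measurable] = V_joint[OF process_P]
  have \<Phi>0: "0 \<le> \<Phi> w" for w using \<Phi> by (auto simp: lip_cyl_def)
  let ?a = "\<lambda>\<omega>. ennreal (R * u - rate_integral I \<rho> X 0 u \<omega>)"
  have "(\<integral>\<^sup>+s. ennreal (psi k (\<lambda>w. \<Phi> w * (R - \<rho> (w s))) u x) \<partial>time_measure I 0 u)
     = (\<integral>\<^sup>+s. \<integral>\<^sup>+\<omega>. ennreal (\<Phi> (\<lambda>s\<in>I. X s \<omega>)) * ennreal (R - \<rho> (X s \<omega>)) * ?a \<omega> ^ k \<partial>P x \<partial>time_measure I 0 u)"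
  proof (rule nn_integral_cong)
    fix s assume "s \<in> space (time_measure I 0 u)"
    hence s: "s \<in> I" by (simp add: space_T)
    show "ennreal (psi k (\<lambda>w. \<Phi> w * (R - \<rho> (w s))) u x)
      = (\<integral>\<^sup>+\<omega>. ennreal (\<Phi> (\<lambda>s\<in>I. X s \<omega>)) * ennreal (R - \<rho> (X s \<omega>)) * ?a \<omega> ^ k \<partial>P x)"
      unfolding ennreal_psi[OF lip_cyl_mult[OF \<Phi> s] u]
      using s \<Phi>0 rate_le by (intro nn_integral_cong) (simp add: ennreal_mult')
  qed
  also have "\<dots> = (\<integral>\<^sup>+\<omega>. \<integral>\<^sup>+s. ennreal (\<Phi> (\<lambda>s\<in>I. X s \<omega>)) * ennreal (R - \<rho> (X s \<omega>)) * ?a \<omega> ^ k \<partial>time_measure I 0 u \<partial>P x)"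
    by (rule Fubini'[symmetric]) (unfold split_beta, measurable)
  also have "\<dots> = (\<integral>\<^sup>+\<omega>. ennreal (\<Phi> (\<lambda>s\<in>I. X s \<omega>)) * ?a \<omega> ^ Suc k \<partial>P x)"
  proof (rule nn_integral_cong)
    fix \<omega> assume \<omega>: "\<omega> \<in> space (P x)"
    note [measurable] = rate_section[OF process_P \<omega>]
    have "(\<integral>\<^sup>+s. ennreal (\<Phi> (\<lambda>s\<in>I. X s \<omega>)) * ennreal (R - \<rho> (X s \<omega>)) * ?a \<omega> ^ k \<partial>time_measure I 0 u)
      = (\<integral>\<^sup>+s. ennreal (R - \<rho> (X s \<omega>)) * (ennreal (\<Phi> (\<lambda>s\<in>I. X s \<omega>)) * ?a \<omega> ^ k) \<partial>time_measure I 0 u)"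
      by (simp add: mult_ac)
    also have "\<dots> = (\<integral>\<^sup>+s. ennreal (R - \<rho> (X s \<omega>)) \<partial>time_measure I 0 u) * (ennreal (\<Phi> (\<lambda>s\<in>I. X s \<omega>)) * ?a \<omega> ^ k)"
      by (rule nn_integral_multc) measurable
    also have "(\<integral>\<^sup>+s. ennreal (R - \<rho> (X s \<omega>)) \<partial>time_measure I 0 u) = ?a \<omega>"
      using nn_integral_complement[OF process_P I_0 u I_nonneg[OF u] \<omega>] by simp
    finally show "(\<integral>\<^sup>+s. ennreal (\<Phi> (\<lambda>s\<in>I. X s \<omega>)) * ennreal (R - \<rho> (X s \<omega>)) * ?a \<omega> ^ k \<partial>time_measure I 0 u)
       = ennreal (\<Phi> (\<lambda>s\<in>I. X s \<omega>)) * ?a \<omega> ^ Suc k"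
      by (simp only: power_Suc mult_ac)
  qed
  also have "\<dots> = ennreal (psi (Suc k) \<Phi> u x)" by (rule ennreal_psi[OF \<Phi> u, symmetric])
  finally show ?thesis .
qed

text \<open>Induction on the power: take out one factor as a time integral, absorb it into the
  cylinder function, apply the induction hypothesis for each fixed time, and reassemble the integral
  at the restarted point with \<open>psi_Suc\<close>. The base case is the Markov property for
  cylinder functions.\<close>

lemma markov_power:
  assumes t: "t \<in> I" and u: "u \<in> I" and H: "past t H" and \<Phi>: "lip_cyl I \<Phi>"
  shows "(\<integral>\<^sup>+\<omega>. ennreal (H \<omega>) * ennreal (\<Phi> (\<lambda>s\<in>I. Y2 (t + s) \<omega>))
            * ennreal (R * u - rate_integral I \<rho> Y2 t (t + u) \<omega>) ^ k \<partial>Q z)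
       = (\<integral>\<^sup>+\<omega>. ennreal (H \<omega>) * ennreal (psi k \<Phi> u (Y2 t \<omega>)) \<partial>Q z)"
  using \<Phi>
proof (induction k arbitrary: \<Phi>)
  case 0
  have "(\<lambda>w. ennreal (\<Phi> w)) \<in> borel_measurable (path_space I)" using 0 by (auto simp: lip_cyl_def)
  from markov_path[OF t H this] show ?case by (simp only: power_0 mult_1_right ennreal_psi[OF 0 u])
next
  case (Suc k)
  interpret Qz: prob_space "Q z" by (rule prob_Q)
  interpret T: finite_measure "time_measure I 0 u" by (rule finite_T)
  interpret pair_sigma_finite "time_measure I 0 u" "Q z" ..
  note proc = process_shift[OF process_Q2[of z] t]
  have \<Phi>0: "0 \<le> \<Phi> w" for w using Suc.prems by (auto simp: lip_cyl_def)
  have [measurable]: "(\<lambda>\<omega>. \<Phi> (\<lambda>s\<in>I. Y2 (t + s) \<omega>)) \<in> borel_measurable (Q z)"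
    "rate_integral I \<rho> Y2 t (t + u) \<in> borel_measurable (Q z)" "H \<in> borel_measurable (Q z)"
    using measurable_compose[OF path_measurable[OF proc]] rate_integral_measurable[OF process_Q2[of z]] Suc.prems
      past_measurable[OF H t, of z] by (auto simp: lip_cyl_def)
  note [measurable] = V_joint[OF proc] Y2_meas[OF t]
  let ?a = "\<lambda>\<omega>. ennreal (R * u - rate_integral I \<rho> Y2 t (t + u) \<omega>)"
  let ?f = "\<lambda>\<omega>. ennreal (\<Phi> (\<lambda>s\<in>I. Y2 (t + s) \<omega>))"
  have a: "(\<integral>\<^sup>+s. ennreal (R - \<rho> (Y2 (t + s) \<omega>)) \<partial>time_measure I 0 u) = ?a \<omega>" if "\<omega> \<in> space (Q z)" for \<omega>
    using nn_integral_complement[OF proc I_0 u I_nonneg[OF u] that] rate_integral_shift[OF process_Q2[of z] t that] by simp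
  have "(\<integral>\<^sup>+\<omega>. ennreal (H \<omega>) * ?f \<omega> * ?a \<omega> ^ Suc k \<partial>Q z)
      = (\<integral>\<^sup>+\<omega>. \<integral>\<^sup>+s. ennreal (H \<omega>) * (?f \<omega> * ennreal (R - \<rho> (Y2 (t + s) \<omega>))) * ?a \<omega> ^ k \<partial>time_measure I 0 u \<partial>Q z)"
  proof (rule nn_integral_cong)
    fix \<omega> assume \<omega>: "\<omega> \<in> space (Q z)"
    note [measurable] = rate_section[OF proc \<omega>]
    have "(\<integral>\<^sup>+s. ennreal (H \<omega>) * (?f \<omega> * ennreal (R - \<rho> (Y2 (t + s) \<omega>))) * ?a \<omega> ^ k \<partial>time_measure I 0 u)
      = (\<integral>\<^sup>+s. ennreal (R - \<rho> (Y2 (t + s) \<omega>)) * (ennreal (H \<omega>) * ?f \<omega> * ?a \<omega> ^ k) \<partial>time_measure I 0 u)"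
      by (simp add: mult_ac)
    also have "\<dots> = (\<integral>\<^sup>+s. ennreal (R - \<rho> (Y2 (t + s) \<omega>)) \<partial>time_measure I 0 u) * (ennreal (H \<omega>) * ?f \<omega> * ?a \<omega> ^ k)"
      by (rule nn_integral_multc) measurable
    finally show "ennreal (H \<omega>) * ?f \<omega> * ?a \<omega> ^ Suc k
      = (\<integral>\<^sup>+s. ennreal (H \<omega>) * (?f \<omega> * ennreal (R - \<rho> (Y2 (t + s) \<omega>))) * ?a \<omega> ^ k \<partial>time_measure I 0 u)"
      by (simp add: a[OF \<omega>] mult_ac)
  qed
  also have "\<dots> = (\<integral>\<^sup>+s. \<integral>\<^sup>+\<omega>. ennreal (H \<omega>) * (?f \<omega> * ennreal (R - \<rho> (Y2 (t + s) \<omega>))) * ?a \<omega> ^ k \<partial>Q z \<partial>time_measure I 0 u)"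
    by (rule Fubini') (unfold split_beta, measurable)
  also have "\<dots> = (\<integral>\<^sup>+s. \<integral>\<^sup>+\<omega>. ennreal (H \<omega>) * ennreal (psi k (\<lambda>w. \<Phi> w * (R - \<rho> (w s))) u (Y2 t \<omega>)) \<partial>Q z \<partial>time_measure I 0 u)"
  proof (rule nn_integral_cong)
    fix s assume "s \<in> space (time_measure I 0 u)"
    hence s: "s \<in> I" by (simp add: space_T)
    have "(\<integral>\<^sup>+\<omega>. ennreal (H \<omega>) * (?f \<omega> * ennreal (R - \<rho> (Y2 (t + s) \<omega>))) * ?a \<omega> ^ k \<partial>Q z)
      = (\<integral>\<^sup>+\<omega>. ennreal (H \<omega>) * ennreal (\<Phi> (\<lambda>s\<in>I. Y2 (t + s) \<omega>) * (R - \<rho> ((\<lambda>s\<in>I. Y2 (t + s) \<omega>) s))) * ?a \<omega> ^ k \<partial>Q z)"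
      using s \<Phi>0 rate_le by (intro nn_integral_cong) (simp add: ennreal_mult')
    also have "\<dots> = (\<integral>\<^sup>+\<omega>. ennreal (H \<omega>) * ennreal (psi k (\<lambda>w. \<Phi> w * (R - \<rho> (w s))) u (Y2 t \<omega>)) \<partial>Q z)"
      by (rule Suc.IH[OF lip_cyl_mult[OF Suc.prems s]])
    finally show "(\<integral>\<^sup>+\<omega>. ennreal (H \<omega>) * (?f \<omega> * ennreal (R - \<rho> (Y2 (t + s) \<omega>))) * ?a \<omega> ^ k \<partial>Q z)
      = (\<integral>\<^sup>+\<omega>. ennreal (H \<omega>) * ennreal (psi k (\<lambda>w. \<Phi> w * (R - \<rho> (w s))) u (Y2 t \<omega>)) \<partial>Q z)" .
  qed
  also have "\<dots> = (\<integral>\<^sup>+\<omega>. \<integral>\<^sup>+s. ennreal (H \<omega>) * ennreal (psi k (\<lambda>w. \<Phi> w * (R - \<rho> (w s))) u (Y2 t \<omega>)) \<partial>time_measure I 0 u \<partial>Q z)"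
  proof (rule Fubini'[symmetric])
    have "(\<lambda>v. (fst v, Y2 t (snd v))) \<in> time_measure I 0 u \<Otimes>\<^sub>M Q z \<rightarrow>\<^sub>M time_measure I 0 u \<Otimes>\<^sub>M borel"
      by measurable
    from measurable_compose[OF this psi_joint_measurable[OF Suc.prems u]]
    have [measurable]: "(\<lambda>v. psi k (\<lambda>w. \<Phi> w * (R - \<rho> (w (fst v)))) u (Y2 t (snd v)))
        \<in> borel_measurable (time_measure I 0 u \<Otimes>\<^sub>M Q z)" by (simp add: split_beta)
    show "(\<lambda>(s, \<omega>). ennreal (H \<omega>) * ennreal (psi k (\<lambda>w. \<Phi> w * (R - \<rho> (w s))) u (Y2 t \<omega>)))
        \<in> borel_measurable (time_measure I 0 u \<Otimes>\<^sub>M Q z)"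
      unfolding split_beta by measurable
  qed
  also have "\<dots> = (\<integral>\<^sup>+\<omega>. ennreal (H \<omega>) * ennreal (psi (Suc k) \<Phi> u (Y2 t \<omega>)) \<partial>Q z)"
  proof (rule nn_integral_cong)
    fix \<omega>
    have [measurable]: "(\<lambda>s. psi k (\<lambda>w. \<Phi> w * (R - \<rho> (w s))) u (Y2 t \<omega>)) \<in> borel_measurable (time_measure I 0 u)"
      by (rule psi_section_measurable[OF Suc.prems u])
    have "(\<integral>\<^sup>+s. ennreal (H \<omega>) * ennreal (psi k (\<lambda>w. \<Phi> w * (R - \<rho> (w s))) u (Y2 t \<omega>)) \<partial>time_measure I 0 u)
      = ennreal (H \<omega>) * (\<integral>\<^sup>+s. ennreal (psi k (\<lambda>w. \<Phi> w * (R - \<rho> (w s))) u (Y2 t \<omega>)) \<partial>time_measure I 0 u)"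
      by (rule nn_integral_cmult) measurable
    thus "(\<integral>\<^sup>+s. ennreal (H \<omega>) * ennreal (psi k (\<lambda>w. \<Phi> w * (R - \<rho> (w s))) u (Y2 t \<omega>)) \<partial>time_measure I 0 u)
      = ennreal (H \<omega>) * ennreal (psi (Suc k) \<Phi> u (Y2 t \<omega>))"
      by (simp add: psi_Suc[OF Suc.prems u])
  qed
  finally show ?case .
qed

text \<open>Besides its use in the Markov property, the series yields measurability of
  \<open>S u g\<close> in the starting point, each coefficient being continuous there.\<close>

lemma ennreal_S_series:
  assumes g: "lipb l b g" and u: "u \<in> I"
  shows "ennreal (S u g x) = ennreal (exp (- R * u)) * (\<Sum>k. ennreal (1 / fact k) * ennreal (psi k (\<lambda>w. g (w u)) u x))"
proof -
  interpret prob_space "P x" by (rule prob_P)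
  have u0: "0 \<le> u" using u by (rule I_nonneg)
  have [measurable]: "(\<lambda>\<omega>. g (X u \<omega>)) \<in> borel_measurable (P x)" "rate_integral I \<rho> X 0 u \<in> borel_measurable (P x)"
    using measurable_compose[OF X_meas[OF u] lipb_measurable[OF g]] rate_integral_measurable[OF process_P] by auto
  have b: "0 \<le> pen I \<rho> X 0 u \<omega> * g (X u \<omega>)" "pen I \<rho> X 0 u \<omega> * g (X u \<omega>) \<le> 1 * b" for \<omega>
    by (rule mult_nonneg_nonneg[OF pen_nonneg[OF process_P] lipbD(1)[OF g]],
        rule mult_mono[OF pen_le_1[OF process_P] lipbD(2)[OF g] zero_le_one lipbD(1)[OF g]])
  have "ennreal (S u g x) = (\<integral>\<^sup>+\<omega>. ennreal (pen I \<rho> X 0 u \<omega> * g (X u \<omega>)) \<partial>P x)"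
    unfolding S_def using b pen_measurable[OF process_P]
    by (intro nn_integral_eq_integral[symmetric] integrable_const_bound[of _ "1 * b"]) auto
  also have "\<dots> = (\<integral>\<^sup>+\<omega>. ennreal (exp (- R * u)) *
    (ennreal (g (X u \<omega>)) * ennreal (exp (R * u - rate_integral I \<rho> X 0 u \<omega>))) \<partial>P x)"
    using lipbD[OF g] pen_eq_exp_complement[OF process_P, of 0 u]
    by (intro nn_integral_cong) (simp add: ennreal_mult[symmetric] mult_ac)
  also have "\<dots> = ennreal (exp (- R * u)) *
    (\<integral>\<^sup>+\<omega>. ennreal (g (X u \<omega>)) * ennreal (exp (R * u - rate_integral I \<rho> X 0 u \<omega>)) \<partial>P x)"
    by (rule nn_integral_cmult) measurable
  also have "(\<integral>\<^sup>+\<omega>. ennreal (g (X u \<omega>)) * ennreal (exp (R * u - rate_integral I \<rho> X 0 u \<omega>)) \<partial>P x)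
    = (\<Sum>k. ennreal (1 / fact k) * (\<integral>\<^sup>+\<omega>. ennreal (g (X u \<omega>)) * ennreal (R * u - rate_integral I \<rho> X 0 u \<omega>) ^ k \<partial>P x))"
    using complement_bounds(1)[OF process_P u] by (intro nn_integral_exp_series) auto
  also have "\<dots> = (\<Sum>k. ennreal (1 / fact k) * ennreal (psi k (\<lambda>w. g (w u)) u x))"
    using u by (simp add: ennreal_psi[OF lip_cyl_eval[OF g u] u])
  finally show ?thesis .
qed

text \<open>The exponential series of \<open>markov_power\<close>: the future weight is replaced by
  the semigroup at the current position. Continuous time forces the detour, as the weight is not a
  path functional covered by \<open>markov_path\<close>.\<close>

lemma markov_S:
  assumes t: "t \<in> I" and u: "u \<in> I" and H: "past t H" and g: "lipb l b g"
  shows "(\<integral>\<^sup>+\<omega>. ennreal (H \<omega>) * ennreal (pen I \<rho> Y2 t (t + u) \<omega> * g (Y2 (t + u) \<omega>)) \<partial>Q z)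
       = (\<integral>\<^sup>+\<omega>. ennreal (H \<omega>) * ennreal (S u g (Y2 t \<omega>)) \<partial>Q z)"
proof -
  interpret prob_space "Q z" by (rule prob_Q)
  have u0: "0 \<le> u" using u by (rule I_nonneg)
  note cyl = lip_cyl_eval[OF g u]
  have [measurable]: "(\<lambda>\<omega>. g (Y2 (t + u) \<omega>)) \<in> borel_measurable (Q z)"
    "rate_integral I \<rho> Y2 t (t + u) \<in> borel_measurable (Q z)"
    "H \<in> borel_measurable (Q z)" and pm[measurable]: "\<And>k. (\<lambda>\<omega>. psi k (\<lambda>w. g (w u)) u (Y2 t \<omega>)) \<in> borel_measurable (Q z)"
    using measurable_compose[OF Y2_meas[OF I_add[OF t u]] lipb_measurable[OF g]]
      rate_integral_measurable[OF process_Q2[of z]]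
      past_measurable[OF H t] measurable_compose[OF Y2_meas[OF t] psi_measurable[OF cyl u]] by auto
  let ?a = "\<lambda>\<omega>. R * u - rate_integral I \<rho> Y2 t (t + u) \<omega>"
  have a: "0 \<le> ?a \<omega>" if "\<omega> \<in> space (Q z)" for \<omega>
    using rate_integral_le[OF process_Q2[of z] t I_add[OF t u] _ that] u0 by simp
  have "(\<integral>\<^sup>+\<omega>. ennreal (H \<omega>) * ennreal (pen I \<rho> Y2 t (t + u) \<omega> * g (Y2 (t + u) \<omega>)) \<partial>Q z)
     = (\<integral>\<^sup>+\<omega>. ennreal (exp (- R * u)) * ((ennreal (H \<omega>) * ennreal (g (Y2 (t + u) \<omega>))) * ennreal (exp (?a \<omega>))) \<partial>Q z)"
  proof (rule nn_integral_cong)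
    fix \<omega>
    have "pen I \<rho> Y2 t (t + u) \<omega> = exp (- R * u) * exp (?a \<omega>)"
      using pen_eq_exp_complement[OF process_Q2[of z], of t "t + u" \<omega>] by simp
    thus "ennreal (H \<omega>) * ennreal (pen I \<rho> Y2 t (t + u) \<omega> * g (Y2 (t + u) \<omega>))
      = ennreal (exp (- R * u)) * ((ennreal (H \<omega>) * ennreal (g (Y2 (t + u) \<omega>))) * ennreal (exp (?a \<omega>)))"
      using lipbD(1)[OF g] past_nonneg[OF H] by (simp add: ennreal_mult mult_ac)
  qed
  also have "\<dots> = ennreal (exp (- R * u)) * (\<integral>\<^sup>+\<omega>. (ennreal (H \<omega>) * ennreal (g (Y2 (t + u) \<omega>))) * ennreal (exp (?a \<omega>)) \<partial>Q z)"
    by (rule nn_integral_cmult) measurable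
  also have "(\<integral>\<^sup>+\<omega>. (ennreal (H \<omega>) * ennreal (g (Y2 (t + u) \<omega>))) * ennreal (exp (?a \<omega>)) \<partial>Q z)
     = (\<Sum>k. ennreal (1 / fact k) * (\<integral>\<^sup>+\<omega>. (ennreal (H \<omega>) * ennreal (g (Y2 (t + u) \<omega>))) * ennreal (?a \<omega>) ^ k \<partial>Q z))"
    using a by (intro nn_integral_exp_series) auto
  also have "\<dots> = (\<Sum>k. ennreal (1 / fact k) * (\<integral>\<^sup>+\<omega>. ennreal (H \<omega>) * ennreal (psi k (\<lambda>w. g (w u)) u (Y2 t \<omega>)) \<partial>Q z))"
    using markov_power[OF t u H cyl] u by simp
  also have "\<dots> = (\<Sum>k. \<integral>\<^sup>+\<omega>. ennreal (H \<omega>) * (ennreal (1 / fact k) * ennreal (psi k (\<lambda>w. g (w u)) u (Y2 t \<omega>))) \<partial>Q z)"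
    by (intro suminf_cong, subst nn_integral_cmult[symmetric]) (auto simp: mult_ac)
  also have "\<dots> = (\<integral>\<^sup>+\<omega>. (\<Sum>k. ennreal (H \<omega>) * (ennreal (1 / fact k) * ennreal (psi k (\<lambda>w. g (w u)) u (Y2 t \<omega>)))) \<partial>Q z)"
    by (rule nn_integral_suminf[symmetric]) measurable
  also have "ennreal (exp (- R * u)) * \<dots>
     = (\<integral>\<^sup>+\<omega>. ennreal (exp (- R * u)) *
       (\<Sum>k. ennreal (H \<omega>) * (ennreal (1 / fact k) * ennreal (psi k (\<lambda>w. g (w u)) u (Y2 t \<omega>)))) \<partial>Q z)"
    by (rule nn_integral_cmult[symmetric]) measurable
  also have "\<dots> = (\<integral>\<^sup>+\<omega>. ennreal (H \<omega>) * ennreal (S u g (Y2 t \<omega>)) \<partial>Q z)"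
    by (intro nn_integral_cong) (simp only: ennreal_S_series[OF g u] ennreal_suminf_cmult mult.left_commute)
  finally show ?thesis .
qed

text \<open>An identity that holds against all of \<open>past\<close> persists under a factor
  \<open>R - \<rho>\<close> taken at one fixed earlier time, hence under all moments of the additive
  functional, hence under the weight itself.\<close>

lemma past_weight:
  assumes V: "measurable_process I (Q z) V" "\<And>s. s \<in> I \<Longrightarrow> s \<le> t \<Longrightarrow> V s \<in> Gf t \<rightarrow>\<^sub>M borel"
    and ab: "a \<in> I" "b \<in> I" "a \<le> b" "b \<le> t" and t: "t \<in> I"
    and G: "G1 \<in> borel_measurable (Q z)" "G2 \<in> borel_measurable (Q z)"
    and eq: "\<And>H. past t H \<Longrightarrow> (\<integral>\<^sup>+\<omega>. ennreal (H \<omega>) * G1 \<omega> \<partial>Q z) = (\<integral>\<^sup>+\<omega>. ennreal (H \<omega>) * G2 \<omega> \<partial>Q z)"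
    and H0: "past t H0"
  shows "(\<integral>\<^sup>+\<omega>. ennreal (H0 \<omega>) * (ennreal (pen I \<rho> V a b \<omega>) * G1 \<omega>) \<partial>Q z)
       = (\<integral>\<^sup>+\<omega>. ennreal (H0 \<omega>) * (ennreal (pen I \<rho> V a b \<omega>) * G2 \<omega>) \<partial>Q z)"
proof -
  interpret prob_space "Q z" by (rule prob_Q)
  interpret T: finite_measure "time_measure I a b" by (rule finite_T)
  note [measurable] = G rate_integral_measurable[OF V(1)] past_measurable[OF H0 t]
  define C where "C = (\<lambda>H1 H2. \<exists>H. past t H \<and> H1 = (\<lambda>\<omega>. ennreal (H \<omega>)) \<and> H2 = (\<lambda>\<omega>. ennreal (H \<omega>)))"
  let ?a = "\<lambda>\<omega>. R * (b - a) - rate_integral I \<rho> V a b \<omega>"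
  have a: "0 \<le> ?a \<omega>" if "\<omega> \<in> space (Q z)" for \<omega>
    using rate_integral_le[OF V(1) ab(1-3) that] by simp
  have "(\<integral>\<^sup>+\<omega>. ennreal (H0 \<omega>) * ennreal (exp (?a \<omega>)) * G1 \<omega> \<partial>Q z)
      = (\<integral>\<^sup>+\<omega>. ennreal (H0 \<omega>) * ennreal (exp (?a \<omega>)) * G2 \<omega> \<partial>Q z)"
  proof (rule exp_weight[where K = C, OF T.sigma_finite_measure_axioms sigma_finite_measure_axioms
        sigma_finite_measure_axioms complement_joint[OF V(1)] complement_joint[OF V(1)] G])
    show "H1 \<in> borel_measurable (Q z) \<and> H2 \<in> borel_measurable (Q z)" if "C H1 H2" for H1 H2
      using that past_measurable[OF _ t, of _ z] by (auto simp: C_def)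
    show "C (\<lambda>\<omega>. H1 \<omega> * ennreal (R - \<rho> (V s \<omega>))) (\<lambda>\<omega>. H2 \<omega> * ennreal (R - \<rho> (V s \<omega>)))"
      if CH: "C H1 H2" and "s \<in> space (time_measure I a b)" for H1 H2 s
    proof -
      have s: "s \<in> I" "s \<le> t" using that(2) ab by (auto simp: space_T)
      obtain H where H: "past t H" "H1 = (\<lambda>\<omega>. ennreal (H \<omega>))" "H2 = (\<lambda>\<omega>. ennreal (H \<omega>))"
        using CH unfolding C_def by blast
      have "(\<lambda>x. R - \<rho> x) \<in> borel_measurable borel" by measurable
      from measurable_compose[OF V(2)[OF s] this] have "past t (\<lambda>\<omega>. R - \<rho> (V s \<omega>))"
        using rate_le rate_nonneg by (auto simp: past_def intro!: exI[of _ R])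
      with H(1) have "past t (\<lambda>\<omega>. H \<omega> * (R - \<rho> (V s \<omega>)))" by (rule past_mult)
      moreover have "ennreal (H \<omega>) * ennreal (R - \<rho> (V s \<omega>)) = ennreal (H \<omega> * (R - \<rho> (V s \<omega>)))" for \<omega>
        using past_nonneg[OF H(1)] rate_le by (simp add: ennreal_mult')
      ultimately show ?thesis unfolding C_def H(2,3)
        by (intro exI[of _ "\<lambda>\<omega>. H \<omega> * (R - \<rho> (V s \<omega>))"]) auto
    qed
    show "(\<integral>\<^sup>+\<omega>. H1 \<omega> * G1 \<omega> \<partial>Q z) = (\<integral>\<^sup>+\<omega>. H2 \<omega> * G2 \<omega> \<partial>Q z)" if "C H1 H2" for H1 H2
      using that eq by (auto simp: C_def)
    show "C (\<lambda>\<omega>. ennreal (H0 \<omega>)) (\<lambda>\<omega>. ennreal (H0 \<omega>))" using H0 by (auto simp: C_def)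
  qed (use a nn_integral_complement[OF V(1) ab(1-3)] in auto)
  hence "ennreal (exp (- R * (b - a))) * (\<integral>\<^sup>+\<omega>. ennreal (H0 \<omega>) * ennreal (exp (?a \<omega>)) * G1 \<omega> \<partial>Q z)
      = ennreal (exp (- R * (b - a))) * (\<integral>\<^sup>+\<omega>. ennreal (H0 \<omega>) * ennreal (exp (?a \<omega>)) * G2 \<omega> \<partial>Q z)" by simp
  moreover have "(\<integral>\<^sup>+\<omega>. ennreal (H0 \<omega>) * (ennreal (pen I \<rho> V a b \<omega>) * G \<omega>) \<partial>Q z)
      = ennreal (exp (- R * (b - a))) * (\<integral>\<^sup>+\<omega>. ennreal (H0 \<omega>) * ennreal (exp (?a \<omega>)) * G \<omega> \<partial>Q z)"
    if [measurable]: "G \<in> borel_measurable (Q z)" for G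
    by (subst nn_integral_cmult[symmetric], measurable)
       (simp add: pen_eq_exp_complement[OF V(1)] ennreal_mult mult_ac)
  ultimately show ?thesis using G by simp
qed

text \<open>The stretch from \<open>a\<close> to \<open>t\<close> carries the weight of either
  coordinate: with \<open>Y1\<close> the switch to the second coordinate happens at
  \<open>t\<close>, with \<open>Y2\<close> already at \<open>a\<close>. Both cases leave the same
  future, so their difference is concentrated on this stretch.\<close>

lemma markov_weighted:
  assumes V: "V = Y1 \<or> V = Y2" and a: "a \<in> I" "a \<le> t" and t: "t \<in> I" and u: "u \<in> I"
    and H: "past t H" and g: "lipb l b g"
  shows "(\<integral>\<omega>. H \<omega> * (pen I \<rho> Y1 0 a \<omega> * (pen I \<rho> V a t \<omega> * (pen I \<rho> Y2 t (t + u) \<omega> * g (Y2 (t + u) \<omega>)))) \<partial>Q z)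
       = (\<integral>\<omega>. H \<omega> * (pen I \<rho> Y1 0 a \<omega> * (pen I \<rho> V a t \<omega> * S u g (Y2 t \<omega>))) \<partial>Q z)"
proof -
  interpret prob_space "Q z" by (rule prob_Q)
  have Sm: "(\<lambda>\<omega>. ennreal (S u g (Y2 t \<omega>))) \<in> borel_measurable (Q z)"
    unfolding ennreal_S_series[OF g u]
    using measurable_compose[OF Y2_meas[OF t] psi_measurable[OF lip_cyl_eval[OF g u] u]] by measurable
  hence "(\<lambda>\<omega>. enn2real (ennreal (S u g (Y2 t \<omega>)))) \<in> borel_measurable (Q z)" by measurable
  hence Sm': "(\<lambda>\<omega>. S u g (Y2 t \<omega>)) \<in> borel_measurable (Q z)" using S_nonneg[OF lipbD(1)[OF g]] by simp
  have procV: "measurable_process I (Q z) V" using V process_Q1[of z] process_Q2[of z] by auto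
  have gm: "(\<lambda>\<omega>. g (Y2 (t + u) \<omega>)) \<in> borel_measurable (Q z)"
    using measurable_compose[OF Y2_meas[OF I_add[OF t u]] lipb_measurable[OF g]] by simp
  note [measurable] = Sm' gm pen_measurable[OF process_Q1[of z]] pen_measurable[OF process_Q2[of z]] pen_measurable[OF procV]
     past_measurable[OF H t]
  have Vm: "V s \<in> Gf t \<rightarrow>\<^sub>M borel" and Y1m: "Y1 s \<in> Gf t \<rightarrow>\<^sub>M borel" if "s \<in> I" "s \<le> t" for s
    using V Gf_measurable[OF that(1) t that(2)] by auto
  have a0: "0 \<le> a" using a(1) by (rule I_nonneg)
  have "(\<integral>\<^sup>+\<omega>. ennreal (H \<omega>) *
    (ennreal (pen I \<rho> Y1 0 a \<omega>) * (ennreal (pen I \<rho> V a t \<omega>) * ennreal (pen I \<rho> Y2 t (t + u) \<omega> * g (Y2 (t + u) \<omega>)))) \<partial>Q z)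
    = (\<integral>\<^sup>+\<omega>. ennreal (H \<omega>) * (ennreal (pen I \<rho> Y1 0 a \<omega>) * (ennreal (pen I \<rho> V a t \<omega>) * ennreal (S u g (Y2 t \<omega>)))) \<partial>Q z)"
  proof (rule past_weight[OF process_Q1[of z] Y1m I_0 a(1) a0 a(2) t _ _ _ H])
    show "(\<integral>\<^sup>+\<omega>. ennreal (H \<omega>) * (ennreal (pen I \<rho> V a t \<omega>) * ennreal (pen I \<rho> Y2 t (t + u) \<omega> * g (Y2 (t + u) \<omega>))) \<partial>Q z)
      = (\<integral>\<^sup>+\<omega>. ennreal (H \<omega>) * (ennreal (pen I \<rho> V a t \<omega>) * ennreal (S u g (Y2 t \<omega>))) \<partial>Q z)" if "past t H" for H
      by (rule past_weight[OF procV Vm a(1) t a(2) order_refl t _ _ _ that]) (measurable, rule markov_S[OF t u _ g])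
  qed measurable
  hence "(\<integral>\<^sup>+\<omega>. ennreal (H \<omega> * (pen I \<rho> Y1 0 a \<omega> * (pen I \<rho> V a t \<omega> * (pen I \<rho> Y2 t (t + u) \<omega> * g (Y2 (t + u) \<omega>))))) \<partial>Q z)
    = (\<integral>\<^sup>+\<omega>. ennreal (H \<omega> * (pen I \<rho> Y1 0 a \<omega> * (pen I \<rho> V a t \<omega> * S u g (Y2 t \<omega>)))) \<partial>Q z)"
    using pen_nonneg[OF process_Q1[of z]] pen_nonneg[OF procV] past_nonneg[OF H] by (simp add: ennreal_mult')
  thus ?thesis
    using S_nonneg[OF lipbD(1)[OF g]] lipbD(1)[OF g] pen_nonneg[OF process_Q1[of z]] pen_nonneg[OF process_Q2[of z]]
      pen_nonneg[OF procV] past_nonneg[OF H]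
    by (subst (1 2) integral_eq_nn_integral) (auto intro!: AE_I2 mult_nonneg_nonneg)
qed

section \<open>Doeblin--Fortet bounds\<close>

text \<open>\<open>L\<close> converts distances into differences of rates, \<open>CA\<close> is the
  constant of (A), and e^R compensates for replacing the weight up to \<open>k\<close> by the weight
  up to a time at most one unit later.\<close>

definition K1 :: real where "K1 = L * (exp R * CA)"

lemma K1_nonneg: "0 \<le> K1"
  using L_nonneg CA_pos by (simp add: K1_def)

section \<open>Elementary properties of the penalized semigroup\<close>

lemma S_integrable:
  assumes "f \<in> borel_measurable borel" "\<And>x. \<bar>f x\<bar> \<le> b" "t \<in> I"
  shows "integrable (P x) (\<lambda>\<omega>. pen I \<rho> X 0 t \<omega> * f (X t \<omega>))"
proof -
  interpret prob_space "P x" by (rule prob_P)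
  have [measurable]: "(\<lambda>\<omega>. f (X t \<omega>)) \<in> borel_measurable (P x)"
    by (rule measurable_compose[OF X_meas[OF assms(3)] assms(1)])
  have "\<bar>pen I \<rho> X 0 t \<omega> * f (X t \<omega>)\<bar> \<le> 1 * b" for \<omega>
    unfolding abs_mult using pen_le_1[OF process_P] pen_nonneg[OF process_P] assms(2) by (intro mult_mono) auto
  thus ?thesis using pen_measurable[OF process_P] by (intro integrable_const_bound[of _ "1 * b"]) auto
qed

lemma S_cmult: "S t (\<lambda>x. c * f x) x = c * S t f x"
  by (simp add: S_def mult.left_commute)

lemma S_add:
  assumes "f \<in> borel_measurable borel" "\<And>x. \<bar>f x\<bar> \<le> b" "g \<in> borel_measurable borel" "\<And>x. \<bar>g x\<bar> \<le> c" "t \<in> I"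
  shows "S t (\<lambda>x. f x + g x) x = S t f x + S t g x"
  using S_integrable[OF assms(1,2,5)] S_integrable[OF assms(3,4,5)] by (simp add: S_def distrib_left)

lemma S_mono:
  assumes "f \<in> borel_measurable borel" "\<And>x. \<bar>f x\<bar> \<le> b" "g \<in> borel_measurable borel" "\<And>x. \<bar>g x\<bar> \<le> c" "t \<in> I"
    and "\<And>x. f x \<le> g x"
  shows "S t f x \<le> S t g x"
  unfolding S_def using assms(6) pen_nonneg[OF process_P]
  by (intro integral_mono S_integrable[OF assms(1,2,5)] S_integrable[OF assms(3,4,5)] mult_left_mono)

lemma S_measurable:
  assumes g: "lipb l b g" and u: "u \<in> I"
  shows "S u g \<in> borel_measurable borel"
proof -
  have "(\<lambda>x. ennreal (S u g x)) \<in> borel_measurable borel"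
    unfolding ennreal_S_series[OF g u] using psi_measurable[OF lip_cyl_eval[OF g u] u] by measurable
  hence "(\<lambda>x. enn2real (ennreal (S u g x))) \<in> borel_measurable borel" by measurable
  thus ?thesis using S_nonneg[OF lipbD(1)[OF g]] by simp
qed

lemma S_le:
  assumes "lipb l b g" "u \<in> I"
  shows "S u g x \<le> b * h u x"
proof -
  have "S u g x \<le> S u (\<lambda>_. b * 1) x"
    using lipbD[OF assms(1)] lipb_measurable[OF assms(1)] assms(2)
    by (intro S_mono[of _ b _ "\<bar>b\<bar>"]) auto
  thus ?thesis by (simp only: S_cmult)
qed

lemma S_0:
  assumes "f \<in> borel_measurable borel"
  shows "S 0 f x = f x"
proof -
  interpret prob_space "P x" by (rule prob_P)
  have "AE \<omega> in P x. X 0 \<omega> = x" using markov unfolding markov_process_def by blast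
  hence "S 0 f x = (\<integral>\<omega>. f x \<partial>P x)"
    unfolding S_def using measurable_compose[OF X_meas[OF I_0] assms, of x]
    by (intro integral_cong_AE) (auto simp: pen_same[OF process_P])
  thus ?thesis by (simp add: prob_space)
qed

text \<open>The Markov property of \<open>X\<close> under the penalization, read off the second
  coordinate of a coupling; no separate argument for \<open>X\<close> is required.\<close>

lemma occupation_S:
  assumes s: "s \<in> I" and u: "u \<in> I" and f: "lipb l' b' f" and g: "lipb l b g"
  shows "(\<integral>\<omega>. f (Y2 s \<omega>) * (pen I \<rho> Y2 0 (s + u) \<omega> * g (Y2 (s + u) \<omega>)) \<partial>Q (y, x)) = S s (\<lambda>x. f x * S u g x) x"
proof -
  have su: "0 \<le> s" "s \<le> s + u" using I_nonneg s u by auto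
  have H: "past s (\<lambda>\<omega>. f (Y2 s \<omega>))"
    using lipbD[OF f] by (intro past_Y(2)[OF s s order_refl lipb_measurable[OF f]])
  have "(\<integral>\<omega>. f (Y2 s \<omega>) * (pen I \<rho> Y2 0 (s + u) \<omega> * g (Y2 (s + u) \<omega>)) \<partial>Q (y, x))
    = (\<integral>\<omega>. f (Y2 s \<omega>) * (pen I \<rho> Y1 0 0 \<omega> * (pen I \<rho> Y2 0 s \<omega> * (pen I \<rho> Y2 s (s + u) \<omega> * g (Y2 (s + u) \<omega>)))) \<partial>Q (y, x))"
    using pen_mult[OF process_Q2[of "(y, x)"] su]
    by (intro Bochner_Integration.integral_cong) (auto simp: pen_same[OF process_Q1] mult_ac)
  also have "\<dots> = (\<integral>\<omega>. f (Y2 s \<omega>) * (pen I \<rho> Y1 0 0 \<omega> * (pen I \<rho> Y2 0 s \<omega> * S u g (Y2 s \<omega>))) \<partial>Q (y, x))"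
    by (rule markov_weighted[OF _ I_0 su(1) s u H g]) simp
  also have "\<dots> = (\<integral>\<omega>. pen I \<rho> Y2 0 s \<omega> * (f (Y2 s \<omega>) * S u g (Y2 s \<omega>)) \<partial>Q (y, x))"
    by (simp add: pen_same[OF process_Q1] mult_ac)
  also have "\<dots> = S s (\<lambda>x. f x * S u g x) x"
    using lipbD(1)[OF f] S_nonneg[OF lipbD(1)[OF g]] lipb_measurable[OF f] S_measurable[OF g u]
    by (intro S_Y(2) s borel_measurable_times) auto
  finally show ?thesis .
qed

lemma lipb_one: "lipb 0 1 (\<lambda>_. 1)"
  by (simp add: lipb_def)

lemma occupation_eq:
  assumes s: "s \<in> I" and u: "u \<in> I" and f: "lipb l b f"
  shows "(\<integral>\<omega>. pen I \<rho> X 0 (s + u) \<omega> * f (X s \<omega>) \<partial>P x) = S s (\<lambda>x. f x * h u x) x"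
  using occupation_transfer(2)[OF lipb_measurable[OF f] lipbD(1)[OF f] s I_add[OF s u], of x x]
    occupation_S[OF s u f lipb_one, of x x] by (simp add: mult_ac)

lemma S_semigroup:
  assumes s: "s \<in> I" and u: "u \<in> I" and g: "lipb l b g"
  shows "S (s + u) g x = S s (S u g) x"
  using S_Y(2)[OF lipb_measurable[OF g] lipbD(1)[OF g] I_add[OF s u], of x x]
    occupation_S[OF s u lipb_one g, of x x] by simp

lemma h_antimono:
  assumes "s \<in> I" "t \<in> I" "s \<le> t"
  shows "h t x \<le> h s x"
proof -
  have "h t x = S s (\<lambda>x. 1 * h (t - s) x) x"
    using S_semigroup[OF assms(1) I_diff[OF assms] lipb_one, of x] by simp
  also have "\<dots> \<le> S s (\<lambda>x. 1) x"
    using h_bounds[OF I_diff[OF assms]] h_pos[OF I_diff[OF assms]] S_measurable[OF lipb_one I_diff[OF assms]] assms(1)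
    by (intro S_mono[of _ 1 _ 1]) (auto simp: less_imp_le)
  finally show ?thesis .
qed

section \<open>Telescoping between the weights of the two coordinates\<close>

lemma integrable_Q:
  assumes "g \<in> borel_measurable (Q z)" "\<And>\<omega>. \<omega> \<in> space (Q z) \<Longrightarrow> \<bar>g \<omega>\<bar> \<le> (b :: real)"
  shows "integrable (Q z) g"
proof -
  interpret prob_space "Q z" by (rule prob_Q)
  show ?thesis using assms by (intro integrable_const_bound[of _ b]) auto
qed

lemma integrable_Q_mult:
  fixes b :: real
  assumes "u \<in> borel_measurable (Q z)" "v \<in> borel_measurable (Q z)" "\<And>\<omega>. \<bar>u \<omega>\<bar> \<le> 1" "\<And>\<omega>. \<bar>v \<omega>\<bar> \<le> b"
  shows "integrable (Q z) (\<lambda>\<omega>. u \<omega> * v \<omega>)"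
proof (rule integrable_Q[of _ _ "1 * b"])
  show "\<bar>u \<omega> * v \<omega>\<bar> \<le> 1 * b" for \<omega>
    unfolding abs_mult using assms(3,4) by (intro mult_mono) auto
qed (use assms in measurable)

text \<open>The two weights on the stretch differ at most by the difference of the additive
  functionals, that is, by \<open>L\<close> times the integrated distance, and (A) controls this
  distance under the weight of the first coordinate.\<close>

lemma step_diff:
  assumes k: "k \<in> I" and r: "r \<in> I" "r \<le> 1"
  shows "(\<integral>\<omega>. pen I \<rho> Y1 0 k \<omega> * \<bar>pen I \<rho> Y1 k (k + r) \<omega> - pen I \<rho> Y2 k (k + r) \<omega>\<bar> \<partial>Q (x, y))
      \<le> K1 * (exp (- \<gamma> * k) * h k x) * dist x y"
proof -
  let ?Q = "Q (x, y)"
  have k0: "0 \<le> k" and r0: "0 \<le> r" using I_nonneg k r by auto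
  note m[measurable] = pen_measurable[OF process_Q1[of "(x, y)"]] pen_measurable[OF process_Q2[of "(x, y)"]]
    rate_integral_measurable[OF process_Q1[of "(x, y)"]] rate_integral_measurable[OF process_Q2[of "(x, y)"]]
  have kr: "k + r \<in> I" "k \<le> k + r" using I_add k r r0 by auto
  let ?B = "exp R * (CA * (exp (- \<gamma> * k) * h k x) * dist x y)"
  have B0: "0 \<le> ?B" using CA_pos h_pos[OF k, of x] by (intro mult_nonneg_nonneg) auto
  have "(\<integral>\<omega>. pen I \<rho> Y1 0 k \<omega> * \<bar>pen I \<rho> Y1 k (k + r) \<omega> - pen I \<rho> Y2 k (k + r) \<omega>\<bar> \<partial>?Q)
     \<le> (\<integral>\<omega>. pen I \<rho> Y1 0 k \<omega> * \<bar>rate_integral I \<rho> Y1 k (k + r) \<omega> - rate_integral I \<rho> Y2 k (k + r) \<omega>\<bar> \<partial>?Q)"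
  proof (rule integral_mono)
    show "pen I \<rho> Y1 0 k \<omega> * \<bar>pen I \<rho> Y1 k (k + r) \<omega> - pen I \<rho> Y2 k (k + r) \<omega>\<bar>
      \<le> pen I \<rho> Y1 0 k \<omega> * \<bar>rate_integral I \<rho> Y1 k (k + r) \<omega> - rate_integral I \<rho> Y2 k (k + r) \<omega>\<bar>" for \<omega>
      unfolding pen_def[of _ _ _ k]
      by (intro mult_left_mono exp_minus_diff rate_integral_nonneg[OF process_Q1] rate_integral_nonneg[OF process_Q2]
          pen_nonneg[OF process_Q1])
    show "integrable ?Q (\<lambda>\<omega>. pen I \<rho> Y1 0 k \<omega> * \<bar>pen I \<rho> Y1 k (k + r) \<omega> - pen I \<rho> Y2 k (k + r) \<omega>\<bar>)"
    proof (rule integrable_Q[of _ _ "1 * 1"])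
      show "\<bar>pen I \<rho> Y1 0 k \<omega> * \<bar>pen I \<rho> Y1 k (k + r) \<omega> - pen I \<rho> Y2 k (k + r) \<omega>\<bar>\<bar> \<le> 1 * 1" for \<omega>
        using pen_le_1[OF process_Q1, of 0 k \<omega>] pen_nonneg[OF process_Q1, of 0 k \<omega>]
          pen_le_1[OF process_Q1, of k "k + r" \<omega>] pen_nonneg[OF process_Q1, of k "k + r" \<omega>]
          pen_le_1[OF process_Q2, of k "k + r" \<omega>] pen_nonneg[OF process_Q2, of k "k + r" \<omega>]
        unfolding abs_mult by (intro mult_mono) auto
    qed measurable
    show "integrable ?Q (\<lambda>\<omega>. pen I \<rho> Y1 0 k \<omega> * \<bar>rate_integral I \<rho> Y1 k (k + r) \<omega> - rate_integral I \<rho> Y2 k (k + r) \<omega>\<bar>)"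
    proof (rule integrable_Q[of _ _ "1 * (R * (k + r - k))"])
      fix \<omega> assume \<omega>: "\<omega> \<in> space ?Q"
      show "\<bar>pen I \<rho> Y1 0 k \<omega> * \<bar>rate_integral I \<rho> Y1 k (k + r) \<omega> - rate_integral I \<rho> Y2 k (k + r) \<omega>\<bar>\<bar>
        \<le> 1 * (R * (k + r - k))"
        using rate_integral_le[OF process_Q1 k kr \<omega>] rate_integral_le[OF process_Q2 k kr \<omega>]
          rate_integral_nonneg[OF process_Q1, of k "k + r" \<omega>] rate_integral_nonneg[OF process_Q2, of k "k + r" \<omega>]
          pen_le_1[OF process_Q1, of 0 k \<omega>] pen_nonneg[OF process_Q1, of 0 k \<omega>]
        unfolding abs_mult by (intro mult_mono) auto
    qed measurable
  qed
  also have "\<dots> \<le> L * (k + r - k) * ?B"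
  proof (rule weighted_rate_diff[OF k kr])
    fix s assume s: "s \<in> I" "k \<le> s" "s < k + r"
    note [measurable] = dist_Y_measurable[OF s(1), of "(x, y)"]
    have pd: "\<bar>pen I \<rho> Y1 0 a \<omega> * dist (Y1 s \<omega>) (Y2 s \<omega>)\<bar> \<le> 1 * dbar" for a \<omega>
      unfolding abs_mult using pen_le_1[OF process_Q1, of 0 a \<omega>] pen_nonneg[OF process_Q1, of 0 a \<omega>] dist_le
      by (intro mult_mono) auto
    have "(\<integral>\<omega>. pen I \<rho> Y1 0 k \<omega> * dist (Y1 s \<omega>) (Y2 s \<omega>) \<partial>?Q)
       \<le> (\<integral>\<omega>. exp R * (pen I \<rho> Y1 0 s \<omega> * dist (Y1 s \<omega>) (Y2 s \<omega>)) \<partial>?Q)"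
    proof (rule integral_mono)
      show "integrable ?Q (\<lambda>\<omega>. pen I \<rho> Y1 0 k \<omega> * dist (Y1 s \<omega>) (Y2 s \<omega>))"
        by (rule integrable_Q[OF _ pd]) measurable
      show "integrable ?Q (\<lambda>\<omega>. exp R * (pen I \<rho> Y1 0 s \<omega> * dist (Y1 s \<omega>) (Y2 s \<omega>)))"
        by (rule integrable_mult_right, rule integrable_Q[OF _ pd]) measurable
      fix \<omega> assume \<omega>: "\<omega> \<in> space ?Q"
      have "R * (s - k) \<le> R * 1" using s r R_nonneg by (intro mult_left_mono) auto
      \<comment> \<open>(A) at time \<open>s\<close> requires the weight up to \<open>s\<close>, but
        only the weight up to \<open>k\<close> is present; over less than one unit of time the two
        differ at most by the factor e^R.\<close>
      hence "1 \<le> exp R * exp (- R * (s - k))" by (simp flip: exp_add)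
      also have "\<dots> \<le> exp R * pen I \<rho> Y1 k s \<omega>"
        using pen_ge[OF process_Q1 k s(1,2) \<omega>] by (intro mult_left_mono) auto
      finally have "pen I \<rho> Y1 0 k \<omega> * 1 \<le> pen I \<rho> Y1 0 k \<omega> * (exp R * pen I \<rho> Y1 k s \<omega>)"
        using pen_nonneg[OF process_Q1] by (intro mult_left_mono) auto
      also have "\<dots> = exp R * pen I \<rho> Y1 0 s \<omega>"
        using pen_mult[OF process_Q1 k0 s(2) \<omega>] by simp
      finally have "pen I \<rho> Y1 0 k \<omega> * dist (Y1 s \<omega>) (Y2 s \<omega>) \<le> exp R * pen I \<rho> Y1 0 s \<omega> * dist (Y1 s \<omega>) (Y2 s \<omega>)"
        by (intro mult_right_mono) auto
      thus "pen I \<rho> Y1 0 k \<omega> * dist (Y1 s \<omega>) (Y2 s \<omega>) \<le> exp R * (pen I \<rho> Y1 0 s \<omega> * dist (Y1 s \<omega>) (Y2 s \<omega>))"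
        by (simp add: mult.assoc)
    qed
    also have "\<dots> \<le> exp R * (CA * exp (- \<gamma> * s) * h s x * dist x y)"
      using weighted_dist[OF s(1), of x y] by simp
    also have "\<dots> = exp R * (CA * (exp (- \<gamma> * s) * h s x) * dist x y)" by simp
    also have "\<dots> \<le> ?B"
    proof -
      have "exp (- \<gamma> * s) * h s x \<le> exp (- \<gamma> * k) * h k x"
        using h_antimono[OF k s(1,2)] s(2) \<gamma>_pos h_pos[OF s(1), of x] by (intro mult_mono) auto
      thus ?thesis using CA_pos by (intro mult_left_mono mult_right_mono) auto
    qed
    finally show "(\<integral>\<omega>. pen I \<rho> Y1 0 k \<omega> * dist (Y1 s \<omega>) (Y2 s \<omega>) \<partial>?Q) \<le> ?B" .
  qed (auto intro: pen_le_1[OF process_Q1] pen_nonneg[OF process_Q1])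
  also have "\<dots> \<le> L * 1 * ?B"
    using r r0 L_nonneg B0 by (intro mult_right_mono mult_left_mono) auto
  finally show ?thesis by (simp add: K1_def mult_ac)
qed

text \<open>Interpolates between \<open>S t f y\<close> at k = 0 and, for integer \<open>t\<close>,
  the expectation of \<open>f (Y2 t)\<close> under the full weight of the first coordinate at k = t.
  The function is evaluated at the second coordinate throughout.\<close>

definition mixed :: "('e \<Rightarrow> real) \<Rightarrow> real \<Rightarrow> nat \<Rightarrow> 'e \<Rightarrow> 'e \<Rightarrow> real" where
  "mixed f t k x y = (\<integral>\<omega>. pen I \<rho> Y1 0 (real k) \<omega> * (pen I \<rho> Y2 (real k) t \<omega> * f (Y2 t \<omega>)) \<partial>Q (x, y))"

text \<open>Consecutive interpolations differ only on the stretch from \<open>k\<close> to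
  \<open>k + 1\<close>. Conditioning at its end replaces the common future by a semigroup value of
  at most \<open>B\<close>, and \<open>step_diff\<close> bounds what is left.\<close>

lemma mixed_step:
  assumes g: "lipb l b f" and k: "Suc k \<le> n" and B: "\<And>z. S (real (n - Suc k)) f z \<le> B"
  shows "\<bar>mixed f (real n) (Suc k) x y - mixed f (real n) k x y\<bar>
     \<le> K1 * (exp (- \<gamma> * k) * h k x) * B * dist x y"
proof -
  let ?Q = "Q (x, y)"
  let ?t = "real (Suc k)" and ?u = "real (n - Suc k)"
  have tu: "?t + ?u = real n" using k by simp
  have ord: "0 \<le> real k" "real k \<le> ?t" "?t \<le> real n" using k by auto
  have B0: "0 \<le> B" by (rule order_trans[OF S_nonneg[OF lipbD(1)[OF g]] B[of x]])
  let ?s = "\<lambda>\<omega>. S ?u f (Y2 ?t \<omega>)"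
  note m[measurable] = pen_measurable[OF process_Q1[of "(x, y)"]] pen_measurable[OF process_Q2[of "(x, y)"]]
    measurable_compose[OF Y2_meas[OF I_of_nat, where z = "(x, y)"] S_measurable[OF g I_of_nat]]
  have s: "0 \<le> ?s \<omega>" "?s \<omega> \<le> B" for \<omega>
    by (rule S_nonneg[OF lipbD(1)[OF g]], rule B)
  have mw: "(\<integral>\<omega>. pen I \<rho> Y1 0 k \<omega> * (pen I \<rho> V k ?t \<omega> * (pen I \<rho> Y2 ?t n \<omega> * f (Y2 n \<omega>))) \<partial>?Q)
      = (\<integral>\<omega>. pen I \<rho> Y1 0 k \<omega> * (pen I \<rho> V k ?t \<omega> * ?s \<omega>) \<partial>?Q)" if "V = Y1 \<or> V = Y2" for V
    using markov_weighted[OF that I_of_nat ord(2) I_of_nat I_of_nat[of "n - Suc k"] past_one g, where z = "(x, y)"]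
    unfolding tu mult_1 .
  have e1: "mixed f (real n) (Suc k) x y = (\<integral>\<omega>. pen I \<rho> Y1 0 k \<omega> * (pen I \<rho> Y1 k ?t \<omega> * ?s \<omega>) \<partial>?Q)"
    unfolding mw[OF disjI1[OF refl], symmetric] mixed_def
    using pen_mult[OF process_Q1[of "(x, y)"] ord(1,2)]
    by (intro Bochner_Integration.integral_cong) (auto simp: mult_ac)
  have e2: "mixed f (real n) k x y = (\<integral>\<omega>. pen I \<rho> Y1 0 k \<omega> * (pen I \<rho> Y2 k ?t \<omega> * ?s \<omega>) \<partial>?Q)"
    unfolding mw[OF disjI2[OF refl], symmetric] mixed_def
    using pen_mult[OF process_Q2[of "(x, y)"] ord(2,3)]
    by (intro Bochner_Integration.integral_cong) (auto simp: mult_ac)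
  have pb: "0 \<le> pen I \<rho> Y1 a c \<omega>" "pen I \<rho> Y1 a c \<omega> \<le> 1" "0 \<le> pen I \<rho> Y2 a c \<omega>" "pen I \<rho> Y2 a c \<omega> \<le> 1" for a c \<omega>
    by (rule pen_nonneg[OF process_Q1] pen_le_1[OF process_Q1] pen_nonneg[OF process_Q2] pen_le_1[OF process_Q2])+
  have sb: "\<bar>pen I \<rho> Y1 k ?t \<omega> * ?s \<omega>\<bar> \<le> 1 * B" "\<bar>pen I \<rho> Y2 k ?t \<omega> * ?s \<omega>\<bar> \<le> 1 * B" for \<omega>
    unfolding abs_mult using pb s by (intro mult_mono; simp)+
  have db: "\<bar>pen I \<rho> Y1 k ?t \<omega> - pen I \<rho> Y2 k ?t \<omega>\<bar> \<le> 1" for \<omega>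
    using pb(1,2)[of k ?t \<omega>] pb(3,4)[of k ?t \<omega>] by (simp add: abs_le_iff)
  have p1: "\<bar>pen I \<rho> Y1 0 k \<omega>\<bar> \<le> 1" for \<omega> using pb by simp
  have i1: "integrable ?Q (\<lambda>\<omega>. pen I \<rho> Y1 0 k \<omega> * (pen I \<rho> Y1 k ?t \<omega> * ?s \<omega>))"
    by (rule integrable_Q_mult[OF _ _ p1 sb(1)]) measurable
  have i2: "integrable ?Q (\<lambda>\<omega>. pen I \<rho> Y1 0 k \<omega> * (pen I \<rho> Y2 k ?t \<omega> * ?s \<omega>))"
    by (rule integrable_Q_mult[OF _ _ p1 sb(2)]) measurable
  have i3: "integrable ?Q (\<lambda>\<omega>. pen I \<rho> Y1 0 k \<omega> * \<bar>pen I \<rho> Y1 k ?t \<omega> - pen I \<rho> Y2 k ?t \<omega>\<bar>)"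
    using db by (intro integrable_Q_mult[OF _ _ p1]) auto
  have "\<bar>mixed f (real n) (Suc k) x y - mixed f (real n) k x y\<bar>
    = \<bar>\<integral>\<omega>. pen I \<rho> Y1 0 k \<omega> * (pen I \<rho> Y1 k ?t \<omega> * ?s \<omega>) - pen I \<rho> Y1 0 k \<omega> * (pen I \<rho> Y2 k ?t \<omega> * ?s \<omega>) \<partial>?Q\<bar>"
    unfolding e1 e2 by (rule arg_cong[OF Bochner_Integration.integral_diff[OF i1 i2, symmetric]])
  also have "\<dots> \<le> (\<integral>\<omega>. \<bar>pen I \<rho> Y1 0 k \<omega> * (pen I \<rho> Y1 k ?t \<omega> * ?s \<omega>) - pen I \<rho> Y1 0 k \<omega> * (pen I \<rho> Y2 k ?t \<omega> * ?s \<omega>)\<bar> \<partial>?Q)"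
    by (rule integral_abs_bound)
  also have "\<dots> \<le> (\<integral>\<omega>. B * (pen I \<rho> Y1 0 k \<omega> * \<bar>pen I \<rho> Y1 k ?t \<omega> - pen I \<rho> Y2 k ?t \<omega>\<bar>) \<partial>?Q)"
  proof (rule integral_mono)
    show "integrable ?Q (\<lambda>\<omega>. \<bar>pen I \<rho> Y1 0 k \<omega> * (pen I \<rho> Y1 k ?t \<omega> * ?s \<omega>) - pen I \<rho> Y1 0 k \<omega> *
      (pen I \<rho> Y2 k ?t \<omega> * ?s \<omega>)\<bar>)"
      by (intro integrable_abs Bochner_Integration.integrable_diff i1 i2)
    show "integrable ?Q (\<lambda>\<omega>. B * (pen I \<rho> Y1 0 k \<omega> * \<bar>pen I \<rho> Y1 k ?t \<omega> - pen I \<rho> Y2 k ?t \<omega>\<bar>))"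
      by (intro integrable_mult_right i3)
    fix \<omega>
    have "pen I \<rho> Y1 0 k \<omega> * (pen I \<rho> Y1 k ?t \<omega> * ?s \<omega>) - pen I \<rho> Y1 0 k \<omega> * (pen I \<rho> Y2 k ?t \<omega> * ?s \<omega>)
      = ?s \<omega> * (pen I \<rho> Y1 0 k \<omega> * (pen I \<rho> Y1 k ?t \<omega> - pen I \<rho> Y2 k ?t \<omega>))"
      by (simp only: right_diff_distrib mult_ac)
    hence "\<bar>pen I \<rho> Y1 0 k \<omega> * (pen I \<rho> Y1 k ?t \<omega> * ?s \<omega>) - pen I \<rho> Y1 0 k \<omega> * (pen I \<rho> Y2 k ?t \<omega> * ?s \<omega>)\<bar>
      = ?s \<omega> * (pen I \<rho> Y1 0 k \<omega> * \<bar>pen I \<rho> Y1 k ?t \<omega> - pen I \<rho> Y2 k ?t \<omega>\<bar>)"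
      by (simp only: abs_mult abs_of_nonneg[OF s(1)] abs_of_nonneg[OF pb(1)])
    also have "\<dots> \<le> B * (pen I \<rho> Y1 0 k \<omega> * \<bar>pen I \<rho> Y1 k ?t \<omega> - pen I \<rho> Y2 k ?t \<omega>\<bar>)"
      using s pb by (intro mult_right_mono) auto
    finally show "\<bar>pen I \<rho> Y1 0 k \<omega> * (pen I \<rho> Y1 k ?t \<omega> * ?s \<omega>) - pen I \<rho> Y1 0 k \<omega> * (pen I \<rho> Y2 k ?t \<omega> * ?s \<omega>)\<bar>
      \<le> B * (pen I \<rho> Y1 0 k \<omega> * \<bar>pen I \<rho> Y1 k ?t \<omega> - pen I \<rho> Y2 k ?t \<omega>\<bar>)" .
  qed
  also have "\<dots> = B * (\<integral>\<omega>. pen I \<rho> Y1 0 k \<omega> * \<bar>pen I \<rho> Y1 k (k + 1) \<omega> - pen I \<rho> Y2 k (k + 1) \<omega>\<bar> \<partial>?Q)"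
    by (simp add: add.commute)
  also have "\<dots> \<le> B * (K1 * (exp (- \<gamma> * k) * h k x) * dist x y)"
    using step_diff[OF I_of_nat[of k] I_1 order_refl, of x y]
    by (intro mult_left_mono B0) (simp add: add.commute)
  finally show ?thesis by (simp add: mult_ac)
qed

lemma mixed_telescope:
  fixes B :: "nat \<Rightarrow> real" and m n :: nat
  assumes g: "lipb l b f" and B: "\<And>k z. k < n \<Longrightarrow> S (real (n - Suc k)) f z \<le> B k" and "m \<le> n"
  shows "\<bar>mixed f (real n) n x y - mixed f (real n) m x y\<bar>
    \<le> (\<Sum>k=m..<n. K1 * (exp (- \<gamma> * real k) * h (real k) x) * B k) * dist x y"
proof -
  have eq: "mixed f (real n) n x y - mixed f (real n) m x y
    = (\<Sum>k=m..<n. mixed f (real n) (Suc k) x y - mixed f (real n) k x y)"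
    using sum_Suc_diff'[OF \<open>m \<le> n\<close>, of "\<lambda>k. mixed f (real n) k x y"] by simp
  have "\<bar>mixed f (real n) n x y - mixed f (real n) m x y\<bar>
     \<le> (\<Sum>k=m..<n. \<bar>mixed f (real n) (Suc k) x y - mixed f (real n) k x y\<bar>)"
    unfolding eq by (rule sum_abs)
  also have "\<dots> \<le> (\<Sum>k=m..<n. K1 * (exp (- \<gamma> * real k) * h (real k) x) * B k * dist x y)"
    using B by (intro sum_mono mixed_step[OF g]) auto
  finally show ?thesis by (simp add: sum_distrib_right)
qed

lemma mixed_0:
  assumes "lipb l b f" "t \<in> I"
  shows "mixed f t 0 x y = S t f y"
  using S_Y(2)[OF lipb_measurable[OF assms(1)] lipbD(1)[OF assms(1)] assms(2), of x y]
  by (simp add: mixed_def pen_same[OF process_Q1])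

text \<open>Both expectations carry the weight of the first coordinate, the one that (A) normalises
  by; only the argument of \<open>f\<close> changes.\<close>

lemma first_coordinate_diff:
  assumes f: "lipb l b f" and "0 \<le> l" and t: "t \<in> I"
  shows "\<bar>S t f x - (\<integral>\<omega>. pen I \<rho> Y1 0 t \<omega> * f (Y2 t \<omega>) \<partial>Q (x, y))\<bar> \<le> l * (CA * exp (- \<gamma> * t) * h t x * dist x y)"
proof -
  let ?Q = "Q (x, y)"
  have pb: "0 \<le> pen I \<rho> Y1 a c \<omega>" "pen I \<rho> Y1 a c \<omega> \<le> 1" for a c \<omega>
    by (rule pen_nonneg[OF process_Q1] pen_le_1[OF process_Q1])+
  note m[measurable] = pen_measurable[OF process_Q1[of "(x, y)"]] dist_Y_measurable[OF t, of "(x, y)"]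
    measurable_compose[OF Y2_meas[OF t, of "(x, y)"] lipb_measurable[OF f]]
      measurable_compose[OF Y1_meas[OF t, of "(x, y)"] lipb_measurable[OF f]]
  have b: "\<bar>pen I \<rho> Y1 0 t \<omega> * f z\<bar> \<le> 1 * b" "\<bar>pen I \<rho> Y1 0 t \<omega> * dist z z'\<bar> \<le> 1 * dbar" for \<omega> z z'
    unfolding abs_mult using pb lipbD[OF f] dist_le by (intro mult_mono; simp)+
  have i: "integrable ?Q (\<lambda>\<omega>. pen I \<rho> Y1 0 t \<omega> * f (Y1 t \<omega>))" "integrable ?Q (\<lambda>\<omega>. pen I \<rho> Y1 0 t \<omega> * f (Y2 t \<omega>))"
    "integrable ?Q (\<lambda>\<omega>. pen I \<rho> Y1 0 t \<omega> * dist (Y1 t \<omega>) (Y2 t \<omega>))"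
    by (rule integrable_Q[OF _ b(1)], measurable)
      (rule integrable_Q[OF _ b(1)], measurable, rule integrable_Q[OF _ b(2)], measurable)
  have "\<bar>S t f x - (\<integral>\<omega>. pen I \<rho> Y1 0 t \<omega> * f (Y2 t \<omega>) \<partial>?Q)\<bar>
    = \<bar>\<integral>\<omega>. pen I \<rho> Y1 0 t \<omega> * f (Y1 t \<omega>) - pen I \<rho> Y1 0 t \<omega> * f (Y2 t \<omega>) \<partial>?Q\<bar>"
    using i by (simp add: S_Y(1)[OF lipb_measurable[OF f] lipbD(1)[OF f] t])
  also have "\<dots> \<le> (\<integral>\<omega>. \<bar>pen I \<rho> Y1 0 t \<omega> * f (Y1 t \<omega>) - pen I \<rho> Y1 0 t \<omega> * f (Y2 t \<omega>)\<bar> \<partial>?Q)"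
    by (rule integral_abs_bound)
  also have "\<dots> \<le> (\<integral>\<omega>. l * (pen I \<rho> Y1 0 t \<omega> * dist (Y1 t \<omega>) (Y2 t \<omega>)) \<partial>?Q)"
  proof (rule integral_mono)
    fix \<omega>
    have "\<bar>pen I \<rho> Y1 0 t \<omega> * f (Y1 t \<omega>) - pen I \<rho> Y1 0 t \<omega> * f (Y2 t \<omega>)\<bar> = pen I \<rho> Y1 0 t \<omega> * \<bar>f (Y1 t \<omega>) - f (Y2 t \<omega>)\<bar>"
      using pb(1)[of 0 t \<omega>] by (simp add: abs_mult flip: right_diff_distrib)
    also have "\<dots> \<le> pen I \<rho> Y1 0 t \<omega> * (l * dist (Y1 t \<omega>) (Y2 t \<omega>))"
      by (intro mult_left_mono lipbD(3)[OF f] pb)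
    finally show "\<bar>pen I \<rho> Y1 0 t \<omega> * f (Y1 t \<omega>) - pen I \<rho> Y1 0 t \<omega> * f (Y2 t \<omega>)\<bar>
      \<le> l * (pen I \<rho> Y1 0 t \<omega> * dist (Y1 t \<omega>) (Y2 t \<omega>))"
      by (simp add: mult_ac)
  qed (use i in auto)
  also have "\<dots> \<le> l * (CA * exp (- \<gamma> * t) * h t x * dist x y)"
    using weighted_dist[OF t, of x y] \<open>0 \<le> l\<close> by (simp add: mult_left_mono)
  finally show ?thesis .
qed

text \<open>Moving \<open>f\<close> from the first to the second coordinate costs the contracting
  term; exchanging the weights costs the sum. The bounds \<open>B\<close> on the suprema stay
  abstract because exponential bounds become available only after the Harnack inequality.\<close>

lemma doeblin_fortet:
  fixes B :: "nat \<Rightarrow> real" and n :: nat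
  assumes f: "lipb l b f" and l: "0 \<le> l" and B: "\<And>k z. k < n \<Longrightarrow> S (real (n - Suc k)) f z \<le> B k"
  shows "\<bar>S (real n) f x - S (real n) f y\<bar>
     \<le> (l * (CA * exp (- \<gamma> * n) * h n x) + (\<Sum>k<n. K1 * (exp (- \<gamma> * real k) * h (real k) x) * B k)) * dist x y"
proof -
  have "mixed f (real n) n x y = (\<integral>\<omega>. pen I \<rho> Y1 0 n \<omega> * f (Y2 n \<omega>) \<partial>Q (x, y))"
    by (simp add: mixed_def pen_same[OF process_Q2])
  hence "\<bar>S n f x - mixed f (real n) n x y\<bar> \<le> l * (CA * exp (- \<gamma> * n) * h n x) * dist x y"
    using first_coordinate_diff[OF f l I_of_nat[of n], where x = x and y = y] by (simp add: mult_ac)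
  moreover have "\<bar>mixed f (real n) n x y - S n f y\<bar> \<le> (\<Sum>k<n. K1 * (exp (- \<gamma> * real k) * h (real k) x) * B k) * dist x y"
    using mixed_telescope[OF f B, where m = 0 and x = x and y = y] mixed_0[OF f I_of_nat[of n], where x = x and y = y]
      by (simp add: lessThan_atLeast0)
  ultimately show ?thesis by (simp add: distrib_right)
qed

text \<open>Stopping the telescoping at \<open>m\<close> leaves a tail of the error sum, which is
  small for large \<open>m\<close>. The first \<open>m\<close> units are paid for crudely: there the
  weight of the first coordinate is at most 1, and the weight of the second is at least e^(-R
  m).\<close>

lemma comparison:
  fixes B :: "nat \<Rightarrow> real" and m n :: nat
  assumes B: "\<And>k z. k < n \<Longrightarrow> h (real (n - Suc k)) z \<le> B k" and "m \<le> n"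
  shows "h n x \<le> exp (R * m) * h n y + (\<Sum>k=m..<n. K1 * (exp (- \<gamma> * real k) * h (real k) x) * B k) * dist x y"
proof -
  let ?Q = "Q (x, y)"
  note m[measurable] = pen_measurable[OF process_Q1[of "(x, y)"]] pen_measurable[OF process_Q2[of "(x, y)"]]
  have pb: "0 \<le> pen I \<rho> Y1 a c \<omega>" "pen I \<rho> Y1 a c \<omega> \<le> 1" "0 \<le> pen I \<rho> Y2 a c \<omega>" "pen I \<rho> Y2 a c \<omega> \<le> 1" for a c \<omega>
    by (rule pen_nonneg[OF process_Q1] pen_le_1[OF process_Q1] pen_nonneg[OF process_Q2] pen_le_1[OF process_Q2])+
  have "mixed (\<lambda>_. 1) (real n) n x y = h n x"
    by (simp add: mixed_def pen_same[OF process_Q2] h_Y)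
  moreover have "mixed (\<lambda>_. 1) (real n) m x y \<le> exp (R * m) * h n y"
  proof -
    have "mixed (\<lambda>_. 1) (real n) m x y \<le> (\<integral>\<omega>. exp (R * m) * pen I \<rho> Y2 0 n \<omega> \<partial>?Q)"
      unfolding mixed_def
    proof (rule integral_mono)
      show "integrable ?Q (\<lambda>\<omega>. pen I \<rho> Y1 0 m \<omega> * (pen I \<rho> Y2 m n \<omega> * 1))"
        using pb by (intro integrable_Q_mult[of _ _ _ 1]) auto
      show "integrable ?Q (\<lambda>\<omega>. exp (R * m) * pen I \<rho> Y2 0 n \<omega>)"
        using pb by (intro integrable_mult_right integrable_Q[of _ _ 1]) auto
      fix \<omega> assume \<omega>: "\<omega> \<in> space ?Q"
      have "1 = exp (R * m) * exp (- R * (real m - 0))" by (simp flip: exp_add)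
      also have "\<dots> \<le> exp (R * m) * pen I \<rho> Y2 0 m \<omega>"
        by (intro mult_left_mono pen_ge[OF process_Q2 I_0 I_of_nat _ \<omega>]) auto
      finally have "pen I \<rho> Y1 0 m \<omega> * pen I \<rho> Y2 m n \<omega> \<le> (exp (R * m) * pen I \<rho> Y2 0 m \<omega>) * pen I \<rho> Y2 m n \<omega>"
        using pb(2)[of 0 m \<omega>] pb(3) by (intro mult_right_mono) auto
      also have "\<dots> = exp (R * m) * pen I \<rho> Y2 0 n \<omega>"
        using pen_mult[OF process_Q2 _ _ \<omega>, of 0 m n] \<open>m \<le> n\<close> by simp
      finally show "pen I \<rho> Y1 0 m \<omega> * (pen I \<rho> Y2 m n \<omega> * 1) \<le> exp (R * m) * pen I \<rho> Y2 0 n \<omega>" by simp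
    qed
    thus ?thesis by (simp add: h_Y)
  qed
  ultimately show ?thesis using mixed_telescope[OF lipb_one B \<open>m \<le> n\<close>, where x = x and y = y] by linarith
qed

text \<open>Telescoping uses integer times; this estimate handles the fractional remainder of a
  continuous time with a single comparison of weights.\<close>

lemma short_time_lipschitz:
  assumes f: "lipb l b f" and l: "0 \<le> l" and r: "r \<in> I" "r \<le> 1"
  shows "lipb (CA * l + K1 * b) b (S r f)"
proof -
  have b0: "0 \<le> b" by (rule order_trans[OF lipbD(1)[OF f] lipbD(2)[OF f]])
  have r0: "0 \<le> r" using r I_nonneg by auto
  have "\<bar>S r f x - S r f y\<bar> \<le> (CA * l + K1 * b) * dist x y" for x y
  proof -
    let ?Q = "Q (x, y)"
    note m[measurable] = pen_measurable[OF process_Q1[of "(x, y)"]] pen_measurable[OF process_Q2[of "(x, y)"]]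
      measurable_compose[OF Y2_meas[OF r(1), of "(x, y)"] lipb_measurable[OF f]]
    have pb: "0 \<le> pen I \<rho> Y1 a c \<omega>" "pen I \<rho> Y1 a c \<omega> \<le> 1" "0 \<le> pen I \<rho> Y2 a c \<omega>" "pen I \<rho> Y2 a c \<omega> \<le> 1" for a c \<omega>
      by (rule pen_nonneg[OF process_Q1] pen_le_1[OF process_Q1] pen_nonneg[OF process_Q2] pen_le_1[OF process_Q2])+
    have bd: "\<bar>pen I \<rho> Y1 0 r \<omega> * f z\<bar> \<le> 1 * b" "\<bar>pen I \<rho> Y2 0 r \<omega> * f z\<bar> \<le> 1 * b" for \<omega> z
      unfolding abs_mult using pb lipbD[OF f] by (intro mult_mono; simp)+
    have i1: "integrable ?Q (\<lambda>\<omega>. pen I \<rho> Y1 0 r \<omega> * f (Y2 r \<omega>))"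
      by (rule integrable_Q[OF _ bd(1)]) measurable
    have i2: "integrable ?Q (\<lambda>\<omega>. pen I \<rho> Y2 0 r \<omega> * f (Y2 r \<omega>))"
      by (rule integrable_Q[OF _ bd(2)]) measurable
    have db: "\<bar>pen I \<rho> Y1 0 r \<omega> - pen I \<rho> Y2 0 r \<omega>\<bar> \<le> 1" for \<omega>
      using pb(1,2)[of 0 r \<omega>] pb(3,4)[of 0 r \<omega>] by auto
    have i3: "integrable ?Q (\<lambda>\<omega>. \<bar>pen I \<rho> Y1 0 r \<omega> - pen I \<rho> Y2 0 r \<omega>\<bar>)"
      using db by (intro integrable_Q[of _ _ 1]) auto
    have "\<bar>(\<integral>\<omega>. pen I \<rho> Y1 0 r \<omega> * f (Y2 r \<omega>) \<partial>?Q) - S r f y\<bar>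
      = \<bar>\<integral>\<omega>. pen I \<rho> Y1 0 r \<omega> * f (Y2 r \<omega>) - pen I \<rho> Y2 0 r \<omega> * f (Y2 r \<omega>) \<partial>?Q\<bar>"
      using i1 i2 by (simp add: S_Y(2)[OF lipb_measurable[OF f] lipbD(1)[OF f] r(1)])
    also have "\<dots> \<le> (\<integral>\<omega>. \<bar>pen I \<rho> Y1 0 r \<omega> * f (Y2 r \<omega>) - pen I \<rho> Y2 0 r \<omega> * f (Y2 r \<omega>)\<bar> \<partial>?Q)"
      by (rule integral_abs_bound)
    also have "\<dots> \<le> (\<integral>\<omega>. b * \<bar>pen I \<rho> Y1 0 r \<omega> - pen I \<rho> Y2 0 r \<omega>\<bar> \<partial>?Q)"
    proof (rule integral_mono)
      fix \<omega>
      have "\<bar>pen I \<rho> Y1 0 r \<omega> * f (Y2 r \<omega>) - pen I \<rho> Y2 0 r \<omega> * f (Y2 r \<omega>)\<bar>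
        = f (Y2 r \<omega>) * \<bar>pen I \<rho> Y1 0 r \<omega> - pen I \<rho> Y2 0 r \<omega>\<bar>"
        using lipbD(1)[OF f] by (simp add: abs_mult mult.commute flip: right_diff_distrib)
      also have "\<dots> \<le> b * \<bar>pen I \<rho> Y1 0 r \<omega> - pen I \<rho> Y2 0 r \<omega>\<bar>"
        using lipbD(2)[OF f] by (intro mult_right_mono) auto
      finally show "\<bar>pen I \<rho> Y1 0 r \<omega> * f (Y2 r \<omega>) - pen I \<rho> Y2 0 r \<omega> * f (Y2 r \<omega>)\<bar>
        \<le> b * \<bar>pen I \<rho> Y1 0 r \<omega> - pen I \<rho> Y2 0 r \<omega>\<bar>" .
    qed (use i1 i2 i3 in auto)
    also have "\<dots> = b * (\<integral>\<omega>. \<bar>pen I \<rho> Y1 0 r \<omega> - pen I \<rho> Y2 0 r \<omega>\<bar> \<partial>?Q)" by simp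
    also have "\<dots> \<le> b * (K1 * dist x y)"
    proof -
      have "(\<integral>\<omega>. pen I \<rho> Y1 0 0 \<omega> * \<bar>pen I \<rho> Y1 0 (0 + r) \<omega> - pen I \<rho> Y2 0 (0 + r) \<omega>\<bar> \<partial>?Q)
        \<le> K1 * (exp (- \<gamma> * 0) * h 0 x) * dist x y" by (rule step_diff[OF I_0 r])
      hence "(\<integral>\<omega>. \<bar>pen I \<rho> Y1 0 r \<omega> - pen I \<rho> Y2 0 r \<omega>\<bar> \<partial>?Q) \<le> K1 * dist x y"
        by (simp add: pen_same[OF process_Q1] S_0)
      thus ?thesis using b0 by (intro mult_left_mono)
    qed
    finally have "\<bar>(\<integral>\<omega>. pen I \<rho> Y1 0 r \<omega> * f (Y2 r \<omega>) \<partial>?Q) - S r f y\<bar> \<le> b * (K1 * dist x y)" .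
    moreover have "\<bar>S r f x - (\<integral>\<omega>. pen I \<rho> Y1 0 r \<omega> * f (Y2 r \<omega>) \<partial>?Q)\<bar> \<le> l * (CA * dist x y)"
    proof -
      have "exp (- \<gamma> * r) * h r x \<le> 1 * 1"
        using \<gamma>_pos r0 h_bounds[OF r(1), of x] h_pos[OF r(1), of x] by (intro mult_mono) auto
      hence "CA * (exp (- \<gamma> * r) * h r x) * dist x y \<le> CA * (1 * 1) * dist x y"
        using CA_pos by (intro mult_right_mono mult_left_mono) auto
      hence "l * (CA * exp (- \<gamma> * r) * h r x * dist x y) \<le> l * (CA * dist x y)"
        using l by (intro mult_left_mono) (auto simp: mult_ac)
      thus ?thesis using first_coordinate_diff[OF f l r(1), of x y] by linarith
    qed
    ultimately have "\<bar>S r f x - S r f y\<bar> \<le> l * (CA * dist x y) + b * (K1 * dist x y)" by linarith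
    thus ?thesis by (simp add: algebra_simps)
  qed
  moreover have "S r f x \<le> b" for x
    using S_le[OF f r(1), of x] mult_left_mono[OF h_bounds(2)[OF r(1), of x] b0] by simp
  ultimately show ?thesis using S_nonneg[OF lipbD(1)[OF f]] by (simp add: lipb_def)
qed

text \<open>Doeblin minorization along the coupling: both normalised weights dominate
  \<open>c\<close> times the weight of the first coordinate divided by \<open>h t x\<close>. On this
  common part the values of \<open>f\<close> are compared through the coupled distance; the
  remaining mass \<open>1 - c\<close> contributes at most the oscillation. The points x and y may be
  arbitrarily far apart.\<close>

lemma far_contraction:
  assumes t: "t \<in> I" and w: "lipb lw bw w" and w0: "0 < w0" "\<And>z. w0 \<le> w z"
    and f: "lipb l osc f" and l: "0 \<le> l" and c: "0 \<le> c"
    and cx: "c * S t w x \<le> w0 * h t x" and cy: "c * S t w y \<le> exp (- R * t) * w0 * h t x"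
    and A0: "0 < S t w x" and B0: "0 < S t w y"
  shows "S t (\<lambda>z. w z * f z) x / S t w x - S t (\<lambda>z. w z * f z) y / S t w y
     \<le> (1 - c) * osc + c * (l * (CA * exp (- \<gamma> * t) * dist x y))"
proof -
  let ?Q = "Q (x, y)"
  let ?A = "S t w x" and ?B = "S t w y" and ?H = "h t x"
  have H0: "0 < ?H" by (rule h_pos[OF t])
  have pb: "0 \<le> pen I \<rho> Y1 a c \<omega>" "pen I \<rho> Y1 a c \<omega> \<le> 1" "0 \<le> pen I \<rho> Y2 a c \<omega>" "pen I \<rho> Y2 a c \<omega> \<le> 1" for a c \<omega>
    by (rule pen_nonneg[OF process_Q1] pen_le_1[OF process_Q1] pen_nonneg[OF process_Q2] pen_le_1[OF process_Q2])+
  note wm = lipb_measurable[OF w] and fm = lipb_measurable[OF f]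
  note wb = lipbD(1,2)[OF w] and fb = lipbD(1,2)[OF f]
  have wfm: "(\<lambda>z. w z * f z) \<in> borel_measurable borel" using wm fm by simp
  have wfb: "0 \<le> w z * f z" "\<bar>w z * f z\<bar> \<le> bw * osc" for z
    using lipbD(1,2)[OF lipb_mult[OF w f], of z] by auto
  have int: "integrable ?Q (\<lambda>\<omega>. pen I \<rho> Y1 0 t \<omega> * g (Y1 t \<omega>))" "integrable ?Q (\<lambda>\<omega>. pen I \<rho> Y2 0 t \<omega> * g (Y2 t \<omega>))"
    if g: "g \<in> borel_measurable borel" "\<And>z. \<bar>g z\<bar> \<le> b" for g b
  proof -
    show "integrable ?Q (\<lambda>\<omega>. pen I \<rho> Y1 0 t \<omega> * g (Y1 t \<omega>))"
      using pb g measurable_compose[OF Y1_meas[OF t] g(1)] pen_measurable[OF process_Q1]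
      by (intro integrable_Q_mult[of _ _ _ b]) auto
    show "integrable ?Q (\<lambda>\<omega>. pen I \<rho> Y2 0 t \<omega> * g (Y2 t \<omega>))"
      using pb g measurable_compose[OF Y2_meas[OF t] g(1)] pen_measurable[OF process_Q2]
      by (intro integrable_Q_mult[of _ _ _ b]) auto
  qed
  have iw: "integrable ?Q (\<lambda>\<omega>. pen I \<rho> Y1 0 t \<omega> * w (Y1 t \<omega>))"
    using int(1)[OF wm, of bw] wb by (simp add: abs_of_nonneg)
  have i1: "integrable ?Q (\<lambda>\<omega>. pen I \<rho> Y1 0 t \<omega> * (w (Y1 t \<omega>) * f (Y1 t \<omega>)))" by (rule int(1)[OF wfm wfb(2)])
  have i2: "integrable ?Q (\<lambda>\<omega>. pen I \<rho> Y2 0 t \<omega> * (w (Y2 t \<omega>) * f (Y2 t \<omega>)))" by (rule int(2)[OF wfm wfb(2)])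
  have ip: "integrable ?Q (pen I \<rho> Y1 0 t)" using int(1)[of "\<lambda>_. 1" 1] by simp
  have idd: "integrable ?Q (\<lambda>\<omega>. pen I \<rho> Y1 0 t \<omega> * dist (Y1 t \<omega>) (Y2 t \<omega>))"
    using pb dist_le dist_Y_measurable[OF t] pen_measurable[OF process_Q1]
    by (intro integrable_Q_mult[of _ _ _ dbar]) auto
  have o0: "0 \<le> osc" using fb[of x] by linarith
  have "S t (\<lambda>z. w z * f z) x / ?A - S t (\<lambda>z. w z * f z) y / ?B
    = (\<integral>\<omega>. pen I \<rho> Y1 0 t \<omega> * (w (Y1 t \<omega>) * f (Y1 t \<omega>)) / ?A - pen I \<rho> Y2 0 t \<omega> * (w (Y2 t \<omega>) * f (Y2 t \<omega>)) / ?B \<partial>?Q)"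
    using i1 i2 S_Y[OF wfm wfb(1) t, of x y] by simp
  also have "\<dots> \<le> (\<integral>\<omega>. osc * (pen I \<rho> Y1 0 t \<omega> * w (Y1 t \<omega>) / ?A - c * (pen I \<rho> Y1 0 t \<omega> / ?H))
        + c * l * (pen I \<rho> Y1 0 t \<omega> * dist (Y1 t \<omega>) (Y2 t \<omega>) / ?H) \<partial>?Q)"
  proof (rule integral_mono)
    fix \<omega> assume \<omega>: "\<omega> \<in> space ?Q"
    let ?u1 = "pen I \<rho> Y1 0 t \<omega>" and ?u2 = "pen I \<rho> Y2 0 t \<omega>"
    let ?w1 = "w (Y1 t \<omega>)" and ?w2 = "w (Y2 t \<omega>)" and ?f1 = "f (Y1 t \<omega>)" and ?f2 = "f (Y2 t \<omega>)"
    \<comment> \<open>Minorization at x: the lower bound \<open>w0\<close> for the weight function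
      together with \<open>cx\<close>.\<close>
    have e1: "0 \<le> ?u1 * ?w1 / ?A - c * (?u1 / ?H)"
    proof -
      have "c * ?A \<le> ?w1 * ?H" using cx mult_right_mono[OF w0(2), of ?H "Y1 t \<omega>"] H0 by linarith
      hence "c / ?H \<le> ?w1 / ?A" using H0 A0 by (simp add: divide_le_eq le_divide_eq mult.commute)
      hence "?u1 * (c / ?H) \<le> ?u1 * (?w1 / ?A)" using pb by (intro mult_left_mono) auto
      thus ?thesis by (simp add: mult.commute)
    qed
    \<comment> \<open>Minorization of the weight of the second coordinate by that of the first:
      bound the latter by 1 and the former below by e^(-R t), which is why \<open>cy\<close> carries
      this factor.\<close>
    have e2: "c * (?u1 / ?H) \<le> ?u2 * ?w2 / ?B"
    proof -
      have "c * ?u1 * ?B \<le> c * 1 * ?B" using pb c B0 by (intro mult_right_mono mult_left_mono) auto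
      also have "\<dots> \<le> exp (- R * t) * w0 * ?H" using cy by simp
      also have "\<dots> \<le> ?u2 * ?w2 * ?H"
        using pen_ge[OF process_Q2 I_0 t I_nonneg[OF t] \<omega>] w0 H0 pb by (intro mult_right_mono mult_mono) auto
      finally have "(c * ?u1) * ?B \<le> (?u2 * ?w2) * ?H" .
      hence "(c * ?u1) / ?H \<le> (?u2 * ?w2) / ?B" using H0 B0 by (simp add: divide_le_eq le_divide_eq)
      thus ?thesis by simp
    qed
    have "?u1 * (?w1 * ?f1) / ?A - ?u2 * (?w2 * ?f2) / ?B
       = (?u1 * ?w1 / ?A - c * (?u1 / ?H)) * ?f1 + c * (?u1 / ?H) * ?f1 - ?u2 * ?w2 / ?B * ?f2"
      by (simp add: algebra_simps)
    also have "\<dots> \<le> (?u1 * ?w1 / ?A - c * (?u1 / ?H)) * osc + c * (?u1 / ?H) * ?f1 - c * (?u1 / ?H) * ?f2"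
    proof -
      have "(?u1 * ?w1 / ?A - c * (?u1 / ?H)) * ?f1 \<le> (?u1 * ?w1 / ?A - c * (?u1 / ?H)) * osc"
        by (rule mult_left_mono[OF fb(2) e1])
      moreover have "c * (?u1 / ?H) * ?f2 \<le> ?u2 * ?w2 / ?B * ?f2" by (rule mult_right_mono[OF e2 fb(1)])
      ultimately show ?thesis by linarith
    qed
    also have "\<dots> = osc * (?u1 * ?w1 / ?A - c * (?u1 / ?H)) + c * (?u1 / ?H) * (?f1 - ?f2)"
      by (simp only: right_diff_distrib[of "c * (?u1 / ?H)"] mult.commute[of osc] add_diff_eq)
    also have "\<dots> \<le> osc * (?u1 * ?w1 / ?A - c * (?u1 / ?H)) + c * (?u1 / ?H) * (l * dist (Y1 t \<omega>) (Y2 t \<omega>))"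
      using lipbD(3)[OF f, of "Y1 t \<omega>" "Y2 t \<omega>"] c pb H0 by (intro add_left_mono mult_left_mono) auto
    finally show "?u1 * (?w1 * ?f1) / ?A - ?u2 * (?w2 * ?f2) / ?B
      \<le> osc * (?u1 * ?w1 / ?A - c * (?u1 / ?H)) + c * l * (?u1 * dist (Y1 t \<omega>) (Y2 t \<omega>) / ?H)"
      by (simp add: mult_ac)
  next
    show "integrable ?Q (\<lambda>\<omega>. pen I \<rho> Y1 0 t \<omega> * (w (Y1 t \<omega>) * f (Y1 t \<omega>)) / ?A - pen I \<rho> Y2 0 t \<omega> *
      (w (Y2 t \<omega>) * f (Y2 t \<omega>)) / ?B)"
      by (intro Bochner_Integration.integrable_diff integrable_divide i1 i2)
    show "integrable ?Q (\<lambda>\<omega>. osc * (pen I \<rho> Y1 0 t \<omega> * w (Y1 t \<omega>) / ?A - c * (pen I \<rho> Y1 0 t \<omega> / ?H))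
        + c * l * (pen I \<rho> Y1 0 t \<omega> * dist (Y1 t \<omega>) (Y2 t \<omega>) / ?H))"
      by (intro Bochner_Integration.integrable_add Bochner_Integration.integrable_diff integrable_mult_right
            integrable_divide iw ip idd)
  qed
  also have "\<dots> = osc * ((\<integral>\<omega>. pen I \<rho> Y1 0 t \<omega> * w (Y1 t \<omega>) \<partial>?Q) / ?A - c * ((\<integral>\<omega>. pen I \<rho> Y1 0 t \<omega> \<partial>?Q) / ?H))
       + c * l * ((\<integral>\<omega>. pen I \<rho> Y1 0 t \<omega> * dist (Y1 t \<omega>) (Y2 t \<omega>) \<partial>?Q) / ?H)"
    using iw ip idd by (subst Bochner_Integration.integral_add) auto
  also have "\<dots> = osc * (1 - c) + c * l * ((\<integral>\<omega>. pen I \<rho> Y1 0 t \<omega> * dist (Y1 t \<omega>) (Y2 t \<omega>) \<partial>?Q) / ?H)"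
    using H0 A0 by (simp add: h_Y(1)[OF t] S_Y(1)[OF wm wb(1) t])
  also have "\<dots> \<le> osc * (1 - c) + c * l * (CA * exp (- \<gamma> * t) * dist x y)"
    using weighted_dist[OF t, of x y] H0 c l
    by (intro add_left_mono mult_left_mono) (auto simp: divide_le_eq mult_ac)
  finally show ?thesis by (simp add: mult_ac)
qed

end

section \<open>Harnack inequality\<close>

locale coupled_qsd = coupled I \<rho> R L dbar CA \<gamma> M F P X N Q Y1 Y2
  for I :: "real set" and \<rho> :: "'e::polish_space \<Rightarrow> real" and R L dbar CA \<gamma> :: real
    and M :: "'w measure" and F :: "real \<Rightarrow> 'w measure"
    and P :: "'e \<Rightarrow> 'w measure" and X :: "real \<Rightarrow> 'w \<Rightarrow> 'e"
    and N :: "'v measure" and Q :: "'e \<times> 'e \<Rightarrow> 'v measure"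
    and Y1 Y2 :: "real \<Rightarrow> 'v \<Rightarrow> 'e" +
  fixes nu :: "'e measure" and lam :: real
  assumes prob_nu: "prob_space nu" and sets_nu: "sets nu = sets borel" and lam_nonneg: "0 \<le> lam"
    and nu_S: "\<And>t f. t \<in> I \<Longrightarrow> f \<in> borel_measurable borel \<Longrightarrow> bounded (range f)
        \<Longrightarrow> (\<integral>x. S t f x \<partial>nu) = exp (- lam * t) * (\<integral>x. f x \<partial>nu)"
begin

lemma nu_integrable:
  assumes "f \<in> borel_measurable borel" "\<And>x. \<bar>f x\<bar> \<le> (b :: real)"
  shows "integrable nu f"
proof -
  interpret prob_space nu by (rule prob_nu)
  have "f \<in> borel_measurable nu" using assms(1) measurable_cong_sets[OF sets_nu refl] by blast
  thus ?thesis using assms(2) by (intro integrable_const_bound[of _ b]) auto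
qed

lemma nu_h:
  assumes "t \<in> I"
  shows "(\<integral>x. h t x \<partial>nu) = exp (- lam * t)"
proof -
  interpret prob_space nu by (rule prob_nu)
  show ?thesis using nu_S[OF assms, of "\<lambda>_. 1"] by (simp add: prob_space)
qed

lemma h_measurable: "t \<in> I \<Longrightarrow> h t \<in> borel_measurable borel"
  by (rule S_measurable[OF lipb_one])

lemma h_abs_le: "t \<in> I \<Longrightarrow> \<bar>h t x\<bar> \<le> 1"
  using h_bounds[of t x] h_pos[of t x] by simp

text \<open>The quasi-stationary measure averages \<open>h t\<close> to
  \<open>exp (- lam * t)\<close>, so any uniform bound on \<open>h t\<close> passes to this
  exponential. This links the rate \<open>lam\<close> to the infimum and supremum of
  \<open>h t\<close>.\<close>

lemma exp_rate_between:
  assumes "t \<in> I"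
  shows "(\<And>y. a \<le> h t y) \<Longrightarrow> a \<le> exp (- lam * t)" "(\<And>y. h t y \<le> a) \<Longrightarrow> exp (- lam * t) \<le> a"
proof -
  interpret prob_space nu by (rule prob_nu)
  note int = nu_integrable[OF h_measurable[OF assms] h_abs_le[OF assms]]
  have "(\<integral>x. a \<partial>nu) \<le> (\<integral>x. h t x \<partial>nu)" if "\<And>y. a \<le> h t y"
    using int that by (intro integral_mono) auto
  thus "(\<And>y. a \<le> h t y) \<Longrightarrow> a \<le> exp (- lam * t)" by (simp add: nu_h[OF assms] prob_space)
  have "(\<integral>x. h t x \<partial>nu) \<le> (\<integral>x. a \<partial>nu)" if "\<And>y. h t y \<le> a"
    using int that by (intro integral_mono) auto
  thus "(\<And>y. h t y \<le> a) \<Longrightarrow> exp (- lam * t) \<le> a" by (simp add: nu_h[OF assms] prob_space)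
qed

section \<open>Growth of the suprema of the expected penalization\<close>

definition hsup :: "nat \<Rightarrow> real" where
  "hsup n = (SUP x. h (real n) x)"

lemma h_le_hsup: "h (real n) x \<le> hsup n"
  unfolding hsup_def by (rule cSUP_upper) (auto intro!: bdd_aboveI[of _ 1] h_bounds)

lemma hsup_le_1: "hsup n \<le> 1"
  unfolding hsup_def by (rule cSUP_least) (auto intro: h_bounds)

lemma hsup_pos: "0 < hsup n"
  using h_le_hsup[of n undefined] h_pos[OF I_of_nat, of n undefined] by linarith

lemma hsup_ge: "exp (- R * real n) \<le> hsup n"
  using h_le_hsup[of n undefined] h_bounds(1)[OF I_of_nat, of n undefined] by linarith

lemma hsup_approx: "\<exists>x. hsup n / 2 \<le> h (real n) x"
proof -
  have "hsup n / 2 < hsup n" using hsup_pos[of n] by simp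
  then obtain y where "y \<in> range (h (real n))" "hsup n / 2 < y"
    unfolding hsup_def by (rule less_cSupE) auto
  thus ?thesis by (auto intro: less_imp_le)
qed

lemma hsup_add: "hsup (m + n) \<le> hsup m * hsup n"
  unfolding hsup_def[of "m + n"]
proof (rule cSUP_least)
  fix x
  have "h (real (m + n)) x = S (real m) (h (real n)) x"
    using S_semigroup[OF I_of_nat I_of_nat lipb_one, of m n x] by simp
  also have "\<dots> \<le> S (real m) (\<lambda>_. hsup n * 1) x"
    using h_le_hsup[of n] hsup_pos[of n]
    by (intro S_mono[of _ 1 _ "hsup n"] h_measurable h_abs_le I_of_nat) auto
  also have "\<dots> = hsup n * h (real m) x" by (rule S_cmult)
  also have "\<dots> \<le> hsup n * hsup m" using h_le_hsup hsup_pos[of n] by (intro mult_left_mono) auto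
  finally show "h (real (m + n)) x \<le> hsup m * hsup n" by (simp add: mult.commute)
qed simp

lemma hsup_mult: "hsup (q * n) \<le> hsup n ^ q"
proof (induction q)
  case 0
  show ?case using hsup_le_1 by simp
next
  case (Suc q)
  have "hsup (Suc q * n) \<le> hsup n * hsup (q * n)" using hsup_add[of n "q * n"] by simp
  also have "\<dots> \<le> hsup n * hsup n ^ q" using Suc.IH hsup_pos[of n] by (intro mult_left_mono) auto
  finally show ?case by simp
qed

text \<open>The decay rate that Fekete's lemma attaches to the submultiplicative sequence
  \<open>hsup\<close>. Written as a supremum it gives the lower bound e^(-lexp n) for every
  \<open>hsup n\<close> at once, so that the normalised suprema are at least 1.\<close>

definition lexp :: real where
  "lexp = (SUP n\<in>{1..}. - ln (hsup n) / real n)"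

lemma lexp_upper:
  assumes "1 \<le> n"
  shows "- ln (hsup n) / real n \<le> lexp"
  unfolding lexp_def
proof (rule cSUP_upper)
  show "bdd_above ((\<lambda>n. - ln (hsup n) / real n) ` {1..})"
  proof (rule bdd_aboveI2[of _ _ R])
    fix n :: nat assume "n \<in> {1..}"
    have "ln (exp (- R * real n)) \<le> ln (hsup n)" by (rule ln_mono[OF hsup_ge exp_gt_zero])
    thus "- ln (hsup n) / real n \<le> R" using \<open>n \<in> {1..}\<close> by (subst pos_divide_le_eq) auto
  qed
qed (use assms in simp)

lemma lexp_le_lam: "lexp \<le> lam"
  unfolding lexp_def
proof (rule cSUP_least)
  fix n :: nat assume n: "n \<in> {1..}"
  have "exp (- lam * real n) \<le> hsup n"
    by (rule exp_rate_between(2)[OF I_of_nat]) (rule h_le_hsup)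
  hence "ln (exp (- lam * real n)) \<le> ln (hsup n)" by (intro ln_mono) (auto simp: hsup_pos)
  thus "- ln (hsup n) / real n \<le> lam" using n by (subst pos_divide_le_eq) auto
qed simp

definition nsup :: "nat \<Rightarrow> real" where
  "nsup n = exp (lexp * real n) * hsup n"

lemma nsup_pos: "0 < nsup n"
  using hsup_pos by (simp add: nsup_def)

lemma nsup_ge_1: "1 \<le> nsup n"
proof (cases "n = 0")
  case True
  have "h (real 0) x = 1" for x by (simp add: S_0)
  thus ?thesis using h_le_hsup[of 0 undefined] True by (simp add: nsup_def)
next
  case False
  hence "- ln (hsup n) \<le> lexp * real n"
    using lexp_upper[of n] pos_divide_le_eq[of "real n" "- ln (hsup n)" lexp] by linarith
  hence "exp (- ln (hsup n)) \<le> exp (lexp * real n)" by simp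
  hence "1 / hsup n \<le> exp (lexp * real n)" using hsup_pos[of n] by (simp add: exp_minus inverse_eq_divide)
  thus ?thesis using hsup_pos[of n] by (simp add: nsup_def divide_le_eq)
qed

text \<open>Choose \<open>n0\<close> whose own decay rate is within \<open>e\<close> of the supremum
  and divide n by n0: submultiplicativity bounds the full blocks, and the remainder, shorter than
  \<open>n0\<close>, only costs a constant.\<close>

lemma nsup_subexponential:
  assumes "0 < e"
  shows "\<exists>C>0. \<forall>n. nsup n \<le> C * exp (e * real n)"
proof -
  have "\<exists>n\<in>{1..}. lexp - e < - ln (hsup n) / real n"
  proof (rule ccontr)
    assume "\<not> (\<exists>n\<in>{1..}. lexp - e < - ln (hsup n) / real n)"
    hence "lexp \<le> lexp - e" unfolding lexp_def[abs_def] by (intro cSUP_least) (auto simp: not_less lexp_def)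
    thus False using assms by simp
  qed
  then obtain n0 where n0: "1 \<le> n0" "lexp - e < - ln (hsup n0) / real n0" by auto
  hence "(lexp - e) * real n0 < - ln (hsup n0)" by (subst (asm) pos_less_divide_eq) auto
  hence "ln (hsup n0) \<le> - (lexp - e) * real n0" by linarith
  hence "exp (ln (hsup n0)) \<le> exp (- (lexp - e) * real n0)" by (simp only: exp_le_cancel_iff)
  hence M0: "hsup n0 \<le> exp (- (lexp - e) * real n0)" using hsup_pos[of n0] by simp
  have "nsup n \<le> exp (\<bar>lexp - e\<bar> * real n0) * exp (e * real n)" for n
  proof -
    define q r where "q = n div n0" and "r = n mod n0"
    have n: "n = q * n0 + r" "r < n0" using n0(1) by (auto simp: q_def r_def)
    have "hsup n \<le> hsup (q * n0) * hsup r" unfolding n(1) by (rule hsup_add)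
    also have "\<dots> \<le> hsup n0 ^ q * 1"
      using hsup_mult[of q n0] hsup_le_1[of r] hsup_pos[of r] hsup_pos[of n0] by (intro mult_mono) auto
    also have "\<dots> \<le> exp (- (lexp - e) * real n0) ^ q"
      using power_mono[OF M0, of q] hsup_pos[of n0] by simp
    also have "\<dots> = exp (real q * (- (lexp - e) * real n0))" by (rule exp_of_nat_mult[symmetric])
    finally have "nsup n \<le> exp (lexp * real n) * exp (real q * (- (lexp - e) * real n0))"
      unfolding nsup_def by (rule mult_left_mono) simp
    also have "\<dots> = exp (e * real n + (lexp - e) * real r)"
      by (simp add: n(1) algebra_simps flip: exp_add)
    also have "\<dots> \<le> exp (e * real n + \<bar>lexp - e\<bar> * real n0)"
    proof -
      have "(lexp - e) * real r \<le> \<bar>lexp - e\<bar> * real n0" using n(2) by (intro mult_mono) auto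
      thus ?thesis by simp
    qed
    finally show ?thesis by (simp add: exp_add mult.commute)
  qed
  thus ?thesis by (intro exI[of _ "exp (\<bar>lexp - e\<bar> * real n0)"]) auto
qed

text \<open>If \<open>n\<close> is close to being a record time of the normalised suprema, then the telescoping sum is
  negligible after finitely many terms, whence a comparison of all the values of \<open>h n\<close>.\<close>

lemma comparison_at_records:
  assumes "1 \<le> B"
  shows "\<exists>c>0. \<forall>n. (\<forall>s\<le>n. nsup (n - s) \<le> B * exp (\<gamma> / 4 * real s) * nsup n) \<longrightarrow> (\<forall>y. c * hsup n \<le> h (real n) y)"
proof -
  obtain C where C: "0 < C" "\<And>n. nsup n \<le> C * exp (\<gamma> / 4 * real n)"
    using nsup_subexponential[of "\<gamma> / 4"] \<gamma>_pos by auto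
  \<comment> \<open>Of the decay e^(-\<gamma> k) one quarter is spent on the subexponential growth
    of \<open>nsup k\<close> and one quarter on the hypothesis about
    \<open>nsup (n - (k + 1))\<close>; half of the rate survives.\<close>
  define q where "q = exp (- \<gamma> / 2)"
  have q: "0 < q" "q < 1" using \<gamma>_pos by (auto simp: q_def)
  define D where "D = K1 * dbar * (exp (lexp + \<gamma> / 4) * C * B)"
  have D0: "0 \<le> D" using K1_nonneg dbar_nonneg C(1) assms by (simp add: D_def)
  have "(\<lambda>m. D * (q ^ m / (1 - q))) \<longlonglongrightarrow> D * (0 / (1 - q))"
    using q by (intro tendsto_intros LIMSEQ_power_zero) auto
  hence "eventually (\<lambda>m. D * (q ^ m / (1 - q)) < 1 / 4) sequentially"
    by (intro order_tendstoD) auto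
  \<comment> \<open>\<open>m\<close> does not depend on \<open>n\<close>: from \<open>m\<close> on,
    the telescoping sum amounts to at most a quarter of \<open>hsup n\<close>.\<close>
  then obtain m where m: "D * (q ^ m / (1 - q)) < 1 / 4" by (auto simp: eventually_sequentially)
  \<comment> \<open>A nearly maximal point has value at least half the supremum, the tail removes a
    quarter, and the first \<open>m\<close> units of time cost e^(R m).\<close>
  define c where "c = exp (- R * real m) / 4"
  have "c * hsup n \<le> h (real n) y" if good: "\<And>s. s \<le> n \<Longrightarrow> nsup (n - s) \<le> B * exp (\<gamma> / 4 * real s) * nsup n" for n y
  proof (cases "m \<le> n")
    case True
    obtain x where x: "hsup n / 2 \<le> h (real n) x" using hsup_approx by blast
    have cmp: "h n x \<le> exp (R * m) * h n y +
      (\<Sum>k=m..<n. K1 * (exp (- \<gamma> * real k) * h (real k) x) * hsup (n - Suc k)) * dist x y"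
      by (rule comparison[OF h_le_hsup True])
    have "(\<Sum>k=m..<n. K1 * (exp (- \<gamma> * real k) * h (real k) x) * hsup (n - Suc k))
        \<le> (\<Sum>k=m..<n. K1 * (exp (lexp + \<gamma> / 4) * C * B * q ^ k * hsup n))"
    proof (rule sum_mono)
      fix k assume k: "k \<in> {m..<n}"
      have nk: "n - Suc k = n - (k + 1)" and kn: "k + 1 \<le> n" using k by auto
      have "exp (- \<gamma> * real k) * h (real k) x * hsup (n - Suc k) \<le> exp (- \<gamma> * real k) * hsup k * hsup (n - Suc k)"
        using h_le_hsup[of k x] hsup_pos[of "n - Suc k"] by (intro mult_right_mono mult_left_mono) auto
      also have "\<dots> = exp (- \<gamma> * real k) * exp (- lexp * (real n - 1)) * (nsup k * nsup (n - Suc k))"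
      proof -
        have "real (n - Suc k) = real n - 1 - real k" using kn by (simp add: of_nat_diff)
        hence "exp (- lexp * (real n - 1)) * (exp (lexp * real k) * exp (lexp * real (n - Suc k))) = 1"
          by (simp add: algebra_simps flip: exp_add)
        thus ?thesis by (simp add: nsup_def mult_ac)
      qed
      also have "\<dots> \<le> exp (- \<gamma> * real k) * exp (- lexp * (real n - 1))
          * ((C * exp (\<gamma> / 4 * real k)) * (B * exp (\<gamma> / 4 * real (k + 1)) * nsup n))"
        using C(2)[of k] good[OF kn] C(1) nsup_pos[of "n - (k + 1)"] unfolding nk
        by (intro mult_left_mono mult_mono) (auto intro: less_imp_le)
      also have "\<dots> = exp (lexp + \<gamma> / 4) * C * B * q ^ k * hsup n"
      proof -
        have "exp (- \<gamma> * real k) * exp (- lexp * (real n - 1)) * exp (\<gamma> / 4 * real k) * exp (\<gamma> / 4 * real (k + 1)) * exp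
          (lexp * real n)
          = exp (lexp + \<gamma> / 4) * q ^ k"
          by (simp add: q_def algebra_simps flip: exp_add exp_of_nat_mult)
        thus ?thesis by (simp add: nsup_def mult_ac)
      qed
      finally have "K1 * (exp (- \<gamma> * real k) * h (real k) x * hsup (n - Suc k))
        \<le> K1 * (exp (lexp + \<gamma> / 4) * C * B * q ^ k * hsup n)"
        using K1_nonneg by (rule mult_left_mono)
      thus "K1 * (exp (- \<gamma> * real k) * h (real k) x) * hsup (n - Suc k) \<le> K1 * (exp (lexp + \<gamma> / 4) * C * B * q ^ k * hsup n)"
        by (simp add: mult_ac)
    qed
    moreover have "0 \<le> (\<Sum>k=m..<n. K1 * (exp (lexp + \<gamma> / 4) * C * B * q ^ k * hsup n))"
      using K1_nonneg C(1) assms q hsup_pos[of n] by (intro sum_nonneg mult_nonneg_nonneg) auto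
    ultimately have "(\<Sum>k=m..<n. K1 * (exp (- \<gamma> * real k) * h (real k) x) * hsup (n - Suc k)) * dist x y
        \<le> (\<Sum>k=m..<n. K1 * (exp (lexp + \<gamma> / 4) * C * B * q ^ k * hsup n)) * dbar"
      by (rule mult_mono[OF _ dist_le]) simp
    also have "\<dots> = D * hsup n * (\<Sum>k=m..<n. q ^ k)"
      by (simp add: D_def sum_distrib_left sum_distrib_right mult_ac)
    also have "\<dots> \<le> D * hsup n * (q ^ m / (1 - q))"
      using D0 hsup_pos[of n] q by (intro mult_left_mono geometric_tail) auto
    also have "\<dots> = hsup n * (D * (q ^ m / (1 - q)))" by simp
    also have "\<dots> \<le> hsup n * (1 / 4)" using m hsup_pos[of n] by (intro mult_left_mono) auto
    finally have "hsup n / 4 \<le> exp (R * m) * h n y" using cmp x by linarith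
    hence "exp (- R * m) * (hsup n / 4) \<le> exp (- R * m) * (exp (R * m) * h n y)" by (intro mult_left_mono) auto
    also have "\<dots> = h n y" by (simp add: mult.assoc[symmetric] flip: exp_add)
    finally show ?thesis by (simp add: c_def)
  next
    case False
    \<comment> \<open>For n < m the trivial lower bound e^(-R n) suffices.\<close>
    have "c * hsup n \<le> exp (- R * real m) * 1"
      unfolding c_def using hsup_le_1[of n] hsup_pos[of n] by (intro mult_mono) auto
    also have "\<dots> \<le> exp (- R * real n) * 1" using False R_nonneg by (simp add: mult_left_mono)
    also have "\<dots> \<le> h (real n) y" using h_bounds(1)[OF I_of_nat, of n y] by simp
    finally show ?thesis .
  qed
  moreover have "0 < c" by (simp add: c_def)
  ultimately show ?thesis by blast
qed

text \<open>Strong induction. At a record, in the weakened sense of the case distinction, the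
  comparison makes all values of \<open>h n\<close> of the order of the supremum, and averaging over
  \<open>nu\<close> bounds the latter; otherwise an earlier normalised supremum is larger and the
  induction hypothesis applies to it.\<close>

lemma nsup_bounded: "\<exists>K\<ge>1. \<forall>n. nsup n \<le> K"
proof -
  obtain c where c: "0 < c" "\<And>n y. (\<forall>s\<le>n. nsup (n - s) \<le> 1 * exp (\<gamma> / 4 * real s) * nsup n) \<Longrightarrow> c * hsup n \<le> h (real n) y"
    using comparison_at_records[of 1] by blast
  have "nsup n \<le> 1 / c" for n
  proof (induction n rule: less_induct)
    case (less n)
    show ?case
    proof (cases "\<forall>s\<le>n. nsup (n - s) \<le> 1 * exp (\<gamma> / 4 * real s) * nsup n")
      case True
      from c(2)[OF this] have "c * hsup n \<le> exp (- lam * real n)" by (rule exp_rate_between(1)[OF I_of_nat])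
      \<comment> \<open>Here the two rates meet: the suprema cannot decay faster than the
        \<open>nu\<close>-average.\<close>
      also have "\<dots> \<le> exp (- lexp * real n)" using lexp_le_lam by (simp add: mult_right_mono)
      finally have "exp (lexp * real n) * (c * hsup n) \<le> exp (lexp * real n) * exp (- lexp * real n)"
        by (intro mult_left_mono) auto
      also have "\<dots> = 1" by (simp flip: exp_add)
      finally show ?thesis using c(1) by (simp add: nsup_def le_divide_eq mult_ac)
    next
      case False
      then obtain s where s: "s \<le> n" "exp (\<gamma> / 4 * real s) * nsup n < nsup (n - s)" by (auto simp: not_le)
      have "s \<noteq> 0" using s by (intro notI) simp
      have "1 * nsup n \<le> exp (\<gamma> / 4 * real s) * nsup n"
        using \<gamma>_pos nsup_pos[of n] by (intro mult_right_mono) auto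
      also have "\<dots> \<le> nsup (n - s)" using s by simp
      also have "\<dots> \<le> 1 / c" using s(1) \<open>s \<noteq> 0\<close> by (intro less.IH) auto
      finally show ?thesis by simp
    qed
  qed
  thus ?thesis by (intro exI[of _ "max 1 (1 / c)"]) (auto simp: le_max_iff_disj)
qed

text \<open>As the normalised suprema lie between 1 and \<open>K\<close>, every time satisfies the
  hypothesis of \<open>comparison_at_records\<close> with B = K; averaging over \<open>nu\<close>
  then replaces the supremum by the exponential.\<close>

lemma harnack_nat: "\<exists>c>0. \<forall>n y. c * exp (- lam * real n) \<le> h (real n) y \<and> c * h (real n) y \<le> exp (- lam * real n)"
proof -
  obtain K where K: "1 \<le> K" "\<And>n. nsup n \<le> K" using nsup_bounded by blast
  obtain c where c: "0 < c" "\<And>n y. (\<forall>s\<le>n. nsup (n - s) \<le> K * exp (\<gamma> / 4 * real s) * nsup n) \<Longrightarrow> c * hsup n \<le> h (real n) y"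
    using comparison_at_records[OF K(1)] by blast
  have ch: "c * hsup n \<le> h (real n) y" for n y
  proof (rule c(2), intro allI impI)
    fix s
    have "K * 1 * 1 \<le> K * exp (\<gamma> / 4 * real s) * nsup n"
      using K(1) \<gamma>_pos nsup_ge_1[of n] by (intro mult_mono) auto
    thus "nsup (n - s) \<le> K * exp (\<gamma> / 4 * real s) * nsup n" using K(2)[of "n - s"] by simp
  qed
  have "c * exp (- lam * real n) \<le> h (real n) y \<and> c * h (real n) y \<le> exp (- lam * real n)" for n y
  proof
    have "exp (- lam * real n) \<le> hsup n" by (rule exp_rate_between(2)[OF I_of_nat h_le_hsup])
    hence "c * exp (- lam * real n) \<le> c * hsup n" using c(1) by (intro mult_left_mono) auto
    thus "c * exp (- lam * real n) \<le> h (real n) y" using ch[of n y] by linarith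
    have "c * hsup n \<le> exp (- lam * real n)" by (rule exp_rate_between(1)[OF I_of_nat ch])
    moreover have "c * h (real n) y \<le> c * hsup n" using c(1) h_le_hsup by (intro mult_left_mono) auto
    ultimately show "c * h (real n) y \<le> exp (- lam * real n)" by linarith
  qed
  thus ?thesis using c(1) by blast
qed

lemma harnack: "\<exists>c>0. \<forall>t\<in>I. \<forall>y. c * exp (- lam * t) \<le> h t y \<and> c * h t y \<le> exp (- lam * t)"
proof -
  obtain c where c: "0 < c" "\<And>n y. c * exp (- lam * real n) \<le> h (real n) y" "\<And>n y. c * h (real n) y \<le> exp (- lam * real n)"
    using harnack_nat by blast
  \<comment> \<open>e^(-R) pays for the fractional part of \<open>t\<close> in the lower bound,
    \<open>exp (- lam)\<close> in the upper bound.\<close>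
  define c' where "c' = c * exp (- R) * exp (- lam)"
  have c': "0 < c'" using c(1) by (simp add: c'_def)
  have "c' * exp (- lam * t) \<le> h t y \<and> c' * h t y \<le> exp (- lam * t)" if t: "t \<in> I" for t y
  proof -
    obtain n r where nr: "t = real n + r" "r \<in> I" "0 \<le> r" "r < 1" using I_decompose[OF t] by blast
    have et: "exp (- lam * t) = exp (- lam * real n) * exp (- lam * r)" by (simp add: nr(1) algebra_simps flip: exp_add)
    have er: "exp (- lam) \<le> exp (- lam * r)" "exp (- lam * r) \<le> 1"
      using lam_nonneg nr by (auto simp: mult_left_le)
    have "exp (- R) \<le> h r z" for z
    proof -
      have "R * r \<le> R * 1" using R_nonneg nr by (intro mult_left_mono) auto
      hence "exp (- R) \<le> exp (- R * r)" by simp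
      thus ?thesis using h_bounds(1)[OF nr(2), of z] by linarith
    qed
    hence "S (real n) (\<lambda>_. exp (- R) * 1) y \<le> S (real n) (h r) y"
      by (intro S_mono[of _ "exp (- R)" _ 1] h_measurable h_abs_le nr I_of_nat) auto
    hence low: "exp (- R) * h (real n) y \<le> h t y"
      unfolding S_cmult using S_semigroup[OF I_of_nat nr(2) lipb_one, of n y] nr(1) by simp
    have "c' * exp (- lam * t) \<le> exp (- R) * (c * exp (- lam * real n)) * (1 * 1)"
      unfolding c'_def et using er lam_nonneg c(1)
      by (auto simp: mult_ac intro!: mult_left_mono mult_le_one)
    also have "\<dots> \<le> exp (- R) * h (real n) y" using c(2)[of n y] by simp
    also have "\<dots> \<le> h t y" by (rule low)
    finally have 1: "c' * exp (- lam * t) \<le> h t y" .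
    have "c' * h t y = exp (- R) * (exp (- lam) * (c * h t y))" by (simp add: c'_def mult_ac)
    also have "\<dots> \<le> 1 * (exp (- lam * r) * exp (- lam * real n))"
    proof (intro mult_mono er)
      have "c * h t y \<le> c * h (real n) y" using c(1) nr by (intro mult_left_mono h_antimono t I_of_nat) auto
      thus "c * h t y \<le> exp (- lam * real n)" using c(3)[of n y] by linarith
    qed (use R_nonneg c(1) h_pos[OF t, of y] in auto)
    finally have "c' * h t y \<le> exp (- lam * t)" unfolding et by (simp add: mult.commute)
    with 1 show ?thesis by blast
  qed
  thus ?thesis using c' by blast
qed

section \<open>Contraction of the conditioned kernels\<close>

text \<open>The Harnack constant is fixed once by choice, so that the constants built from it are
  visibly independent of time, starting point and test function.\<close>

definition hc :: real where
  "hc = (SOME c. 0 < c \<and> (\<forall>t\<in>I. \<forall>y. c * exp (- lam * t) \<le> h t y \<and> c * h t y \<le> exp (- lam * t)))"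

lemma hc: "0 < hc" "t \<in> I \<Longrightarrow> hc * exp (- lam * t) \<le> h t y" "t \<in> I \<Longrightarrow> hc * h t y \<le> exp (- lam * t)"
proof -
  have "0 < hc \<and> (\<forall>t\<in>I. \<forall>y. hc * exp (- lam * t) \<le> h t y \<and> hc * h t y \<le> exp (- lam * t))"
    unfolding hc_def using harnack by (rule someI_ex[of "\<lambda>c. _ c \<and> _ c"])
  thus "0 < hc" "t \<in> I \<Longrightarrow> hc * exp (- lam * t) \<le> h t y" "t \<in> I \<Longrightarrow> hc * h t y \<le> exp (- lam * t)" by blast+
qed

lemma h_upper: "t \<in> I \<Longrightarrow> h t y \<le> exp (- lam * t) / hc"
  using hc(3)[of t y] hc(1) by (simp add: le_divide_eq mult.commute)

lemma hc_le_1: "hc \<le> 1"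
  using hc(2)[OF I_0, of undefined] by (simp add: S_0)

lemma fortet_nat:
  "\<exists>K>0. \<forall>n f l b x y. 0 \<le> l \<longrightarrow> lipb l b f \<longrightarrow>
     \<bar>S (real n) f x - S (real n) f y\<bar> \<le> K * exp (- lam * real n) * (exp (- \<gamma> * real n) * l + b) * dist x y"
proof -
  define q where "q = exp (- \<gamma>)"
  have q: "0 < q" "q < 1" using \<gamma>_pos by (auto simp: q_def)
  \<comment> \<open>The first summand belongs to the contracting term. In the second, the two
    factors 1 / hc come from the upper bounds on \<open>h k\<close> and on the remaining semigroup,
    \<open>exp lam\<close> from the unit of time missing in \<open>n - Suc k\<close>, and
    \<open>1 - q\<close> from the geometric series.\<close>
  define K where "K = CA / hc + K1 * exp lam / (hc * hc * (1 - q))"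
  have K0: "0 \<le> K1 * exp lam / (hc * hc * (1 - q))" "0 < CA / hc" using K1_nonneg hc(1) q CA_pos by auto
  have "\<bar>S (real n) f x - S (real n) f y\<bar> \<le> K * exp (- lam * real n) * (exp (- \<gamma> * real n) * l + b) * dist x y"
    if l: "0 \<le> l" and f: "lipb l b f" for n f l b x y
  proof -
    have b0: "0 \<le> b" by (rule order_trans[OF lipbD(1)[OF f] lipbD(2)[OF f]])
    have B: "S (real (n - Suc k)) f z \<le> b * (exp (- lam * real (n - Suc k)) / hc)" for k z
      using S_le[OF f I_of_nat, of "n - Suc k" z] mult_left_mono[OF h_upper[OF I_of_nat, of "n - Suc k" z] b0] by linarith
    have "(\<Sum>k<n. K1 * (exp (- \<gamma> * real k) * h (real k) x) * (b * (exp (- lam * real (n - Suc k)) / hc)))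
      \<le> (\<Sum>k<n. K1 * exp lam / (hc * hc) * b * exp (- lam * real n) * q ^ k)"
    proof (rule sum_mono)
      fix k assume k: "k \<in> {..<n}"
      have "K1 * (exp (- \<gamma> * real k) * h (real k) x) * (b * (exp (- lam * real (n - Suc k)) / hc))
        \<le> K1 * (exp (- \<gamma> * real k) * (exp (- lam * real k) / hc)) * (b * (exp (- lam * real (n - Suc k)) / hc))"
        using K1_nonneg b0 hc(1) h_upper[OF I_of_nat, of k x] by (intro mult_right_mono mult_left_mono) auto
      also have "\<dots> = K1 * exp lam / (hc * hc) * b * exp (- lam * real n) * q ^ k"
      proof -
        have "real (n - Suc k) = real n - 1 - real k" using k by (simp add: of_nat_diff)
        hence "exp (- \<gamma> * real k) * exp (- lam * real k) * exp (- lam * real (n - Suc k))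
          = exp lam * exp (- lam * real n) * q ^ k"
          by (simp add: q_def algebra_simps flip: exp_add exp_of_nat_mult)
        thus ?thesis by (simp add: mult_ac)
      qed
      finally show "K1 * (exp (- \<gamma> * real k) * h (real k) x) * (b * (exp (- lam * real (n - Suc k)) / hc))
        \<le> K1 * exp lam / (hc * hc) * b * exp (- lam * real n) * q ^ k" .
    qed
    also have "\<dots> = K1 * exp lam / (hc * hc) * b * exp (- lam * real n) * (\<Sum>k=0..<n. q ^ k)"
      by (simp add: sum_distrib_left lessThan_atLeast0)
    also have "\<dots> \<le> K1 * exp lam / (hc * hc) * b * exp (- lam * real n) * (q ^ 0 / (1 - q))"
      using q K1_nonneg b0 hc(1) by (intro mult_left_mono geometric_tail) auto
    also have "\<dots> = K1 * exp lam / (hc * hc * (1 - q)) * exp (- lam * real n) * b"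
      by simp
    finally have sum: "(\<Sum>k<n. K1 * (exp (- \<gamma> * real k) * h (real k) x) * (b * (exp (- lam * real (n - Suc k)) / hc)))
       \<le> K1 * exp lam / (hc * hc * (1 - q)) * exp (- lam * real n) * b" .
    have "l * (CA * exp (- \<gamma> * real n) * h (real n) x) \<le> l * (CA * exp (- \<gamma> * real n) * (exp (- lam * real n) / hc))"
      using l CA_pos h_upper[OF I_of_nat, of n x] by (intro mult_left_mono) auto
    also have "\<dots> = CA / hc * exp (- lam * real n) * (exp (- \<gamma> * real n) * l)" by simp
    finally have "l * (CA * exp (- \<gamma> * real n) * h (real n) x)
       + (\<Sum>k<n. K1 * (exp (- \<gamma> * real k) * h (real k) x) * (b * (exp (- lam * real (n - Suc k)) / hc)))
      \<le> CA / hc * exp (- lam * real n) * (exp (- \<gamma> * real n) * l) + K1 * exp lam / (hc * hc * (1 - q)) * exp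
        (- lam * real n) * b"
      using sum by linarith
    also have "\<dots> \<le> K * exp (- lam * real n) * (exp (- \<gamma> * real n) * l) + K * exp (- lam * real n) * b"
      using K0 l b0 by (intro add_mono mult_right_mono) (auto simp: K_def)
    also have "\<dots> = K * exp (- lam * real n) * (exp (- \<gamma> * real n) * l + b)" by (simp add: distrib_left)
    finally have *: "l * (CA * exp (- \<gamma> * real n) * h (real n) x)
       + (\<Sum>k<n. K1 * (exp (- \<gamma> * real k) * h (real k) x) * (b * (exp (- lam * real (n - Suc k)) / hc)))
      \<le> K * exp (- lam * real n) * (exp (- \<gamma> * real n) * l + b)" .
    have "\<bar>S (real n) f x - S (real n) f y\<bar> \<le> (l * (CA * exp (- \<gamma> * real n) * h (real n) x)
       + (\<Sum>k<n. K1 * (exp (- \<gamma> * real k) * h (real k) x) * (b * (exp (- lam * real (n - Suc k)) / hc)))) * dist x y"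
      by (rule doeblin_fortet[OF f l B])
    also have "\<dots> \<le> K * exp (- lam * real n) * (exp (- \<gamma> * real n) * l + b) * dist x y"
      using * by (intro mult_right_mono) auto
    finally show ?thesis .
  qed
  moreover have "0 < K" using K0 by (simp add: K_def)
  ultimately show ?thesis by blast
qed

text \<open>Apply the short-time estimate over the fractional part first, then the integer estimate.
  Rounding changes the two exponentials at most by the factors \<open>exp lam\<close> and
  \<open>exp \<gamma>\<close>.\<close>

lemma fortet:
  "\<exists>K>0. \<forall>t\<in>I. \<forall>f l b x y. 0 \<le> l \<longrightarrow> lipb l b f \<longrightarrow>
     \<bar>S t f x - S t f y\<bar> \<le> K * exp (- lam * t) * (exp (- \<gamma> * t) * l + b) * dist x y"
proof -
  obtain K where K: "0 < K" "\<And>n f l b x y. 0 \<le> l \<Longrightarrow> lipb l b f \<Longrightarrow>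
     \<bar>S (real n) f x - S (real n) f y\<bar> \<le> K * exp (- lam * real n) * (exp (- \<gamma> * real n) * l + b) * dist x y"
    using fortet_nat by blast
  define K' where "K' = K * exp lam * (exp \<gamma> * CA + K1 + 1)"
  have "\<bar>S t f x - S t f y\<bar> \<le> K' * exp (- lam * t) * (exp (- \<gamma> * t) * l + b) * dist x y"
    if t: "t \<in> I" and l: "0 \<le> l" and f: "lipb l b f" for t f l b x y
  proof -
    have b0: "0 \<le> b" by (rule order_trans[OF lipbD(1)[OF f] lipbD(2)[OF f]])
    obtain n r where nr: "t = real n + r" "r \<in> I" "0 \<le> r" "r < 1" using I_decompose[OF t] by blast
    have St: "S t f z = S (real n) (S r f) z" for z unfolding nr(1) by (rule S_semigroup[OF I_of_nat nr(2) f])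
    have l': "0 \<le> CA * l + K1 * b" using CA_pos l K1_nonneg b0 by simp
    have "\<bar>S t f x - S t f y\<bar> \<le> K * exp (- lam * real n) * (exp (- \<gamma> * real n) * (CA * l + K1 * b) + b) * dist x y"
      unfolding St by (rule K(2)[OF l' short_time_lipschitz[OF f l nr(2) less_imp_le[OF nr(4)]]])
    also have "\<dots> \<le> K * (exp lam * exp (- lam * t)) * (((exp \<gamma> * CA + K1 + 1) * (exp (- \<gamma> * t) * l + b))) * dist x y"
    proof (intro mult_right_mono mult_mono mult_left_mono)
      have "lam * r \<le> lam * 1" using lam_nonneg nr by (intro mult_left_mono) auto
      thus "exp (- lam * real n) \<le> exp lam * exp (- lam * t)" by (simp add: nr(1) algebra_simps flip: exp_add)
      have "\<gamma> * r \<le> \<gamma> * 1" using \<gamma>_pos nr by (intro mult_left_mono) auto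
      hence e: "exp (- \<gamma> * real n) \<le> exp \<gamma> * exp (- \<gamma> * t)" by (simp add: nr(1) algebra_simps flip: exp_add)
      have "exp (- \<gamma> * real n) * (CA * l + K1 * b) + b = exp (- \<gamma> * real n) * (CA * l) + exp (- \<gamma> * real n) * (K1 * b) + b"
        by (simp add: distrib_left)
      also have "\<dots> \<le> (exp \<gamma> * exp (- \<gamma> * t)) * (CA * l) + 1 * (K1 * b) + b"
        using e CA_pos l K1_nonneg b0 \<gamma>_pos by (intro add_mono mult_right_mono) auto
      also have "\<dots> \<le> (exp \<gamma> * CA + K1 + 1) * (exp (- \<gamma> * t) * l + b)"
      proof -
        have "0 \<le> exp \<gamma> * CA * b" "0 \<le> (K1 + 1) * (exp (- \<gamma> * t) * l)" using CA_pos b0 K1_nonneg l by auto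
        thus ?thesis by (simp add: algebra_simps)
      qed
      finally show "exp (- \<gamma> * real n) * (CA * l + K1 * b) + b \<le> (exp \<gamma> * CA + K1 + 1) * (exp (- \<gamma> * t) * l + b)" .
    qed (use K(1) l' b0 in auto)
    finally show ?thesis by (simp add: K'_def mult_ac)
  qed
  moreover have "0 < K'" using K(1) CA_pos K1_nonneg
    by (auto simp: K'_def intro!: mult_pos_pos add_pos_nonneg add_nonneg_pos)
  ultimately show ?thesis by blast
qed

definition KF :: real where
  "KF = (SOME K. 0 < K \<and> (\<forall>t\<in>I. \<forall>f l b x y. 0 \<le> l \<longrightarrow> lipb l b f \<longrightarrow>
     \<bar>S t f x - S t f y\<bar> \<le> K * exp (- lam * t) * (exp (- \<gamma> * t) * l + b) * dist x y))"

lemma KF: "0 < KF" "t \<in> I \<Longrightarrow> 0 \<le> l \<Longrightarrow> lipb l b f \<Longrightarrow>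
     \<bar>S t f x - S t f y\<bar> \<le> KF * exp (- lam * t) * (exp (- \<gamma> * t) * l + b) * dist x y"
proof -
  have "0 < KF \<and> (\<forall>t\<in>I. \<forall>f l b x y. 0 \<le> l \<longrightarrow> lipb l b f \<longrightarrow>
     \<bar>S t f x - S t f y\<bar> \<le> KF * exp (- lam * t) * (exp (- \<gamma> * t) * l + b) * dist x y)"
    unfolding KF_def using fortet by (rule someI_ex[of "\<lambda>c. _ c \<and> _ c"])
  thus "0 < KF" "t \<in> I \<Longrightarrow> 0 \<le> l \<Longrightarrow> lipb l b f \<Longrightarrow>
     \<bar>S t f x - S t f y\<bar> \<le> KF * exp (- lam * t) * (exp (- \<gamma> * t) * l + b) * dist x y" by blast+
qed

lemma S_lipb:
  assumes "t \<in> I" "0 \<le> l" "lipb l b f"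
  shows "lipb (KF * exp (- lam * t) * (exp (- \<gamma> * t) * l + b)) (b * (exp (- lam * t) / hc)) (S t f)"
proof -
  have b0: "0 \<le> b" by (rule order_trans[OF lipbD(1)[OF assms(3)] lipbD(2)[OF assms(3)]])
  have "S t f x \<le> b * (exp (- lam * t) / hc)" for x
    using S_le[OF assms(3,1), of x] mult_left_mono[OF h_upper[OF assms(1), of x] b0] by linarith
  thus ?thesis using S_nonneg[OF lipbD(1)[OF assms(3)]] KF(2)[OF assms] by (simp add: lipb_def)
qed

lemma h_lipb:
  assumes "t \<in> I"
  shows "lipb (KF * exp (- lam * t)) (exp (- lam * t) / hc) (h t)"
  using S_lipb[OF assms _ lipb_one] by simp

text \<open>From the quotient rule: the leading summands in the bracket belong to the numerator, the
  final 1 to the denominator.\<close>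

definition KN :: real where
  "KN = KF / hc * (1 / hc + (KF + 1 / hc) + 1)"

lemma KN_pos: "0 < KN"
  using KF(1) hc(1) by (simp add: KN_def add_pos_pos)

text \<open>Numerator and denominator are both of the order of \<open>exp (- lam * (t + u))\<close>
  by the Harnack inequality, with Lipschitz constants of the same order, so the dependence on
  \<open>u\<close> cancels in the quotient.\<close>

lemma ratio_lipschitz:
  assumes t: "t \<in> I" and u: "u \<in> I" and l: "0 \<le> l" and f: "lipb l b f"
  shows "\<bar>S t (\<lambda>z. h u z * f z) x / h (t + u) x - S t (\<lambda>z. h u z * f z) y / h (t + u) y\<bar>
     \<le> KN * (exp (- \<gamma> * t) * l + b) * dist x y"
proof -
  have b0: "0 \<le> b" by (rule order_trans[OF lipbD(1)[OF f] lipbD(2)[OF f]])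
  have tu: "t + u \<in> I" using t u by (rule I_add)
  note hf = lipb_mult[OF h_lipb[OF u] f]
  have l': "0 \<le> KF * exp (- lam * u) * b + exp (- lam * u) / hc * l" using KF(1) b0 l hc(1) by simp
  define E where "E = exp (- lam * (t + u))"
  have E: "0 < E" "exp (- lam * t) * exp (- lam * u) = E" by (auto simp: E_def algebra_simps simp flip: exp_add)
  let ?A = "S t (\<lambda>z. h u z * f z)" and ?B = "h (t + u)"
  have B0: "0 < ?B z" "hc * E \<le> ?B z" for z unfolding E_def by (rule h_pos[OF tu], rule hc(2)[OF tu])
  have A: "\<bar>?A x - ?A y\<bar> \<le> KF * E * (1 / hc + (KF + 1 / hc)) * (exp (- \<gamma> * t) * l + b) * dist x y"
  proof -
    have "\<bar>?A x - ?A y\<bar> \<le> KF * exp (- lam * t) * (exp (- \<gamma> * t) * (KF * exp (- lam * u) * b + exp (- lam * u) / hc * l)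
        + exp (- lam * u) / hc * b) * dist x y"
      by (rule KF(2)[OF t l' hf])
    also have "\<dots> = KF * E * (exp (- \<gamma> * t) * (KF * b + 1 / hc * l) + 1 / hc * b) * dist x y"
      unfolding E(2)[symmetric] by (simp add: algebra_simps)
    also have "\<dots> \<le> KF * E * ((1 / hc + (KF + 1 / hc)) * (exp (- \<gamma> * t) * l + b)) * dist x y"
    proof (intro mult_right_mono mult_left_mono)
      have "exp (- \<gamma> * t) * (KF * b + i * l) + i * b \<le> (i + (KF + i)) * (exp (- \<gamma> * t) * l + b)" if i: "0 \<le> i" for i
      proof -
        have "exp (- \<gamma> * t) * (KF * b) \<le> 1 * (KF * b)"
          using \<gamma>_pos I_nonneg[OF t] KF(1) b0 by (intro mult_right_mono) auto
        moreover have "0 \<le> i * b" "0 \<le> (KF + i) * (exp (- \<gamma> * t) * l)" using i KF(1) l b0 by auto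
        ultimately show ?thesis by (simp add: algebra_simps)
      qed
      from this[of "1 / hc"] hc(1)
      show "exp (- \<gamma> * t) * (KF * b + 1 / hc * l) + 1 / hc * b \<le> (1 / hc + (KF + 1 / hc)) * (exp (- \<gamma> * t) * l + b)"
        by simp
    qed (use KF(1) E(1) in auto)
    finally show ?thesis by (simp only: mult.assoc)
  qed
  have B: "\<bar>?B y - ?B x\<bar> \<le> KF * E * dist x y"
    using lipbD(3)[OF h_lipb[OF tu], of y x] by (simp add: E_def dist_commute)
  have G: "0 \<le> ?A y / ?B y" "?A y / ?B y \<le> b"
  proof -
    show "0 \<le> ?A y / ?B y" using S_nonneg[OF lipbD(1)[OF hf]] B0(1)[of y] by auto
    have "?A y \<le> S t (\<lambda>z. b * h u z) y"
    proof (rule S_mono)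
      show "\<bar>h u x * f x\<bar> \<le> exp (- lam * u) / hc * b" for x using lipbD(1,2)[OF hf, of x] by simp
      show "\<bar>b * h u x\<bar> \<le> b * 1" for x
        unfolding abs_mult using h_abs_le[OF u] b0 by (intro mult_mono) auto
      show "h u x * f x \<le> b * h u x" for x
        using mult_left_mono[OF lipbD(2)[OF f, of x] less_imp_le[OF h_pos[OF u, of x]]] by (simp add: mult.commute)
    qed (use lipb_measurable[OF hf] h_measurable[OF u] t in auto)
    also have "\<dots> = b * ?B y" unfolding S_cmult using S_semigroup[OF t u lipb_one, of y] by simp
    finally show "?A y / ?B y \<le> b" using B0(1)[of y] by (simp add: divide_le_eq)
  qed
  have Gabs: "\<bar>?A y / ?B y * D\<bar> = ?A y / ?B y * \<bar>D\<bar>" for D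
    by (simp only: abs_mult abs_of_nonneg[OF G(1)])
  have "?A x / ?B x - ?A y / ?B y = (?A x - ?A y) / ?B x + ?A y / ?B y * ((?B y - ?B x) / ?B x)"
    using B0(1)[of x] B0(1)[of y] by (simp add: field_simps)
  hence "\<bar>?A x / ?B x - ?A y / ?B y\<bar> \<le> \<bar>?A x - ?A y\<bar> / ?B x + ?A y / ?B y * (\<bar>?B y - ?B x\<bar> / ?B x)"
    using abs_triangle_ineq[of "(?A x - ?A y) / ?B x" "?A y / ?B y * ((?B y - ?B x) / ?B x)"]
    unfolding Gabs abs_divide[of _ "?B x"] abs_of_pos[OF B0(1)] by simp
  also have "\<dots> \<le> (KF * E * (1 / hc + (KF + 1 / hc)) * (exp (- \<gamma> * t) * l + b) * dist x y) / (hc * E)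
       + b * ((KF * E * dist x y) / (hc * E))"
    using A B G B0 hc(1) E(1) l b0 KF(1)
      by (intro add_mono mult_mono frac_le) (auto simp: B0(1) less_imp_le intro!: divide_nonneg_pos)
  also have "\<dots> = KF / hc * (1 / hc + (KF + 1 / hc)) * (exp (- \<gamma> * t) * l + b) * dist x y + KF / hc * b * dist x y"
    using E(1) hc(1) by (simp add: mult_ac)
  also have "\<dots> \<le> KF / hc * (1 / hc + (KF + 1 / hc)) * (exp (- \<gamma> * t) * l + b) * dist x y + KF / hc *
    (exp (- \<gamma> * t) * l + b) * dist x y"
    using KF(1) hc(1) l by (intro add_left_mono mult_right_mono mult_left_mono) auto
  also have "\<dots> = KN * (exp (- \<gamma> * t) * l + b) * dist x y" by (simp add: KN_def algebra_simps)
  finally show ?thesis .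
qed

text \<open>The minorization with weight function \<open>h u\<close>. The three factors
  \<open>hc\<close> come from the lower bounds on \<open>h u\<close> and \<open>h t x\<close> and
  from the upper bound on \<open>h (t + u)\<close>; the exponentials in \<open>u\<close> cancel, so
  \<open>c\<close> is uniform in \<open>u\<close>.\<close>

lemma ratio_osc:
  assumes t: "t \<in> I" and u: "u \<in> I" and l: "0 \<le> l" and f: "lipb l b f"
  defines "c \<equiv> hc ^ 3 * exp (- R * t)"
  shows "S t (\<lambda>z. h u z * f z) x / h (t + u) x - S t (\<lambda>z. h u z * f z) y / h (t + u) y
     \<le> (1 - c) * b + c * (l * (CA * exp (- \<gamma> * t) * dist x y))"
proof -
  have tu: "t + u \<in> I" using t u by (rule I_add)
  have hu: "S t (h u) z = h (t + u) z" for z using S_semigroup[OF t u lipb_one, of z] by simp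
  define E where "E = exp (- lam * (t + u))"
  have E: "0 < E" "exp (- lam * t) * exp (- lam * u) = E" by (auto simp: E_def algebra_simps simp flip: exp_add)
  have e1: "exp (- R * t) \<le> 1" using R_nonneg I_nonneg[OF t] by simp
  have c1: "c * h (t + u) z \<le> hc ^ 2 * exp (- R * t) * E" for z
  proof -
    have "hc ^ 2 * exp (- R * t) * (hc * h (t + u) z) \<le> hc ^ 2 * exp (- R * t) * E"
      using hc(1) hc(3)[OF tu, of z] by (intro mult_left_mono) (auto simp: E_def)
    thus ?thesis by (simp add: c_def power2_eq_square power3_eq_cube mult_ac)
  qed
  have c2: "hc ^ 2 * E \<le> hc * exp (- lam * u) * h t x"
  proof -
    have "hc * exp (- lam * u) * (hc * exp (- lam * t)) \<le> hc * exp (- lam * u) * h t x"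
      using hc(1) hc(2)[OF t, of x] by (intro mult_left_mono) auto
    thus ?thesis by (simp add: power2_eq_square E(2)[symmetric] mult_ac)
  qed
  have "S t (\<lambda>z. h u z * f z) x / S t (h u) x - S t (\<lambda>z. h u z * f z) y / S t (h u) y
     \<le> (1 - c) * b + c * (l * (CA * exp (- \<gamma> * t) * dist x y))"
  proof (rule far_contraction[OF t h_lipb[OF u] _ hc(2)[OF u] f l])
    show "0 < hc * exp (- lam * u)" "0 \<le> c" using hc(1) by (auto simp: c_def)
    have "hc ^ 2 * exp (- R * t) * E \<le> hc ^ 2 * 1 * E" using e1 hc(1) E(1) by (intro mult_right_mono mult_left_mono) auto
    thus "c * S t (h u) x \<le> hc * exp (- lam * u) * h t x" using c1[of x] c2 by (simp add: hu)
    have "exp (- R * t) * (hc ^ 2 * E) \<le> exp (- R * t) * (hc * exp (- lam * u) * h t x)" using c2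
      by (intro mult_left_mono) auto
    moreover have "c * h (t + u) y \<le> exp (- R * t) * (hc ^ 2 * E)" using c1[of y] by (simp add: mult_ac)
    ultimately have "c * h (t + u) y \<le> exp (- R * t) * (hc * exp (- lam * u) * h t x)" by linarith
    thus "c * S t (h u) y \<le> exp (- R * t) * (hc * exp (- lam * u)) * h t x" by (simp only: hu mult.assoc)
    show "0 < S t (h u) x" "0 < S t (h u) y" unfolding hu by (rule h_pos[OF tu])+
  qed
  thus ?thesis by (simp only: hu)
qed

text \<open>The ball of radius \<open>v\<close> for the seminorm that takes the larger of the
  oscillation and 1 / A times the Lipschitz constant. It ignores additive constants.\<close>

definition cone :: "real \<Rightarrow> real \<Rightarrow> ('e \<Rightarrow> real) \<Rightarrow> bool" where
  "cone A v g \<longleftrightarrow> (\<forall>x y. \<bar>g x - g y\<bar> \<le> v \<and> \<bar>g x - g y\<bar> \<le> A * v * dist x y)"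

lemma cone_shift:
  assumes "cone A v g"
  obtains a f where "lipb (A * v) v f" "g = (\<lambda>x. f x + a)"
proof
  have d: "\<bar>g x - g y\<bar> \<le> v" "\<bar>g x - g y\<bar> \<le> A * v * dist x y" for x y
    using assms by (auto simp: cone_def)
  have bdd: "bdd_below (range g)"
  proof (rule bdd_belowI2)
    show "g undefined - v \<le> g x" for x using d(1)[of undefined x] by linarith
  qed
  define a where "a = (INF x. g x)"
  have a1: "a \<le> g x" for x unfolding a_def using bdd by (rule cINF_lower) simp
  have a2: "g x - v \<le> a" for x unfolding a_def
  proof (rule cINF_greatest)
    show "g x - v \<le> g y" for y using d(1)[of x y] by linarith
  qed simp
  show "lipb (A * v) v (\<lambda>x. g x - a)" unfolding lipb_def
    using a1 a2 d(2) by (auto simp: algebra_simps)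
  show "g = (\<lambda>x. (g x - a) + a)" by simp
qed

text \<open>The conditioned kernels have total mass one by the semigroup property, so they preserve
  constants and may be studied modulo them.\<close>

lemma weighted_shift:
  assumes t: "t \<in> I" and u: "u \<in> I" and f: "lipb l b f"
  shows "S t (\<lambda>z. h u z * (f z + a)) x / h (t + u) x = S t (\<lambda>z. h u z * f z) x / h (t + u) x + a"
proof -
  note hf = lipb_mult[OF h_lipb[OF u] f]
  have "S t (\<lambda>z. h u z * (f z + a)) x = S t (\<lambda>z. h u z * f z + a * h u z) x" by (simp add: algebra_simps)
  also have "\<dots> = S t (\<lambda>z. h u z * f z) x + S t (\<lambda>z. a * h u z) x"
  proof (rule S_add)
    show "\<bar>h u x * f x\<bar> \<le> exp (- lam * u) / hc * b" for x using lipbD(1,2)[OF hf, of x] by simp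
    show "\<bar>a * h u x\<bar> \<le> \<bar>a\<bar> * 1" for x unfolding abs_mult using h_abs_le[OF u] by (intro mult_mono) auto
  qed (use lipb_measurable[OF hf] h_measurable[OF u] t in auto)
  also have "S t (\<lambda>z. a * h u z) x = a * h (t + u) x"
    unfolding S_cmult using S_semigroup[OF t u lipb_one, of x] by simp
  finally show ?thesis using h_pos[OF I_add[OF t u], of x] by (simp add: add_divide_distrib)
qed

text \<open>The order of the choices matters: \<open>A\<close> depends on the Lipschitz estimate
  alone, \<open>n\<close> on \<open>A\<close>, and the minorization constant on \<open>n\<close>.
  None of them depends on \<open>u\<close>, so the inhomogeneous kernels can be composed.\<close>

lemma contraction:
  "\<exists>A>0. \<exists>\<kappa>. 0 < \<kappa> \<and> \<kappa> < 1 \<and> (\<exists>n\<ge>1. \<forall>u\<in>I. \<forall>g v. cone A v g \<longrightarrow>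
     cone A (\<kappa> * v) (\<lambda>x. S (real n) (\<lambda>z. h u z * g z) x / h (real n + u) x))"
proof -
  \<comment> \<open>Once \<open>n\<close> makes e^(-\<gamma> n) * A at most 1, the new Lipschitz
    constant is at most 2 * KN * v, which is half of \<open>A * v\<close>.\<close>
  define A where "A = 4 * KN"
  have A: "0 < A" using KN_pos by (simp add: A_def)
  have "(\<lambda>n. exp (- \<gamma>) ^ n) \<longlonglongrightarrow> 0" using \<gamma>_pos by (intro LIMSEQ_power_zero) auto
  hence lim: "(\<lambda>n. exp (- \<gamma> * real n)) \<longlonglongrightarrow> 0" by (simp flip: exp_of_nat_mult add: mult.commute)
  have "(\<lambda>n. exp (- \<gamma> * real n) * A) \<longlonglongrightarrow> 0 * A" "(\<lambda>n. A * CA * dbar * exp (- \<gamma> * real n)) \<longlonglongrightarrow> A * CA * dbar * 0"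
    by (intro tendsto_intros lim)+
  from order_tendstoD(2)[OF this(1), of 1] order_tendstoD(2)[OF this(2), of "1 / 2"]
  have "eventually (\<lambda>n. exp (- \<gamma> * real n) * A < 1) sequentially"
    "eventually (\<lambda>n. A * CA * dbar * exp (- \<gamma> * real n) < 1 / 2) sequentially"
    by simp_all
  hence "eventually (\<lambda>n. exp (- \<gamma> * real n) * A < 1 \<and> A * CA * dbar * exp (- \<gamma> * real n) < 1 / 2 \<and> 1 \<le> n) sequentially"
    using eventually_ge_at_top[of 1] by (intro eventually_conj) auto
  then obtain n where n: "exp (- \<gamma> * real n) * A < 1" "A * CA * dbar * exp (- \<gamma> * real n) < 1 / 2" "1 \<le> n"
    by (auto simp: eventually_sequentially)
  define c where "c = hc ^ 3 * exp (- R * real n)"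
  have c: "0 < c" "c \<le> 1"
  proof -
    show "0 < c" using hc(1) by (simp add: c_def)
    have "hc ^ 3 * exp (- R * real n) \<le> 1 * 1"
      using hc(1) hc_le_1 R_nonneg by (intro mult_mono power_le_one) auto
    thus "c \<le> 1" by (simp add: c_def)
  qed
  \<comment> \<open>The Lipschitz part contributes 1 / 2. In the oscillation part the common mass
    \<open>c\<close> contributes at most c * v / 2, because the coupled distance is small at time
    \<open>n\<close>, and the rest (1 - c) * v.\<close>
  define \<kappa> where "\<kappa> = max (1 / 2) (1 - c / 2)"
  have \<kappa>: "0 < \<kappa>" "\<kappa> < 1" "1 / 2 \<le> \<kappa>" "1 - c / 2 \<le> \<kappa>" using c by (auto simp: \<kappa>_def)
  have "cone A (\<kappa> * v) (\<lambda>x. S (real n) (\<lambda>z. h u z * g z) x / h (real n + u) x)"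
    if u: "u \<in> I" and g: "cone A v g" for u g v
  proof -
    obtain a f where f: "lipb (A * v) v f" and Ff: "g = (\<lambda>x. f x + a)" using g by (rule cone_shift)
    have v: "0 \<le> v" by (rule order_trans[OF lipbD(1)[OF f] lipbD(2)[OF f]])
    have l: "0 \<le> A * v" using A v by simp
    let ?G = "\<lambda>x. S (real n) (\<lambda>z. h u z * f z) x / h (real n + u) x"
    have G: "S (real n) (\<lambda>z. h u z * g z) x / h (real n + u) x = ?G x + a" for x
      unfolding Ff by (rule weighted_shift[OF I_of_nat u f])
    have osc: "?G x - ?G y \<le> \<kappa> * v" for x y
    proof -
      have "?G x - ?G y \<le> (1 - c) * v + c * (A * v * (CA * exp (- \<gamma> * real n) * dist x y))"
        unfolding c_def by (rule ratio_osc[OF I_of_nat u l f])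
      also have "A * v * (CA * exp (- \<gamma> * real n) * dist x y) \<le> A * v * (CA * exp (- \<gamma> * real n) * dbar)"
        using l CA_pos dist_le by (intro mult_left_mono) auto
      also have "\<dots> = v * (A * CA * dbar * exp (- \<gamma> * real n))" by simp
      also have "\<dots> \<le> v * (1 / 2)" using n(2) v by (intro mult_left_mono) auto
      finally have "?G x - ?G y \<le> (1 - c) * v + c * (v * (1 / 2))" using c by (simp add: mult_left_mono)
      also have "\<dots> = (1 - c / 2) * v" by (simp add: algebra_simps)
      also have "\<dots> \<le> \<kappa> * v" using \<kappa> v by (intro mult_right_mono)
      finally show ?thesis .
    qed
    have lip: "\<bar>?G x - ?G y\<bar> \<le> A * (\<kappa> * v) * dist x y" for x y
    proof -
      have "\<bar>?G x - ?G y\<bar> \<le> KN * (exp (- \<gamma> * real n) * (A * v) + v) * dist x y"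
        by (rule ratio_lipschitz[OF I_of_nat u l f])
      also have "\<dots> \<le> KN * (2 * v) * dist x y"
      proof (intro mult_right_mono mult_left_mono)
        have "exp (- \<gamma> * real n) * A * v \<le> 1 * v" using n(1) v by (intro mult_right_mono) auto
        thus "exp (- \<gamma> * real n) * (A * v) + v \<le> 2 * v" by (simp add: mult.assoc)
      qed (use KN_pos in auto)
      also have "\<dots> = A * (1 / 2 * v) * dist x y" by (simp add: A_def)
      also have "\<dots> \<le> A * (\<kappa> * v) * dist x y" using A \<kappa> v by (intro mult_right_mono mult_left_mono) auto
      finally show ?thesis .
    qed
    show ?thesis unfolding cone_def G
    proof (intro allI conjI)
      fix x y
      show "\<bar>?G x + a - (?G y + a)\<bar> \<le> \<kappa> * v" using osc[of x y] osc[of y x] by (simp add: abs_le_iff)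
      show "\<bar>?G x + a - (?G y + a)\<bar> \<le> A * (\<kappa> * v) * dist x y" using lip[of x y] by simp
    qed
  qed
  thus ?thesis using A \<kappa>(1,2) n(3) by blast
qed

text \<open>The kernel from \<open>u\<close> to \<open>n + u\<close> maps the conditioned
  expectation at horizon \<open>u\<close> to that at horizon \<open>n + u\<close>; iterating the
  contraction therefore gives geometric decay of its oscillation.\<close>

lemma osc_decay:
  "\<exists>K>0. \<exists>\<delta>>0. \<forall>t\<in>I. \<forall>f l b x y. 0 \<le> l \<longrightarrow> lipb l b f \<longrightarrow>
     \<bar>S t f x / h t x - S t f y / h t y\<bar> \<le> K * (l + b) * exp (- \<delta> * t)"
proof -
  obtain A \<kappa> n where A: "0 < A" and \<kappa>: "0 < \<kappa>" "\<kappa> < 1" and n: "1 \<le> n"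
    and con: "\<And>u g v. u \<in> I \<Longrightarrow> cone A v g \<Longrightarrow>
     cone A (\<kappa> * v) (\<lambda>x. S (real n) (\<lambda>z. h u z * g z) x / h (real n + u) x)"
    using contraction by blast
  define \<delta> where "\<delta> = - ln \<kappa> / real n"
  have \<delta>: "0 < \<delta>" using \<kappa> n by (simp add: \<delta>_def divide_neg_pos)
  have \<delta>n: "exp (- \<delta> * real n) = \<kappa>" using \<kappa> n by (simp add: \<delta>_def)
  \<comment> \<open>The exponential compensates for the time \<open>r \<le> n\<close> at which the
    iteration starts.\<close>
  define K where "K = (1 + KN / A) * exp (\<delta> * real n)"
  have K: "0 < K" using KN_pos A by (auto simp: K_def intro!: mult_pos_pos add_pos_pos)
  have main: "\<bar>S t f x / h t x - S t f y / h t y\<bar> \<le> K * (l + b) * exp (- \<delta> * t)"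
    if t: "t \<in> I" and l: "0 \<le> l" and f: "lipb l b f" for t f l b x y
  proof -
    have b0: "0 \<le> b" by (rule order_trans[OF lipbD(1)[OF f] lipbD(2)[OF f]])
    \<comment> \<open>A radius that dominates both the bound \<open>b\<close> on the values and KN *
      (l + b) / A, so that every starting function of the iteration lies in the ball.\<close>
    define v0 where "v0 = (1 + KN / A) * (l + b)"
    have *: "cone A (\<kappa> ^ j * v0) (\<lambda>x. S (r + real (j * n)) f x / h (r + real (j * n)) x)" if r: "r \<in> I" for r j
    proof (induction j)
      case 0
      have "\<bar>S r (\<lambda>z. h 0 z * f z) x / h (r + 0) x - S r (\<lambda>z. h 0 z * f z) y / h (r + 0) y\<bar>
         \<le> KN * (exp (- \<gamma> * r) * l + b) * dist x y" for x y
        by (rule ratio_lipschitz[OF r I_0 l f])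
      hence lip: "\<bar>S r f x / h r x - S r f y / h r y\<bar> \<le> KN * (exp (- \<gamma> * r) * l + b) * dist x y" for x y
        by (simp add: S_0)
      have N: "0 \<le> S r f x / h r x" "S r f x / h r x \<le> b" for x
        using S_nonneg[OF lipbD(1)[OF f]] h_pos[OF r, of x] S_le[OF f r, of x] by (auto simp: divide_le_eq)
      show ?case unfolding cone_def
      proof (intro allI conjI)
        fix x y
        have "b \<le> v0" using b0 l KN_pos A by (simp add: v0_def distrib_right)
        thus "\<bar>S (r + real (0 * n)) f x / h (r + real (0 * n)) x - S (r + real (0 * n)) f y / h (r + real (0 * n))
          y\<bar> \<le> \<kappa> ^ 0 * v0"
          using N[of x] N[of y] by simp
        have "KN * (exp (- \<gamma> * r) * l + b) * dist x y \<le> A * v0 * dist x y"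
        proof (rule mult_right_mono)
          have "exp (- \<gamma> * r) * l \<le> 1 * l" using \<gamma>_pos I_nonneg[OF r] l by (intro mult_right_mono) auto
          hence "KN * (exp (- \<gamma> * r) * l + b) \<le> KN * (l + b)" using KN_pos by (intro mult_left_mono) auto
          also have "\<dots> \<le> A * v0" using A l b0 by (simp add: v0_def distrib_right distrib_left)
          finally show "KN * (exp (- \<gamma> * r) * l + b) \<le> A * v0" .
        qed simp
        thus "\<bar>S (r + real (0 * n)) f x / h (r + real (0 * n)) x - S (r + real (0 * n)) f y / h (r + real (0 * n)) y\<bar>
          \<le> A * (\<kappa> ^ 0 * v0) * dist x y"
          using lip[of x y] by simp
      qed
    next
      case (Suc j)
      let ?u = "r + real (j * n)"
      have u: "?u \<in> I" by (rule I_add[OF r I_of_nat])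
      have "S (real n) (\<lambda>z. h ?u z * (S ?u f z / h ?u z)) x / h (real n + ?u) x
        = S (r + real (Suc j * n)) f x / h (r + real (Suc j * n)) x" for x
      proof -
        have "h ?u z * (S ?u f z / h ?u z) = S ?u f z" for z using h_pos[OF u, of z] by simp
        hence "S (real n) (\<lambda>z. h ?u z * (S ?u f z / h ?u z)) x = S (real n) (S ?u f) x" by (simp only:)
        also have "\<dots> = S (real n + ?u) f x" by (rule S_semigroup[OF I_of_nat u f, symmetric])
        also have eq: "real n + ?u = r + real (Suc j * n)" by simp
        finally show ?thesis unfolding eq by (simp only:)
      qed
      with con[OF u Suc.IH] show ?case by (simp add: mult.assoc)
    qed
    obtain m r0 where mr: "t = real m + r0" "r0 \<in> I" "0 \<le> r0" "r0 < 1" using I_decompose[OF t] by blast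
    define j where "j = m div n"
    define r where "r = r0 + real (m mod n)"
    have r: "r \<in> I" unfolding r_def by (rule I_add[OF mr(2) I_of_nat])
    have "m = j * n + m mod n" unfolding j_def by simp
    hence "real m = real (j * n) + real (m mod n)" by (simp only: of_nat_add[symmetric])
    hence tr: "t = r + real (j * n)" by (simp add: mr(1) r_def)
    have "m mod n + 1 \<le> n" using n mod_less_divisor[of n m] by linarith
    hence "real (m mod n + 1) \<le> real n" by (simp only: of_nat_le_iff)
    hence rn: "r \<le> real n" using mr(4) by (simp add: r_def)
    have "\<bar>S t f x / h t x - S t f y / h t y\<bar> \<le> \<kappa> ^ j * v0"
      using *[OF r, of j] unfolding tr cone_def by blast
    also have "\<kappa> ^ j = exp (- \<delta> * t) * exp (\<delta> * r)"
      unfolding \<delta>n[symmetric] by (simp add: tr algebra_simps flip: exp_add exp_of_nat_mult)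
    also have "exp (- \<delta> * t) * exp (\<delta> * r) * v0 \<le> exp (- \<delta> * t) * exp (\<delta> * real n) * v0"
      using rn \<delta> b0 l KN_pos A by (intro mult_right_mono mult_left_mono) (auto simp: v0_def)
    also have "\<dots> = K * (l + b) * exp (- \<delta> * t)" by (simp add: K_def v0_def mult_ac)
    finally show ?thesis .
  qed
  show ?thesis by (intro exI[of _ K] exI[of _ \<delta>] conjI ballI allI impI K \<delta> main)
qed

text \<open>Quasi-stationarity makes the \<open>nu\<close>-average of \<open>f\<close> the average
  of \<open>S t f / h t\<close> with respect to \<open>nu\<close> weighted by \<open>h t\<close>. A
  quantity of small oscillation is close to each of its averages, which identifies the
  limit.\<close>

lemma ratio_converges:
  "\<exists>K>0. \<exists>\<delta>>0. \<forall>t\<in>I. \<forall>f l b x. 0 \<le> l \<longrightarrow> lipb l b f \<longrightarrow>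
     \<bar>S t f x / h t x - (\<integral>z. f z \<partial>nu)\<bar> \<le> K * (l + b) * exp (- \<delta> * t)"
proof -
  from osc_decay obtain K \<delta> where K: "0 < K" "0 < \<delta>" and
    raw: "\<forall>t\<in>I. \<forall>f l b x y. 0 \<le> l \<longrightarrow> lipb l b f \<longrightarrow>
     \<bar>S t f x / h t x - S t f y / h t y\<bar> \<le> K * (l + b) * exp (- \<delta> * t)"
    by (elim exE conjE)
  note osc = raw[rule_format]
  have main: "\<bar>S t f x / h t x - (\<integral>z. f z \<partial>nu)\<bar> \<le> K * (l + b) * exp (- \<delta> * t)"
    if t: "t \<in> I" and l: "0 \<le> l" and f: "lipb l b f" for t f l b x
  proof -
    interpret prob_space nu by (rule prob_nu)
    let ?e = "K * (l + b) * exp (- \<delta> * t)"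
    let ?N = "S t f x / h t x"
    have b0: "0 \<le> b" by (rule order_trans[OF lipbD(1)[OF f] lipbD(2)[OF f]])
    have fb: "bounded (range f)"
      unfolding bounded_iff using lipbD(1,2)[OF f] by (intro exI[of _ b]) auto
    have Sf: "integrable nu (S t f)"
      using lipbD(1,2)[OF S_lipb[OF t l f]] lipb_measurable[OF S_lipb[OF t l f]]
      by (intro nu_integrable[of _ "b * (exp (- lam * t) / hc)"]) auto
    have ih: "integrable nu (h t)" by (rule nu_integrable[OF h_measurable[OF t] h_abs_le[OF t]])
    have pt: "\<bar>?N * h t y - S t f y\<bar> \<le> ?e * h t y" for y
    proof -
      have "?N * h t y - S t f y = (?N - S t f y / h t y) * h t y" using h_pos[OF t, of y] by (simp add: left_diff_distrib)
      thus ?thesis using osc[OF t l f, of x y] h_pos[OF t, of y] by (simp add: abs_mult mult_right_mono)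
    qed
    have "exp (- lam * t) * \<bar>?N - (\<integral>z. f z \<partial>nu)\<bar> = \<bar>?N * exp (- lam * t) - exp (- lam * t) * (\<integral>z. f z \<partial>nu)\<bar>"
    proof -
      have "N * e - e * J = e * (N - J)" for N J e :: real by (simp add: algebra_simps)
      thus ?thesis by (simp only: abs_mult abs_of_pos[OF exp_gt_zero])
    qed
    also have "\<dots> = \<bar>\<integral>y. ?N * h t y - S t f y \<partial>nu\<bar>"
      using Sf ih nu_S[OF t lipb_measurable[OF f] fb] nu_h[OF t] by simp
    also have "\<dots> \<le> (\<integral>y. \<bar>?N * h t y - S t f y\<bar> \<partial>nu)" by (rule integral_abs_bound)
    also have "\<dots> \<le> (\<integral>y. ?e * h t y \<partial>nu)"
      using pt Sf ih by (intro integral_mono) auto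
    also have "\<dots> = exp (- lam * t) * ?e" using nu_h[OF t] by simp
    finally show ?thesis by (simp only: mult_le_cancel_left_pos exp_gt_zero)
  qed
  show ?thesis by (intro exI[of _ K] exI[of _ \<delta>] conjI ballI allI impI K main)
qed

definition KR :: real where
  "KR = (SOME K. 0 < K \<and> (\<exists>\<delta>>0. \<forall>t\<in>I. \<forall>f l b x. 0 \<le> l \<longrightarrow> lipb l b f \<longrightarrow>
     \<bar>S t f x / h t x - (\<integral>z. f z \<partial>nu)\<bar> \<le> K * (l + b) * exp (- \<delta> * t)))"

definition rate :: real where
  "rate = (SOME \<delta>. 0 < \<delta> \<and> (\<forall>t\<in>I. \<forall>f l b x. 0 \<le> l \<longrightarrow> lipb l b f \<longrightarrow>
     \<bar>S t f x / h t x - (\<integral>z. f z \<partial>nu)\<bar> \<le> KR * (l + b) * exp (- \<delta> * t)))"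

lemma KR_pos: "0 < KR"
  and rate_ex: "\<exists>\<delta>>0. \<forall>t\<in>I. \<forall>f l b x. 0 \<le> l \<longrightarrow> lipb l b f \<longrightarrow>
     \<bar>S t f x / h t x - (\<integral>z. f z \<partial>nu)\<bar> \<le> KR * (l + b) * exp (- \<delta> * t)"
  using someI_ex[OF ratio_converges] unfolding KR_def by (rule conjunct1, rule conjunct2)

lemma rate_pos: "0 < rate"
  and ratio_rate_all: "\<forall>t\<in>I. \<forall>f l b x. 0 \<le> l \<longrightarrow> lipb l b f \<longrightarrow>
     \<bar>S t f x / h t x - (\<integral>z. f z \<partial>nu)\<bar> \<le> KR * (l + b) * exp (- rate * t)"
  using someI_ex[OF rate_ex] unfolding rate_def by (rule conjunct1, rule conjunct2)

lemma ratio_rate: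
  assumes "t \<in> I" "0 \<le> l" "lipb l b f"
  shows "\<bar>S t f x / h t x - (\<integral>z. f z \<partial>nu)\<bar> \<le> KR * (l + b) * exp (- rate * t)"
  by (rule ratio_rate_all[rule_format, OF assms])

section \<open>Convergence of the normalised expected penalization\<close>

definition ht :: "real \<Rightarrow> 'e \<Rightarrow> real" where
  "ht t x = exp (lam * t) * h t x"

lemma ht_lipb:
  assumes "t \<in> I"
  shows "lipb KF (1 / hc) (ht t)"
proof -
  have "exp (lam * t) * exp (- lam * t) = 1" by (simp flip: exp_add)
  hence "exp (lam * t) * (c * exp (- lam * t)) = c" "exp (lam * t) * (exp (- lam * t) / c) = 1 / c" for c
    by (simp_all only: mult.left_commute[of "exp (lam * t)" c] mult_1_right times_divide_eq_right)
  moreover have "lipb (exp (lam * t) * (KF * exp (- lam * t))) (exp (lam * t) * (exp (- lam * t) / hc)) (ht t)"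
    unfolding lipb_def ht_def
  proof (intro conjI allI)
    fix x y
    note hl = lipbD[OF h_lipb[OF assms]]
    show "0 \<le> exp (lam * t) * h t x" using hl(1)[of x] by simp
    show "exp (lam * t) * h t x \<le> exp (lam * t) * (exp (- lam * t) / hc)" by (intro mult_left_mono hl(2)) simp
    have "\<bar>exp (lam * t) * h t x - exp (lam * t) * h t y\<bar> = exp (lam * t) * \<bar>h t x - h t y\<bar>"
      by (simp add: abs_mult flip: right_diff_distrib)
    also have "\<dots> \<le> exp (lam * t) * (KF * exp (- lam * t) * dist x y)" by (intro mult_left_mono hl(3)) simp
    finally show "\<bar>exp (lam * t) * h t x - exp (lam * t) * h t y\<bar> \<le> exp (lam * t) * (KF * exp (- lam * t)) * dist x y"
      by (simp add: mult.assoc)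
  qed
  ultimately show ?thesis by (simp only:)
qed

lemma ht_ge:
  assumes "t \<in> I"
  shows "hc \<le> ht t x"
proof -
  have "exp (lam * t) * (hc * exp (- lam * t)) \<le> ht t x"
    unfolding ht_def by (intro mult_left_mono hc(2) assms) simp
  moreover have "exp (lam * t) * exp (- lam * t) = 1" by (simp flip: exp_add)
  ultimately show ?thesis by (simp add: mult.left_commute[of "exp (lam * t)"])
qed

lemma nu_ht: "t \<in> I \<Longrightarrow> (\<integral>x. ht t x \<partial>nu) = 1"
  by (simp add: ht_def nu_h flip: exp_add)

definition KE :: real where
  "KE = KR * (KF + 1 / hc) / hc"

lemma KE_pos: "0 < KE"
  using KR_pos KF(1) hc(1) by (simp add: KE_def add_pos_pos)

text \<open>Test the convergence of the ratios on \<open>ht u\<close> itself: its conditioned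
  expectation at time \<open>t\<close> is \<open>ht (t + u) / ht t\<close> by the semigroup
  property, and its \<open>nu\<close>-average is 1.\<close>

lemma ht_cauchy:
  assumes t: "t \<in> I" and u: "u \<in> I"
  shows "\<bar>ht (t + u) x / ht t x - 1\<bar> \<le> KR * (KF + 1 / hc) * exp (- rate * t)"
    and "\<bar>ht (t + u) x - ht t x\<bar> \<le> KE * exp (- rate * t)"
proof -
  have "S t (ht u) x / h t x = ht (t + u) x / ht t x"
  proof -
    have "S t (ht u) x = exp (lam * u) * h (t + u) x"
      unfolding ht_def S_cmult using S_semigroup[OF t u lipb_one, of x] by simp
    thus ?thesis by (simp add: ht_def distrib_left exp_add)
  qed
  with ratio_rate[OF t _ ht_lipb[OF u], of x] KF(1) nu_ht[OF u]
  show *: "\<bar>ht (t + u) x / ht t x - 1\<bar> \<le> KR * (KF + 1 / hc) * exp (- rate * t)" by simp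
  have p: "0 < ht t x" using ht_ge[OF t, of x] hc(1) by linarith
  have "ht (t + u) x - ht t x = (ht (t + u) x / ht t x - 1) * ht t x" using p by (simp add: left_diff_distrib)
  hence "\<bar>ht (t + u) x - ht t x\<bar> = \<bar>ht (t + u) x / ht t x - 1\<bar> * ht t x" using p by (simp add: abs_mult)
  also have "\<dots> \<le> (KR * (KF + 1 / hc) * exp (- rate * t)) * (1 / hc)"
    using * lipbD(2)[OF ht_lipb[OF t], of x] p KR_pos KF(1) hc(1) by (intro mult_mono) auto
  finally show "\<bar>ht (t + u) x - ht t x\<bar> \<le> KE * exp (- rate * t)" by (simp add: KE_def)
qed

text \<open>A limit is first found along the integers; comparing an arbitrary time with later
  integers extends both the limit and the rate to all of \<open>I\<close>.\<close>

lemma ht_eta: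
  assumes t: "t \<in> I"
  shows "\<bar>ht t x - eta I \<rho> P X lam x\<bar> \<le> KE * exp (- rate * t)"
proof -
  have lim: "(\<lambda>n. KE * exp (- rate) ^ n) \<longlonglongrightarrow> KE * 0"
    using rate_pos by (intro tendsto_intros LIMSEQ_power_zero) auto
  have e: "KE * exp (- rate * real n) = KE * exp (- rate) ^ n" for n
    by (simp add: mult.commute flip: exp_of_nat_mult)
  have "Cauchy (\<lambda>n. ht (real n) x)"
  proof (rule metric_CauchyI)
    fix d :: real assume "0 < d"
    have "eventually (\<lambda>n. KE * exp (- rate) ^ n < d) sequentially"
      using order_tendstoD(2)[OF lim, of d] \<open>0 < d\<close> by simp
    then obtain n0 where n0: "\<And>n. n0 \<le> n \<Longrightarrow> KE * exp (- rate) ^ n < d" by (auto simp: eventually_sequentially)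
    have *: "dist (ht (real m) x) (ht (real n) x) < d" if "n0 \<le> m" "m \<le> n" for m n
    proof -
      have "\<bar>ht (real m + real (n - m)) x - ht (real m) x\<bar> < d"
        using ht_cauchy(2)[OF I_of_nat I_of_nat, of m "n - m" x] n0[OF that(1)] unfolding e by linarith
      thus ?thesis using that(2) by (simp add: dist_real_def abs_minus_commute of_nat_diff)
    qed
    show "\<exists>n0. \<forall>m\<ge>n0. \<forall>n\<ge>n0. dist (ht (real m) x) (ht (real n) x) < d"
    proof (intro exI allI impI)
      fix m n assume "n0 \<le> m" "n0 \<le> n"
      thus "dist (ht (real m) x) (ht (real n) x) < d"
        using *[of m n] *[of n m] by (cases "m \<le> n") (auto simp: dist_commute)
    qed
  qed
  then obtain g where g: "(\<lambda>n. ht (real n) x) \<longlonglongrightarrow> g" using Cauchy_convergent convergent_def by blast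
  have bound: "\<bar>ht s x - g\<bar> \<le> KE * exp (- rate * s)" if s: "s \<in> I" for s
  proof (rule tendsto_upperbound)
    show "(\<lambda>n. \<bar>ht s x - ht (real n) x\<bar>) \<longlonglongrightarrow> \<bar>ht s x - g\<bar>" by (intro tendsto_intros g)
    show "eventually (\<lambda>n. \<bar>ht s x - ht (real n) x\<bar> \<le> KE * exp (- rate * s)) sequentially"
    proof (rule eventually_sequentiallyI)
      fix n assume "nat \<lceil>s\<rceil> \<le> n"
      hence "s \<le> real n" using I_nonneg[OF s] by linarith
      \<comment> \<open>Closure of \<open>I\<close> under differences is what allows integer times
        to be reached from \<open>s\<close>.\<close>
      hence "real n - s \<in> I" by (rule I_diff[OF s I_of_nat])
      from ht_cauchy(2)[OF s this, of x] show "\<bar>ht s x - ht (real n) x\<bar> \<le> KE * exp (- rate * s)"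
        by (simp add: abs_minus_commute)
    qed
  qed simp
  let ?F = "inf at_top (principal I)"
  have ev: "eventually (\<lambda>t. t \<in> I) ?F" by (simp add: eventually_inf_principal)
  have "((\<lambda>t. KE * exp (- rate * t)) \<longlongrightarrow> 0) at_top"
  proof -
    have "filterlim (\<lambda>t. rate * t) at_top at_top"
      using rate_pos by (intro filterlim_tendsto_pos_mult_at_top[OF tendsto_const] filterlim_ident)
    hence "filterlim (\<lambda>t. - (rate * t)) at_bot at_top" by (simp add: filterlim_uminus_at_bot)
    from filterlim_compose[OF exp_at_bot this] have "((\<lambda>t. exp (- (rate * t))) \<longlongrightarrow> 0) at_top" .
    from tendsto_mult_right_zero[OF this, of KE] show ?thesis by simp
  qed
  hence "((\<lambda>t. KE * exp (- rate * t)) \<longlongrightarrow> 0) ?F" by (rule tendsto_mono[rotated]) simp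
  hence "((\<lambda>t. ht t x - g) \<longlongrightarrow> 0) ?F"
    by (rule Lim_null_comparison[rotated]) (use ev bound in \<open>auto elim: eventually_mono\<close>)
  hence "((\<lambda>t. ht t x) \<longlongrightarrow> g) ?F" by (simp add: Lim_null[symmetric])
  hence "((\<lambda>t. exp (lam * t) * expected_penalization I \<rho> P X t x) \<longlongrightarrow> g) ?F"
    by (rule Lim_transform_eventually) (use ev in eventually_elim, simp add: ht_def expected_penalization_eq)
  \<comment> \<open>\<open>Lim\<close> has a meaningful value only along a nontrivial filter; here
    this amounts to \<open>I\<close> being unbounded.\<close>
  moreover have "?F \<noteq> bot"
  proof
    assume "?F = bot"
    hence "eventually (\<lambda>_. False) ?F" by simp
    hence "eventually (\<lambda>t. t \<notin> I) at_top" by (simp add: eventually_inf_principal)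
    then obtain a where a: "\<And>t. a \<le> t \<Longrightarrow> t \<notin> I" by (auto simp: eventually_at_top_linorder)
    have "a \<le> real (nat \<lceil>a\<rceil>)" by linarith
    from a[OF this] show False by simp
  qed
  ultimately have "eta I \<rho> P X lam x = g" unfolding eta_def by (intro tendsto_Lim)
  thus ?thesis using bound[OF t] by simp
qed

section \<open>Penalized occupation measures\<close>

abbreviation et :: "'e \<Rightarrow> real" where
  "et \<equiv> eta I \<rho> P X lam"

section \<open>The limiting function and its integrals\<close>

lemma ht_tendsto_et: "(\<lambda>n. ht (real n) x) \<longlonglongrightarrow> et x"
proof -
  have eq: "(\<lambda>n. KE * exp (- rate * real n)) = (\<lambda>n. KE * exp (- rate) ^ n)"
    by (simp add: mult.commute flip: exp_of_nat_mult)
  have "(\<lambda>n. KE * exp (- rate) ^ n) \<longlonglongrightarrow> KE * 0"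
    using rate_pos by (intro tendsto_intros LIMSEQ_power_zero) auto
  hence "(\<lambda>n. KE * exp (- rate * real n)) \<longlonglongrightarrow> 0" unfolding eq by simp
  hence "(\<lambda>n. ht (real n) x - et x) \<longlonglongrightarrow> 0"
    by (rule Lim_null_comparison[rotated]) (use ht_eta[OF I_of_nat] in auto)
  thus ?thesis by (simp add: LIM_zero_iff)
qed

lemma et_measurable [measurable]: "et \<in> borel_measurable borel"
  by (rule borel_measurable_LIMSEQ_real[OF ht_tendsto_et lipb_measurable[OF ht_lipb[OF I_of_nat]]])

lemma et_bounds: "0 \<le> et x" "et x \<le> 1 / hc"
proof -
  show "0 \<le> et x"
    by (rule LIMSEQ_le_const[OF ht_tendsto_et]) (use lipbD(1)[OF ht_lipb[OF I_of_nat]] in auto)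
  show "et x \<le> 1 / hc"
    by (rule LIMSEQ_le_const2[OF ht_tendsto_et]) (use lipbD(2)[OF ht_lipb[OF I_of_nat]] in auto)
qed

lemma integral_ht_et:
  assumes u: "u \<in> I" and f: "f \<in> borel_measurable borel" "\<And>x. 0 \<le> f x" "\<And>x. f x \<le> b"
  shows "\<bar>(\<integral>x. f x * ht u x \<partial>nu) - (\<integral>x. f x * et x \<partial>nu)\<bar> \<le> b * (KE * exp (- rate * u))"
proof -
  interpret prob_space nu by (rule prob_nu)
  have b0: "0 \<le> b" using f(2,3) order_trans by blast
  have hb: "0 \<le> ht u x" "ht u x \<le> 1 / hc" for x using lipbD(1,2)[OF ht_lipb[OF u]] by auto
  have i1: "integrable nu (\<lambda>x. f x * ht u x)"
  proof (rule nu_integrable)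
    show "\<bar>f x * ht u x\<bar> \<le> b * (1 / hc)" for x unfolding abs_mult using f hb b0 by (intro mult_mono) auto
  qed (use f lipb_measurable[OF ht_lipb[OF u]] in auto)
  have i2: "integrable nu (\<lambda>x. f x * et x)"
  proof (rule nu_integrable)
    show "\<bar>f x * et x\<bar> \<le> b * (1 / hc)" for x unfolding abs_mult using f et_bounds b0 by (intro mult_mono) auto
  qed (use f in auto)
  have "\<bar>(\<integral>x. f x * ht u x \<partial>nu) - (\<integral>x. f x * et x \<partial>nu)\<bar> = \<bar>\<integral>x. f x * ht u x - f x * et x \<partial>nu\<bar>"
    using i1 i2 by simp
  also have "\<dots> \<le> (\<integral>x. \<bar>f x * ht u x - f x * et x\<bar> \<partial>nu)" by (rule integral_abs_bound)
  also have "\<dots> \<le> (\<integral>x. b * (KE * exp (- rate * u)) \<partial>nu)"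
  proof (rule integral_mono)
    fix x
    have "\<bar>f x * ht u x - f x * et x\<bar> = f x * \<bar>ht u x - et x\<bar>"
      using f(2)[of x] by (simp add: abs_mult flip: right_diff_distrib)
    also have "\<dots> \<le> b * (KE * exp (- rate * u))" using f b0 ht_eta[OF u, of x] by (intro mult_mono) auto
    finally show "\<bar>f x * ht u x - f x * et x\<bar> \<le> b * (KE * exp (- rate * u))" .
  qed (use i1 i2 in auto)
  also have "\<dots> = b * (KE * exp (- rate * u))" by (simp add: prob_space)
  finally show ?thesis .
qed

lemma nu_et: "(\<integral>x. et x \<partial>nu) = 1"
proof -
  have "(\<lambda>n. KE * exp (- rate) ^ n) \<longlonglongrightarrow> KE * 0"
    using rate_pos by (intro tendsto_intros LIMSEQ_power_zero) auto
  moreover have "\<bar>1 - (\<integral>x. et x \<partial>nu)\<bar> \<le> KE * exp (- rate) ^ n" for n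
    using integral_ht_et[OF I_of_nat[of n], of "\<lambda>_. 1" 1] nu_ht[OF I_of_nat, of n]
    by (simp add: mult.commute flip: exp_of_nat_mult)
  ultimately have "\<bar>1 - (\<integral>x. et x \<partial>nu)\<bar> \<le> KE * 0"
    by (intro LIMSEQ_le_const) auto
  thus ?thesis by simp
qed

text \<open>The penalized law of X_s at horizon s + u forgets the starting point over the first
  \<open>s\<close> units, and over the last \<open>u\<close> units its weight becomes that of the
  limiting function. The upper bound \<open>b\<close> of the test functions is fixed beforehand
  since the constant depends on it.\<close>

lemma occupation_converges:
  "\<exists>K\<ge>0. \<forall>s\<in>I. \<forall>u\<in>I. \<forall>f x. lipb 1 b f \<longrightarrow>
     \<bar>S s (\<lambda>z. f z * h u z) x / h (s + u) x - (\<integral>z. f z * et z \<partial>nu)\<bar> \<le> K * (exp (- rate * s) + exp (- rate * u))"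
proof (cases "0 \<le> b")
  case b0: True
  define C1 where "C1 = KR * ((1 * (1 / hc) + b * KF) + b * (1 / hc))"
  define C2 where "C2 = b * (1 / hc) * (KR * (KF + 1 / hc) / (hc * hc))"
  define K where "K = C1 + C2 + b * KE"
  have C: "0 \<le> C1" "0 \<le> C2" "0 \<le> b * KE"
    using KR_pos KF(1) hc(1) b0 KE_pos by (auto simp: C1_def C2_def intro!: mult_nonneg_nonneg add_nonneg_nonneg)
  have main: "\<bar>S s (\<lambda>z. f z * h u z) x / h (s + u) x - (\<integral>z. f z * et z \<partial>nu)\<bar> \<le> K * (exp (- rate * s) + exp (- rate * u))"
    if s: "s \<in> I" and u: "u \<in> I" and f: "lipb 1 b f" for s u f x
  proof -
    \<comment> \<open>The ratio splits as p / q: the conditioned expectation at time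
      \<open>s\<close> of the weighted test function, over a normalisation that tends to 1. Harnack
      keeps \<open>q\<close> away from 0.\<close>
    define p q where "p = S s (\<lambda>z. f z * ht u z) x / h s x" and "q = ht (s + u) x / ht s x"
    note g = lipb_mult[OF f ht_lipb[OF u]]
    have lg: "0 \<le> 1 * (1 / hc) + b * KF" using hc(1) b0 KF(1) by simp
    have hs: "0 < h s x" by (rule h_pos[OF s])
    have hts: "hc \<le> ht (s + u) x" "0 < ht s x" "ht s x \<le> 1 / hc"
      using ht_ge[OF I_add[OF s u], of x] ht_ge[OF s, of x] hc(1) lipbD(2)[OF ht_lipb[OF s], of x] by auto
    have 1: "\<bar>p - (\<integral>z. f z * ht u z \<partial>nu)\<bar> \<le> C1 * exp (- rate * s)"
      using ratio_rate[OF s lg g, of x] by (simp add: p_def C1_def)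
    have 2: "\<bar>q - 1\<bar> \<le> KR * (KF + 1 / hc) * exp (- rate * s)"
      unfolding q_def by (rule ht_cauchy(1)[OF s u])
    have p: "0 \<le> p" "p \<le> b * (1 / hc)"
      using S_nonneg[of "\<lambda>z. f z * ht u z" s x] lipbD(1)[OF g] S_le[OF g s, of x] hs by (auto simp: p_def divide_le_eq)
    have q: "hc * hc \<le> q"
    proof -
      have "hc * hc * ht s x \<le> hc * hc * (1 / hc)" using hts hc(1) by (intro mult_left_mono) auto
      also have "\<dots> = hc" using hc(1) by simp
      finally show ?thesis using hts by (simp add: q_def le_divide_eq)
    qed
    hence q0: "0 < q" using hc(1) by (meson less_le_trans mult_pos_pos)
    have pq: "S s (\<lambda>z. f z * h u z) x / h (s + u) x = p / q"
    proof -
      have "S s (\<lambda>z. exp (lam * u) * (f z * h u z)) x = exp (lam * u) * S s (\<lambda>z. f z * h u z) x"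
        by (rule S_cmult)
      hence "S s (\<lambda>z. f z * ht u z) x = exp (lam * u) * S s (\<lambda>z. f z * h u z) x"
        by (simp add: ht_def mult.left_commute)
      moreover have "q = exp (lam * u) * h (s + u) x / h s x"
        using hs by (simp add: q_def ht_def distrib_left exp_add)
      ultimately show ?thesis using hs h_pos[OF I_add[OF s u], of x] by (simp add: p_def)
    qed
    have 3: "\<bar>p / q - p\<bar> \<le> C2 * exp (- rate * s)"
    proof -
      have "p / q - p = p * ((1 - q) / q)" using q0 by (simp add: field_simps)
      hence "\<bar>p / q - p\<bar> = p * (\<bar>q - 1\<bar> / q)" using p q0 by (simp add: abs_mult abs_minus_commute)
      also have "\<dots> \<le> b * (1 / hc) * (KR * (KF + 1 / hc) * exp (- rate * s) / (hc * hc))"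
        using p q q0 2 hc(1) b0 by (intro mult_mono frac_le) auto
      finally show ?thesis by (simp add: C2_def)
    qed
    have 4: "\<bar>(\<integral>z. f z * ht u z \<partial>nu) - (\<integral>z. f z * et z \<partial>nu)\<bar> \<le> b * KE * exp (- rate * u)"
      using integral_ht_et[OF u lipb_measurable[OF f] lipbD(1)[OF f] lipbD(2)[OF f]] by simp
    have "\<bar>p / q - (\<integral>z. f z * et z \<partial>nu)\<bar> \<le> C1 * exp (- rate * s) + C2 * exp (- rate * s) + b * KE * exp (- rate * u)"
      using 1 3 4 by linarith
    also have "\<dots> \<le> K * exp (- rate * s) + K * exp (- rate * u)"
    proof (rule add_mono)
      have "(C1 + C2) * exp (- rate * s) \<le> K * exp (- rate * s)" using C by (intro mult_right_mono) (auto simp: K_def)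
      thus "C1 * exp (- rate * s) + C2 * exp (- rate * s) \<le> K * exp (- rate * s)" by (simp add: distrib_right)
      show "b * KE * exp (- rate * u) \<le> K * exp (- rate * u)" using C by (intro mult_right_mono) (auto simp: K_def)
    qed
    finally show ?thesis unfolding pq by (simp add: distrib_left)
  qed
  have "0 \<le> K" using C by (simp add: K_def)
  thus ?thesis by (intro exI[of _ K] conjI ballI allI impI main)
next
  case False
  have "\<not> lipb 1 b f" for f :: "'e \<Rightarrow> real"
  proof
    assume "lipb 1 b f"
    from lipbD(1,2)[OF this, of undefined] False show False by simp
  qed
  thus ?thesis by (intro exI[of _ 0]) auto
qed

text \<open>\<open>penalized_occupation\<close> is given by a set function, and
  \<open>measure_of\<close> returns it unchanged only if it is a measure. This image of a density on
  time times sample space is a measure by construction and has the same values; Fubini becomes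
  available with it.\<close>

definition occ :: "'e \<Rightarrow> real \<Rightarrow> 'e measure" where
  "occ x t = distr (density (time_measure I 0 t \<Otimes>\<^sub>M P x) (\<lambda>z. ennreal (pen I \<rho> X 0 t (snd z) / (t * h t x)))) borel
      (\<lambda>z. X (fst z) (snd z))"

lemma empirical_eq:
  assumes "t \<in> I"
  shows "empirical I X t \<omega> B = 1 / t * (\<integral>s. indicator B (X s \<omega>) \<partial>time_measure I 0 t)"
  using integral_T[OF I_nonneg[OF assms], of "\<lambda>s. indicator B (X s \<omega>)"] by (simp add: empirical_def)

lemma
  assumes t: "t \<in> I" "0 < t"
  shows emeasure_occ: "B \<in> sets borel \<Longrightarrow> emeasure (occ x t) B
      = ennreal ((\<integral>\<omega>. penalization I \<rho> X t \<omega> * empirical I X t \<omega> B \<partial>P x) / expected_penalization I \<rho> P X t x)"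
    and integral_occ: "f \<in> borel_measurable borel \<Longrightarrow> (\<And>y. \<bar>f y\<bar> \<le> b) \<Longrightarrow>
      (\<integral>y. f y \<partial>occ x t) = (1 / t) * (\<integral>s. (\<integral>\<omega>. pen I \<rho> X 0 t \<omega> * f (X s \<omega>) \<partial>P x) / h t x \<partial>time_measure I 0 t)"
    and integrable_occ_section: "f \<in> borel_measurable borel \<Longrightarrow> (\<And>y. \<bar>f y\<bar> \<le> b) \<Longrightarrow>
      integrable (time_measure I 0 t) (\<lambda>s. \<integral>\<omega>. pen I \<rho> X 0 t \<omega> * f (X s \<omega>) \<partial>P x)"
proof -
  interpret Px: prob_space "P x" by (rule prob_P)
  interpret T: finite_measure "time_measure I 0 t" by (rule finite_T)
  interpret TP: pair_sigma_finite "time_measure I 0 t" "P x" ..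
  interpret TPf: finite_measure "time_measure I 0 t \<Otimes>\<^sub>M P x"
    by (intro finite_measure_pair_measure T.finite_measure_axioms Px.finite_measure_axioms)
  note [measurable] = V_joint[OF process_P[of x]] pen_measurable[OF process_P[of x]]
  have hp: "0 < h t x" by (rule h_pos[OF t(1)])
  have pb: "0 \<le> pen I \<rho> X 0 t \<omega>" "pen I \<rho> X 0 t \<omega> \<le> 1" for \<omega>
    by (rule pen_nonneg[OF process_P], rule pen_le_1[OF process_P])
  have int: "integrable (time_measure I 0 t \<Otimes>\<^sub>M P x) (\<lambda>(s, \<omega>). pen I \<rho> X 0 t \<omega> * f (X s \<omega>))"
    if [measurable]: "f \<in> borel_measurable borel" and fb: "\<And>y. \<bar>f y\<bar> \<le> b" for f b
  proof -
    have "\<bar>pen I \<rho> X 0 t \<omega> * f y\<bar> \<le> 1 * b" for \<omega> y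
      unfolding abs_mult using pb fb by (intro mult_mono) auto
    moreover have "(\<lambda>z. pen I \<rho> X 0 t (snd z) * f (X (fst z) (snd z))) \<in> borel_measurable (time_measure I 0 t \<Otimes>\<^sub>M P x)"
      by measurable
    ultimately show ?thesis by (intro TPf.integrable_const_bound[of _ "1 * b"]) (auto simp: split_beta)
  qed
  have dens: "(\<lambda>z. ennreal (pen I \<rho> X 0 t (snd z) / (t * h t x))) \<in> borel_measurable (time_measure I 0 t \<Otimes>\<^sub>M P x)"
    by measurable
  have integral_occ': "(\<integral>y. f y \<partial>occ x t)
    = (1 / t) * (\<integral>s. (\<integral>\<omega>. pen I \<rho> X 0 t \<omega> * f (X s \<omega>) \<partial>P x) / h t x \<partial>time_measure I 0 t)"
    if [measurable]: "f \<in> borel_measurable borel" and fb: "\<And>y. \<bar>f y\<bar> \<le> b" for f b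
  proof -
    have "(\<integral>y. f y \<partial>occ x t) = (\<integral>z. f (X (fst z) (snd z)) \<partial>density (time_measure I 0 t \<Otimes>\<^sub>M P x)
      (\<lambda>z. ennreal (pen I \<rho> X 0 t (snd z) / (t * h t x))))"
      unfolding occ_def by (rule integral_distr) measurable
    also have "\<dots> = (\<integral>z. (pen I \<rho> X 0 t (snd z) / (t * h t x)) *\<^sub>R f (X (fst z) (snd z)) \<partial>(time_measure I 0 t \<Otimes>\<^sub>M P x))"
      using pb t(2) hp by (intro integral_density) auto
    also have "\<dots> = (\<integral>z. (case z of (s, \<omega>) \<Rightarrow> pen I \<rho> X 0 t \<omega> * f (X s \<omega>)) / (t * h t x) \<partial>(time_measure I 0 t \<Otimes>\<^sub>M P x))"
      by (simp add: split_beta)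
    also have "\<dots> = (\<integral>z. (case z of (s, \<omega>) \<Rightarrow> pen I \<rho> X 0 t \<omega> * f (X s \<omega>)) \<partial>(time_measure I 0 t \<Otimes>\<^sub>M P x)) / (t * h t x)"
      by simp
    also have "(\<integral>z. (case z of (s, \<omega>) \<Rightarrow> pen I \<rho> X 0 t \<omega> * f (X s \<omega>)) \<partial>(time_measure I 0 t \<Otimes>\<^sub>M P x))
       = (\<integral>s. \<integral>\<omega>. pen I \<rho> X 0 t \<omega> * f (X s \<omega>) \<partial>P x \<partial>time_measure I 0 t)"
      by (rule TP.integral_fst[OF int[OF that], symmetric])
    finally show ?thesis by simp
  qed
  show "f \<in> borel_measurable borel \<Longrightarrow> (\<And>y. \<bar>f y\<bar> \<le> b) \<Longrightarrow>
      (\<integral>y. f y \<partial>occ x t) = (1 / t) * (\<integral>s. (\<integral>\<omega>. pen I \<rho> X 0 t \<omega> * f (X s \<omega>) \<partial>P x) / h t x \<partial>time_measure I 0 t)"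
    by (rule integral_occ')
  show "f \<in> borel_measurable borel \<Longrightarrow> (\<And>y. \<bar>f y\<bar> \<le> b) \<Longrightarrow>
      integrable (time_measure I 0 t) (\<lambda>s. \<integral>\<omega>. pen I \<rho> X 0 t \<omega> * f (X s \<omega>) \<partial>P x)"
    by (rule TP.integrable_fst[OF int])
  show "emeasure (occ x t) B
      = ennreal ((\<integral>\<omega>. penalization I \<rho> X t \<omega> * empirical I X t \<omega> B \<partial>P x) / expected_penalization I \<rho> P X t x)"
    if B[measurable]: "B \<in> sets borel"
  proof -
    have fin: "finite_measure (occ x t)"
    proof (rule finite_measureI)
      have "emeasure (occ x t) (space (occ x t))
        = (\<integral>\<^sup>+z. ennreal (pen I \<rho> X 0 t (snd z) / (t * h t x)) \<partial>(time_measure I 0 t \<Otimes>\<^sub>M P x))"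
        unfolding occ_def by (subst emeasure_distr) (auto simp: emeasure_density intro!: nn_integral_cong)
      also have "\<dots> \<le> (\<integral>\<^sup>+z. ennreal (1 / (t * h t x)) \<partial>(time_measure I 0 t \<Otimes>\<^sub>M P x))"
        using pb t(2) hp by (intro nn_integral_mono ennreal_leI divide_right_mono) auto
      also have "\<dots> < \<infinity>"
        by (simp add: TPf.emeasure_eq_measure ennreal_mult_less_top)
      finally show "emeasure (occ x t) (space (occ x t)) \<noteq> \<infinity>" by simp
    qed
    have "measure (occ x t) B = (\<integral>y. indicator B y \<partial>occ x t)"
      using fin by (simp add: occ_def)
    also have "\<dots> = (1 / t) * (\<integral>s. (\<integral>\<omega>. pen I \<rho> X 0 t \<omega> * indicator B (X s \<omega>) \<partial>P x) / h t x \<partial>time_measure I 0 t)"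
      by (rule integral_occ'[of _ 1]) (auto simp: indicator_def)
    also have "\<dots> = (1 / t) * ((\<integral>s. (\<integral>\<omega>. pen I \<rho> X 0 t \<omega> * indicator B (X s \<omega>) \<partial>P x) \<partial>time_measure I 0 t) / h t x)"
      by simp
    also have "(\<integral>s. (\<integral>\<omega>. pen I \<rho> X 0 t \<omega> * indicator B (X s \<omega>) \<partial>P x) \<partial>time_measure I 0 t)
       = (\<integral>\<omega>. (\<integral>s. pen I \<rho> X 0 t \<omega> * indicator B (X s \<omega>) \<partial>time_measure I 0 t) \<partial>P x)"
      by (rule TP.Fubini_integral[OF int[of _ 1], symmetric]) (auto simp: indicator_def)
    also have "(1 / t) * (\<dots> / h t x) = (\<integral>\<omega>. penalization I \<rho> X t \<omega> * empirical I X t \<omega> B \<partial>P x) /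
      expected_penalization I \<rho> P X t x"
      by (simp add: empirical_eq[OF t(1)] penalization_eq[OF measurable_X t(1)]
        expected_penalization_eq[OF t(1)] mult.commute)
    finally show ?thesis using finite_measure.emeasure_eq_measure[OF fin] by simp
  qed
qed

lemma penalized_occupation_eq:
  assumes t: "t \<in> I" "0 < t"
  shows "penalized_occupation I \<rho> P X x t = occ x t"
proof -
  have "penalized_occupation I \<rho> P X x t = measure_of UNIV (sets borel) (emeasure (occ x t))"
    unfolding penalized_occupation_def
  proof (rule measure_of_eq)
    fix B assume "B \<in> sigma_sets UNIV (sets (borel :: 'e measure))"
    hence "B \<in> sets borel" by (metis sets.sigma_sets_eq space_borel)
    thus "ennreal ((\<integral>\<omega>. penalization I \<rho> X t \<omega> * empirical I X t \<omega> B \<partial>P x) / expected_penalization I \<rho> P X t x)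
      = emeasure (occ x t) B" by (rule emeasure_occ[OF t, symmetric])
  qed simp
  also have "\<dots> = occ x t"
    using measure_of_of_measure[of "occ x t"] by (simp add: occ_def)
  finally show ?thesis .
qed

lemma prob_occ:
  assumes t: "t \<in> I" "0 < t"
  shows "prob_space (occ x t)"
proof (rule prob_spaceI)
  have "space (occ x t) = UNIV" by (simp add: occ_def)
  moreover have "empirical I X t \<omega> UNIV = 1" for \<omega>
    using t measure_T[OF I_0 t(1) less_imp_le[OF t(2)]] by (simp add: empirical_eq)
  ultimately show "emeasure (occ x t) (space (occ x t)) = 1"
    using emeasure_occ[OF t, of UNIV x] h_pos[OF t(1), of x]
    by (simp add: expected_penalization_eq[OF t(1)] penalization_eq[OF measurable_X t(1)] S_def)
qed

lemma prob_density_et: "prob_space (density nu (\<lambda>x. ennreal (et x)))"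
proof (rule prob_spaceI)
  note [measurable_cong] = sets_nu
  have "emeasure (density nu (\<lambda>x. ennreal (et x))) (space (density nu (\<lambda>x. ennreal (et x)))) = (\<integral>\<^sup>+x. ennreal (et x) \<partial>nu)"
    by (subst emeasure_density) (auto intro!: nn_integral_cong)
  also have "\<dots> = ennreal (\<integral>x. et x \<partial>nu)"
    using et_bounds by (intro nn_integral_eq_integral nu_integrable[of _ "1 / hc"]) auto
  finally show "emeasure (density nu (\<lambda>x. ennreal (et x))) (space (density nu (\<lambda>x. ennreal (et x)))) = 1"
    by (simp add: nu_et)
qed

theorem wasserstein_occupation:
  "\<exists>C>0. \<forall>x. \<forall>t\<in>I - {0}. wasserstein (penalized_occupation I \<rho> P X x t) (density nu (\<lambda>x. ennreal (et x))) \<le> ennreal (C / t)"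
proof -
  obtain K where K: "0 \<le> K" and occ: "\<And>s u f x. s \<in> I \<Longrightarrow> u \<in> I \<Longrightarrow> lipb 1 (2 * dbar) f \<Longrightarrow>
     \<bar>S s (\<lambda>z. f z * h u z) x / h (s + u) x - (\<integral>z. f z * et z \<partial>nu)\<bar> \<le> K * (exp (- rate * s) + exp (- rate * u))"
    using occupation_converges[of "2 * dbar"] by blast
  obtain C where C: "\<And>t. t \<in> I \<Longrightarrow> (\<integral>s. exp (- rate * s) \<partial>time_measure I 0 t) \<le> C"
      "\<And>t. t \<in> I \<Longrightarrow> (\<integral>s. exp (- rate * (t - s)) \<partial>time_measure I 0 t) \<le> C"
    using T_exp_bounded[OF rate_pos] by blast
  have "0 \<le> (\<integral>s. exp (- rate * s) \<partial>time_measure I 0 0)" by (intro integral_nonneg_AE) auto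
  hence C0: "0 \<le> C" using C(1)[OF I_0] by linarith
  \<comment> \<open>Two exponential integrals, each at most \<open>C\<close>; the summand 1 only
    ensures positivity.\<close>
  define D where "D = 2 * K * C + 1"
  have "wasserstein (penalized_occupation I \<rho> P X x t) (density nu (\<lambda>x. ennreal (et x))) \<le> ennreal (D / t)"
    if "t \<in> I - {0}" for x t
  proof -
    have t: "t \<in> I" "0 < t" using that I_nonneg[of t] by auto
    interpret O: prob_space "occ x t" by (rule prob_occ[OF t])
    interpret W: prob_space "density nu (\<lambda>x. ennreal (et x))" by (rule prob_density_et)
    interpret T: finite_measure "time_measure I 0 t" by (rule finite_T)
    have so: "sets (occ x t) = sets borel" by (simp add: occ_def)
    show ?thesis unfolding penalized_occupation_eq[OF t]
    proof (rule kantorovich_rubinstein_le[OF O.prob_space_axioms W.prob_space_axioms so _ dist_le])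
      show "sets (density nu (\<lambda>x. ennreal (et x))) = sets borel" by (simp add: sets_nu)
      fix f :: "'e \<Rightarrow> real" assume f1: "1-lipschitz_on UNIV f"
      have fl: "\<bar>f x - f y\<bar> \<le> 1 * dist x y" for x y using lipschitz_onD[OF f1, of x y] by (simp add: dist_real_def)
      \<comment> \<open>Normalises the test function to values between 0 and
        \<open>2 * dbar\<close>, as \<open>lipb\<close> requires; \<open>undefined\<close> is an
        arbitrary base point. The constant cancels because both measures are probabilities.\<close>
      define g where "g = (\<lambda>x. f x - f undefined + dbar)"
      have gl: "lipb 1 (2 * dbar) g" unfolding lipb_def
      proof (intro conjI allI)
        fix x y
        show "0 \<le> g x" "g x \<le> 2 * dbar" using fl[of x undefined] dist_le[of x undefined] by (auto simp: g_def)
        show "\<bar>g x - g y\<bar> \<le> 1 * dist x y" using fl[of x y] by (simp add: g_def)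
      qed
      have gb: "\<bar>g y\<bar> \<le> 2 * dbar" for y using lipbD(1,2)[OF gl, of y] by simp
      have gm: "g \<in> borel_measurable borel" by (rule lipb_measurable[OF gl])
      have ig: "integrable (occ x t) g" "integrable (density nu (\<lambda>x. ennreal (et x))) g"
        using gm gb so sets_nu
        by (auto intro!: O.integrable_const_bound[of _ "2 * dbar"] W.integrable_const_bound[of _ "2 * dbar"]
            simp: measurable_cong_sets[OF so refl] measurable_cong_sets[OF sets_nu refl])
      define c where "c = f undefined - dbar"
      have fg: "(\<integral>y. f y \<partial>\<mu>) = (\<integral>y. g y + c \<partial>\<mu>)" for \<mu> by (simp add: g_def c_def)
      have diff: "(\<integral>y. f y \<partial>occ x t) - (\<integral>y. f y \<partial>density nu (\<lambda>x. ennreal (et x)))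
         = (\<integral>y. g y \<partial>occ x t) - (\<integral>y. g y \<partial>density nu (\<lambda>x. ennreal (et x)))"
        unfolding fg using ig O.prob_space W.prob_space[unfolded space_density] by simp
      have density: "(\<integral>y. g y \<partial>density nu (\<lambda>x. ennreal (et x))) = (\<integral>y. g y * et y \<partial>nu)"
        using gm et_bounds(1) by (subst integral_density)
          (auto simp: measurable_cong_sets[OF sets_nu refl] mult.commute)
      have "(\<integral>y. g y \<partial>occ x t) = (1 / t) * (\<integral>s. (\<integral>\<omega>. pen I \<rho> X 0 t \<omega> * g (X s \<omega>) \<partial>P x) / h t x \<partial>time_measure I 0 t)"
        by (rule integral_occ[OF t gm gb])
      \<comment> \<open>For each \<open>s\<close> the weight up to \<open>t\<close> is split at
        \<open>s\<close>, leaving u = t - s units after the observation; the two error exponentials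
        are then integrated over time.\<close>
      also have "\<dots> \<le> (1 / t) * (\<integral>s. (\<integral>y. g y * et y \<partial>nu) + K * (exp (- rate * s) + exp (- rate * (t - s)))
        \<partial>time_measure I 0 t)"
      proof (intro mult_left_mono integral_mono)
        show "integrable (time_measure I 0 t) (\<lambda>s. (\<integral>\<omega>. pen I \<rho> X 0 t \<omega> * g (X s \<omega>) \<partial>P x) / h t x)"
          by (intro integrable_divide integrable_occ_section[OF t gm gb])
        show "integrable (time_measure I 0 t) (\<lambda>s. (\<integral>y. g y * et y \<partial>nu) + K * (exp (- rate * s) + exp (- rate * (t - s))))"
          using rate_pos by (intro Bochner_Integration.integrable_add T.integrable_const integrable_mult_right
            T_integrable[where c = 1]) auto
        fix s assume "s \<in> space (time_measure I 0 t)"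
        hence s: "s \<in> I" "s \<le> t" by (auto simp: space_T)
        have u: "t - s \<in> I" by (rule I_diff[OF s(1) t(1) s(2)])
        have "(\<integral>\<omega>. pen I \<rho> X 0 t \<omega> * g (X s \<omega>) \<partial>P x) = S s (\<lambda>z. g z * h (t - s) z) x"
          using occupation_eq[OF s(1) u gl, of x] by simp
        thus "(\<integral>\<omega>. pen I \<rho> X 0 t \<omega> * g (X s \<omega>) \<partial>P x) / h t x
          \<le> (\<integral>y. g y * et y \<partial>nu) + K * (exp (- rate * s) + exp (- rate * (t - s)))"
          using occ[OF s(1) u gl, of x] by simp
      qed (use t in simp)
      also have "\<dots> = (\<integral>y. g y * et y \<partial>nu) + (1 / t) *
        (K * ((\<integral>s. exp (- rate * s) \<partial>time_measure I 0 t) + (\<integral>s. exp (- rate * (t - s)) \<partial>time_measure I 0 t)))"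
      proof -
        have i: "integrable (time_measure I 0 t) (\<lambda>s. exp (- rate * s))"
          using rate_pos by (intro T_integrable[where c = 1]) auto
        have j: "integrable (time_measure I 0 t) (\<lambda>s. exp (- rate * (t - s)))"
          using rate_pos by (intro T_integrable[where c = 1]) auto
        have "(\<integral>s. (\<integral>y. g y * et y \<partial>nu) + K * (exp (- rate * s) + exp (- rate * (t - s))) \<partial>time_measure I 0 t)
          = t * (\<integral>y. g y * et y \<partial>nu) + K *
            ((\<integral>s. exp (- rate * s) \<partial>time_measure I 0 t) + (\<integral>s. exp (- rate * (t - s)) \<partial>time_measure I 0 t))"
          using i j measure_T[OF I_0 t(1) less_imp_le[OF t(2)]] by simp
        thus ?thesis using t by (simp add: distrib_left)
      qed
      also have "\<dots> \<le> (\<integral>y. g y * et y \<partial>nu) + (1 / t) * (K * (C + C))"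
        using C[OF t(1)] K t by (intro add_left_mono mult_left_mono add_mono) auto
      finally have "(\<integral>y. g y \<partial>occ x t) \<le> (\<integral>y. g y * et y \<partial>nu) + (1 / t) * (K * (C + C))" .
      moreover have "(1 / t) * (K * (C + C)) \<le> D / t"
        using t by (simp add: D_def divide_right_mono)
      ultimately show "(\<integral>y. f y \<partial>occ x t) - (\<integral>y. f y \<partial>density nu (\<lambda>x. ennreal (et x))) \<le> D / t"
        unfolding diff density by linarith
    qed
  qed
  moreover have "0 < D" using K C0 by (simp add: D_def add_nonneg_pos)
  ultimately show ?thesis by blast
qed

end

theorem theorem2p5:
  fixes I :: "real set"
    and dbar :: real
    and \<rho> :: "'e::polish_space \<Rightarrow> real"
    and M :: "'w measure" and F :: "real \<Rightarrow> 'w measure"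
    and P :: "'e \<Rightarrow> 'w measure" and X :: "real \<Rightarrow> 'w \<Rightarrow> 'e"
    and N :: "'v measure" and Q :: "'e \<times> 'e \<Rightarrow> 'v measure"
    and Y1 Y2 :: "real \<Rightarrow> 'v \<Rightarrow> 'e"
    and nu_QS :: "'e measure" and lam0 :: real
  assumes time_set: "I = {0..} \<or> I = \<nat>"
    and dist_bounded: "\<And>x y :: 'e. dist x y \<le> dbar"
    and rho_nonneg: "\<And>x. 0 \<le> \<rho> x"
    and rho_lipschitz: "\<exists>L. L-lipschitz_on UNIV \<rho>"
    and markov: "markov_process I M F P X"
    and measurable: "measurable_process I M X"
    and A: "condition_A I \<rho> P X N Q Y1 Y2"
    and qsd: "quasi_stationary I \<rho> P X nu_QS"
    and rate: "absorption_rate I \<rho> P X nu_QS lam0"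
  shows "\<exists>C>0. \<forall>x. \<forall>t\<in>I - {0}.
           wasserstein (penalized_occupation I \<rho> P X x t)
             (density nu_QS (\<lambda>x. ennreal (eta I \<rho> P X lam0 x))) \<le> ennreal (C / t)"
proof -
  obtain L where L: "L-lipschitz_on UNIV \<rho>" using rho_lipschitz by blast
  have lip: "\<bar>\<rho> x - \<rho> y\<bar> \<le> L * dist x y" for x y
    using lipschitz_onD[OF L, of x y] by (simp add: dist_real_def)
  have L0: "0 \<le> L" by (rule lipschitz_on_nonneg[OF L])
  obtain C \<gamma> where C: "0 < C" "0 < \<gamma>" "markovian_coupling I P X N Q Y1 Y2"
      "\<And>x y t. t \<in> I \<Longrightarrow> (LINT \<omega>|Q (x, y). penalization I \<rho> Y1 t \<omega> / expected_penalization I \<rho> P X t x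
          * dist (Y1 t \<omega>) (Y2 t \<omega>)) \<le> C * exp (- \<gamma> * t) * dist x y"
    using A unfolding condition_A_def by blast
  \<comment> \<open>Boundedness of the distance makes the Lipschitz rate bounded; this supplies the
    constant \<open>R\<close> on which the power expansion and all crude lower bounds on the weight
    rest.\<close>
  have "\<rho> x \<le> \<rho> undefined + L * dbar" for x
    using lip[of x undefined] mult_left_mono[OF dist_bounded[of x undefined] L0] by linarith
  moreover have "\<rho> \<in> borel_measurable borel"
    using L by (intro borel_measurable_continuous_onI lipschitz_on_continuous_on)
  ultimately interpret coupled I \<rho> "\<rho> undefined + L * dbar" L dbar C \<gamma> M F P X N Q Y1 Y2
    using time_set rho_nonneg dist_bounded lip L0 C markov measurable by unfold_locales
  have S: "penalized_semigroup I \<rho> P X t f x = S t f x" if "t \<in> I" for t f x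
    by (simp add: penalized_semigroup_def S_def penalization_eq[OF measurable that])
  have "(\<integral>x. S t f x \<partial>nu_QS) = exp (- lam0 * t) * (\<integral>x. f x \<partial>nu_QS)"
    if "t \<in> I" "f \<in> borel_measurable borel" "bounded (range f)" for t f
    using rate that unfolding absorption_rate_def S[OF that(1), symmetric] by blast
  moreover have "prob_space nu_QS" "sets nu_QS = sets borel" "0 \<le> lam0"
    using qsd rate by (simp_all add: quasi_stationary_def absorption_rate_def)
  ultimately interpret coupled_qsd I \<rho> "\<rho> undefined + L * dbar" L dbar C \<gamma> M F P X N Q Y1 Y2 nu_QS lam0
    by (intro coupled_qsd.intro coupled_axioms coupled_qsd_axioms.intro)
  show ?thesis by (rule wasserstein_occupation)
qed

end
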